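(* Let $K',K''>0$ and $K>\max(2K',2)$ be constants, let $x\geq2$, and let $1\leq y'\leq(\log x)^{K'}$ and $(\log x)^K<y\leq x$. If $q<(\log x)^{K''}$ is a positive integer all of whose prime factors are $<y'$, and $a$ is an integer with $(a,q)=1$, then $$\Psi(x,[y',y];q,a)=\frac{\Psi(x,[y',y])}{\phi(q)}\Big(1+O\big(\log^{-1/5}x\big)\Big),$$ provided that $K$ and $K/K''$ are sufficiently large.
   Context: $S([y',y])$ is the set of positive integers all of whose prime factors lie in $[y',y]$; $\Psi(x,[y',y])=\#(S([y',y])\cap[1,x])$ and $\Psi(x,[y',y];q,a)=\#\{n\leq x: n\in S([y',y]),\ n\equiv a\ (\mathrm{mod}\ q)\}$. *)

theory Defs
  imports Complex_Main "HOL-Number_Theory.Number_Theory"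
begin

definition S_range :: "real \<Rightarrow> real \<Rightarrow> nat set" where
  "S_range y' y = {n. n > 0 \<and> (\<forall>p\<in>prime_factors n. real p \<in> {y'..y})}"

definition Psi :: "real \<Rightarrow> real \<Rightarrow> real \<Rightarrow> nat" where
  "Psi x y' y = card {n \<in> S_range y' y. real n \<le> x}"

definition Psi_ap :: "real \<Rightarrow> real \<Rightarrow> real \<Rightarrow> nat \<Rightarrow> int \<Rightarrow> nat" where
  "Psi_ap x y' y q a = card {n \<in> S_range y' y. real n \<le> x \<and> [int n = a] (mod int q)}"

end

theory Submission
  imports Defs "HOL-Complex_Analysis.Complex_Analysis" "HOL-Real_Asymp.Real_Asymp"
begin

text \<open>
  Write \<open>X = ln x\<close>, \<open>T = ln y\<close>, and let \<open>S\<close> be the set of integers composed of primes in \<open>[y', y]\<close>.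
  The proof splits at \<open>T = X powr (1/4)\<close>.

  If \<open>T\<close> is small, let \<open>\<alpha>\<close> be close to the saddle point of \<open>x powr \<sigma> * Z \<sigma>\<close>, where \<open>Z\<close> is the Euler product over \<open>S\<close>.
  Then \<open>exp (T * (1 - \<alpha>))\<close> lies between \<open>X / (16 * T)\<close> and \<open>O(X)\<close>, and \<open>S\<close> has at least \<open>x powr \<alpha> * Z \<alpha> / X ^ 7\<close>
  elements up to \<open>x\<close>. Such elements are detected by a finite trigonometric polynomial, which expresses the
  discrepancy between residue classes by the values of \<open>\<Prod>(1 - \<omega> p / p powr s)\<^sup>-\<^sup>1\<close> for \<open>Re s = \<alpha>\<close>, \<open>\<bar>Im s\<bar> \<le> X powr O(1)\<close>
  and non-principal \<open>\<omega>\<close>. These are smaller than \<open>Z \<alpha>\<close> by a factor \<open>exp (- c * X powr (3/8))\<close>, because \<open>\<omega>\<close> cannot pretend to be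
  \<open>n powr (i t)\<close> on the primes with \<open>T / 2 < ln p \<le> T\<close>. This last fact needs no zero-free region: a zero of
  \<open>L(s, \<omega>)\<close> enters the logarithmic derivative with a favourable sign, which gives the upper bound
  \<open>Re (\<Sum>p. \<omega> p * ln p / p powr (1 + r + i t)) \<le> O(ln (q * (\<bar>t\<bar> + 2)) + ln (1 / r))\<close>, uniformly in \<open>t\<close>. Averaged over
  a few shifts of \<open>t\<close> of size \<open>O(1 / T)\<close>, it contradicts \<open>\<omega> p \<approx> p powr (i t)\<close> on those primes.

  If \<open>T\<close> is large, Legendre's sieve with Rankin's trick gives equidistribution for \<open>n\<close> up to a bit more than \<open>y\<close>, since few
  such \<open>n\<close> free of prime factors below \<open>y'\<close> have a prime factor above \<open>y\<close>. The identity
  \<open>ln n = (\<Sum>d | d dvd n. mangoldt d)\<close> carries this over to all larger \<open>n\<close>.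
\<close>

section \<open>Chebyshev and Mertens estimates\<close>

text \<open>The threshold \<open>X powr (1/4)\<close> only has to lie between the exponents 1/5 and
  1/2. Below it, counting the \<open>n\<close> within a factor \<open>exp \<eta>\<close> of
  \<open>x\<close> leaves an error \<open>exp (- c * X / T ^ 2)\<close>, so \<open>T\<close> must
  stay well under \<open>X powr (1/2)\<close>. Above it, the sieve has relative error
  \<open>1 / T\<close> up to \<open>X powr (1/100)\<close> and powers of \<open>ln X\<close>, which
  has to beat \<open>X powr (- 1/5)\<close>.

  In the small range errors are measured against a crude lower bound that loses
  \<open>X ^ 7\<close>. This is affordable since the smoothing scale \<open>\<eta>\<close> may be a
  fixed power of \<open>1 / X\<close> as long as \<open>ln (1 / \<eta>) \<le> T / 2\<close>, one
  reason why \<open>K\<close> and \<open>K / K''\<close> must be large.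

  An exceptional zero is harmless: it pushes \<open>\<omega> p\<close> towards -1, and only values
  near \<open>p powr (i t)\<close> have to be excluded. A one-sided bound, however, can be averaged
  only with nonnegative coefficients, which dictates a kernel built from even powers of the cosine.

  In the large range the induction must not lose a constant factor at each step: the relative error
  is passed on with coefficient 1, and the new errors add up over \<open>O(X)\<close>
  halvings.\<close>

abbreviation lnn :: "nat \<Rightarrow> real" where
  "lnn n \<equiv> ln (real n)"

abbreviation npow :: "nat \<Rightarrow> real \<Rightarrow> real" where
  "npow n \<sigma> \<equiv> real n powr (- \<sigma>)"

definition primes_le :: "real \<Rightarrow> nat set" where
  "primes_le x = {p. prime p \<and> real p \<le> x}"

lemma finite_primes_le [simp, intro]: "finite (primes_le x)"
proof (rule finite_subset)
  show "primes_le x \<subseteq> {..nat \<lfloor>x\<rfloor>}" by (auto simp: primes_le_def le_nat_floor)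
qed auto

lemma finite_nat_le_real [simp, intro]: "finite {n::nat. real n \<le> x}" "finite {n::nat. real n < x}"
proof -
  show "finite {n::nat. real n \<le> x}"
    by (rule finite_subset[of _ "{..nat \<lfloor>x\<rfloor>}"]) (auto simp: le_nat_floor)
  then show "finite {n::nat. real n < x}"
    by (rule rev_finite_subset) auto
qed

lemma prime_prod_dvd:
  fixes n :: nat
  assumes "finite P" "\<And>p. p \<in> P \<Longrightarrow> prime p" "\<And>p. p \<in> P \<Longrightarrow> p dvd n"
  shows "\<Prod>P dvd n"
  using assms
proof (induction P rule: finite_induct)
  case (insert p P)
  have "coprime p (\<Prod>P)"
    using insert by (intro prod_coprime_right) (metis insertCI primes_coprime)
  then show ?case using insert by (simp add: divides_mult)
qed auto

section \<open>Chebyshev's upper bound\<close>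

definition theta :: "nat \<Rightarrow> real" where
  "theta n = (\<Sum>p | prime p \<and> p \<le> n. lnn p)"

text \<open>The primes in \<open>(n, 2 * n]\<close> divide the factorial of \<open>2 * n\<close> but
  not that of \<open>n\<close>. Their product therefore divides the central binomial coefficient,
  which is at most \<open>4 ^ n\<close>.\<close>

lemma theta_double: "theta (2 * n) \<le> theta n + 2 * n * ln 2"
proof (cases "n = 0")
  case False
  let ?P = "{p. prime p \<and> n < p \<and> p \<le> 2 * n}"
  have fin: "finite ?P" by (rule finite_subset[of _ "{..2*n}"]) auto
  have "p dvd (2 * n choose n)" if p: "p \<in> ?P" for p
  proof -
    have "p dvd fact (2 * n)" using p by (simp add: prime_dvd_fact_iff)
    also have "fact (2 * n) = fact n * fact n * (2 * n choose n)"
      using binomial_fact_lemma[of n "2 * n"] by simp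
    finally show ?thesis using p by (auto simp: prime_dvd_mult_iff prime_dvd_fact_iff)
  qed
  then have "\<Prod>?P dvd (2 * n choose n)" using fin by (intro prime_prod_dvd) auto
  then have "\<Prod>?P \<le> (2 * n choose n)" by (intro dvd_imp_le) auto
  also have "\<dots> \<le> 2 ^ (2 * n)"
    using binomial_le_pow2 by blast
  finally have le: "\<Prod>?P \<le> 2 ^ (2 * n)" .
  have "(\<Sum>p\<in>?P. lnn p) = ln (\<Prod>p\<in>?P. real p)"
    using fin by (subst ln_prod) (auto simp: prime_gt_0_nat)
  also have "\<dots> \<le> ln (2 ^ (2 * n))"
  proof (subst ln_le_cancel_iff)
    show "0 < (\<Prod>p\<in>?P. real p)" by (auto intro!: prod_pos simp: prime_gt_0_nat)
    have "real (\<Prod>?P) \<le> real (2 ^ (2 * n))" using le by (subst of_nat_le_iff)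
    then show "(\<Prod>p\<in>?P. real p) \<le> 2 ^ (2 * n)" by simp
  qed auto
  finally have a: "(\<Sum>p\<in>?P. lnn p) \<le> 2 * n * ln 2" by (simp add: ln_realpow)
  have eq: "{p. prime p \<and> p \<le> 2 * n} = {p. prime p \<and> p \<le> n} \<union> ?P" by auto
  have "theta (2 * n) = theta n + (\<Sum>p\<in>?P. lnn p)"
    unfolding theta_def eq by (rule sum.union_disjoint) (auto simp: fin)
  with a show ?thesis by simp
qed (auto simp: theta_def)

lemma theta_mono: "m \<le> n \<Longrightarrow> theta m \<le> theta n"
  unfolding theta_def by (rule sum_mono2) (auto simp: prime_ge_1_nat Suc_leI prime_gt_0_nat)

lemma theta_pow2: "theta (2 ^ k) \<le> 2 ^ (k + 1) * ln 2"
proof (induction k)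
  case 0
  have "{p::nat. prime p \<and> p \<le> 2 ^ 0} = {}" using prime_ge_2_nat by (auto simp: not_le dest: prime_gt_Suc_0_nat)
  then show ?case unfolding theta_def by (simp only: sum.empty) simp
next
  case (Suc k)
  have "theta (2 ^ Suc k) \<le> theta (2 ^ k) + 2 * real (2 ^ k) * ln 2"
    using theta_double[of "2 ^ k"] by simp
  with Suc show ?case by simp
qed

lemma theta_le: "theta n \<le> 4 * n"
proof (cases "n = 0")
  case False
  obtain k where k: "2 ^ k \<le> n" "n < 2 ^ (k + 1)"
    using ex_power_ivl1[of 2 n] False by auto
  have "theta n \<le> theta (2 ^ (k + 1))" using k by (intro theta_mono) auto
  also have "\<dots> \<le> 2 ^ (k + 2) * ln 2" using theta_pow2[of "k+1"] by simp
  also have "\<dots> \<le> 2 ^ (k + 2) * 1" using ln_2_less_1 by (intro mult_left_mono) auto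
  also have "\<dots> = 4 * real (2 ^ k)" by simp
  also have "\<dots> \<le> 4 * n" using of_nat_mono[OF k(1), where ?'a = real] by simp
  finally show ?thesis .
qed (auto simp: theta_def)

section \<open>Mertens' estimate from the logarithm of a factorial\<close>

lemma ln_fact_bounds:
  assumes "n > 0"
  shows "n * lnn n - n \<le> ln (fact n)" "ln (fact n) \<le> n * lnn n"
proof -
  \<comment> \<open>One term of the exponential series is all of Stirling's formula that is
    needed.\<close>
  have "exp (real n) \<ge> real n ^ n / fact n"
  proof -
    have "(\<Sum>k\<in>{n}. inverse (fact k) * real n ^ k) \<le> (\<Sum>k. inverse (fact k) * real n ^ k)"
      by (rule sum_le_suminf) (auto intro: summable_exp)
    then show ?thesis by (simp add: exp_def divide_simps scaleR_conv_of_real)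
  qed
  then have "real n ^ n \<le> exp (real n) * fact n" by (simp add: divide_simps)
  then have "ln (real n ^ n) \<le> ln (exp (real n) * fact n)" using assms by (subst ln_le_cancel_iff) auto
  then show "n * lnn n - n \<le> ln (fact n)" using assms by (simp add: ln_mult ln_realpow)
  have "fact n \<le> (real n ^ n)" using fact_le_power[of n, where ?'a = real] by simp
  then have "ln (fact n) \<le> ln (real n ^ n)" using assms by (subst ln_le_cancel_iff) auto
  then show "ln (fact n) \<le> n * lnn n" using assms by (simp add: ln_realpow)
qed

lemma ln_fact_mangoldt: "ln (fact n) = (\<Sum>d\<in>{1..n}. mangoldt d * real (n div d))"
proof -
  have "ln (fact n :: real) = (\<Sum>m\<in>{1..n}. lnn m)"
    unfolding fact_prod of_nat_prod by (subst ln_prod) auto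
  also have "\<dots> = (\<Sum>m\<in>{1..n}. \<Sum>d | d dvd m. mangoldt d)"
    by (intro sum.cong) (auto simp: mangoldt_sum)
  also have "\<dots> = (\<Sum>m\<in>{1..n}. \<Sum>d\<in>{1..n}. if d dvd m then mangoldt d else 0)"
  proof (rule sum.cong[OF refl])
    fix m assume m: "m \<in> {1..n}"
    show "(\<Sum>d | d dvd m. mangoldt d) = (\<Sum>d\<in>{1..n}. if d dvd m then mangoldt d else (0::real))"
    proof (intro sum.mono_neutral_cong_left)
      show "{d. d dvd m} \<subseteq> {1..n}"
      proof
        fix d assume "d \<in> {d. d dvd m}"
        then have d: "d dvd m" by simp
        then have "d \<le> m" using m by (intro dvd_imp_le) auto
        moreover have "d \<noteq> 0" using d m by (metis atLeastAtMost_iff dvd_0_left not_one_le_zero)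
        ultimately show "d \<in> {1..n}" using m by simp
      qed
    qed auto
  qed
  also have "\<dots> = (\<Sum>d\<in>{1..n}. \<Sum>m\<in>{1..n}. if d dvd m then mangoldt d else 0)"
    by (rule sum.swap)
  also have "\<dots> = (\<Sum>d\<in>{1..n}. mangoldt d * real (n div d))"
  proof (intro sum.cong refl)
    fix d assume d: "d \<in> {1..n}"
    have "card {m\<in>{1..n}. d dvd m} = n div d"
    proof -
      have "{m\<in>{1..n}. d dvd m} = (\<lambda>k. d * k) ` {1..n div d}"
        using d by (auto simp: image_iff dvd_def div_le_mono less_eq_div_iff_mult_less_eq mult.commute Suc_le_eq)
      moreover have "inj_on ((*) d) {1..n div d}" using d by (auto simp: inj_on_def)
      ultimately show ?thesis by (simp add: card_image)
    qed
    then show "(\<Sum>m\<in>{1..n}. if d dvd m then mangoldt d else 0) = mangoldt d * real (n div d)"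
      by (simp add: sum.If_cases Int_def)
  qed
  finally show ?thesis .
qed

text \<open>Keep only the primes in the expansion of \<open>ln (fact n)\<close> and replace
  \<open>n div p\<close> by \<open>n / p\<close>. The rounding costs at most
  \<open>theta n \<le> 4 * n\<close>, which becomes the constant 4 after division by
  \<open>n\<close>.\<close>

lemma mertens_upper_nat:
  fixes n :: nat
  assumes "n > 0"
  shows "(\<Sum>p | prime p \<and> p \<le> n. lnn p / p) \<le> ln n + 4"
proof -
  let ?P = "{p. prime p \<and> p \<le> n}"
  have "n * (\<Sum>p\<in>?P. lnn p / p) = (\<Sum>p\<in>?P. lnn p * (n / p))"
    by (simp add: sum_distrib_left mult_ac)
  also have "\<dots> \<le> (\<Sum>p\<in>?P. lnn p * (real (n div p) + 1))"
  proof (intro sum_mono mult_left_mono)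
    fix p assume "p \<in> ?P"
    then have "p > 0" by (auto simp: prime_gt_0_nat)
    then show "real n / real p \<le> real (n div p) + 1"
    proof -
      have "n < p * (n div p + 1)" using \<open>p > 0\<close> by (simp add: dividend_less_times_div)
      then have "real n < real (p * (n div p + 1))" by (rule of_nat_less_iff[THEN iffD2])
      then show ?thesis using \<open>p > 0\<close> by (simp add: field_simps)
    qed
    show "0 \<le> lnn p" using \<open>p > 0\<close> by (simp add: Suc_leI)
  qed
  also have "\<dots> = (\<Sum>p\<in>?P. mangoldt p * real (n div p)) + theta n"
    by (simp add: theta_def sum.distrib algebra_simps)
  also have "(\<Sum>p\<in>?P. mangoldt p * real (n div p)) \<le> (\<Sum>d\<in>{1..n}. mangoldt d * real (n div d))"
    by (rule sum_mono2) (auto simp: mangoldt_nonneg prime_gt_0_nat Suc_leI)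
  also have "\<dots> \<le> n * ln n" using ln_fact_bounds(2)[OF assms] by (simp add: ln_fact_mangoldt)
  also have "theta n \<le> 4 * n" by (rule theta_le)
  finally have "n * (\<Sum>p\<in>?P. lnn p / p) \<le> n * (ln n + 4)" by (simp add: algebra_simps)
  then show ?thesis using assms by simp
qed

text \<open>Bounds the contribution of prime powers with exponent at least 2. The second sum occurs
  in Mertens' estimate and in logarithmic derivatives to the right of 1, the first one at abscissas
  above 3/4. Since \<open>ln p\<close> is at most \<open>4 * p powr (1/4)\<close>, both are
  dominated by the sum of \<open>n powr (- 5/4)\<close>. The uniform bound over finite sets avoids
  infinite sums over primes.\<close>

lemma prime_power_excess_bounded:
  "\<exists>C\<ge>0. \<forall>P. finite P \<longrightarrow> (\<forall>p\<in>P. p \<ge> (2::nat)) \<longrightarrow> (\<Sum>p\<in>P. lnn p * (real p powr (-3/2))) \<le> C \<and> (\<Sum>p\<in>P. lnn p / (p * (p - 1))) \<le> C"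
proof -
  have s: "summable (\<lambda>n. 8 * real n powr (-5/4))"
    using summable_real_powr_iff[of "-5/4"] by (intro summable_mult) auto
  define C where "C = (\<Sum>n. 8 * real n powr (-5/4))"
  have lnle: "lnn p \<le> 4 * real p powr (1/4)" if "p \<ge> 2" for p :: nat
    using ln_powr_bound[of "real p" "1/4"] that by simp
  have "(\<Sum>p\<in>P. lnn p * (real p powr (-3/2))) \<le> C \<and> (\<Sum>p\<in>P. lnn p / (p * (p - 1))) \<le> C"
    if P: "finite P" "\<forall>p\<in>P. p \<ge> 2" for P
  proof -
    have 1: "lnn p * real p powr (-3/2) \<le> 4 * real p powr (-5/4)" if "p \<in> P" for p
    proof -
      have "lnn p * real p powr (-3/2) \<le> (4 * real p powr (1/4)) * real p powr (-3/2)"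
        using lnle P that by (intro mult_right_mono) auto
      also have "\<dots> = 4 * real p powr (-5/4)" by (simp add: powr_add [symmetric])
      finally show ?thesis .
    qed
    have 2: "lnn p / (p * (p - 1)) \<le> 2 * (lnn p * real p powr (-3/2))" if "p \<in> P" for p
    proof -
      have p: "p \<ge> 2" using P that by auto
      have a: "real (p * (p - 1)) \<ge> real p powr 2 / 2"
        using p by (simp add: of_nat_diff power2_eq_square powr_numeral field_simps)
      have "lnn p / (p * (p - 1)) \<le> lnn p / (real p powr 2 / 2)"
        using p a by (intro divide_left_mono) (auto intro!: mult_pos_pos)
      also have "\<dots> = 2 * (lnn p * real p powr (-2))" using p by (simp add: powr_minus_divide)
      also have "\<dots> \<le> 2 * (lnn p * real p powr (-3/2))"
        using p by (intro mult_left_mono powr_mono) auto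
      finally show ?thesis .
    qed
    have le: "(\<Sum>p\<in>P. 8 * real p powr (-5/4)) \<le> C"
      unfolding C_def using P s by (intro sum_le_suminf) auto
    have "(\<Sum>p\<in>P. lnn p * (real p powr (-3/2))) \<le> (\<Sum>p\<in>P. 8 * real p powr (-5/4))"
    proof (rule sum_mono)
      fix p assume "p \<in> P"
      have "0 \<le> real p powr (-5/4)" by simp
      with 1[OF \<open>p \<in> P\<close>] show "lnn p * real p powr (- 3 / 2) \<le> 8 * real p powr (- 5 / 4)" by linarith
    qed
    moreover have "(\<Sum>p\<in>P. lnn p / (p * (p - 1))) \<le> (\<Sum>p\<in>P. 8 * real p powr (-5/4))"
      using 1 2 by (intro sum_mono) fastforce
    ultimately show ?thesis using le by linarith
  qed
  moreover have "C \<ge> 0" unfolding C_def using s by (intro suminf_nonneg) auto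
  ultimately show ?thesis by blast
qed

text \<open>In this direction dropping the floor in \<open>n div d\<close> costs nothing. Only prime
  powers contribute, and for each prime the exponents from 2 on form a geometric series whose total
  over all primes is bounded.\<close>

lemma mertens_lower_nat:
  "\<exists>C. \<forall>n>(0::nat). (\<Sum>p | prime p \<and> p \<le> n. lnn p / p) \<ge> ln n - C"
proof -
  obtain C where C: "\<And>P. finite P \<Longrightarrow> (\<forall>p\<in>P. p \<ge> (2::nat)) \<Longrightarrow> (\<Sum>p\<in>P. lnn p / (p * (p - 1))) \<le> C"
    using prime_power_excess_bounded by blast
  have "(\<Sum>p | prime p \<and> p \<le> n. lnn p / p) \<ge> ln n - (1 + C)" if n: "n > 0" for n :: nat
  proof -
    let ?P = "{p. prime p \<and> p \<le> n}"
    let ?D = "{d\<in>{1..n}. primepow d}"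
    have fin: "finite ?P" by (rule finite_subset[of _ "{..n}"]) auto
    have "n * ln n - n \<le> ln (fact n)" using ln_fact_bounds(1)[OF n] .
    also have "\<dots> = (\<Sum>d\<in>{1..n}. mangoldt d * real (n div d))" by (rule ln_fact_mangoldt)
    also have "\<dots> = (\<Sum>d\<in>?D. mangoldt d * real (n div d))"
      by (rule sum.mono_neutral_right) (auto simp: mangoldt_def)
    also have "\<dots> \<le> (\<Sum>d\<in>?D. mangoldt d * (n / d))"
      by (intro sum_mono mult_left_mono) (auto simp: mangoldt_nonneg of_nat_div_le_of_nat)
    also have "\<dots> \<le> (\<Sum>d\<in>(\<lambda>(p,k). p ^ k) ` (?P \<times> {1..n}). mangoldt d * (n / d))"
    proof (intro sum_mono2)
      show "?D \<subseteq> (\<lambda>(p,k). p ^ k) ` (?P \<times> {1..n})"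
      proof
        fix d assume d: "d \<in> ?D"
        then obtain p k where pk: "prime p" "k > 0" "d = p ^ k" by (auto simp: primepow_def)
        have "p \<le> d" using pk by (simp add: prime_gt_0_nat self_le_power Suc_leI)
        moreover have "k < p ^ k" using pk by (intro power_gt_expt) (auto simp: prime_gt_Suc_0_nat)
        ultimately show "d \<in> (\<lambda>(p,k). p ^ k) ` (?P \<times> {1..n})" using pk d by (intro image_eqI[of _ _ "(p, k)"]) auto
      qed
    qed (auto simp: fin mangoldt_nonneg)
    also have "\<dots> \<le> (\<Sum>(p,k)\<in>?P \<times> {1..n}. ln p * (n / p ^ k))"
    proof (rule order.trans[OF sum_image_le])
      show "sum ((\<lambda>d. mangoldt d * (real n / real d)) \<circ> (\<lambda>(p, k). p ^ k)) (?P \<times> {1..n}) \<le> (\<Sum>(p,k)\<in>?P \<times> {1..n}. ln p * (n / p ^ k))"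
        by (intro sum_mono) auto
    qed (auto simp: fin mangoldt_nonneg)
    also have "\<dots> = (\<Sum>p\<in>?P. ln p * n * (\<Sum>k\<in>{1..n}. (1 / p) ^ k))"
      by (subst sum.cartesian_product[symmetric]) (simp add: sum_distrib_left power_divide mult_ac)
    also have "\<dots> \<le> (\<Sum>p\<in>?P. ln p * n * (1 / p + 1 / (p * (p - 1))))"
    proof (intro sum_mono mult_left_mono)
      fix p assume "p \<in> ?P"
      then have p: "p \<ge> 2" by (auto dest: prime_ge_2_nat)
      have "(\<Sum>k\<in>{1..n}. (1 / real p) ^ k) \<le> (\<Sum>k. (1 / real p) ^ Suc k)"
      proof -
        have "(\<Sum>k\<in>{1..n}. (1 / real p) ^ k) = (\<Sum>k<n. (1 / real p) ^ Suc k)"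
          by (rule sum.reindex_bij_witness[of _ Suc "\<lambda>k. k - 1"]) auto
        also have "\<dots> \<le> (\<Sum>k. (1 / real p) ^ Suc k)"
          using p by (intro sum_le_suminf summable_Suc_iff[THEN iffD2] summable_geometric) auto
        finally show ?thesis .
      qed
      also have "\<dots> = (1 / real p) * (\<Sum>k. (1 / real p) ^ k)"
        using p by (subst suminf_mult[symmetric]) (auto intro: summable_geometric)
      also have "\<dots> = (1 / real p) * (1 / (1 - 1 / real p))" using p by (subst suminf_geometric) auto
      also have "\<dots> = 1 / p + 1 / (p * (p - 1))" using p by (simp add: field_simps of_nat_diff)
      finally show "(\<Sum>k\<in>{1..n}. (1 / real p) ^ k) \<le> 1 / p + 1 / (p * (p - 1))" .
      show "0 \<le> lnn p * real n" using p by simp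
    qed
    also have "\<dots> = n * ((\<Sum>p\<in>?P. ln p / p) + (\<Sum>p\<in>?P. ln p / (p * (p - 1))))"
      by (simp add: sum_distrib_left sum.distrib algebra_simps)
    also have "\<dots> \<le> n * ((\<Sum>p\<in>?P. ln p / p) + C)"
      using C[of ?P] fin by (intro mult_left_mono add_left_mono) (auto dest: prime_ge_2_nat)
    finally have "n * ln n - n \<le> n * ((\<Sum>p\<in>?P. lnn p / p) + C)" .
    then have "n * (ln n - (1 + C)) \<le> n * (\<Sum>p\<in>?P. lnn p / p)" by (simp add: algebra_simps)
    then show ?thesis using n by simp
  qed
  then show ?thesis by blast
qed

theorem mertens_first:
  "\<exists>C\<ge>1. \<forall>x\<ge>1. \<bar>(\<Sum>p\<in>primes_le x. lnn p / p) - ln x\<bar> \<le> C"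
proof -
  obtain C where C: "\<And>n. n > 0 \<Longrightarrow> (\<Sum>p | prime p \<and> p \<le> n. lnn p / p) \<ge> lnn n - C"
    using mertens_lower_nat by auto
  have "\<bar>(\<Sum>p\<in>primes_le x. lnn p / p) - ln x\<bar> \<le> max 5 (C + 1)" if x: "x \<ge> 1" for x
  proof -
    define n where "n = nat \<lfloor>x\<rfloor>"
    have n: "n > 0" "real n \<le> x" "x < real n + 1" "real n \<ge> 1" using x by (auto simp: n_def le_floor_iff)
    have eq: "primes_le x = {p. prime p \<and> p \<le> n}"
      using n by (auto simp: primes_le_def) 
    have "ln x \<le> lnn n + 1"
    proof -
      have "ln x \<le> ln (real n * 2)" using n x by (subst ln_le_cancel_iff) linarith+
      also have "\<dots> = lnn n + ln 2" using n by (subst ln_mult) auto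
      finally show ?thesis using ln_2_less_1 by linarith
    qed
    moreover have "lnn n \<le> ln x" using n by simp
    ultimately show ?thesis using mertens_upper_nat[OF n(1)] C[OF n(1)] unfolding eq by (simp add: abs_le_iff max_def)
  qed
  then show ?thesis by (intro exI[of _ "max 5 (C + 1)"]) auto
qed

section \<open>Dirichlet characters\<close>

definition dchar :: "nat \<Rightarrow> (nat \<Rightarrow> complex) \<Rightarrow> bool" where
  "dchar q \<omega> \<longleftrightarrow> (\<forall>m n. \<omega> (m * n) = \<omega> m * \<omega> n) \<and> (\<forall>m n. [m = n] (mod q) \<longrightarrow> \<omega> m = \<omega> n) \<and>
     (\<forall>n. \<omega> n = 0 \<longleftrightarrow> \<not> coprime n q)"

definition principal :: "nat \<Rightarrow> nat \<Rightarrow> complex" where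
  "principal q n = (if coprime n q then 1 else 0)"

text \<open>A character on a subgroup of the units modulo \<open>q\<close>. The subgroup is a set of
  naturals closed under congruence, which avoids quotient types; inverses exist because powers stay
  in \<open>H\<close> and the group is finite.\<close>

definition partial_char :: "nat \<Rightarrow> nat set \<Rightarrow> (nat \<Rightarrow> complex) \<Rightarrow> bool" where
  "partial_char q H \<psi> \<longleftrightarrow> 1 \<in> H \<and> (\<forall>n\<in>H. coprime n q) \<and> (\<forall>m\<in>H. \<forall>n\<in>H. m * n \<in> H \<and> \<psi> (m * n) = \<psi> m * \<psi> n) \<and>
     (\<forall>m n. m \<in> H \<longrightarrow> [m = n] (mod q) \<longrightarrow> n \<in> H \<and> \<psi> m = \<psi> n) \<and> \<psi> 1 = 1"

lemma partial_charD:
  assumes "partial_char q H \<psi>"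
  shows "1 \<in> H" "n \<in> H \<Longrightarrow> coprime n q" "m \<in> H \<Longrightarrow> n \<in> H \<Longrightarrow> m * n \<in> H"
    "m \<in> H \<Longrightarrow> n \<in> H \<Longrightarrow> \<psi> (m * n) = \<psi> m * \<psi> n"
    "m \<in> H \<Longrightarrow> [m = n] (mod q) \<Longrightarrow> n \<in> H" "m \<in> H \<Longrightarrow> [m = n] (mod q) \<Longrightarrow> \<psi> m = \<psi> n" "\<psi> 1 = 1"
  using assms unfolding partial_char_def by blast+

lemma partial_char_power:
  assumes "partial_char q H \<psi>" "n \<in> H"
  shows "n ^ k \<in> H \<and> \<psi> (n ^ k) = \<psi> n ^ k"
  by (induction k) (use assms partial_charD[OF assms(1)] in auto)

text \<open>By Euler's theorem the power with exponent \<open>totient q - 1\<close> is an inverse,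
  and closure under products keeps it in \<open>H\<close>.\<close>

lemma partial_char_inverse:
  assumes "q > 0" "partial_char q H \<psi>" "n \<in> H"
  obtains m where "m \<in> H" "[n * m = 1] (mod q)" "\<psi> n * \<psi> m = 1"
proof -
  let ?m = "n ^ (totient q - 1)"
  have cop: "coprime n q" using assms partial_charD by blast
  have "n * ?m = n ^ totient q" using assms(1) by (simp add: power_eq_if)
  then have c: "[n * ?m = 1] (mod q)" using euler_theorem[OF cop] by simp
  have mH: "?m \<in> H" using partial_char_power[OF assms(2,3)] by blast
  have "\<psi> n * \<psi> ?m = \<psi> (n * ?m)" using partial_charD(4)[OF assms(2,3) mH] by simp
  also have "\<dots> = \<psi> 1" using partial_charD(3,6)[OF assms(2)] assms(3) mH c by blast
  finally show ?thesis using that mH c partial_charD(7)[OF assms(2)] by simp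
qed

lemma partial_char_cancel:
  assumes "q > 0" "partial_char q H \<psi>" "n \<in> H" "coprime m q" "n * m \<in> H"
  shows "m \<in> H"
proof -
  obtain k where k: "k \<in> H" "[n * k = 1] (mod q)" using partial_char_inverse[OF assms(1-3)] .
  have "[k * (n * m) = m] (mod q)"
    using cong_scalar_right[OF k(2), of m] by (simp add: mult_ac)
  then show ?thesis using partial_charD(3,5)[OF assms(2)] k(1) assms(5) by blast
qed

text \<open>Adjoins one residue \<open>g\<close>. If \<open>m\<close> is the order of
  \<open>g\<close> over \<open>H\<close>, the value at \<open>g\<close> may be any
  \<open>m\<close>-th root of \<open>\<psi> (g ^ m)\<close>: elements of the larger group have the
  form \<open>h * g ^ k\<close>, and the relations among these forms come from powers of
  \<open>g\<close> in \<open>H\<close>, whose exponents are multiples of \<open>m\<close>.\<close>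

lemma partial_char_extend:
  assumes q: "q > 0" and H: "partial_char q H \<psi>" and g: "coprime g q"
  defines "m \<equiv> LEAST k. k > 0 \<and> g ^ k \<in> H"
  assumes c: "c ^ m = \<psi> (g ^ m)"
  shows "\<exists>H' \<psi>'. partial_char q H' \<psi>' \<and> H \<subseteq> H' \<and> g \<in> H' \<and> (\<forall>h\<in>H. \<psi>' h = \<psi> h) \<and> \<psi>' g = c"
proof -
  note D = partial_charD[OF H]
  have "g ^ totient q \<in> H" using D(1,5) euler_theorem[OF g] cong_sym by blast
  then have m: "m > 0" "g ^ m \<in> H"
    unfolding m_def using q LeastI[of "\<lambda>k. k > 0 \<and> g ^ k \<in> H" "totient q"] by auto
  have mleast: "m \<le> k" if "k > 0" "g ^ k \<in> H" for k
    unfolding m_def using that by (intro Least_le) auto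
  have gcop: "coprime (g ^ k) q" for k using g by simp
  have dvd: "m dvd k \<and> \<psi> (g ^ k) = c ^ k" if k: "g ^ k \<in> H" for k
  proof -
    have eq: "g ^ k = (g ^ m) ^ (k div m) * g ^ (k mod m)"
      by (simp flip: power_mult power_add)
    have h1: "(g ^ m) ^ (k div m) \<in> H" "\<psi> ((g ^ m) ^ (k div m)) = \<psi> (g ^ m) ^ (k div m)"
      using partial_char_power[OF H m(2)] by auto
    have "g ^ (k mod m) \<in> H" using partial_char_cancel[OF q H h1(1) gcop] k eq by metis
    then have "k mod m = 0" using mleast[of "k mod m"] m(1) by (meson mod_less_divisor not_gr_zero not_le)
    then have dv: "m dvd k" by (simp add: dvd_eq_mod_eq_0)
    then have "k = m * (k div m)" by simp
    then have "\<psi> (g ^ k) = \<psi> (g ^ m) ^ (k div m)" using h1(2) by (metis power_mult)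
    also have "\<dots> = c ^ (m * (k div m))" by (simp add: c[symmetric] power_mult)
    finally show ?thesis using dv by simp
  qed
  define H' where "H' = {n. \<exists>h\<in>H. \<exists>k. [n = h * g ^ k] (mod q)}"
  \<comment> \<open>Independence of the representation. Assuming \<open>k \<le> k'\<close> allows
    \<open>g ^ k\<close> to be cancelled while all exponents remain natural numbers.\<close>
  have wd: "\<psi> h * c ^ k = \<psi> h' * c ^ k'"
    if h: "h \<in> H" "h' \<in> H" and cong: "[h * g ^ k = h' * g ^ k'] (mod q)" and le: "k \<le> k'" for h h' k k'
  proof -
    have "[h * g ^ k = (h' * g ^ (k' - k)) * g ^ k] (mod q)"
      using cong le by (simp add: mult.assoc flip: power_add)
    then have c1: "[h = h' * g ^ (k' - k)] (mod q)"
      using cong_mult_rcancel_nat gcop by blast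
    then have "h' * g ^ (k' - k) \<in> H" using D(5) h by blast
    then have gH: "g ^ (k' - k) \<in> H" using partial_char_cancel[OF q H h(2) gcop] by blast
    have "\<psi> h = \<psi> (h' * g ^ (k' - k))" using D(6) h c1 by blast
    also have "\<dots> = \<psi> h' * c ^ (k' - k)" using D(4)[OF h(2) gH] dvd[OF gH] by simp
    finally show ?thesis using le by (simp add: mult.assoc flip: power_add)
  qed
  have wd': "\<psi> h * c ^ k = \<psi> h' * c ^ k'"
    if h: "h \<in> H" "h' \<in> H" and cong: "[h * g ^ k = h' * g ^ k'] (mod q)" for h h' k k'
    using wd[OF h cong] wd[OF h(2,1) cong_sym[OF cong]] by (metis nat_le_linear)
  define \<psi>' where "\<psi>' n = (SOME z. \<exists>h\<in>H. \<exists>k. [n = h * g ^ k] (mod q) \<and> z = \<psi> h * c ^ k)" for n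
  have val: "\<psi>' n = \<psi> h * c ^ k" if h: "h \<in> H" and n: "[n = h * g ^ k] (mod q)" for n h k
  proof -
    have "\<exists>h\<in>H. \<exists>k. [n = h * g ^ k] (mod q) \<and> \<psi>' n = \<psi> h * c ^ k"
      unfolding \<psi>'_def by (rule someI_ex) (use h n in blast)
    then obtain h' k' where h': "h' \<in> H" "[n = h' * g ^ k'] (mod q)" "\<psi>' n = \<psi> h' * c ^ k'" by blast
    have "[h' * g ^ k' = h * g ^ k] (mod q)" using h'(2) n cong_sym cong_trans by blast
    then show ?thesis using wd'[OF h'(1) h] h'(3) by simp
  qed
  have mul: "m1 * m2 \<in> H' \<and> \<psi>' (m1 * m2) = \<psi>' m1 * \<psi>' m2" if m12: "m1 \<in> H'" "m2 \<in> H'" for m1 m2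
  proof -
    obtain h1 k1 where 1: "h1 \<in> H" "[m1 = h1 * g ^ k1] (mod q)" using m12(1) unfolding H'_def by blast
    obtain h2 k2 where 2: "h2 \<in> H" "[m2 = h2 * g ^ k2] (mod q)" using m12(2) unfolding H'_def by blast
    have 3: "[m1 * m2 = (h1 * h2) * g ^ (k1 + k2)] (mod q)"
      using cong_mult[OF 1(2) 2(2)] by (simp add: power_add mult_ac)
    have 4: "h1 * h2 \<in> H" using D(3) 1 2 by blast
    have "m1 * m2 \<in> H'" unfolding H'_def using 3 4 by blast
    then show ?thesis using val[OF 4 3] val[OF 1] val[OF 2] D(4)[OF 1(1) 2(1)]
      by (simp add: power_add)
  qed
  have sub: "h \<in> H' \<and> \<psi>' h = \<psi> h" if "h \<in> H" for h
    using val[of h h 0] that by (auto simp: H'_def intro!: bexI[of _ h] exI[of _ 0])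
  have g': "g \<in> H'" "\<psi>' g = c"
    using val[of 1 g 1] D(1,7) by (auto simp: H'_def intro!: bexI[of _ 1] exI[of _ 1])
  have "partial_char q H' \<psi>'"
    unfolding partial_char_def
  proof (intro conjI ballI allI impI)
    show "1 \<in> H'" "\<psi>' 1 = 1" using sub[OF D(1)] D(7) by auto
    show "coprime n q" if nH: "n \<in> H'" for n
    proof -
      obtain h k where "h \<in> H" "[n = h * g ^ k] (mod q)" using nH unfolding H'_def by blast
      then show ?thesis using D(2)[of h] gcop cong_imp_coprime cong_sym by (metis coprime_mult_left_iff)
    qed
    show "m * n \<in> H'" "\<psi>' (m * n) = \<psi>' m * \<psi>' n" if "m \<in> H'" "n \<in> H'" for m n using mul that by auto
    fix m n assume mn: "m \<in> H'" "[m = n] (mod q)"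
    then obtain h k where h: "h \<in> H" "[m = h * g ^ k] (mod q)" using mn(1) unfolding H'_def by blast
    have n: "[n = h * g ^ k] (mod q)" using mn(2) h cong_sym cong_trans by blast
    then show "n \<in> H'" using h by (auto simp: H'_def)
    show "\<psi>' m = \<psi>' n" using val[OF h] val[OF h(1) n] by simp
  qed
  then show ?thesis using sub g' by blast
qed

lemma partial_char_extend_set:
  assumes q: "q > 0" and H: "partial_char q H \<psi>" and B: "finite B" "\<forall>b\<in>B. coprime b q"
  shows "\<exists>H' \<psi>'. partial_char q H' \<psi>' \<and> H \<subseteq> H' \<and> B \<subseteq> H' \<and> (\<forall>h\<in>H. \<psi>' h = \<psi> h)"
  using B
proof (induction B rule: finite_induct)
  case empty
  then show ?case using H by blast
next
  case (insert b B)
  then obtain H1 \<psi>1 where 1: "partial_char q H1 \<psi>1" "H \<subseteq> H1" "B \<subseteq> H1" "\<forall>h\<in>H. \<psi>1 h = \<psi> h" by auto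
  define m where "m = (LEAST k. k > 0 \<and> b ^ k \<in> H1)"
  have "b ^ totient q \<in> H1"
    using partial_charD(1,5)[OF 1(1)] euler_theorem[of b q] insert.prems cong_sym by blast
  then have m: "m > 0" unfolding m_def using q LeastI[of "\<lambda>k. k > 0 \<and> b ^ k \<in> H1" "totient q"] by auto
  define z where "z = \<psi>1 (b ^ m)"
  have ex: "\<exists>c::complex. c ^ m = z"
  proof (cases "z = 0")
    case False
    have "exp (Ln z / of_nat m) ^ m = z"
      using m False by (simp flip: exp_of_nat_mult)
    then show ?thesis by blast
  qed (use m in \<open>auto intro: exI[of _ 0]\<close>)
  then obtain c where "c ^ m = z" by blast
  then have "\<exists>H' \<psi>'. partial_char q H' \<psi>' \<and> H1 \<subseteq> H' \<and> b \<in> H' \<and> (\<forall>h\<in>H1. \<psi>' h = \<psi>1 h) \<and> \<psi>' b = c"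
    using partial_char_extend[OF q 1(1), of b c] insert.prems unfolding m_def z_def by auto
  then obtain H' \<psi>' where 2: "partial_char q H' \<psi>'" "H1 \<subseteq> H'" "b \<in> H'" "\<forall>h\<in>H1. \<psi>' h = \<psi>1 h" by blast
  have "H \<subseteq> H'" "insert b B \<subseteq> H'" "\<forall>h\<in>H. \<psi>' h = \<psi> h" using 1 2 by auto
  then show ?case using 2(1) by blast
qed

text \<open>Start with the trivial character on the class of 1. Since \<open>g\<close> lies outside,
  its order \<open>m\<close> over this subgroup is at least 2, so \<open>g\<close> can be sent to a
  primitive \<open>m\<close>-th root of unity. The remaining reduced residues are then adjoined one
  at a time.\<close>

lemma dchar_separates:
  assumes q: "q > 0" and g: "coprime g q" and ng: "\<not> [g = 1] (mod q)"
  shows "\<exists>\<omega>. dchar q \<omega> \<and> \<omega> g \<noteq> 1"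
proof -
  define H0 where "H0 = {n::nat. [n = 1] (mod q)}"
  have H0: "partial_char q H0 (\<lambda>_. 1)"
    unfolding partial_char_def H0_def
    by (auto intro: cong_mult[of _ 1 q _ 1, simplified] cong_sym cong_trans dest: cong_imp_coprime[OF cong_sym])
  define m where "m = (LEAST k. k > 0 \<and> g ^ k \<in> H0)"
  have "g ^ totient q \<in> H0" using euler_theorem[OF g] by (simp add: H0_def)
  then have m: "m > 0" "g ^ m \<in> H0" unfolding m_def
    using q LeastI[of "\<lambda>k. k > 0 \<and> g ^ k \<in> H0" "totient q"] by auto
  have m2: "m \<ge> 2"
  proof (rule ccontr)
    assume "\<not> m \<ge> 2"
    then have "m = 1" using m by simp
    then show False using m ng by (simp add: H0_def)
  qed
  define c where "c = cis (2 * pi / m)"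
  have "c ^ m = cis (real m * (2 * pi / m))" unfolding c_def by (rule Complex.DeMoivre)
  also have "real m * (2 * pi / m) = 2 * pi" using m by simp
  finally have "c ^ m = 1" by (simp add: cis_2pi)
  have c1: "c \<noteq> 1"
  proof
    assume "c = 1"
    then have "Re c = 1" by simp
    then have "cos (2 * pi / m) = 1" by (simp add: c_def)
    moreover have "0 < 2 * pi / m" "2 * pi / m < 2 * pi" using m2 pi_gt_zero by (auto simp: field_simps)
    ultimately obtain x :: int where x: "2 * pi / m = x * 2 * pi" using cos_one_2pi_int[of "2 * pi / m"] by auto
    then have "1 = x * real m" using m by (simp add: field_simps)
    then have "1 = x * int m" by (metis of_int_1 of_int_eq_iff of_int_mult of_int_of_nat_eq)
    then have "int m dvd 1" by (metis dvd_triv_right)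
    then show False using m2 by simp
  qed
  obtain H1 \<psi>1 where 1: "partial_char q H1 \<psi>1" "g \<in> H1" "\<psi>1 g = c"
    using partial_char_extend[OF q H0 g, of c] \<open>c ^ m = 1\<close> unfolding m_def by auto
  have finB: "finite {b. b < q \<and> coprime b q}" by simp
  have copB: "\<forall>b\<in>{b. b < q \<and> coprime b q}. coprime b q" by simp
  obtain H2 \<psi>2 where 2: "partial_char q H2 \<psi>2" "H1 \<subseteq> H2" "{b. b < q \<and> coprime b q} \<subseteq> H2" "\<forall>h\<in>H1. \<psi>2 h = \<psi>1 h"
    using partial_char_extend_set[OF q 1(1) finB copB] by blast
  note D = partial_charD[OF 2(1)]
  have all: "n \<in> H2 \<longleftrightarrow> coprime n q" for n
  proof
    assume n: "coprime n q"
    have "n mod q \<in> H2" using 2(3) n q by (auto simp: coprime_mod_left_iff subset_iff)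
    then show "n \<in> H2" using D(5)[of "n mod q" n] by (simp add: unique_euclidean_semiring_class.cong_def)
  qed (use D(2) in auto)
  define \<omega> where "\<omega> n = (if coprime n q then \<psi>2 n else 0)" for n
  have nz: "\<psi>2 n \<noteq> 0" if "coprime n q" for n
  proof -
    have "n \<in> H2" using that all by simp
    then obtain k where "\<psi>2 n * \<psi>2 k = 1" by (rule partial_char_inverse[OF q 2(1)])
    then show ?thesis by auto
  qed
  have "dchar q \<omega>"
    unfolding dchar_def \<omega>_def using D(4,6) all nz
    by (auto simp: coprime_mult_left_iff dest: cong_imp_coprime cong_sym)
  moreover have "\<omega> g = c" using 1 2 g by (simp add: \<omega>_def)
  ultimately show ?thesis using c1 by auto
qed

section \<open>Values, number and orthogonality of Dirichlet characters\<close>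

lemma dcharD:
  assumes "dchar q \<omega>"
  shows "\<omega> (m * n) = \<omega> m * \<omega> n" "[m = n] (mod q) \<Longrightarrow> \<omega> m = \<omega> n" "\<omega> n = 0 \<longleftrightarrow> \<not> coprime n q"
    "\<omega> 1 = 1" "\<omega> (Suc 0) = 1" "\<omega> (n ^ k) = \<omega> n ^ k"
proof -
  show 1: "\<omega> (m * n) = \<omega> m * \<omega> n" "[m = n] (mod q) \<Longrightarrow> \<omega> m = \<omega> n" "\<omega> n = 0 \<longleftrightarrow> \<not> coprime n q" for m n
    using assms unfolding dchar_def by blast+
  have "\<omega> 1 * \<omega> 1 = \<omega> 1 * 1" using 1(1)[of 1 1] by simp
  moreover have "\<omega> 1 \<noteq> 0" using 1(3)[of 1] by simp
  ultimately show 2: "\<omega> 1 = 1" by (simp only: mult_cancel_left) simp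
  then show "\<omega> (Suc 0) = 1" by simp
  show "\<omega> (n ^ k) = \<omega> n ^ k" by (induction k) (use 1(1) 2 in auto)
qed

lemma dchar_power_totient:
  assumes "dchar q \<omega>" "coprime n q" shows "\<omega> n ^ totient q = 1"
  using dcharD(2,4,6)[OF assms(1)] euler_theorem[OF assms(2)] by metis

lemma norm_dchar:
  assumes q: "q > 0" and "dchar q \<omega>" "coprime n q"
  shows "norm (\<omega> n) = 1"
proof -
  have "norm (\<omega> n) ^ totient q = 1" using dchar_power_totient[OF assms(2,3)] by (metis norm_one norm_power)
  then show ?thesis using q power_eq_iff_eq_base[of "totient q" "norm (\<omega> n)" 1] by simp
qed

lemma norm_dchar_le: "q > 0 \<Longrightarrow> dchar q \<omega> \<Longrightarrow> norm (\<omega> n) \<le> 1"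
  using norm_dchar[of q \<omega> n] dcharD(3)[of q \<omega> n] by (cases "coprime n q") auto

lemma dchar_principal: "dchar q (principal q)"
  unfolding dchar_def principal_def by (auto simp: coprime_mult_left_iff dest: cong_imp_coprime cong_sym)

text \<open>All values are 0 or roots of unity of order dividing \<open>totient q\<close>, and the
  values below \<open>q\<close> determine the character.\<close>

lemma finite_dchar:
  assumes q: "q > 0" shows "finite {\<omega>. dchar q \<omega>}"
proof -
  let ?Z = "insert 0 {z::complex. z ^ totient q = 1}"
  let ?r = "\<lambda>\<omega>::nat\<Rightarrow>complex. restrict \<omega> {..<q}"
  have "?r ` {\<omega>. dchar q \<omega>} \<subseteq> {..<q} \<rightarrow>\<^sub>E ?Z"
  proof (rule image_subsetI)
    fix \<omega> assume "\<omega> \<in> {\<omega>. dchar q \<omega>}"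
    then have w: "dchar q \<omega>" by simp
    have "\<omega> n \<in> ?Z" for n using dchar_power_totient[OF w, of n] dcharD(3)[OF w, of n] by (cases "coprime n q") auto
    then show "restrict \<omega> {..<q} \<in> {..<q} \<rightarrow>\<^sub>E ?Z" by auto
  qed
  moreover have "finite ({..<q} \<rightarrow>\<^sub>E ?Z)" using q by (intro finite_PiE) (auto intro!: finite_roots_unity simp: Suc_le_eq)
  ultimately have "finite (?r ` {\<omega>. dchar q \<omega>})" by (rule finite_subset)
  moreover have "inj_on ?r {\<omega>. dchar q \<omega>}"
  proof (rule inj_onI, rule ext)
    fix \<omega> \<omega>' n assume *: "\<omega> \<in> {\<omega>. dchar q \<omega>}" "\<omega>' \<in> {\<omega>. dchar q \<omega>}" "?r \<omega> = ?r \<omega>'"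
    have "\<omega> (n mod q) = \<omega>' (n mod q)" using fun_cong[OF *(3), of "n mod q"] q by simp
    moreover have "\<omega> (n mod q) = \<omega> n" "\<omega>' (n mod q) = \<omega>' n"
      using * dcharD(2)[of q _ "n mod q" n] by (auto simp: unique_euclidean_semiring_class.cong_def)
    ultimately show "\<omega> n = \<omega>' n" by simp
  qed
  ultimately show ?thesis by (rule finite_imageD)
qed

lemma sum_dchar_period:
  assumes q: "q > 0" and \<omega>: "dchar q \<omega>" "\<omega> \<noteq> principal q"
  shows "(\<Sum>n<q. \<omega> n) = 0"
proof -
  obtain b where b: "coprime b q" "\<omega> b \<noteq> 1"
  proof -
    have "\<exists>b. \<omega> b \<noteq> principal q b" using \<omega>(2) by auto
    then obtain b where "\<omega> b \<noteq> principal q b" by blast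
    then show ?thesis using that[of b] dcharD(3)[OF \<omega>(1), of b] by (auto simp: principal_def split: if_splits)
  qed
  have inj: "inj_on (\<lambda>n. b * n mod q) {..<q}"
  proof (rule inj_onI)
    fix m n assume "m \<in> {..<q}" "n \<in> {..<q}" "b * m mod q = b * n mod q"
    then show "m = n" using cong_mult_lcancel_nat[of b q m n] b by (auto simp: unique_euclidean_semiring_class.cong_def coprime_commute)
  qed
  have img: "(\<lambda>n. b * n mod q) ` {..<q} = {..<q}"
    by (rule endo_inj_surj) (use q inj in auto)
  have "(\<Sum>n<q. \<omega> n) = (\<Sum>n\<in>(\<lambda>n. b * n mod q) ` {..<q}. \<omega> n)" by (simp only: img)
  also have "\<dots> = (\<Sum>n<q. \<omega> (b * n mod q))" by (simp add: sum.reindex[OF inj])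
  also have "\<dots> = (\<Sum>n<q. \<omega> b * \<omega> n)"
    using dcharD(1,2)[OF \<omega>(1)] by (intro sum.cong refl) (metis cong_mod_left cong_refl)
  also have "\<dots> = \<omega> b * (\<Sum>n<q. \<omega> n)" by (simp add: sum_distrib_left)
  finally have "(1 - \<omega> b) * (\<Sum>n<q. \<omega> n) = 0" by (simp add: algebra_simps)
  then show ?thesis using b by simp
qed

lemma sum_chars_nontriv:
  assumes q: "q > 0" and n: "coprime n q" "\<not> [n = 1] (mod q)"
  shows "(\<Sum>\<omega> | dchar q \<omega>. \<omega> n) = 0"
proof -
  obtain \<omega>1 where \<omega>1: "dchar q \<omega>1" "\<omega>1 n \<noteq> 1" using dchar_separates[OF q n] by blast
  let ?X = "{\<omega>. dchar q \<omega>}"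
  let ?f = "\<lambda>\<omega> (k::nat). \<omega>1 k * \<omega> k :: complex"
  have inj: "inj_on ?f ?X"
  proof (rule inj_onI, rule ext)
    fix \<omega> \<omega>' k assume *: "\<omega> \<in> ?X" "\<omega>' \<in> ?X" "?f \<omega> = ?f \<omega>'"
    show "\<omega> k = \<omega>' k"
      using fun_cong[OF *(3), of k] dcharD(3)[OF \<omega>1(1), of k] dcharD(3)[of q \<omega> k] dcharD(3)[of q \<omega>' k] *(1,2)
      by (cases "coprime k q") auto
  qed
  have sub: "?f ` ?X \<subseteq> ?X"
  proof safe
    fix \<omega> assume "dchar q \<omega>"
    note D = dcharD(1-3)[OF \<omega>1(1)] and E = dcharD(1-3)[OF this]
    show "dchar q (?f \<omega>)"
      unfolding dchar_def
    proof (intro conjI allI impI)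
      fix m n
      show "\<omega>1 (m * n) * \<omega> (m * n) = \<omega>1 m * \<omega> m * (\<omega>1 n * \<omega> n)" by (simp add: D(1) E(1))
      show "\<omega>1 m * \<omega> m = \<omega>1 n * \<omega> n" if "[m = n] (mod q)" using D(2)[OF that] E(2)[OF that] by simp
      show "(\<omega>1 n * \<omega> n = 0) = (\<not> coprime n q)" by (simp add: D(3) E(3))
    qed
  qed
  have img: "?f ` ?X = ?X" by (rule endo_inj_surj[OF finite_dchar[OF q] sub inj])
  have "(\<Sum>\<omega>\<in>?X. \<omega> n) = (\<Sum>\<omega>\<in>?f ` ?X. \<omega> n)" by (simp only: img)
  also have "\<dots> = \<omega>1 n * (\<Sum>\<omega>\<in>?X. \<omega> n)" by (simp add: sum.reindex[OF inj] sum_distrib_left)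
  finally have "(1 - \<omega>1 n) * (\<Sum>\<omega>\<in>?X. \<omega> n) = 0" by (simp add: algebra_simps)
  then show ?thesis using \<omega>1 by simp
qed

lemma card_coprime_less: "q > 0 \<Longrightarrow> card {n. n < q \<and> coprime n q} = totient q"
proof (cases "q = 1")
  case True
  then have "{n. n < q \<and> coprime n q} = {0}" by auto
  then show ?thesis using True by simp
next
  case False
  assume "q > 0"
  with False have "{n. n < q \<and> coprime n q} = totatives q"
  proof (intro equalityI subsetI)
    fix n assume "n \<in> {n. n < q \<and> coprime n q}"
    then have n: "n < q" "coprime n q" by auto
    have "n \<noteq> 0" using n False by (intro notI) simp
    then show "n \<in> totatives q" using n by (simp add: totatives_def)
  next
    fix n assume "n \<in> totatives q"
    then have n: "n \<le> q" "coprime n q" by (auto simp: totatives_def)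
    have "n \<noteq> q" using n False by (intro notI) simp
    then show "n \<in> {n. n < q \<and> coprime n q}" using n by simp
  qed
  then show ?thesis by (simp add: totient_def)
qed

text \<open>Evaluate the double sum of \<open>\<omega> n\<close> over all characters and all
  \<open>n < q\<close> in both orders. For fixed \<open>\<omega>\<close> only the principal
  character survives, for fixed \<open>n\<close> only the class of 1.\<close>

lemma card_dchar:
  assumes q: "q > 0" shows "card {\<omega>. dchar q \<omega>} = totient q"
proof -
  let ?X = "{\<omega>. dchar q \<omega>}"
  note fin = finite_dchar[OF q]
  have "(\<Sum>\<omega>\<in>?X. \<Sum>n<q. \<omega> n) = (\<Sum>\<omega>\<in>{principal q}. \<Sum>n<q. \<omega> n)"
    using sum_dchar_period[OF q] dchar_principal by (intro sum.mono_neutral_right fin) auto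
  also have "\<dots> = of_nat (card {n. n < q \<and> coprime n q})"
    by (simp add: principal_def sum.If_cases Int_def lessThan_def) 
  finally have 1: "(\<Sum>\<omega>\<in>?X. \<Sum>n<q. \<omega> n) = of_nat (totient q)" using card_coprime_less[OF q] by simp
  have "(\<Sum>\<omega>\<in>?X. \<Sum>n<q. \<omega> n) = (\<Sum>n<q. \<Sum>\<omega>\<in>?X. \<omega> n)" by (rule sum.swap)
  \<comment> \<open>Writing \<open>1 mod q\<close> keeps the case \<open>q = 1\<close> correct,
    where the class of 1 is represented by 0.\<close>
  also have "\<dots> = (\<Sum>n\<in>{1 mod q}. \<Sum>\<omega>\<in>?X. \<omega> n)"
  proof (intro sum.mono_neutral_right ballI)
    fix n assume n: "n \<in> {..<q} - {1 mod q}"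
    show "(\<Sum>\<omega>\<in>?X. \<omega> n) = 0"
    proof (cases "coprime n q")
      case True
      have "\<not> [n = 1] (mod q)" using n by (auto simp: unique_euclidean_semiring_class.cong_def)
      then show ?thesis using sum_chars_nontriv[OF q True] by simp
    next
      case False
      then show ?thesis using dcharD(3) by (intro sum.neutral) auto
    qed
  qed (use q in auto)
  also have "\<dots> = (\<Sum>\<omega>\<in>?X. 1)"
  proof -
    have "\<omega> (1 mod q) = 1" if "dchar q \<omega>" for \<omega>
      using dcharD(2)[OF that, of "1 mod q" 1] dcharD(4)[OF that] by (simp add: unique_euclidean_semiring_class.cong_def)
    then have "(\<Sum>\<omega>\<in>?X. \<omega> (1 mod q)) = (\<Sum>\<omega>\<in>?X. 1)" by (intro sum.cong refl) auto
    then show ?thesis by (subst sum.insert) auto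
  qed
  finally have "of_nat (card ?X) = (of_nat (totient q) :: complex)" using 1 by simp
  then show ?thesis by (simp only: of_nat_eq_iff)
qed

theorem dchar_orthogonality:
  assumes q: "q > 0" and n: "coprime n q" "coprime a q"
  shows "(\<Sum>\<omega> | dchar q \<omega>. \<omega> n * cnj (\<omega> a)) = (if [n = a] (mod q) then of_nat (totient q) else 0)"
proof -
  obtain b where b: "[a * b = 1] (mod q)" using cong_solve_coprime_nat[OF n(2)] by auto
  have bc: "coprime b q" using b by (metis cong_imp_coprime cong_sym coprime_1_left coprime_mult_left_iff)
  have eq: "cnj (\<omega> a) = \<omega> b" if "dchar q \<omega>" for \<omega>
  proof -
    have "\<omega> a * \<omega> b = 1" using dcharD(1,2,4)[OF that] b by metis
    moreover have "\<omega> a * cnj (\<omega> a) = 1" using norm_dchar[OF q that n(2)] by (simp add: complex_norm_square[symmetric])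
    moreover have "\<omega> a \<noteq> 0" using dcharD(3)[OF that] n(2) by auto
    ultimately show ?thesis by (metis mult_cancel_left)
  qed
  have "(\<Sum>\<omega> | dchar q \<omega>. \<omega> n * cnj (\<omega> a)) = (\<Sum>\<omega> | dchar q \<omega>. \<omega> (n * b))"
    by (intro sum.cong refl) (use eq dcharD(1) in auto)
  also have "\<dots> = (if [n = a] (mod q) then of_nat (totient q) else 0)"
  proof (cases "[n = a] (mod q)")
    case True
    have "[n * b = 1] (mod q)" using cong_scalar_right[OF True, of b] b cong_trans by blast
    then have "\<omega> (n * b) = 1" if "dchar q \<omega>" for \<omega> using dcharD(2,4)[OF that] by metis
    then have "(\<Sum>\<omega> | dchar q \<omega>. \<omega> (n * b)) = (\<Sum>\<omega> | dchar q \<omega>. 1)" by (intro sum.cong) auto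
    then show ?thesis using True card_dchar[OF q] by simp
  next
    case False
    have "\<not> [n * b = 1] (mod q)"
    proof
      assume "[n * b = 1] (mod q)"
      then have "[n * b = a * b] (mod q)" using b cong_sym cong_trans by blast
      then show False using False bc cong_mult_rcancel_nat by blast
    qed
    then show ?thesis using sum_chars_nontriv[OF q, of "n * b"] n bc False by auto
  qed
  finally show ?thesis .
qed

section \<open>Logarithmic derivatives of zero-free functions\<close>

text \<open>The map sending \<open>w\<close> to \<open>w / (2 * A - w)\<close> takes the half plane
  \<open>Re w < A\<close> into the unit disc and fixes 0, so Schwarz' lemma bounds the derivative at
  the centre.\<close>

lemma borel_caratheodory_deriv:
  fixes h :: "complex \<Rightarrow> complex"
  assumes R: "R > 0" and hol: "h holomorphic_on ball c R"
    and le: "\<And>z. z \<in> ball c R \<Longrightarrow> Re (h z) \<le> M"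
  shows "norm (deriv h c) \<le> 2 * (M - Re (h c)) / R"
proof (rule field_le_epsilon)
  fix e :: real assume e: "e > 0"
  \<comment> \<open>The extra \<open>e * R / 2\<close> keeps \<open>A\<close> positive even if
    \<open>Re (h c)\<close> already equals \<open>M\<close>; it disappears as \<open>e\<close> tends
    to 0.\<close>
  define A where "A = M - Re (h c) + e * R / 2"
  have A: "A > 0" using le[of c] R e by (simp add: A_def add_nonneg_pos)
  define g where "g = (\<lambda>w. h (c + of_real R * w) - h c)"
  define f where "f = (\<lambda>w. g w / (2 * of_real A - g w))"
  have sub: "c + of_real R * w \<in> ball c R" if "norm w < 1" for w
    using that R by (simp add: dist_norm norm_mult)
  have holg: "g holomorphic_on ball 0 1"
    unfolding g_def using sub by (intro holomorphic_intros holomorphic_on_compose_gen[OF _ hol, unfolded o_def]) auto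
  have Reg: "Re (g w) < A" if "norm w < 1" for w
  proof -
    have "e * R > 0" using e R by simp
    then show ?thesis using le[OF sub[OF that]] unfolding g_def A_def minus_complex.simps by linarith
  qed
  have ne: "2 * of_real A - g w \<noteq> 0" if "norm w < 1" for w
    using Reg[OF that] A by (auto simp: complex_eq_iff)
  have holf: "f holomorphic_on ball 0 1"
    unfolding f_def using ne by (intro holomorphic_intros holg) auto
  have f0: "f 0 = 0" by (simp add: f_def g_def)
  have nf: "norm (f w) < 1" if "norm w < 1" for w
  proof -
    have "(norm (g w))\<^sup>2 < (norm (2 * of_real A - g w))\<^sup>2"
    proof -
      have "A * Re (g w) < A * A" using Reg[OF that] A by (intro mult_strict_left_mono) auto
      then show ?thesis unfolding cmod_power2 by (simp add: power2_eq_square algebra_simps)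
    qed
    then have "norm (g w) < norm (2 * of_real A - g w)" by (rule power_less_imp_less_base) auto
    then show ?thesis using ne[OF that] by (simp add: f_def norm_divide)
  qed
  have hder: "(h has_field_derivative deriv h c) (at c)"
    using hol R by (intro holomorphic_derivI[of _ "ball c R"]) auto
  have "((\<lambda>w. h (c + of_real R * w)) has_field_derivative deriv h c * of_real R) (at 0)"
  proof (rule DERIV_chain2[where g = "\<lambda>w. c + of_real R * w"])
    show "(h has_field_derivative deriv h c) (at (c + of_real R * 0))" using hder by simp
    show "((\<lambda>w. c + of_real R * w) has_field_derivative of_real R) (at 0)"
      by (auto intro!: derivative_eq_intros)
  qed
  then have gd: "(g has_field_derivative deriv h c * of_real R - 0) (at 0)"
    unfolding g_def by (intro DERIV_diff DERIV_const)
  have g0: "g 0 = 0" by (simp add: g_def)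
  have "(f has_field_derivative ((deriv h c * of_real R - 0) * (2 * of_real A - g 0) -
     g 0 * (0 - (deriv h c * of_real R - 0))) / ((2 * of_real A - g 0) * (2 * of_real A - g 0))) (at 0)"
    unfolding f_def using A g0 by (intro DERIV_divide DERIV_diff gd DERIV_const) auto
  then have "(f has_field_derivative of_real R * deriv h c / (2 * of_real A)) (at 0)"
    using A by (simp add: g0 mult.commute)
  then have "deriv f 0 = of_real R * deriv h c / (2 * of_real A)" by (rule DERIV_imp_deriv)
  moreover have "norm (deriv f 0) \<le> 1" using Schwarz_Lemma(2)[OF holf f0 nf, of 0] by simp
  ultimately have "R * norm (deriv h c) / (2 * A) \<le> 1" using R A by (simp add: norm_mult norm_divide)
  then have "norm (deriv h c) \<le> 2 * A / R" using R A by (simp add: field_simps)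
  also have "\<dots> = 2 * (M - Re (h c)) / R + e" using R by (simp add: A_def field_simps)
  finally show "norm (deriv h c) \<le> 2 * (M - Re (h c)) / R + e" .
qed

text \<open>On a disc a zero-free function has a logarithm \<open>h\<close>, the bound
  \<open>B\<close> turns into \<open>Re (h z) \<le> ln B\<close>, and the logarithmic derivative is
  the derivative of \<open>h\<close>.\<close>

lemma log_deriv_bound_nonzero:
  fixes F :: "complex \<Rightarrow> complex"
  assumes R: "R > 0" and hol: "F holomorphic_on ball c R"
    and le: "\<And>z. z \<in> ball c R \<Longrightarrow> norm (F z) \<le> B"
    and nz: "\<And>z. z \<in> ball c R \<Longrightarrow> F z \<noteq> 0"
  shows "norm (deriv F c / F c) \<le> 2 * ln (B / norm (F c)) / R"
proof -
  obtain h where h: "h holomorphic_on ball c R" "\<And>z. z \<in> ball c R \<Longrightarrow> F z = exp (h z)"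
    using contractible_imp_holomorphic_log[OF hol _ nz] by (metis convex_ball convex_imp_contractible)
  have Fc: "F c \<noteq> 0" using nz[of c] R by simp
  have B: "B > 0" using le[of c] R Fc by (smt (verit) centre_in_ball norm_le_zero_iff)
  have "Re (h z) \<le> ln B" if z: "z \<in> ball c R" for z
  proof -
    have "exp (Re (h z)) \<le> B" using le[OF z] h(2)[OF z] by simp
    then show ?thesis using B by (simp add: ln_ge_iff)
  qed
  then have "norm (deriv h c) \<le> 2 * (ln B - Re (h c)) / R"
    using R h by (intro borel_caratheodory_deriv) auto
  moreover have "ln (norm (F c)) = Re (h c)" using h(2)[of c] R by simp
  moreover have "deriv F c = F c * deriv h c"
  proof -
    have hd: "(h has_field_derivative deriv h c) (at c)"
      using h R by (intro holomorphic_derivI[of _ "ball c R"]) auto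
    have "((\<lambda>z. exp (h z)) has_field_derivative exp (h c) * deriv h c) (at c)"
      by (rule derivative_eq_intros hd refl)+
    then have "(F has_field_derivative exp (h c) * deriv h c) (at c)"
      by (rule has_field_derivative_transform_within_open[of _ _ _ "ball c R"]) (use R h(2) in auto)
    then show ?thesis using h(2)[of c] R by (simp add: DERIV_imp_deriv)
  qed
  ultimately show ?thesis using Fc B by (simp add: ln_div norm_divide)
qed

text \<open>The hypothesis with \<open>\<rho> ^ n\<close> is the induction measure. Removing a zero
  multiplies the absolute value at the centre by at least \<open>1 / \<rho>\<close> and keeps the
  bound \<open>B\<close>, so \<open>n\<close> drops by 1; for \<open>n = 0\<close> the value at the
  centre would exceed \<open>B\<close>. This avoids factoring out all zeros with multiplicity at
  once.\<close>

lemma Re_log_deriv_lower_bound_aux: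
  fixes F :: "complex \<Rightarrow> complex"
  assumes R: "R > 0" and U: "open U" "cball c R \<subseteq> U" and hol: "F holomorphic_on U"
    and le: "\<And>z. z \<in> cball c R \<Longrightarrow> norm (F z) \<le> B"
    and nz: "F c \<noteq> 0" and rho: "0 < \<rho>"
    and zeros: "\<And>z. z \<in> ball c R \<Longrightarrow> F z = 0 \<Longrightarrow> Re z \<le> Re c \<and> dist c z \<le> \<rho> * R"
    and big: "norm (F c) > B * \<rho> ^ n"
  shows "Re (deriv F c / F c) \<ge> - 2 * ln (B / norm (F c)) / R"
  using hol le nz zeros big
proof (induction n arbitrary: F)
  case 0
  then have "norm (F c) \<le> B" using R by simp
  with 0 show ?case by simp
next
  case (Suc n F)
  show ?case
  proof (cases "\<exists>a\<in>ball c R. F a = 0")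
    case False
    have "norm (deriv F c / F c) \<le> 2 * ln (B / norm (F c)) / R"
      using R False Suc.prems U
      by (intro log_deriv_bound_nonzero) (auto intro: holomorphic_on_subset[OF Suc.prems(1)] simp: subset_iff)
    moreover have "- norm (deriv F c / F c) \<le> Re (deriv F c / F c)"
      using abs_Re_le_cmod[of "deriv F c / F c"] by linarith
    ultimately show ?thesis by simp
  next
    case True
    then obtain a where a: "a \<in> ball c R" "F a = 0" by blast
    have ac: "a \<noteq> c" using a Suc.prems(3) by auto
    define b where "b = a - c"
    have b: "b \<noteq> 0" "norm b < R" using ac a by (auto simp: b_def dist_norm norm_minus_commute)
    have bprop: "Re b \<le> 0" "norm b \<le> \<rho> * R"
      using Suc.prems(4)[OF a] by (auto simp: b_def dist_norm norm_minus_commute)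
    define g where "g = (\<lambda>z. if z = a then deriv F a else (F z - F a) / (z - a))"
    have holg: "g holomorphic_on U" unfolding g_def by (rule pole_lemma_open) (use Suc.prems U in auto)
    have Fg: "F z = (z - a) * g z" for z using a by (simp add: g_def)
    \<comment> \<open>\<open>F\<close> divided by the Blaschke factor of the zero \<open>a\<close>.
      That factor has modulus 1 on the boundary circle, so by the maximum principle \<open>B\<close>
      bounds \<open>G\<close> as well.\<close>
    define G where "G = (\<lambda>z. g z * ((of_real (R^2) - cnj b * (z - c)) / of_real R))"
    have holG: "G holomorphic_on U" unfolding G_def using R by (intro holomorphic_intros holg) auto
    have FG: "F z * (of_real (R^2) - cnj b * (z - c)) = G z * (z - a) * of_real R" for z
      using R by (simp add: G_def Fg[of z])
    have normeq: "norm (of_real (R^2) - cnj b * w) = R * norm (w - b)" if "norm w = R" for w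
    proof -
      have "of_real (R^2) = w * cnj w" using that by (simp add: complex_norm_square[symmetric])
      then have "of_real (R^2) - cnj b * w = w * cnj (w - b)" by (simp add: algebra_simps)
      then show ?thesis using that by (simp add: norm_mult del: complex_cnj_diff)
    qed
    have leG: "norm (G z0) \<le> B" if z0: "z0 \<in> cball c R" for z0
    proof (rule maximum_modulus_frontier[where S = "cball c R" and f = G and B = B])
      show "G holomorphic_on interior (cball c R)" "continuous_on (closure (cball c R)) G"
        using U by (auto intro!: holomorphic_on_subset[OF holG] holomorphic_on_imp_continuous_on simp: subset_iff)
      fix z assume "z \<in> frontier (cball c R)"
      then have z: "norm (z - c) = R" using R by (auto simp: frontier_cball dist_norm norm_minus_commute)
      have zb: "(z - c) - b = z - a" by (simp add: b_def)
      have za: "z \<noteq> a" using z b by (auto simp: b_def)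
      have "norm (F z) * (R * norm (z - a)) = norm (G z) * norm (z - a) * R"
        using arg_cong[OF FG[of z], of norm] normeq[OF z] R unfolding zb by (simp add: norm_mult)
      then have "norm (F z) = norm (G z)" using za R by simp
      then show "norm (G z) \<le> B" using Suc.prems(2)[of z] z by (simp add: dist_norm norm_minus_commute)
    qed (use z0 in auto)
    have fac_nz: "of_real (R^2) - cnj b * (z - c) \<noteq> 0" if "z \<in> ball c R" for z
    proof
      assume "of_real (R^2) - cnj b * (z - c) = 0"
      then have "norm (of_real (R^2) :: complex) = norm (cnj b * (z - c))" by simp
      then have "R^2 = norm b * norm (z - c)" by (simp only: norm_mult norm_of_real complex_mod_cnj) simp
      also have "\<dots> < R * R" using that b R
        by (intro mult_strict_mono') (auto simp: dist_norm norm_minus_commute)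
      finally show False by (simp add: power2_eq_square)
    qed
    have Gzero: "F z = 0" if "z \<in> ball c R" "G z = 0" for z
      using FG[of z] that fac_nz[of z] by simp
    have FGc: "F c * of_real R = - G c * b"
    proof -
      have "(F c * of_real R) * of_real R = (- G c * b) * of_real R"
        using FG[of c] by (simp add: b_def power2_eq_square algebra_simps)
      then show ?thesis using R by (metis mult_right_cancel of_real_eq_0_iff less_irrefl)
    qed
    have nFGc: "norm (F c) * R = norm (G c) * norm b"
      using arg_cong[OF FGc, of norm] R by (simp add: norm_mult)
    have Gc0: "G c \<noteq> 0" using FGc Suc.prems(3) R by auto
    have B0: "B > 0" using Suc.prems(2)[of c] Suc.prems(3) R by (smt (verit) centre_in_cball norm_le_zero_iff)
    have Gge: "norm (G c) \<ge> norm (F c)"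
    proof -
      have "norm (F c) * R \<le> norm (G c) * R" unfolding nFGc using b by (intro mult_left_mono) auto
      then show ?thesis using R by simp
    qed
    have bigG: "norm (G c) > B * \<rho> ^ n"
    proof -
      have "B * \<rho> ^ Suc n * R < norm (F c) * R" using Suc.prems(5) R by (simp del: power_Suc)
      also have "\<dots> \<le> norm (G c) * (\<rho> * R)" unfolding nFGc using bprop by (intro mult_left_mono) auto
      finally show ?thesis using R rho by (simp add: mult_ac)
    qed
    have IH: "Re (deriv G c / G c) \<ge> - 2 * ln (B / norm (G c)) / R"
      by (rule Suc.IH[OF holG leG Gc0 _ bigG]) (use Suc.prems(4) Gzero in auto)
    have dF: "(F has_field_derivative deriv F c) (at c)" "(G has_field_derivative deriv G c) (at c)"
      using Suc.prems(1) holG U R by (auto intro!: holomorphic_derivI[of _ U])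
    have d1: "((\<lambda>z. F z * (of_real (R^2) - cnj b * (z - c))) has_field_derivative
             deriv F c * of_real (R^2) - cnj b * F c) (at c)"
      by (rule derivative_eq_intros dF refl)+ simp
    have d2: "((\<lambda>z. G z * (z - a) * of_real R) has_field_derivative
             (deriv G c * (c - a) + G c) * of_real R) (at c)"
      by (rule derivative_eq_intros dF refl)+ simp
    have "deriv F c * of_real (R^2) - cnj b * F c = (deriv G c * (c - a) + G c) * of_real R"
      using DERIV_unique[OF d1] d2 by (simp only: FG)
    then have "deriv F c * of_real (R^2) = cnj b * F c + (G c - deriv G c * b) * of_real R"
      by (simp add: b_def algebra_simps)
    then have "deriv F c / F c = deriv G c / G c - 1 / b + cnj b / of_real (R^2)"
    proof -
      assume *: "deriv F c * of_real (R^2) = cnj b * F c + (G c - deriv G c * b) * of_real R"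
      have Fc: "F c = - G c * b / of_real R" using FGc R by (simp add: field_simps)
      have "deriv F c = (cnj b * F c + (G c - deriv G c * b) * of_real R) / of_real (R^2)"
        using * R by (simp add: field_simps)
      also have "\<dots> / F c = cnj b / of_real (R^2) + (G c - deriv G c * b) * of_real R / of_real (R^2) / F c"
        using Suc.prems(3) R by (simp add: field_simps)
      also have "(G c - deriv G c * b) * of_real R / of_real (R^2) / F c = deriv G c / G c - 1 / b"
        unfolding Fc using Gc0 b R by (simp add: field_simps power2_eq_square)
      finally show ?thesis by simp
    qed
    \<comment> \<open>This is \<open>Re b * (1 / R ^ 2 - 1 / (norm b) ^ 2)\<close>. Both factors are
      at most 0: the zero is not to the right of the centre, and it lies inside the disc.\<close>
    moreover have "Re (- 1 / b + cnj b / of_real (R^2)) \<ge> 0"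
    proof -
      have "Re (1 / b) = Re b / (norm b)\<^sup>2" by (simp add: Re_divide cmod_power2)
      moreover have "Re (cnj b / of_real (R^2)) = Re b / R^2" by (simp add: Re_divide_of_real del: of_real_power)
      moreover have "Re b / (norm b)\<^sup>2 \<le> Re b / R^2"
        using b bprop R by (intro divide_left_mono_neg) (auto intro: power_mono)
      ultimately show ?thesis by simp
    qed
    ultimately have "Re (deriv F c / F c) \<ge> Re (deriv G c / G c)" by simp
    moreover have "ln (B / norm (G c)) \<le> ln (B / norm (F c))"
      using Gge Gc0 Suc.prems(3) B0 by (intro ln_mono divide_left_mono) auto
    then have "- 2 * ln (B / norm (F c)) / R \<le> - 2 * ln (B / norm (G c)) / R"
      using R by (intro divide_right_mono) auto
    ultimately show ?thesis using IH by linarith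
  qed
qed

text \<open>Dividing out a zero \<open>a\<close> by its Blaschke factor changes the logarithmic derivative at the
  centre \<open>c\<close> by a term whose real part has the sign of \<open>Re (c - a)\<close>; the number of divisions is
  bounded since each of them increases the value at the centre by a definite factor.\<close>

lemma Re_log_deriv_lower_bound:
  fixes F :: "complex \<Rightarrow> complex"
  assumes R: "R > 0" and U: "open U" "connected U" "cball c R \<subseteq> U" and hol: "F holomorphic_on U"
    and le: "\<And>z. z \<in> cball c R \<Longrightarrow> norm (F z) \<le> B"
    and nz: "F c \<noteq> 0"
    and zeros: "\<And>z. z \<in> ball c R \<Longrightarrow> F z = 0 \<Longrightarrow> Re z \<le> Re c"
  shows "Re (deriv F c / F c) \<ge> - 2 * ln (B / norm (F c)) / R"
proof (cases "F constant_on U")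
  case True
  then obtain k where k: "\<And>z. z \<in> U \<Longrightarrow> F z = k" by (auto simp: constant_on_def)
  have "deriv F c = deriv (\<lambda>_. k) c"
    using U R k by (intro deriv_cong_ev eventually_nhds_in_open[THEN eventually_mono, of U]) auto
  moreover have "norm (F c) \<le> B" using le R by simp
  then have "ln (B / norm (F c)) \<ge> 0" using nz by (intro ln_ge_zero) (simp add: field_simps)
  ultimately show ?thesis using R by simp
next
  case False
  let ?Z = "{z\<in>cball c R. F z = 0}"
  have fin: "finite ?Z"
    using holomorphic_compact_finite_zeros[OF hol U(1,2) _ U(3) False] by simp
  \<comment> \<open>Finitely many zeros stay away from the boundary circle by a fixed factor. The
    value 1/2 makes the maximum exist and be positive when there are no zeros.\<close>
  define \<rho> where "\<rho> = Max (insert (1/2) ((\<lambda>z. dist c z / R) ` {z\<in>ball c R. F z = 0}))"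
  have fin2: "finite {z\<in>ball c R. F z = 0}" by (rule finite_subset[OF _ fin]) auto
  have rho1: "\<rho> \<ge> 1/2" unfolding \<rho>_def using fin2 by (intro Max_ge) auto
  have rho2: "\<rho> < 1" unfolding \<rho>_def using fin2 R by (subst Max_less_iff) (auto simp: divide_simps)
  have rho3: "dist c z \<le> \<rho> * R" if "z \<in> ball c R" "F z = 0" for z
  proof -
    have "dist c z / R \<le> \<rho>" unfolding \<rho>_def using fin2 that by (intro Max_ge) auto
    then show ?thesis using R by (simp add: field_simps)
  qed
  have B: "B > 0" using le[of c] nz R by (smt (verit) centre_in_cball norm_le_zero_iff)
  obtain n where "\<rho> ^ n < norm (F c) / B"
    using real_arch_pow_inv[of "norm (F c) / B" \<rho>] rho2 nz B by auto
  then have "norm (F c) > B * \<rho> ^ n" using B by (simp add: field_simps)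
  then show ?thesis
    using Re_log_deriv_lower_bound_aux[OF R U(1,3) hol le nz _ _ , of \<rho> n] rho1 rho3 zeros by auto
qed

section \<open>Euler products over a finite set of primes\<close>

definition smooth :: "nat set \<Rightarrow> nat set" where
  "smooth A = {n. n > 0 \<and> prime_factors n \<subseteq> A}"

lemma smooth_empty [simp]: "smooth {} = {1}"
  by (auto simp: smooth_def prime_factorization_empty_iff)

lemma one_in_smooth [simp]: "Suc 0 \<in> smooth A" "1 \<in> smooth A"
  by (auto simp: smooth_def)

lemma smooth_mult: "m \<in> smooth A \<Longrightarrow> n \<in> smooth A \<Longrightarrow> m * n \<in> smooth A"
  by (auto simp: smooth_def prime_factors_product)

lemma smooth_mult_iff: "m * n \<in> smooth A \<longleftrightarrow> m \<in> smooth A \<and> n \<in> smooth A"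
  by (cases "m = 0 \<or> n = 0") (auto simp: smooth_def prime_factors_product)

lemma prime_in_smooth: "prime p \<Longrightarrow> p \<in> smooth A \<longleftrightarrow> p \<in> A"
  by (auto simp: smooth_def prime_factorization_prime prime_gt_0_nat)

lemma smooth_mono: "A \<subseteq> B \<Longrightarrow> smooth A \<subseteq> smooth B"
  by (auto simp: smooth_def)

lemma smooth_pos: "n \<in> smooth A \<Longrightarrow> n > 0"
  by (auto simp: smooth_def)

lemma bij_betw_smooth_insert:
  assumes p: "prime p" "p \<notin> A"
  shows "bij_betw (\<lambda>(k, n). p ^ k * n) (UNIV \<times> smooth A) (smooth (insert p A))"
proof -
  have ndvd: "\<not> p dvd n" if "n \<in> smooth A" for n
    using that p by (auto simp: smooth_def in_prime_factors_iff)
  have "inj_on (\<lambda>(k, n). p ^ k * n) (UNIV \<times> smooth A)"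
  proof (rule inj_onI, safe)
    fix k n k' n' assume n: "n \<in> smooth A" "n' \<in> smooth A" and eq: "p ^ k * n = p ^ k' * n'"
    have m: "multiplicity p (p ^ j * m) = j" if "m \<in> smooth A" for j m
      using that p ndvd smooth_pos[OF that]
      by (subst prime_elem_multiplicity_mult_distrib) (auto simp: not_dvd_imp_multiplicity_0)
    have "k = k'" using m[OF n(1), of k] m[OF n(2), of k'] eq by simp
    then show "k = k'" "n = n'" using eq p by (auto simp: prime_gt_0_nat)
  qed
  moreover have "(\<lambda>(k, n). p ^ k * n) ` (UNIV \<times> smooth A) = smooth (insert p A)"
  proof (intro equalityI subsetI)
    fix m assume "m \<in> (\<lambda>(k, n). p ^ k * n) ` (UNIV \<times> smooth A)"
    then obtain k n where m: "m = p ^ k * n" "n \<in> smooth A" by auto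
    have "p ^ k \<in> smooth (insert p A)"
      using p by (induction k) (auto intro!: smooth_mult simp: prime_in_smooth)
    then show "m \<in> smooth (insert p A)"
      using m smooth_mono[of A "insert p A"] by (auto intro: smooth_mult)
  next
    fix m assume m: "m \<in> smooth (insert p A)"
    then have "m \<noteq> 0" "\<not> is_unit p" using p by (auto simp: smooth_def)
    then obtain y where y: "m = p ^ multiplicity p m * y" "\<not> p dvd y"
      by (rule multiplicity_decompose')
    have "y \<in> smooth (insert p A)" using m y(1) smooth_mult_iff by metis
    then have "y \<in> smooth A" using y(2) by (auto simp: smooth_def in_prime_factors_iff)
    then show "m \<in> (\<lambda>(k, n). p ^ k * n) ` (UNIV \<times> smooth A)"
      using y(1) by (intro image_eqI[of _ _ "(multiplicity p m, y)"]) auto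
  qed
  ultimately show ?thesis by (simp add: bij_betw_def)
qed

text \<open>Adjoining one prime multiplies the sum by a geometric series. Summability over the
  product set is assumed, since it has two different sources: nonnegativity in the real case, and
  absolute convergence, itself taken from the real case, for complex values.\<close>

lemma euler_smooth_aux:
  fixes g :: "nat \<Rightarrow> 'a :: {real_normed_field, banach}"
  assumes p: "prime p" "p \<notin> A" and g: "\<And>m n. g (m * n) = g m * g n" "g 1 = 1"
    and lt: "norm (g p) < 1" and S: "(g has_sum S) (smooth A)"
    and sum: "(\<lambda>x. g (case x of (k, n) \<Rightarrow> p ^ k * n)) summable_on (UNIV \<times> smooth A)"
  shows "(g has_sum (1 / (1 - g p) * S)) (smooth (insert p A))"
proof -
  have pow: "g (p ^ k) = g p ^ k" for k by (induction k) (use g in auto)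
  have geo: "((\<lambda>k. g p ^ k) has_sum (1 / (1 - g p))) UNIV"
    using lt by (intro norm_summable_imp_has_sum geometric_sums) (auto simp: norm_power)
  have "((\<lambda>x. g (case x of (k, n) \<Rightarrow> p ^ k * n)) has_sum (1 / (1 - g p) * S)) (UNIV \<times> smooth A)"
  proof (rule has_sum_SigmaI)
    show "((\<lambda>y. g (case (k, y) of (k, n) \<Rightarrow> p ^ k * n)) has_sum (g p ^ k * S)) (smooth A)" for k
      using has_sum_cmult_right[OF S, of "g p ^ k"] by (simp add: g(1) pow)
    show "((\<lambda>k. g p ^ k * S) has_sum (1 / (1 - g p) * S)) UNIV"
      by (rule has_sum_cmult_left[OF geo])
  qed (rule sum)
  then show ?thesis
    using has_sum_reindex_bij_betw[OF bij_betw_smooth_insert[OF p], of g] by simp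
qed

lemma euler_smooth_real:
  fixes g :: "nat \<Rightarrow> real"
  assumes A: "finite A" "\<And>p. p \<in> A \<Longrightarrow> prime p" and g: "\<And>m n. g (m * n) = g m * g n" "g 1 = 1"
    "\<And>n. g n \<ge> 0" "\<And>p. p \<in> A \<Longrightarrow> g p < 1"
  shows "(g has_sum (\<Prod>p\<in>A. 1 / (1 - g p))) (smooth A)"
  using A g(4)
proof (induction A rule: finite_induct)
  case empty
  then show ?case using has_sum_finite[of "{1::nat}" g] g(2) by simp
next
  case (insert p A)
  have IH: "(g has_sum (\<Prod>p\<in>A. 1 / (1 - g p))) (smooth A)" using insert by auto
  have pow: "g (p ^ k) = g p ^ k" for k by (induction k) (use g in auto)
  have geo: "((\<lambda>k. g p ^ k) has_sum (1 / (1 - g p))) UNIV"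
    using insert.prems g(3) by (intro norm_summable_imp_has_sum geometric_sums) (auto simp: norm_power)
  have "(\<lambda>x. g (case x of (k, n) \<Rightarrow> p ^ k * n)) summable_on (UNIV \<times> smooth A)"
  proof (rule summable_on_SigmaI)
    show "((\<lambda>y. g (case (k, y) of (k, n) \<Rightarrow> p ^ k * n)) has_sum (g p ^ k * (\<Prod>p\<in>A. 1 / (1 - g p)))) (smooth A)" for k
      using has_sum_cmult_right[OF IH, of "g p ^ k"] by (simp add: g(1) pow)
    show "(\<lambda>k. g p ^ k * (\<Prod>p\<in>A. 1 / (1 - g p))) summable_on UNIV"
      using has_sum_cmult_left[OF geo] by (auto simp: summable_on_def)
  qed (use g(3) in auto)
  then have "(g has_sum (1 / (1 - g p) * (\<Prod>p\<in>A. 1 / (1 - g p)))) (smooth (insert p A))"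
    using insert.prems insert.hyps g by (intro euler_smooth_aux IH) auto
  then show ?case using insert.hyps by simp
qed

lemma euler_smooth:
  fixes g :: "nat \<Rightarrow> complex"
  assumes A: "finite A" "\<And>p. p \<in> A \<Longrightarrow> prime p" and g: "\<And>m n. g (m * n) = g m * g n" "g 1 = 1"
    "\<And>p. p \<in> A \<Longrightarrow> norm (g p) < 1"
  shows "(g has_sum (\<Prod>p\<in>A. 1 / (1 - g p))) (smooth A)"
    and "(\<lambda>n. norm (g n)) summable_on smooth A"
proof -
  have abs: "(\<lambda>n. norm (g n)) summable_on smooth B" if "B \<subseteq> A" for B
  proof -
    have "((\<lambda>n. norm (g n)) has_sum (\<Prod>p\<in>B. 1 / (1 - norm (g p)))) (smooth B)"
      by (rule euler_smooth_real) (use that A g in \<open>auto simp: norm_mult intro: finite_subset\<close>)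
    then show ?thesis by (auto simp: summable_on_def)
  qed
  show "(\<lambda>n. norm (g n)) summable_on smooth A" using abs by auto
  show "(g has_sum (\<Prod>p\<in>A. 1 / (1 - g p))) (smooth A)"
    using A g(3) abs
  proof (induction A rule: finite_induct)
    case empty
    then show ?case using has_sum_finite[of "{1::nat}" g] g(2) by simp
  next
    case (insert p A)
    have IH: "(g has_sum (\<Prod>p\<in>A. 1 / (1 - g p))) (smooth A)" using insert by blast
    have "g summable_on smooth (insert p A)"
      using insert.prems(3)[of "insert p A"] abs_summable_summable by blast
    then have "(\<lambda>x. g (case x of (k, n) \<Rightarrow> p ^ k * n)) summable_on (UNIV \<times> smooth A)"
      using summable_on_reindex_bij_betw[OF bij_betw_smooth_insert, of p A g] insert by auto
    then have "(g has_sum (1 / (1 - g p) * (\<Prod>p\<in>A. 1 / (1 - g p)))) (smooth (insert p A))"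
      using insert.prems insert.hyps g(1,2) by (intro euler_smooth_aux IH) auto
    then show ?case using insert.hyps by simp
  qed
qed

text \<open>The Dirichlet factor \<open>n\<close> to the power \<open>- s\<close>, set to 0 at
  \<open>n = 0\<close> so that it is completely multiplicative on all naturals.\<close>

definition dpow :: "complex \<Rightarrow> nat \<Rightarrow> complex" where
  "dpow s n = (if n = 0 then 0 else exp (- s * of_real (lnn n)))"

lemma dpow_0 [simp]: "dpow s 0 = 0" by (simp add: dpow_def)

lemma dpow_1 [simp]: "dpow s 1 = 1" "dpow s (Suc 0) = 1" by (simp_all add: dpow_def)

lemma dpow_mult: "dpow s (m * n) = dpow s m * dpow s n"
  by (auto simp: dpow_def ln_mult algebra_simps exp_add[symmetric])

lemma norm_dpow: "norm (dpow s n) = real n powr (- Re s)"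
  by (auto simp: dpow_def powr_def)

lemma dpow_of_real: "dpow (of_real \<sigma>) n = of_real (npow n \<sigma>)"
  by (auto simp: dpow_def powr_def exp_of_real[symmetric] simp del: exp_of_real)

lemma dpow_add: "dpow (s + t) n = dpow s n * dpow t n"
  by (auto simp: dpow_def algebra_simps exp_add[symmetric])

lemma has_sum_smooth_powr:
  assumes "finite A" "\<And>p. p \<in> A \<Longrightarrow> prime p" "\<sigma> > 0"
  shows "((\<lambda>n. npow n \<sigma>) has_sum (\<Prod>p\<in>A. 1 / (1 - npow p \<sigma>))) (smooth A)"
proof (rule euler_smooth_real)
  show "npow p \<sigma> < 1" if "p \<in> A" for p
    using assms(2)[OF that] assms(3) by (auto simp: powr_minus_divide prime_gt_Suc_0_nat intro!: gr_one_powr)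
qed (use assms in \<open>auto simp: powr_mult\<close>)

section \<open>Dirichlet L-functions and character sums over primes\<close>

lemma norm_dpow_diff:
  assumes "0 < m" "m \<le> n" "Re s \<ge> 0"
  shows "norm (dpow s m - dpow s n) \<le> norm s * real m powr (- Re s - 1) * (real n - real m)"
proof -
  let ?S = "closed_segment (of_nat m :: complex) (of_nat n)"
  let ?f = "\<lambda>z. exp (- s * Ln z)"
  have seg: "\<exists>t\<ge>real m. z = of_real t" if "z \<in> ?S" for z
  proof -
    have "z \<in> closed_segment (of_real (real m)) (of_real (real n))" using that by simp
    then obtain t where "t \<in> closed_segment (real m) (real n)" "z = of_real t"
      by (auto simp only: closed_segment_of_real)
    then show ?thesis using assms by (auto simp: closed_segment_eq_real_ivl)
  qed
  have "norm (?f (of_nat m) - ?f (of_nat n)) \<le>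
     (norm s * real m powr (- Re s - 1)) * norm (of_nat m - of_nat n :: complex)"
  proof (rule field_differentiable_bound[where S = ?S and f' = "\<lambda>z. ?f z * (- s / z)"])
    fix z assume "z \<in> ?S"
    then obtain t where t: "t \<ge> real m" "z = of_real t" using seg by blast
    have tpos: "t > 0" using t assms by linarith
    have "z \<notin> \<real>\<^sub>\<le>\<^sub>0" using t tpos by (simp add: complex_nonpos_Reals_iff)
    then show "(?f has_field_derivative ?f z * (- s / z)) (at z within ?S)"
      by (auto intro!: derivative_eq_intros simp: divide_inverse mult_ac)
    have "norm (?f z * (- s / z)) = exp (- Re s * ln t) * (norm s / t)"
      using t tpos by (simp add: norm_mult norm_divide Ln_of_real)
    also have "\<dots> = norm s * t powr (- Re s - 1)"
      using tpos by (simp add: powr_def exp_diff left_diff_distrib)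
    also have "\<dots> \<le> norm s * real m powr (- Re s - 1)"
      using t assms by (intro mult_left_mono powr_mono2') auto
    finally show "norm (?f z * (- s / z)) \<le> norm s * real m powr (- Re s - 1)" .
  qed auto
  moreover have "?f (of_nat k) = dpow s k" if "k > 0" for k
    using that Ln_of_real[of "real k"] by (simp add: dpow_def)
  moreover have "norm (of_nat m - of_nat n :: complex) = real n - real m"
  proof -
    have "norm (of_nat m - of_nat n :: complex) = norm (complex_of_real (real m - real n))" by simp
    also have "\<dots> = real n - real m" unfolding norm_of_real using assms by simp
    finally show ?thesis .
  qed
  ultimately show ?thesis using assms by simp
qed

text \<open>Blocks of \<open>q\<close> consecutive terms of the Dirichlet series. A non-principal
  character sums to 0 over a block, so the block of index \<open>k\<close> has size about
  \<open>(k + 1) powr (- Re s - 1)\<close>. The series of blocks therefore converges absolutely for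
  \<open>Re s > 0\<close> and provides the analytic continuation.\<close>

definition Lterm :: "nat \<Rightarrow> (nat \<Rightarrow> complex) \<Rightarrow> nat \<Rightarrow> complex \<Rightarrow> complex" where
  "Lterm q \<omega> k s = (\<Sum>n\<in>{k*q..<k*q+q}. \<omega> (Suc n) * dpow s (Suc n))"

definition Lfun :: "nat \<Rightarrow> (nat \<Rightarrow> complex) \<Rightarrow> complex \<Rightarrow> complex" where
  "Lfun q \<omega> s = (\<Sum>k. Lterm q \<omega> k s)"

lemma sum_dchar_block:
  assumes q: "q > 0" and w: "dchar q \<omega>" "\<omega> \<noteq> principal q"
  shows "(\<Sum>n\<in>{k*q..<k*q+q}. \<omega> (Suc n)) = 0"
proof -
  have "(\<Sum>n\<in>{k*q..<k*q+q}. \<omega> (Suc n)) = (\<Sum>n<q. \<omega> (Suc n))"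
  proof (rule sum.reindex_bij_witness[of _ "\<lambda>n. k * q + n" "\<lambda>n. n - k * q"])
    fix n assume "n \<in> {k*q..<k*q+q}"
    then have "Suc n = Suc (n - k * q) + k * q" by auto
    then have "[Suc (n - k * q) = Suc n] (mod q)" by (metis unique_euclidean_semiring_class.cong_def mod_mult_self1)
    then show "\<omega> (Suc (n - k * q)) = \<omega> (Suc n)" using dcharD(2)[OF w(1)] by blast
  qed auto
  also have "\<dots> = (\<Sum>n<q. \<omega> n)"
  proof -
    obtain j where j: "q = Suc j" using q by (cases q) auto
    have "(\<Sum>n<q. \<omega> (Suc n)) = (\<Sum>n<j. \<omega> (Suc n)) + \<omega> q" by (simp add: j)
    also have "\<omega> q = \<omega> 0" by (rule dcharD(2)[OF w(1)]) (simp add: unique_euclidean_semiring_class.cong_def)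
    also have "(\<Sum>n<j. \<omega> (Suc n)) + \<omega> 0 = (\<Sum>n<Suc j. \<omega> n)" by (subst sum.lessThan_Suc_shift) simp
    finally show ?thesis by (simp add: j)
  qed
  finally show ?thesis using sum_dchar_period[OF q w] by simp
qed

lemma norm_Lterm_le:
  assumes q: "q > 0" and w: "dchar q \<omega>" "\<omega> \<noteq> principal q" and s: "Re s \<ge> 0"
  shows "norm (Lterm q \<omega> k s) \<le> real q ^ 2 * norm s * real (Suc k) powr (- Re s - 1)"
proof -
  let ?I = "{k*q..<k*q+q}"
  \<comment> \<open>The subtracted term vanishes because the character sums to 0 over the block; it
    replaces \<open>dpow\<close> by its variation inside the block.\<close>
  have "Lterm q \<omega> k s = (\<Sum>n\<in>?I. \<omega> (Suc n) * dpow s (Suc n)) - (\<Sum>n\<in>?I. \<omega> (Suc n)) * dpow s (k*q+q)"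
    using sum_dchar_block[OF q w] by (simp add: Lterm_def)
  also have "\<dots> = (\<Sum>n\<in>?I. \<omega> (Suc n) * (dpow s (Suc n) - dpow s (k*q+q)))"
    by (simp only: right_diff_distrib sum_subtractf sum_distrib_right)
  also have "norm \<dots> \<le> (\<Sum>n\<in>?I. real q * norm s * real (Suc k) powr (- Re s - 1))"
  proof (rule sum_norm_le)
    fix n assume n: "n \<in> ?I"
    have "k \<le> k * q" using q by simp
    then have kn: "Suc k \<le> Suc n" using n unfolding atLeastLessThan_iff by linarith
    have "norm (\<omega> (Suc n) * (dpow s (Suc n) - dpow s (k*q+q))) \<le> 1 * norm (dpow s (Suc n) - dpow s (k*q+q))"
      unfolding norm_mult by (intro mult_right_mono norm_dchar_le[OF q w(1)]) auto
    also have "\<dots> \<le> norm s * real (Suc n) powr (- Re s - 1) * (real (k*q+q) - real (Suc n))"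
      using norm_dpow_diff[of "Suc n" "k*q+q" s] n s by simp
    also have "\<dots> \<le> norm s * real (Suc k) powr (- Re s - 1) * real q"
    proof (intro mult_mono powr_mono2')
      have "real (k * q) \<le> real n" using n by (simp del: of_nat_mult)
      then show "real (k*q+q) - real (Suc n) \<le> real q" by simp
      have "real (Suc n) \<le> real (k*q+q)" using n by (intro of_nat_mono) auto
      then show "0 \<le> real (k*q+q) - real (Suc n)" by simp
    qed (use s kn in auto)
    finally show "norm (\<omega> (Suc n) * (dpow s (Suc n) - dpow s (k*q+q))) \<le> real q * norm s * real (Suc k) powr (- Re s - 1)"
      by (simp add: mult_ac)
  qed
  also have "\<dots> = real q ^ 2 * norm s * real (Suc k) powr (- Re s - 1)" by (simp add: power2_eq_square)
  finally show ?thesis .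
qed

lemma summable_Suc_powr: "a < -1 \<Longrightarrow> summable (\<lambda>k. real (Suc k) powr a)"
  using summable_real_powr_iff[of a] summable_Suc_iff[of "\<lambda>n. real n powr a"] by simp

text \<open>The half plane \<open>Re s \<ge> 1/4\<close> contains every disc of radius 1/2 around a
  point with real part above 1, which is where L-functions will be bounded, and on it the exponent
  \<open>- 5/4\<close> serves for all \<open>s\<close> at once.\<close>

lemma norm_Lterm_le':
  assumes q: "q > 0" and w: "dchar q \<omega>" "\<omega> \<noteq> principal q" and s: "Re s \<ge> 1/4"
  shows "norm (Lterm q \<omega> k s) \<le> real q ^ 2 * norm s * real (Suc k) powr (- 5/4)"
proof -
  have "real (Suc k) powr (- Re s - 1) \<le> real (Suc k) powr (- 5/4)" using s by (intro powr_mono) auto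
  then have "real q ^ 2 * norm s * real (Suc k) powr (- Re s - 1) \<le> real q ^ 2 * norm s * real (Suc k) powr (- 5/4)"
    by (intro mult_left_mono) auto
  then show ?thesis using norm_Lterm_le[OF q w, of s k] s by linarith
qed

lemma dpow_holomorphic [holomorphic_intros]: "(\<lambda>s. dpow s n) holomorphic_on A"
  by (cases "n = 0") (auto simp: dpow_def intro!: holomorphic_intros)

lemma Lfun_holomorphic:
  assumes q: "q > 0" and w: "dchar q \<omega>" "\<omega> \<noteq> principal q"
  shows "Lfun q \<omega> holomorphic_on {s. Re s > 1/4}"
proof (rule holomorphic_uniform_sequence[where f = "\<lambda>n s. \<Sum>k<n. Lterm q \<omega> k s"])
  show open': "open {s. Re s > 1/4}" by (rule open_halfspace_Re_gt)
  show "(\<lambda>s. \<Sum>k<n. Lterm q \<omega> k s) holomorphic_on {s. Re s > 1/4}" for n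
    unfolding Lterm_def by (intro holomorphic_intros)
  fix x assume x: "x \<in> {s. Re s > 1/4}"
  then obtain d where d: "d > 0" "cball x d \<subseteq> {s. Re s > 1/4}" using open' open_contains_cball by blast
  have "uniform_limit (cball x d) (\<lambda>n s. \<Sum>k<n. Lterm q \<omega> k s) (Lfun q \<omega>) sequentially"
    unfolding Lfun_def
  proof (rule Weierstrass_m_test)
    fix k s assume s: "s \<in> cball x d"
    have "norm s \<le> norm x + d" using s norm_triangle_ineq[of x "s - x"] by (simp add: dist_norm norm_minus_commute)
    then have "real q ^ 2 * norm s * real (Suc k) powr (- 5/4) \<le> real q ^ 2 * (norm x + d) * real (Suc k) powr (- 5/4)"
      by (intro mult_right_mono mult_left_mono) auto
    moreover have "Re s \<ge> 1/4" using s d by (auto dest!: subsetD)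
    ultimately show "norm (Lterm q \<omega> k s) \<le> real q ^ 2 * (norm x + d) * real (Suc k) powr (- 5/4)"
      using norm_Lterm_le'[OF q w, of s k] by linarith
  qed (intro summable_mult summable_Suc_powr, simp)
  then show "\<exists>d>0. cball x d \<subseteq> {s. Re s > 1/4} \<and>
     uniform_limit (cball x d) (\<lambda>n s. \<Sum>k<n. Lterm q \<omega> k s) (Lfun q \<omega>) sequentially"
    using d by blast
qed

lemma norm_Lfun_le:
  "\<exists>C\<ge>1. \<forall>q \<omega> s. q > 0 \<longrightarrow> dchar q \<omega> \<longrightarrow> \<omega> \<noteq> principal q \<longrightarrow> Re s \<ge> 1/4 \<longrightarrow>
     norm (Lfun q \<omega> s) \<le> C * real q ^ 2 * norm s"
proof -
  define C where "C = (\<Sum>k. real (Suc k) powr (- 5/4))"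
  have sm: "summable (\<lambda>k. real (Suc k) powr (- 5/4))" by (rule summable_Suc_powr) simp
  have "norm (Lfun q \<omega> s) \<le> max 1 C * real q ^ 2 * norm s"
    if a: "q > 0" "dchar q \<omega>" "\<omega> \<noteq> principal q" "Re s \<ge> 1/4" for q \<omega> s
  proof -
    have "norm (Lfun q \<omega> s) \<le> (\<Sum>k. real q ^ 2 * norm s * real (Suc k) powr (- 5/4))"
      unfolding Lfun_def by (rule norm_suminf_le) (use norm_Lterm_le'[OF a] sm summable_mult in blast)+
    also have "\<dots> = real q ^ 2 * norm s * C" unfolding C_def by (rule suminf_mult[OF sm])
    also have "\<dots> \<le> real q ^ 2 * norm s * max 1 C" by (intro mult_left_mono) auto
    finally show ?thesis by (simp add: mult_ac)
  qed
  then show ?thesis by (intro exI[of _ "max 1 C"]) auto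
qed

lemma Lfun_has_sum:
  assumes q: "q > 0" and w: "dchar q \<omega>" and s: "Re s > 1"
  shows "((\<lambda>n. \<omega> n * dpow s n) has_sum Lfun q \<omega> s) UNIV"
proof -
  let ?f = "\<lambda>n. \<omega> n * dpow s n"
  have le: "norm (?f n) \<le> real n powr (- Re s)" for n
    using mult_right_mono[OF norm_dchar_le[OF q w, of n], of "real n powr (- Re s)"] by (simp add: norm_mult norm_dpow)
  have sm: "summable (\<lambda>n. norm (?f n))"
  proof (rule summable_comparison_test')
    show "summable (\<lambda>n. real n powr (- Re s))" using s by (simp add: summable_real_powr_iff)
    show "norm (norm (?f n)) \<le> real n powr (- Re s)" if "n \<ge> 0" for n using le[of n] by simp
  qed
  then have sums: "?f sums suminf ?f" using summable_sums[OF summable_norm_cancel[OF sm]] by simp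
  then have "(\<lambda>n. ?f (Suc n)) sums suminf ?f" using sums_Suc_iff[of ?f] by simp
  then have "Lfun q \<omega> s = suminf ?f"
    unfolding Lfun_def Lterm_def
    using sums_unique[OF sums_group[of "\<lambda>n. ?f (Suc n)" "suminf ?f" q]] q by simp
  then show ?thesis using norm_summable_imp_has_sum[OF sm sums] by simp
qed

section \<open>Finite Euler products and their convergence to the right of 1\<close>

definition Eprod :: "(nat \<Rightarrow> complex) \<Rightarrow> nat \<Rightarrow> complex \<Rightarrow> complex" where
  "Eprod \<omega> N s = (\<Prod>p\<in>primes_le (real N). 1 / (1 - \<omega> p * dpow s p))"

lemma norm_dchar_dpow_less_1:
  assumes q: "q > 0" and w: "dchar q \<omega>" and s: "Re s > 0" and p: "prime p"
  shows "norm (\<omega> p * dpow s p) \<le> real p powr (- Re s)" "norm (\<omega> p * dpow s p) < 1" "\<omega> p * dpow s p \<noteq> 1"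
proof -
  show 1: "norm (\<omega> p * dpow s p) \<le> real p powr (- Re s)"
    using mult_right_mono[OF norm_dchar_le[OF q w, of p], of "real p powr (- Re s)"] by (simp add: norm_mult norm_dpow)
  have "real p powr (- Re s) < 1"
    using p s by (auto simp: powr_minus_divide prime_gt_Suc_0_nat intro!: gr_one_powr)
  with 1 show 2: "norm (\<omega> p * dpow s p) < 1" by linarith
  then show "\<omega> p * dpow s p \<noteq> 1" by auto
qed

lemma Eprod_has_sum:
  assumes q: "q > 0" and w: "dchar q \<omega>" and s: "Re s > 0"
  shows "((\<lambda>n. \<omega> n * dpow s n) has_sum Eprod \<omega> N s) (smooth (primes_le (real N)))"
  unfolding Eprod_def
  by (rule euler_smooth(1)) (use dcharD[OF w] norm_dchar_dpow_less_1[OF q w s] in \<open>auto simp: primes_le_def dpow_mult\<close>)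

lemma smooth_primes_le: "{1..N} \<subseteq> smooth (primes_le (real N))"
proof
  fix n assume n: "n \<in> {1..N}"
  have "p \<le> N" if "p \<in> prime_factors n" for p
    using that n dvd_imp_le[of p n] by (auto simp: in_prime_factors_iff)
  then show "n \<in> smooth (primes_le (real N))"
    using n by (auto simp: smooth_def primes_le_def in_prime_factors_iff)
qed

text \<open>Expanded, the product contains every \<open>n \<le> N\<close>, so the missing terms form
  a subseries of the tail beyond \<open>N\<close>. The bound depends on \<open>s\<close> only
  through \<open>\<sigma>\<close>, which gives uniform convergence.\<close>

lemma norm_Lfun_minus_Eprod:
  assumes q: "q > 0" and w: "dchar q \<omega>" and s: "Re s \<ge> \<sigma>" and \<sigma>: "\<sigma> > 1"
  shows "norm (Lfun q \<omega> s - Eprod \<omega> N s) \<le> (\<Sum>n. npow (n + Suc N) \<sigma>)"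
proof -
  let ?f = "\<lambda>n. \<omega> n * dpow s n" and ?S = "smooth (primes_le (real N))"
  have sm: "summable (\<lambda>n. npow n \<sigma>)" using \<sigma> by (simp add: summable_real_powr_iff)
  have hs: "(?f has_sum (Lfun q \<omega> s - Eprod \<omega> N s)) (UNIV - ?S)"
    by (rule has_sum_Diff) (use Lfun_has_sum[OF q w] Eprod_has_sum[OF q w] s \<sigma> in auto)
  have on: "(\<lambda>n. npow n \<sigma>) summable_on {Suc N..}"
    using sm by (intro norm_summable_imp_summable_on[THEN summable_on_subset_banach]) auto
  have "norm (Lfun q \<omega> s - Eprod \<omega> N s) \<le> infsum (\<lambda>n. npow n \<sigma>) {Suc N..}"
  proof (rule tendsto_upperbound)
    show "((\<lambda>F. norm (sum ?f F)) \<longlongrightarrow> norm (Lfun q \<omega> s - Eprod \<omega> N s)) (finite_subsets_at_top (UNIV - ?S))"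
      using hs unfolding has_sum_def by (rule tendsto_norm)
    show "\<forall>\<^sub>F F in finite_subsets_at_top (UNIV - ?S). norm (sum ?f F) \<le> infsum (\<lambda>n. npow n \<sigma>) {Suc N..}"
    proof (rule eventually_finite_subsets_at_top_weakI)
      fix F assume F: "finite F" "F \<subseteq> UNIV - ?S"
      have "norm (sum ?f F) \<le> (\<Sum>n\<in>F. npow n \<sigma>)"
      proof (rule sum_norm_le)
        fix n
        have "norm (?f n) \<le> real n powr (- Re s)"
          using mult_right_mono[OF norm_dchar_le[OF q w, of n], of "real n powr (- Re s)"] by (simp add: norm_mult norm_dpow)
        also have "\<dots> \<le> npow n \<sigma>" using s by (cases "n = 0") (auto intro!: powr_mono)
        finally show "norm (?f n) \<le> npow n \<sigma>" .
      qed
      also have "\<dots> = (\<Sum>n\<in>F - {0}. npow n \<sigma>)" using F by (intro sum.mono_neutral_right) auto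
      also have "\<dots> \<le> infsum (\<lambda>n. npow n \<sigma>) {Suc N..}"
      proof (rule finite_sum_le_infsum[OF on])
        show "F - {0} \<subseteq> {Suc N..}"
        proof
          fix n assume n: "n \<in> F - {0}"
          then have "n \<notin> {1..N}" using F smooth_primes_le by blast
          then show "n \<in> {Suc N..}" using n by auto
        qed
      qed (use F in auto)
      finally show "norm (sum ?f F) \<le> infsum (\<lambda>n. npow n \<sigma>) {Suc N..}" .
    qed
  qed auto
  also have "infsum (\<lambda>n. npow n \<sigma>) {Suc N..} = infsum (\<lambda>n. npow (n + Suc N) \<sigma>) UNIV"
    by (rule infsum_reindex_bij_witness[of _ "\<lambda>n. n + Suc N" "\<lambda>n. n - Suc N"]) auto
  also have "\<dots> = (\<Sum>n. npow (n + Suc N) \<sigma>)"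
  proof -
    have "summable (\<lambda>n. norm (npow (n + Suc N) \<sigma>))" using summable_ignore_initial_segment[OF sm, of "Suc N"] by simp
    from norm_summable_imp_has_sum[OF this summable_sums[OF summable_norm_cancel[OF this]]]
    show ?thesis by (rule infsumI)
  qed
  finally show ?thesis .
qed

lemma Eprod_uniform_limit:
  assumes q: "q > 0" and w: "dchar q \<omega>" and \<sigma>: "\<sigma> > 1"
  shows "uniform_limit {s. Re s > \<sigma>} (Eprod \<omega>) (Lfun q \<omega>) sequentially"
proof (rule uniform_limitI)
  fix e :: real assume e: "e > 0"
  have sm: "summable (\<lambda>n. npow n \<sigma>)" using \<sigma> by (simp add: summable_real_powr_iff)
  obtain N where N: "\<And>n. n \<ge> N \<Longrightarrow> norm (\<Sum>i. npow (i + n) \<sigma>) < e"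
    using suminf_exist_split[OF e sm] by blast
  show "\<forall>\<^sub>F n in sequentially. \<forall>s\<in>{s. Re s > \<sigma>}. dist (Eprod \<omega> n s) (Lfun q \<omega> s) < e"
  proof (rule eventually_sequentiallyI[of N], intro ballI)
    fix n s assume n: "n \<ge> N" and s: "s \<in> {s. Re s > \<sigma>}"
    have "norm (Lfun q \<omega> s - Eprod \<omega> n s) \<le> (\<Sum>i. npow (i + Suc n) \<sigma>)"
      using norm_Lfun_minus_Eprod[OF q w, of \<sigma> s n] s \<sigma> by simp
    also have "\<dots> < e" using N[of "Suc n"] n by (simp add: abs_less_iff)
    finally show "dist (Eprod \<omega> n s) (Lfun q \<omega> s) < e" by (simp add: dist_norm norm_minus_commute)
  qed
qed

text \<open>The usual comparison with an integral, done by telescoping \<open>n powr (- r)\<close>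
  with the mean value theorem; in effect the bound \<open>1 + 1 / r\<close> for the zeta function at
  \<open>1 + r\<close>.\<close>

lemma sum_powr_le:
  assumes r: "r > 0" and F: "finite F"
  shows "(\<Sum>n\<in>F. npow n (1 + r)) \<le> 1 + 1 / r"
proof -
  have step: "real (Suc n) powr (- (1 + r)) \<le> (real n powr (-r) - real (Suc n) powr (-r)) / r" if n: "n > 0" for n
  proof -
    obtain z where z: "real n < z" "z < real (Suc n)"
      "real (Suc n) powr (-r) - real n powr (-r) = (real (Suc n) - real n) * (- r * z powr (-r - 1))"
    proof -
      have "DERIV (\<lambda>x. x powr (-r)) x :> (- r * x powr (-r - 1))" if "real n \<le> x" for x
        using that n by (intro has_real_derivative_powr) linarith
      then show ?thesis using MVT2[of "real n" "real (Suc n)" "\<lambda>x. x powr (-r)" "\<lambda>x. - r * x powr (-r - 1)"] that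
        by (metis lessI of_nat_less_iff)
    qed
    have "r * real (Suc n) powr (-(1+r)) \<le> r * z powr (-r-1)"
    proof (rule mult_left_mono)
      show "real (Suc n) powr (-(1+r)) \<le> z powr (-r-1)"
      proof -
        have eq: "-(1+r) = -r-1" by simp
        show ?thesis unfolding eq using z n r by (intro powr_mono2') auto
      qed
    qed (use r in auto)
    moreover have "r * z powr (-r-1) = real n powr (-r) - real (Suc n) powr (-r)" using z(3) by simp
    ultimately have "r * real (Suc n) powr (-(1+r)) \<le> real n powr (-r) - real (Suc n) powr (-r)" by linarith
    then show ?thesis using r by (subst pos_le_divide_eq) (simp_all add: mult.commute)
  qed
  have tel: "(\<Sum>n\<in>{1..N}. npow n (1 + r)) \<le> 1 + (1 - real N powr (-r)) / r" if "N \<ge> 1" for N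
    using that
  proof (induction N rule: nat_induct_at_least)
    case (Suc N)
    then show ?case using step[of N] by (simp add: diff_divide_distrib)
  qed auto
  define N where "N = Max (insert 1 F)"
  have N: "N \<ge> 1" "F \<subseteq> {0..N}" using F by (auto simp: N_def)
  have "(\<Sum>n\<in>F. npow n (1 + r)) \<le> (\<Sum>n\<in>{0..N}. npow n (1 + r))"
    using N F by (intro sum_mono2) auto
  also have "\<dots> = (\<Sum>n\<in>{1..N}. npow n (1 + r))"
    by (rule sum.mono_neutral_right) auto
  also have "\<dots> \<le> 1 + (1 - real N powr (-r)) / r" using tel N by simp
  also have "\<dots> \<le> 1 + 1 / r" using r by (intro add_left_mono divide_right_mono) auto
  finally show ?thesis .
qed

text \<open>For each factor,
  \<open>1 / norm (1 - z) \<ge> 1 / (1 + norm z) \<ge> 1 - norm z\<close>, so the product is at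
  least the reciprocal of the zeta product. This supplies the lower bound at the centre of the disc
  when the logarithmic derivative of an L-function is estimated.\<close>

lemma norm_Eprod_ge:
  assumes q: "q > 0" and w: "dchar q \<omega>" and r: "r > 0" and s: "Re s = 1 + r"
  shows "norm (Eprod \<omega> N s) \<ge> 1 / (1 + 1 / r)"
proof -
  let ?P = "primes_le (real N)"
  have "((\<lambda>n. npow n (1 + r)) has_sum (\<Prod>p\<in>?P. 1 / (1 - npow p (1 + r)))) (smooth ?P)"
    by (rule has_sum_smooth_powr) (use r in \<open>auto simp: primes_le_def\<close>)
  then have le: "(\<Prod>p\<in>?P. 1 / (1 - npow p (1 + r))) \<le> 1 + 1 / r"
    by (rule has_sum_le_finite_sums) (use sum_powr_le[OF r] in auto)
  have lt: "npow p (1 + r) < 1" if "p \<in> ?P" for p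
    using that r by (intro powr_less_one) (auto simp: primes_le_def prime_gt_Suc_0_nat)
  have "1 / (1 + 1 / r) \<le> 1 / (\<Prod>p\<in>?P. 1 / (1 - npow p (1 + r)))"
    using le lt r by (intro divide_left_mono) (auto intro!: mult_pos_pos prod_pos add_pos_pos)
  also have "\<dots> = (\<Prod>p\<in>?P. 1 - npow p (1 + r))" by (simp add: prod_dividef)
  also have "\<dots> \<le> (\<Prod>p\<in>?P. norm (1 / (1 - \<omega> p * dpow s p)))"
  proof (rule prod_mono, safe)
    fix p assume p: "p \<in> ?P"
    show "0 \<le> 1 - npow p (1 + r)" using lt[OF p] by simp
    have pr: "prime p" using p by (simp add: primes_le_def)
    have n1: "norm (\<omega> p * dpow s p) \<le> npow p (1 + r)"
      using norm_dchar_dpow_less_1(1)[OF q w _ pr, of s] s r by simp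
    have "norm (1 - \<omega> p * dpow s p) \<le> 1 + npow p (1 + r)"
      using norm_triangle_ineq4[of 1 "\<omega> p * dpow s p"] n1 by simp
    moreover have "norm (1 - \<omega> p * dpow s p) > 0"
      using norm_dchar_dpow_less_1(3)[OF q w _ pr, of s] s r by simp
    moreover have "(1 - npow p (1 + r)) * (1 + npow p (1 + r)) \<le> 1"
      by (simp add: algebra_simps)
    ultimately have "(1 - npow p (1 + r)) * norm (1 - \<omega> p * dpow s p) \<le> 1"
      using lt[OF p] by (smt (verit) mult_left_mono)
    then show "1 - npow p (1 + r) \<le> norm (1 / (1 - \<omega> p * dpow s p))"
      using \<open>norm (1 - \<omega> p * dpow s p) > 0\<close> by (simp add: norm_divide field_simps)
  qed
  also have "\<dots> = norm (Eprod \<omega> N s)" by (simp add: Eprod_def prod_norm)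
  finally show ?thesis .
qed

lemma Eprod_deriv:
  assumes q: "q > 0" and w: "dchar q \<omega>" and s: "Re s > 0"
  shows "(Eprod \<omega> N has_field_derivative
     Eprod \<omega> N s * (\<Sum>p\<in>primes_le (real N). - of_real (lnn p) * (\<omega> p * dpow s p) / (1 - \<omega> p * dpow s p))) (at s)"
proof -
  let ?P = "primes_le (real N)"
  have ne: "1 - \<omega> p * dpow s p \<noteq> 0" if "p \<in> ?P" for p
    using norm_dchar_dpow_less_1(3)[OF q w s, of p] that by (auto simp: primes_le_def)
  have p0: "p \<noteq> 0" if "p \<in> ?P" for p using that by (auto simp: primes_le_def prime_gt_0_nat)
  have "((\<lambda>u. \<Prod>p\<in>?P. 1 / (1 - \<omega> p * dpow u p)) has_field_derivative
     (\<Prod>p\<in>?P. 1 / (1 - \<omega> p * dpow s p)) *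
     (\<Sum>p\<in>?P. (- of_real (lnn p) * (\<omega> p * dpow s p) / (1 - \<omega> p * dpow s p)^2) / (1 / (1 - \<omega> p * dpow s p)))) (at s)"
  proof (rule has_field_derivative_prod')
    fix p assume p: "p \<in> ?P"
    show "1 / (1 - \<omega> p * dpow s p) \<noteq> 0" using ne[OF p] by simp
    have d: "((\<lambda>u. dpow u p) has_field_derivative (- of_real (lnn p) * dpow s p)) (at s)"
      using p0[OF p] unfolding dpow_def by (auto intro!: derivative_eq_intros)
    show "((\<lambda>u. 1 / (1 - \<omega> p * dpow u p)) has_field_derivative
       - of_real (lnn p) * (\<omega> p * dpow s p) / (1 - \<omega> p * dpow s p)^2) (at s)"
      using ne[OF p] by (auto intro!: derivative_eq_intros d simp: power2_eq_square)
  qed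
  moreover have "(- of_real (lnn p) * (\<omega> p * dpow s p) / (1 - \<omega> p * dpow s p)^2) / (1 / (1 - \<omega> p * dpow s p)) =
     - of_real (lnn p) * (\<omega> p * dpow s p) / (1 - \<omega> p * dpow s p)" if "p \<in> ?P" for p
    using ne[OF that] by (simp add: power2_eq_square)
  ultimately show ?thesis unfolding Eprod_def by (simp cong: sum.cong)
qed

text \<open>The zeros of the L-function only contribute negatively, so they need not be located.\<close>

theorem character_prime_sum_upper:
  "\<exists>C\<ge>0. \<forall>q \<omega> t r. q > 0 \<longrightarrow> dchar q \<omega> \<longrightarrow> \<omega> \<noteq> principal q \<longrightarrow> 0 < r \<longrightarrow> r \<le> 1/2 \<longrightarrow>
     (\<forall>\<^sub>F N in sequentially. Re (\<Sum>p\<in>primes_le (real N). of_real (lnn p) * (\<omega> p * dpow (Complex (1 + r) t) p)) \<le>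
        C * (lnn q + ln (\<bar>t\<bar> + 2) + ln (1 / r) + 1))"
proof -
  obtain C1 where C1: "C1 \<ge> 1" "\<And>q \<omega> s. q > 0 \<Longrightarrow> dchar q \<omega> \<Longrightarrow> \<omega> \<noteq> principal q \<Longrightarrow> Re s \<ge> 1/4 \<Longrightarrow>
     norm (Lfun q \<omega> s) \<le> C1 * real q ^ 2 * norm s" using norm_Lfun_le by blast
  obtain C2 where C2: "C2 \<ge> 0" "\<And>P. finite P \<Longrightarrow> (\<forall>p\<in>P. p \<ge> (2::nat)) \<Longrightarrow> (\<Sum>p\<in>P. lnn p / (p * (p - 1))) \<le> C2"
    using prime_power_excess_bounded by blast
  define C where "C = 8 + 4 * ln C1 + C2 + 10"
  show ?thesis
  proof (intro exI[of _ C] conjI allI impI)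
    show "C \<ge> 0" using C1 C2 by (simp add: C_def)
    fix q \<omega> and t r :: real
    assume q: "q > 0" and w: "dchar q \<omega>" "\<omega> \<noteq> principal q" and r: "0 < r" "r \<le> 1/2"
    define s where "s = Complex (1 + r) t"
    have Res: "Re s = 1 + r" by (simp add: s_def)
    define B where "B = C1 * real q ^ 2 * (\<bar>t\<bar> + 2)"
    have ge: "norm (Eprod \<omega> N z) \<ge> 1 / (1 + 1 / (Re z - 1))" if "Re z > 1" for N z
      using norm_Eprod_ge[OF q w(1), of "Re z - 1" z N] that by simp
    have lim: "(\<lambda>N. Eprod \<omega> N z) \<longlonglongrightarrow> Lfun q \<omega> z" if "Re z > 1" for z
      using tendsto_uniform_limitI[OF Eprod_uniform_limit[OF q w(1), of "(1 + Re z) / 2"], of z] that by simp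
    have Lge: "norm (Lfun q \<omega> z) \<ge> 1 / (1 + 1 / (Re z - 1))" if "Re z > 1" for z
      by (rule tendsto_lowerbound[OF tendsto_norm[OF lim[OF that]]]) (use ge[OF that] in auto)
    have Lpos: "Lfun q \<omega> z \<noteq> 0" if "Re z > 1" for z
    proof -
      have "1 / (1 + 1 / (Re z - 1)) > 0" using that by (intro divide_pos_pos add_pos_pos) auto
      then show ?thesis using Lge[OF that] by auto
    qed
    have Ls: "norm (Lfun q \<omega> s) \<ge> r / 2"
    proof -
      have "r / 2 \<le> 1 / (1 + 1 / r)" using r by (simp add: field_simps)
      then show ?thesis using Lge[of s] r by (simp add: Res)
    qed
    have Bpos: "B > 0" using C1 q by (auto simp: B_def intro!: mult_pos_pos)
    have sub: "cball s (1/2) \<subseteq> {z. Re z > 1/4}"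
    proof
      fix z assume "z \<in> cball s (1/2)"
      then have "\<bar>Re (s - z)\<bar> \<le> 1/2" using abs_Re_le_cmod[of "s - z"] by (auto simp: dist_norm)
      then have "Re s - Re z \<le> 1/2" unfolding minus_complex.sel by linarith
      then have "Re z > 1/4" using r unfolding Res by linarith
      then show "z \<in> {z. Re z > 1/4}" by simp
    qed
    \<comment> \<open>The disc extends to the left of the line \<open>Re z = 1\<close>, where zeros
      may lie anywhere. To the right of that line there are none, so every zero satisfies
      \<open>Re z \<le> Re s\<close> and nothing else about its position is used.\<close>
    have low: "Re (deriv (Lfun q \<omega>) s / Lfun q \<omega> s) \<ge> - 2 * ln (B / norm (Lfun q \<omega> s)) / (1/2)"
    proof (rule Re_log_deriv_lower_bound[where U = "{z. Re z > 1/4}"])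
      show "open {z. Re z > 1/4}" by (rule open_halfspace_Re_gt)
      show "connected {z. Re z > 1/4}" by (intro convex_connected convex_halfspace_Re_gt)
      show "Lfun q \<omega> holomorphic_on {z. Re z > 1/4}" by (rule Lfun_holomorphic[OF q w])
      show "Lfun q \<omega> s \<noteq> 0" using Lpos r by (simp add: Res)
      show "norm (Lfun q \<omega> z) \<le> B" if z: "z \<in> cball s (1/2)" for z
      proof -
        have "norm z \<le> norm s + 1/2" using z norm_triangle_ineq[of s "z - s"] by (simp add: dist_norm norm_minus_commute)
        also have "norm s \<le> 1 + r + \<bar>t\<bar>" using cmod_le[of s] r by (simp add: s_def)
        finally have "norm z \<le> \<bar>t\<bar> + 2" using r by simp
        then have "C1 * real q ^ 2 * norm z \<le> B" unfolding B_def using C1 by (intro mult_left_mono) auto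
        moreover have "Re z > 1/4" using z sub by blast
        ultimately show ?thesis using C1(2)[OF q w, of z] by linarith
      qed
      show "Re z \<le> Re s" if "Lfun q \<omega> z = 0" for z
        using Lpos[of z] that r Res by (cases "Re z > 1") auto
    qed (use sub in auto)
    have "ln (B / norm (Lfun q \<omega> s)) \<le> ln (B / (r / 2))"
      using Ls r Bpos by (intro ln_mono divide_left_mono) (auto intro!: mult_pos_pos divide_pos_pos)
    also have "\<dots> = ln C1 + 2 * lnn q + ln (\<bar>t\<bar> + 2) + ln (1 / r) + ln 2"
      using C1 q r by (simp add: B_def ln_mult ln_div ln_realpow)
    finally have lnB: "ln (B / norm (Lfun q \<omega> s)) \<le> ln C1 + 2 * lnn q + ln (\<bar>t\<bar> + 2) + ln (1 / r) + 1"
      using ln_2_less_1 by simp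
    define H where "H N = (\<Sum>p\<in>primes_le (real N). - of_real (lnn p) * (\<omega> p * dpow s p) / (1 - \<omega> p * dpow s p))" for N
    have dE: "deriv (Eprod \<omega> N) s / Eprod \<omega> N s = H N" for N
    proof -
      have "Eprod \<omega> N s \<noteq> 0"
      proof
        assume "Eprod \<omega> N s = 0"
        moreover have "1 / (1 + 1 / r) > 0" using r by (intro divide_pos_pos add_pos_pos) auto
        ultimately show False using ge[of s N] r by (simp add: Res)
      qed
      moreover have "deriv (Eprod \<omega> N) s = Eprod \<omega> N s * H N"
        unfolding H_def by (rule DERIV_imp_deriv[OF Eprod_deriv[OF q w(1)]]) (use r Res in simp)
      ultimately show ?thesis by simp
    qed
    have "(\<lambda>N. deriv (Eprod \<omega> N) s) \<longlonglongrightarrow> deriv (Lfun q \<omega>) s"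
    proof (rule deriv_complex_uniform_limit[where A = "{z. Re z > 1 + r / 2}"])
      show "uniform_limit {z. 1 + r / 2 < Re z} (Eprod \<omega>) (Lfun q \<omega>) sequentially"
        using r by (intro Eprod_uniform_limit[OF q w(1)]) auto
      show "\<forall>\<^sub>F n in sequentially. Eprod \<omega> n holomorphic_on {z. 1 + r / 2 < Re z}"
      proof (intro always_eventually allI)
        fix n
        show "Eprod \<omega> n holomorphic_on {z. 1 + r / 2 < Re z}"
          unfolding holomorphic_on_def
        proof
          fix z assume "z \<in> {z. 1 + r / 2 < Re z}"
          then have "Re z > 0" using r by simp
          from Eprod_deriv[OF q w(1) this, of n]
          show "Eprod \<omega> n field_differentiable at z within {z. 1 + r / 2 < Re z}"
            unfolding field_differentiable_def using has_field_derivative_at_within by blast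
        qed
      qed
      show "open {z. 1 + r / 2 < Re z}" by (rule open_halfspace_Re_gt)
    qed (use r Res in auto)
    then have "(\<lambda>N. deriv (Eprod \<omega> N) s / Eprod \<omega> N s) \<longlonglongrightarrow> deriv (Lfun q \<omega>) s / Lfun q \<omega> s"
      using lim[of s] Lpos[of s] r by (intro tendsto_divide) (auto simp: Res)
    then have "(\<lambda>N. Re (H N)) \<longlonglongrightarrow> Re (deriv (Lfun q \<omega>) s / Lfun q \<omega> s)"
      unfolding dE by (rule tendsto_Re)
    \<comment> \<open>The subtracted 1 makes the inequality strict, so that it passes from the limit
      to all sufficiently long finite products.\<close>
    moreover have "Re (deriv (Lfun q \<omega>) s / Lfun q \<omega> s) > - 4 * (ln C1 + 2 * lnn q + ln (\<bar>t\<bar> + 2) + ln (1 / r) + 1) - 1"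
    proof -
      have "- 4 * ln (B / norm (Lfun q \<omega> s)) \<le> Re (deriv (Lfun q \<omega>) s / Lfun q \<omega> s)" using low by simp
      moreover have "- 4 * ln (B / norm (Lfun q \<omega> s)) > - 4 * (ln C1 + 2 * lnn q + ln (\<bar>t\<bar> + 2) + ln (1 / r) + 1) - 1"
        using lnB by argo
      ultimately show ?thesis by (rule less_le_trans[rotated])
    qed
    ultimately have ev: "\<forall>\<^sub>F N in sequentially. Re (H N) > - 4 * (ln C1 + 2 * lnn q + ln (\<bar>t\<bar> + 2) + ln (1 / r) + 1) - 1"
      by (rule order_tendstoD(1))
    show "\<forall>\<^sub>F N in sequentially. Re (\<Sum>p\<in>primes_le (real N). of_real (lnn p) * (\<omega> p * dpow (Complex (1 + r) t) p)) \<le>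
        C * (lnn q + ln (\<bar>t\<bar> + 2) + ln (1 / r) + 1)"
      using ev
    proof eventually_elim
      case (elim N)
      let ?P = "primes_le (real N)"
      let ?w = "\<lambda>p. \<omega> p * dpow s p"
      \<comment> \<open>The prime \<open>p\<close> contributes \<open>- ln p * w / (1 - w)\<close>
        to the logarithmic derivative, with \<open>w\<close> its Euler term. It differs from
        \<open>- ln p * w\<close> only by prime powers of exponent at least 2.\<close>
      have each: "Re (of_real (lnn p) * ?w p) \<le> lnn p / (p * (p - 1)) -
          Re (- of_real (lnn p) * ?w p / (1 - ?w p))" if p: "p \<in> ?P" for p
      proof -
        have pr: "prime p" using p by (simp add: primes_le_def)
        have p2: "p \<ge> 2" using pr prime_ge_2_nat by blast
        have ne: "1 - ?w p \<noteq> 0" using norm_dchar_dpow_less_1(3)[OF q w(1) _ pr, of s] r Res by simp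
        have nw: "norm (?w p) \<le> 1 / real p"
        proof -
          have "norm (?w p) \<le> real p powr (- Re s)"
            using norm_dchar_dpow_less_1(1)[OF q w(1) _ pr, of s] r Res by simp
          also have "\<dots> \<le> real p powr (-1)" using r p2 by (intro powr_mono) (auto simp: Res)
          finally show ?thesis using p2 by (simp add: powr_minus_divide)
        qed
        have "of_real (lnn p) * ?w p - of_real (lnn p) * ?w p / (1 - ?w p) =
            - (of_real (lnn p) * (?w p ^ 2 / (1 - ?w p)))"
          using ne by (simp add: field_simps power2_eq_square)
        then have "Re (of_real (lnn p) * ?w p - of_real (lnn p) * ?w p / (1 - ?w p)) \<le>
            norm (of_real (lnn p) * (?w p ^ 2 / (1 - ?w p)))"
          using complex_Re_le_cmod by (metis norm_minus_cancel)
        also have "\<dots> = lnn p * (norm (?w p) ^ 2 / norm (1 - ?w p))"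
          using p2 by (simp add: norm_mult norm_divide norm_power)
        also have "\<dots> \<le> lnn p * ((1 / real p) ^ 2 / (1 - 1 / real p))"
        proof (intro mult_left_mono frac_le)
          show "1 - 1 / real p \<le> norm (1 - ?w p)" using norm_triangle_ineq2[of 1 "?w p"] nw by simp
        qed (use nw p2 in \<open>auto intro!: power_mono\<close>)
        also have "\<dots> = lnn p / (p * (p - 1))" using p2 by (simp add: field_simps power2_eq_square of_nat_diff)
        finally show ?thesis by simp
      qed
      have "Re (\<Sum>p\<in>?P. of_real (lnn p) * ?w p) \<le> (\<Sum>p\<in>?P. lnn p / (p * (p - 1))) - Re (H N)"
        unfolding H_def Re_sum sum_subtractf[symmetric] by (rule sum_mono) (rule each)
      also have "(\<Sum>p\<in>?P. lnn p / (p * (p - 1))) \<le> C2"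
        by (rule C2(2)) (auto simp: primes_le_def dest: prime_ge_2_nat)
      finally have "Re (\<Sum>p\<in>?P. of_real (lnn p) * ?w p) \<le>
          C2 + 1 + 4 * (ln C1 + 2 * lnn q + ln (\<bar>t\<bar> + 2) + ln (1 / r) + 1)" using elim by linarith
      also have "\<dots> \<le> C * (lnn q + ln (\<bar>t\<bar> + 2) + ln (1 / r) + 1)"
      proof -
        have nn: "lnn q \<ge> 0" "ln (\<bar>t\<bar> + 2) \<ge> 0" "ln (1 / r) \<ge> 0" using q r by (auto intro!: ln_ge_zero)
        define Y where "Y = lnn q + ln (\<bar>t\<bar> + 2) + ln (1 / r)"
        have Y: "Y \<ge> 0" using nn by (simp add: Y_def)
        have "0 \<le> (4 * ln C1 + C2) * Y" using Y C1 C2 by (intro mult_nonneg_nonneg) auto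
        then have "C2 + 1 + 4 * ln C1 + 8 * Y + 4 \<le> C * (Y + 1)" using Y by (simp add: C_def algebra_simps)
        moreover have "C2 + 1 + 4 * (ln C1 + 2 * lnn q + ln (\<bar>t\<bar> + 2) + ln (1 / r) + 1) \<le> C2 + 1 + 4 * ln C1 + 8 * Y + 4"
          using nn by (simp add: Y_def)
        ultimately show ?thesis by (simp add: Y_def)
      qed
      finally show ?case by (simp add: s_def)
    qed
  qed
qed

section \<open>Trigonometric bumps and an extremal problem\<close>

definition logint :: "real \<Rightarrow> real \<Rightarrow> nat set" where
  "logint u v = {p. prime p \<and> u < lnn p \<and> lnn p \<le> v}"

lemma finite_logint [simp, intro]: "finite (logint u v)"
proof (rule finite_subset)
  show "logint u v \<subseteq> primes_le (exp v)"
  proof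
    fix p assume p: "p \<in> logint u v"
    then have pr: "prime p" "lnn p \<le> v" by (auto simp: logint_def)
    then have "exp (lnn p) \<le> exp v" by (simp only: exp_le_cancel_iff)
    moreover have "exp (lnn p) = real p" using pr by (simp add: prime_gt_0_nat)
    ultimately show "p \<in> primes_le (exp v)" using pr by (simp add: primes_le_def)
  qed
qed auto

text \<open>In the variable \<open>ln p\<close> the weights \<open>ln p / p\<close> behave like
  Lebesgue measure, with a bounded error on every interval. This is the form in which Mertens'
  theorem is used from here on.\<close>

definition mmass :: "real \<Rightarrow> real \<Rightarrow> real" where
  "mmass u v = (\<Sum>p\<in>logint u v. lnn p / p)"

lemma mmass_bound:
  "\<exists>C\<ge>1. \<forall>u v. 0 \<le> u \<longrightarrow> u \<le> v \<longrightarrow> \<bar>mmass u v - (v - u)\<bar> \<le> C"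
proof -
  obtain C where C: "C \<ge> 1" "\<And>x. x \<ge> 1 \<Longrightarrow> \<bar>(\<Sum>p\<in>primes_le x. lnn p / p) - ln x\<bar> \<le> C"
    using mertens_first by blast
  have "\<bar>mmass u v - (v - u)\<bar> \<le> 2 * C" if uv: "0 \<le> u" "u \<le> v" for u v
  proof -
    have eq: "primes_le (exp w) = {p. prime p \<and> lnn p \<le> w}" for w
      unfolding primes_le_def by (metis exp_le_cancel_iff exp_ln of_nat_0_less_iff prime_gt_0_nat)
    have "primes_le (exp v) = primes_le (exp u) \<union> logint u v" "primes_le (exp u) \<inter> logint u v = {}"
      using uv by (auto simp: eq logint_def)
    then have "(\<Sum>p\<in>primes_le (exp v). lnn p / p) = (\<Sum>p\<in>primes_le (exp u). lnn p / p) + mmass u v"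
      unfolding mmass_def by (simp add: sum.union_disjoint)
    moreover have "exp u \<ge> 1" "exp v \<ge> 1" using uv by auto
    then have "\<bar>(\<Sum>p\<in>primes_le (exp u). lnn p / p) - ln (exp u)\<bar> \<le> C"
       "\<bar>(\<Sum>p\<in>primes_le (exp v). lnn p / p) - ln (exp v)\<bar> \<le> C" using C(2) by blast+
    ultimately show ?thesis by (simp add: abs_le_iff)
  qed
  then show ?thesis using C(1) by (intro exI[of _ "2 * C"]) auto
qed

lemma logint_split: "u \<le> v \<Longrightarrow> v \<le> w \<Longrightarrow> logint u w = logint u v \<union> logint v w"
  and logint_disjoint: "logint u v \<inter> logint v w = {}"
  by (auto simp: logint_def)

lemma sum_logint_split: "u \<le> v \<Longrightarrow> v \<le> w \<Longrightarrow> sum h (logint u w) = sum h (logint u v) + sum h (logint v w)"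
  by (simp add: logint_split[of u v w] sum.union_disjoint logint_disjoint)

lemma abel_bound:
  fixes g D :: "nat \<Rightarrow> real"
  assumes g: "\<And>j. j < J \<Longrightarrow> g (Suc j) \<le> g j" "g J \<ge> 0" and D: "D 0 = 0" "\<And>k. k \<le> J \<Longrightarrow> \<bar>D k\<bar> \<le> c"
  shows "\<bar>\<Sum>j<J. g j * (D (Suc j) - D j)\<bar> \<le> c * g 0"
proof -
  have id: "(\<Sum>j<k. g j * (D (Suc j) - D j)) = g k * D k + (\<Sum>j<k. (g j - g (Suc j)) * D (Suc j))" for k
    by (induction k) (auto simp: D(1) algebra_simps)
  have tel: "(\<Sum>j<k. (g j - g (Suc j)) * c) = (g 0 - g k) * c" for k
    by (induction k) (auto simp: algebra_simps)
  have "\<bar>\<Sum>j<J. g j * (D (Suc j) - D j)\<bar> \<le> \<bar>g J * D J\<bar> + \<bar>\<Sum>j<J. (g j - g (Suc j)) * D (Suc j)\<bar>"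
    unfolding id by (rule abs_triangle_ineq)
  also have "\<bar>g J * D J\<bar> \<le> g J * c" using g(2) D(2)[of J] by (simp add: abs_mult mult_left_mono)
  also have "\<bar>\<Sum>j<J. (g j - g (Suc j)) * D (Suc j)\<bar> \<le> (\<Sum>j<J. (g j - g (Suc j)) * c)"
  proof (rule order.trans[OF sum_abs], rule sum_mono)
    fix j assume "j \<in> {..<J}"
    then show "\<bar>(g j - g (Suc j)) * D (Suc j)\<bar> \<le> (g j - g (Suc j)) * c"
      using g(1)[of j] D(2)[of "Suc j"] by (simp add: abs_mult mult_left_mono)
  qed
  finally show ?thesis unfolding tel by (simp add: algebra_simps)
qed

text \<open>A single unit cell need not have mass close to 1; only the cumulative mass is within
  \<open>c\<close> of the length. Hence each point is first moved to an end of its cell, the left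
  one for the upper and the right one for the lower bound, and partial summation against the
  decreasing \<open>g\<close> uses the cumulative bound.\<close>

lemma cell_sum_bound:
  fixes g :: "real \<Rightarrow> real" and S :: "nat \<Rightarrow> nat set" and w \<phi> :: "nat \<Rightarrow> real"
  assumes g: "\<And>u v. 0 \<le> u \<Longrightarrow> u \<le> v \<Longrightarrow> v \<le> real J \<Longrightarrow> g v \<le> g u" "g J \<ge> 0"
    and w: "\<And>j p. j < J \<Longrightarrow> p \<in> S j \<Longrightarrow> w p \<ge> 0"
    and \<phi>: "\<And>j p. j < J \<Longrightarrow> p \<in> S j \<Longrightarrow> real j \<le> \<phi> p \<and> \<phi> p \<le> real j + 1"
    and m: "\<And>k. k \<le> J \<Longrightarrow> \<bar>(\<Sum>j<k. \<Sum>p\<in>S j. w p) - real k\<bar> \<le> c"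
  shows "\<bar>(\<Sum>j<J. \<Sum>p\<in>S j. w p * g (\<phi> p)) - (\<Sum>j<J. g (real j))\<bar> \<le> (c + 1) * g 0"
proof -
  define D where "D k = (\<Sum>j<k. \<Sum>p\<in>S j. w p) - real k" for k
  have mj: "(\<Sum>p\<in>S j. w p) = 1 + (D (Suc j) - D j)" for j by (simp add: D_def)
  have c0: "c \<ge> 0" using m[of 0] by simp
  have gmono: "g (real (Suc j)) \<le> g (real j)" if "j < J" for j using that by (intro g(1)) auto
  have g0: "g (real j) \<ge> 0" if "j \<le> J" for j using g(1)[of "real j" "real J"] g(2) that by auto
  have up: "(\<Sum>j<J. \<Sum>p\<in>S j. w p * g (\<phi> p)) \<le> (\<Sum>j<J. g (real j)) + c * g 0"
  proof -
    have "(\<Sum>j<J. \<Sum>p\<in>S j. w p * g (\<phi> p)) \<le> (\<Sum>j<J. \<Sum>p\<in>S j. w p * g (real j))"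
    proof (intro sum_mono mult_left_mono)
      fix j p assume jp: "j \<in> {..<J}" "p \<in> S j"
      then have "real j \<le> \<phi> p" "\<phi> p \<le> real j + 1" using \<phi> by auto
      moreover have "real j + 1 \<le> real J" using jp(1) by (simp add: Suc_leI flip: of_nat_Suc)
      ultimately show "g (\<phi> p) \<le> g (real j)" by (intro g(1)) auto
    qed (use w in auto)
    also have "\<dots> = (\<Sum>j<J. g (real j) * (1 + (D (Suc j) - D j)))"
      by (simp add: sum_distrib_right[symmetric] mj mult.commute)
    also have "\<dots> = (\<Sum>j<J. g (real j)) + (\<Sum>j<J. g (real j) * (D (Suc j) - D j))"
      by (simp add: algebra_simps sum.distrib sum_subtractf)
    also have "(\<Sum>j<J. g (real j) * (D (Suc j) - D j)) \<le> c * g (real 0)"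
      using abel_bound[of J "\<lambda>j. g (real j)" D c] gmono g(2) m by (auto simp: D_def)
    finally show ?thesis by simp
  qed
  have lo: "(\<Sum>j<J. \<Sum>p\<in>S j. w p * g (\<phi> p)) \<ge> (\<Sum>j<J. g (real j)) - g 0 - c * g 0"
  proof (cases J)
    case (Suc J')
    \<comment> \<open>Values at right ends of cells; the cap at \<open>J\<close> keeps the sequence
      within the range where \<open>g\<close> is controlled, also at index \<open>J\<close>.\<close>
    define h where "h j = g (real (min J (Suc j)))" for j
    have "\<bar>\<Sum>j<J. h j * (D (Suc j) - D j)\<bar> \<le> c * h 0"
    proof (rule abel_bound)
      show "h (Suc j) \<le> h j" if j: "j < J" for j
      proof (cases "Suc j < J")
        case True
        then have "h (Suc j) = g (real (Suc (Suc j)))" "h j = g (real (Suc j))"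
          by (simp_all add: h_def min_absorb2 Suc_le_eq)
        then show ?thesis using gmono[OF True] by simp
      next
        case False
        then have "h (Suc j) = h j" using j by (auto simp: h_def min_def le_antisym)
        then show ?thesis by simp
      qed
      show "h J \<ge> 0" using g(2) by (simp add: h_def)
    qed (use m in \<open>auto simp: D_def\<close>)
    also have "c * h 0 \<le> c * g 0" using gmono[of 0] Suc c0 by (intro mult_left_mono) (auto simp: h_def)
    finally have ab: "\<bar>\<Sum>j<J. h j * (D (Suc j) - D j)\<bar> \<le> c * g 0" .
    have "(\<Sum>j<J. \<Sum>p\<in>S j. w p * g (\<phi> p)) \<ge> (\<Sum>j<J. \<Sum>p\<in>S j. w p * h j)"
    proof (intro sum_mono mult_left_mono)
      fix j p assume jp: "j \<in> {..<J}" "p \<in> S j"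
      then have "real j \<le> \<phi> p" "\<phi> p \<le> real j + 1" using \<phi> by auto
      moreover have "real j + 1 \<le> real J" using jp(1) by (simp add: Suc_leI flip: of_nat_Suc)
      ultimately show "h j \<le> g (\<phi> p)" unfolding h_def using jp(1) by (intro g(1)) auto
    qed (use w in auto)
    moreover have "(\<Sum>j<J. \<Sum>p\<in>S j. w p * h j) = (\<Sum>j<J. h j * (1 + (D (Suc j) - D j)))"
      by (intro sum.cong refl) (metis mult.commute sum_distrib_right mj)
    moreover have "\<dots> = (\<Sum>j<J. h j) + (\<Sum>j<J. h j * (D (Suc j) - D j))"
      by (simp add: algebra_simps sum.distrib sum_subtractf)
    moreover have "(\<Sum>j<J. h j) \<ge> (\<Sum>j<J. g (real j)) - g 0"
    proof -
      have "(\<Sum>j<J. h j) = (\<Sum>j<J. g (real (Suc j)))" by (intro sum.cong) (auto simp: h_def min_absorb2 Suc_le_eq)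
      also have "(\<Sum>j<J. g (real (Suc j))) = (\<Sum>j<Suc J. g (real j)) - g (real 0)"
        by (subst sum.lessThan_Suc_shift) simp
      also have "\<dots> \<ge> (\<Sum>j<J. g (real j)) - g 0" using g(2) by simp
      finally show ?thesis .
    qed
    ultimately show ?thesis using ab by linarith
  next
    case 0
    then show ?thesis using g(2) mult_nonneg_nonneg[OF c0, of "g 0"] by simp
  qed
  show ?thesis using up lo g0[of 0] by (simp add: abs_le_iff algebra_simps)
qed

lemma sum_cells_forward: "(\<Sum>j<k. \<Sum>p\<in>logint (X0 + real j) (X0 + real j + 1). h p) = sum h (logint X0 (X0 + real k))"
proof (induction k)
  case 0
  have "logint X0 X0 = {}" by (auto simp: logint_def)
  then show ?case by simp
next
  case (Suc k)
  then show ?case using sum_logint_split[of X0 "X0 + real k" "X0 + real k + 1" h] by (simp add: add.assoc add.commute[of 1])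
qed

lemma sum_cells_backward: "(\<Sum>j<k. \<Sum>p\<in>logint (X0 - real j - 1) (X0 - real j). h p) = sum h (logint (X0 - real k) X0)"
proof (induction k)
  case 0
  have "logint X0 X0 = {}" by (auto simp: logint_def)
  then show ?case by simp
next
  case (Suc k)
  then show ?case using sum_logint_split[of "X0 - real k - 1" "X0 - real k" X0 h] by (simp add: algebra_simps)
qed

lemma unimodal_sums:
  assumes C: "\<And>u v. 0 \<le> u \<Longrightarrow> u \<le> v \<Longrightarrow> \<bar>mmass u v - (v - u)\<bar> \<le> C"
    and g: "\<And>u v. 0 \<le> u \<Longrightarrow> u \<le> v \<Longrightarrow> v \<le> real J \<Longrightarrow> g v \<le> g u" "g J \<ge> 0"
  shows "X0 \<ge> 0 \<Longrightarrow> \<bar>(\<Sum>p\<in>logint X0 (X0 + real J). lnn p / p * g (lnn p - X0)) - (\<Sum>j<J. g (real j))\<bar> \<le> (C + 1) * g 0"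
    and "X0 \<ge> real J \<Longrightarrow> \<bar>(\<Sum>p\<in>logint (X0 - real J) X0. lnn p / p * g (X0 - lnn p)) - (\<Sum>j<J. g (real j))\<bar> \<le> (C + 1) * g 0"
proof -
  assume X0: "X0 \<ge> 0"
  have "\<bar>(\<Sum>j<J. \<Sum>p\<in>logint (X0 + real j) (X0 + real j + 1). lnn p / p * g (lnn p - X0)) - (\<Sum>j<J. g (real j))\<bar> \<le> (C + 1) * g 0"
  proof (rule cell_sum_bound[where g = g and J = J])
    show "\<bar>(\<Sum>j<k. \<Sum>p\<in>logint (X0 + real j) (X0 + real j + 1). lnn p / p) - real k\<bar> \<le> C" for k
      using C[of X0 "X0 + real k"] X0 sum_cells_forward[of "\<lambda>p. lnn p / p" X0 k] by (simp add: mmass_def)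
  qed (use g in \<open>auto simp: logint_def prime_gt_0_nat Suc_leI\<close>)
  then show "\<bar>(\<Sum>p\<in>logint X0 (X0 + real J). lnn p / p * g (lnn p - X0)) - (\<Sum>j<J. g (real j))\<bar> \<le> (C + 1) * g 0"
    by (subst (asm) sum_cells_forward)
next
  assume X0: "X0 \<ge> real J"
  have "\<bar>(\<Sum>j<J. \<Sum>p\<in>logint (X0 - real j - 1) (X0 - real j). lnn p / p * g (X0 - lnn p)) - (\<Sum>j<J. g (real j))\<bar> \<le> (C + 1) * g 0"
  proof (rule cell_sum_bound[where g = g and J = J])
    show "\<bar>(\<Sum>j<k. \<Sum>p\<in>logint (X0 - real j - 1) (X0 - real j). lnn p / p) - real k\<bar> \<le> C" if "k \<le> J" for k
      using C[of "X0 - real k" X0] X0 that sum_cells_backward[of "\<lambda>p. lnn p / p" X0 k] by (simp add: mmass_def)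
  qed (use g in \<open>auto simp: logint_def prime_gt_0_nat Suc_leI\<close>)
  then show "\<bar>(\<Sum>p\<in>logint (X0 - real J) X0. lnn p / p * g (X0 - lnn p)) - (\<Sum>j<J. g (real j))\<bar> \<le> (C + 1) * g 0"
    by (subst (asm) sum_cells_backward)
qed

text \<open>Cut the logarithmic axis into blocks of length \<open>T\<close>: each has mass at most
  \<open>T + C\<close>, and the weight drops by the factor \<open>exp (- a)\<close> from one block
  to the next.\<close>

lemma exp_weighted_tail:
  assumes C: "\<And>u v. 0 \<le> u \<Longrightarrow> u \<le> v \<Longrightarrow> \<bar>mmass u v - (v - u)\<bar> \<le> C" and T: "T > 0" and a: "a > 0" and Y: "Y \<ge> 0"
  shows "(\<Sum>p\<in>{p\<in>primes_le x. Y < lnn p}. lnn p / p * exp (- a * lnn p / T)) \<le> (T + C) * exp (- a * Y / T) / (1 - exp (- a))"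
proof -
  let ?h = "\<lambda>p. lnn p / p * exp (- a * lnn p / T)"
  have C0: "C \<ge> 0" using C[of 0 0] by simp
  have h0: "?h p \<ge> 0" if "prime p" for p using that by (simp add: prime_gt_0_nat Suc_leI)
  have ind: "sum ?h (logint Y (Y + real k * T)) \<le> (T + C) * exp (- a * Y / T) * (\<Sum>j<k. exp (- a) ^ j)" for k
  proof (induction k)
    case 0
    have "logint Y Y = {}" by (auto simp: logint_def)
    then show ?case by simp
  next
    case (Suc k)
    let ?u = "Y + real k * T"
    have "sum ?h (logint ?u (?u + T)) \<le> (\<Sum>p\<in>logint ?u (?u + T). lnn p / p * exp (- a * ?u / T))"
      using a T by (intro sum_mono mult_left_mono) (auto simp: logint_def divide_right_mono prime_gt_0_nat Suc_leI)
    also have "\<dots> = mmass ?u (?u + T) * exp (- a * ?u / T)" by (simp add: mmass_def sum_distrib_right)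
    also have "\<dots> \<le> (T + C) * exp (- a * ?u / T)"
      using C[of ?u "?u + T"] Y T by (intro mult_right_mono) (auto simp: abs_le_iff)
    also have "exp (- a * ?u / T) = exp (- a * Y / T) * exp (- a) ^ k"
      using T by (simp add: exp_of_nat_mult[symmetric] exp_add[symmetric] field_simps)
    finally have "sum ?h (logint ?u (?u + T)) \<le> (T + C) * exp (- a * Y / T) * exp (- a) ^ k" by (simp add: mult_ac)
    moreover have "sum ?h (logint Y (Y + real (Suc k) * T)) = sum ?h (logint Y ?u) + sum ?h (logint ?u (?u + T))"
      using sum_logint_split[of Y ?u "?u + T" ?h] T by (simp add: algebra_simps)
    ultimately show ?case using Suc by (simp add: algebra_simps)
  qed
  obtain k where k: "ln (max 1 x) \<le> real k * T" using T real_arch_simple[of "ln (max 1 x) / T"] by (auto simp: field_simps)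
  have "{p\<in>primes_le x. Y < lnn p} \<subseteq> logint Y (Y + real k * T)"
  proof
    fix p assume p: "p \<in> {p\<in>primes_le x. Y < lnn p}"
    then have pp: "prime p" "real p \<le> x" "real p \<ge> 1" by (auto simp: primes_le_def prime_gt_0_nat Suc_leI)
    then have "lnn p \<le> ln (max 1 x)" by (intro ln_mono) auto
    then have "lnn p \<le> Y + real k * T" using k Y by linarith
    then show "p \<in> logint Y (Y + real k * T)" using p pp k Y by (auto simp: logint_def)
  qed
  then have "(\<Sum>p\<in>{p\<in>primes_le x. Y < lnn p}. ?h p) \<le> sum ?h (logint Y (Y + real k * T))"
    by (intro sum_mono2[OF finite_logint] h0) (auto simp: logint_def)
  also note ind[of k]
  also have "(T + C) * exp (- a * Y / T) * (\<Sum>j<k. exp (- a) ^ j) \<le> (T + C) * exp (- a * Y / T) * (1 / (1 - exp (- a)))"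
  proof (rule mult_left_mono)
    have "(\<Sum>j<k. exp (- a) ^ j) \<le> (\<Sum>j. exp (- a) ^ j)"
      using a by (intro sum_le_suminf summable_geometric) auto
    also have "\<dots> = 1 / (1 - exp (- a))" using a by (intro suminf_geometric) auto
    finally show "(\<Sum>j<k. exp (- a) ^ j) \<le> 1 / (1 - exp (- a))" .
  qed (use T C0 in auto)
  finally show ?thesis by simp
qed

section \<open>Even powers of the cosine as weights with nonnegative coefficients\<close>

abbreviation bwt :: "nat \<Rightarrow> nat \<Rightarrow> real" where
  "bwt M j \<equiv> real ((2 * M) choose j) / 4 ^ M"

lemma cos_power_expansion:
  "cos (x / 2) ^ (2 * M) = (\<Sum>j\<le>2*M. bwt M j * cos ((real j - real M) * x))"
proof -
  have "of_real (cos (x / 2)) = (cis (x / 2) + cis (- (x / 2))) / 2" by (simp add: complex_eq_iff)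
  then have "(of_real (cos (x / 2)) :: complex) ^ (2 * M) = (cis (x / 2) + cis (- (x / 2))) ^ (2 * M) / 4 ^ M"
  proof -
    have "(4::complex) ^ M = 2 ^ (2 * M)" by (simp add: power_mult)
    then show ?thesis by (simp only: \<open>of_real (cos (x / 2)) = _\<close> power_divide)
  qed
  also have "\<dots> = (\<Sum>j\<le>2*M. of_nat ((2 * M) choose j) * cis (x / 2) ^ j * cis (- (x / 2)) ^ (2 * M - j)) / 4 ^ M"
    by (simp only: binomial_ring)
  also have "\<dots> = (\<Sum>j\<le>2*M. of_real (bwt M j) * cis ((real j - real M) * x))"
    unfolding sum_divide_distrib
  proof (intro sum.cong refl)
    fix j assume j: "j \<in> {..2*M}"
    have "cis (x / 2) ^ j * cis (- (x / 2)) ^ (2 * M - j) = cis (real j * (x / 2) + real (2 * M - j) * (- (x / 2)))"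
      unfolding Complex.DeMoivre cis_mult by simp
    also have "real j * (x / 2) + real (2 * M - j) * (- (x / 2)) = (real j - real M) * x"
      using j by (simp add: of_nat_diff field_simps)
    finally show "of_nat ((2 * M) choose j) * cis (x / 2) ^ j * cis (- (x / 2)) ^ (2 * M - j) / 4 ^ M =
        of_real (bwt M j) * cis ((real j - real M) * x)"
      by (simp add: mult.assoc)
  qed
  finally have "Re (of_real (cos (x / 2) ^ (2 * M))) = Re (\<Sum>j\<le>2*M. of_real (bwt M j) * cis ((real j - real M) * x))"
    by simp
  then show ?thesis by (simp add: Re_sum)
qed

lemma sum_binomial_weights: "(\<Sum>j\<le>2*M. bwt M j) = 1"
  using cos_power_expansion[of 0 M] by simp

lemma cos_le_exp:
  fixes t :: real
  assumes "0 \<le> t" "t \<le> 1"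
  shows "cos t \<le> exp (- t\<^sup>2 / 8)"
proof (cases "t = 0")
  case False
  have "sin (t / 2) \<ge> t / 4"
  proof -
    obtain z where z: "0 < z" "z < t / 2" "sin (t / 2) - sin 0 = (t / 2 - 0) * cos z"
      using MVT2[of 0 "t / 2" sin cos] False assms by auto
    have "cos (pi / 3) \<le> cos z" using z assms pi_gt3 by (intro cos_monotone_0_pi_le) auto
    then have "cos z \<ge> 1 / 2" by (simp add: cos_60)
    then have "t / 2 * (1 / 2) \<le> t / 2 * cos z" using assms by (intro mult_left_mono) auto
    then show ?thesis using z(3) by simp
  qed
  then have "(t / 4)\<^sup>2 \<le> (sin (t / 2))\<^sup>2" using assms by (intro power_mono) auto
  moreover have "cos t = 1 - 2 * (sin (t / 2))\<^sup>2" using cos_double_sin[of "t / 2"] by simp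
  ultimately have "cos t \<le> 1 + (- t\<^sup>2 / 8)" by (simp add: power2_eq_square field_simps)
  also have "\<dots> \<le> exp (- t\<^sup>2 / 8)" by (rule exp_ge_add_one_self)
  finally show ?thesis .
qed simp

text \<open>A nonnegative trigonometric polynomial whose coefficients are nonnegative and sum to 1.
  It peaks at 0 with width about \<open>1 / (\<kappa> * sqrt M)\<close>, has period
  \<open>2 * pi / \<kappa>\<close>, and its frequencies do not exceed \<open>M * \<kappa>\<close>.
  It plays the role of a Gaussian but needs only finitely many frequencies.\<close>

definition bump :: "nat \<Rightarrow> real \<Rightarrow> real \<Rightarrow> real" where
  "bump M \<kappa> v = cos (\<kappa> * v / 2) ^ (2 * M)"

lemma bump_expansion: "bump M \<kappa> v = (\<Sum>j\<le>2*M. bwt M j * cos ((real j - real M) * \<kappa> * v))"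
  unfolding bump_def by (simp add: cos_power_expansion mult.assoc)

lemma bump_nonneg: "bump M \<kappa> v \<ge> 0"
  by (simp add: bump_def power_mult)

lemma bump_le_1: "bump M \<kappa> v \<le> 1"
proof -
  have "(cos (\<kappa> * v / 2))\<^sup>2 \<le> 1" by (simp add: abs_square_le_1)
  then show ?thesis unfolding bump_def power_mult by (rule power_le_one[OF zero_le_power2])
qed

lemma bump_0 [simp]: "bump M \<kappa> 0 = 1" by (simp add: bump_def)

lemma bump_even: "bump M \<kappa> (- v) = bump M \<kappa> v" by (simp add: bump_def)

lemma bump_mono:
  assumes "\<kappa> > 0" "\<bar>u\<bar> \<le> \<bar>v\<bar>" "\<kappa> * \<bar>v\<bar> \<le> pi"
  shows "bump M \<kappa> v \<le> bump M \<kappa> u"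
proof -
  have eq: "bump M \<kappa> w = cos (\<kappa> * \<bar>w\<bar> / 2) ^ (2 * M)" for w
    by (cases "w \<ge> 0") (auto simp: bump_def)
  have uv: "\<kappa> * \<bar>u\<bar> / 2 \<le> \<kappa> * \<bar>v\<bar> / 2" using assms by simp
  have "cos (\<kappa> * \<bar>v\<bar> / 2) \<le> cos (\<kappa> * \<bar>u\<bar> / 2)" 
  proof (rule cos_monotone_0_pi_le)
    show "\<kappa> * \<bar>v\<bar> / 2 \<le> pi" using assms pi_gt_zero by linarith
  qed (use assms uv in auto)
  moreover have "cos (\<kappa> * \<bar>v\<bar> / 2) \<ge> 0" 
  proof (rule cos_ge_zero)
    have "0 \<le> \<kappa> * \<bar>v\<bar>" using assms by simp
    then show "- (pi / 2) \<le> \<kappa> * \<bar>v\<bar> / 2" using pi_gt_zero by linarith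
    show "\<kappa> * \<bar>v\<bar> / 2 \<le> pi / 2" using assms by simp
  qed
  ultimately show ?thesis unfolding eq by (intro power_mono)
qed

lemma bump_ge:
  assumes "(\<kappa> * v / 2)\<^sup>2 \<le> 2"
  shows "bump M \<kappa> v \<ge> 1 - real M * (\<kappa> * v / 2)\<^sup>2"
proof -
  let ?t = "\<kappa> * v / 2"
  have "(sin (?t / 2))\<^sup>2 \<le> (?t / 2)\<^sup>2" using abs_sin_x_le_abs_x[of "?t / 2"] by (rule abs_le_square_iff[THEN iffD1])
  moreover have "cos ?t = 1 - 2 * (sin (?t / 2))\<^sup>2" using cos_double_sin[of "?t / 2"] by simp
  ultimately have c: "cos ?t \<ge> 1 - ?t\<^sup>2 / 2" by (simp add: power_divide)
  have "1 + real (2 * M) * (- (?t\<^sup>2 / 2)) \<le> (1 + (- (?t\<^sup>2 / 2))) ^ (2 * M)"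
    using assms by (intro Bernoulli_inequality) auto
  also have "\<dots> \<le> cos ?t ^ (2 * M)" using c assms by (intro power_mono) auto
  finally show ?thesis by (simp add: bump_def)
qed

lemma bump_le_exp:
  assumes "\<kappa> > 0" "0 \<le> u" "u \<le> \<bar>v\<bar>" "\<kappa> * u / 2 \<le> 1" "\<kappa> * \<bar>v\<bar> \<le> pi"
  shows "bump M \<kappa> v \<le> exp (- real M * (\<kappa> * u / 2)\<^sup>2 / 4)"
proof -
  have "bump M \<kappa> v \<le> bump M \<kappa> u" using assms by (intro bump_mono) auto
  also have "\<dots> \<le> exp (- (\<kappa> * u / 2)\<^sup>2 / 8) ^ (2 * M)"
    unfolding bump_def
  proof (intro power_mono cos_le_exp cos_ge_zero)
    show "- (pi / 2) \<le> \<kappa> * u / 2" using mult_nonneg_nonneg[of \<kappa> u] assms pi_gt_zero by linarith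
    show "\<kappa> * u / 2 \<le> pi / 2" using assms pi_gt3 by linarith
  qed (use assms in auto)
  also have "\<dots> = exp (- real M * (\<kappa> * u / 2)\<^sup>2 / 4)"
    by (simp add: exp_of_nat_mult[symmetric] field_simps)
  finally show ?thesis .
qed

text \<open>This is \<open>|1 - 2 e^{0.45 i g} + e^{0.55 i g}|^2 + 2 |2 + e^{0.52 i g} + e^{0.97 i g}|^2 +
  2 |2 + e^{0.6 i g} + e^{0.7 i g}|^2\<close>.\<close>

definition ppoly :: "real \<Rightarrow> real" where
  "ppoly g = 30 + 8 * (cos (52/100 * g) + cos (97/100 * g) + cos (6/10 * g) + cos (7/10 * g)) + 2 * cos (55/100 * g)"

text \<open>The last two squares also produce \<open>cos (45/100 * g)\<close> and
  \<open>cos (1/10 * g)\<close>, the differences of their shifts. These would place mass in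
  \<open>(0, 1/2)\<close>, outside the window; the first square is chosen to cancel exactly these
  terms, at the price of a small extra shift 55/100.\<close>

lemma ppoly_nonneg: "ppoly g \<ge> 0"
proof -
  have a: "6 + 4 * cos x + 4 * cos y + 2 * cos (y - x) \<ge> 0" for x y :: real
  proof -
    have "6 + 4 * cos x + 4 * cos y + 2 * cos (y - x) = (2 + cos x + cos y)\<^sup>2 + (sin x + sin y)\<^sup>2 +
       2 - (sin x)\<^sup>2 - (cos x)\<^sup>2 - (sin y)\<^sup>2 - (cos y)\<^sup>2"
      by (simp add: cos_diff power2_eq_square algebra_simps)
    also have "\<dots> = (2 + cos x + cos y)\<^sup>2 + (sin x + sin y)\<^sup>2"
      using sin_cos_squared_add[of x] sin_cos_squared_add[of y] by linarith
    finally show ?thesis by simp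
  qed
  have b: "6 - 4 * cos x - 4 * cos (y - x) + 2 * cos y \<ge> 0" for x y :: real
  proof -
    have "(1 - 2 * cos x + cos y)\<^sup>2 + (sin y - 2 * sin x)\<^sup>2 - (6 - 4 * cos x - 4 * cos (y - x) + 2 * cos y) =
       4 * ((sin x)\<^sup>2 + (cos x)\<^sup>2 - 1) + ((sin y)\<^sup>2 + (cos y)\<^sup>2 - 1)"
      unfolding cos_diff power2_eq_square by argo
    also have "\<dots> = 0" by simp
    finally have "6 - 4 * cos x - 4 * cos (y - x) + 2 * cos y = (1 - 2 * cos x + cos y)\<^sup>2 + (sin y - 2 * sin x)\<^sup>2" by simp
    then show ?thesis by simp
  qed
  have "(55/100 * g - 45/100 * g) = 1/10 * g" "97/100 * g - 52/100 * g = 45/100 * g" "7/10 * g - 6/10 * g = 1/10 * g"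
    by (simp_all add: field_simps)
  then show ?thesis
    using a[of "52/100 * g" "97/100 * g"] a[of "6/10 * g" "7/10 * g"] b[of "45/100 * g" "55/100 * g"]
    unfolding ppoly_def by (simp only:) argo
qed

lemma ppoly_le: "ppoly g \<le> 64"
  using cos_le_one[of "52/100 * g"] cos_le_one[of "97/100 * g"] cos_le_one[of "6/10 * g"] cos_le_one[of "7/10 * g"]
    cos_le_one[of "55/100 * g"] unfolding ppoly_def by argo

text \<open>Multiplying the coefficients of \<open>bump\<close> by \<open>ppoly\<close> amounts to
  superposing translates: weight 30 at 0 and, in each direction, weight 4 at 52/100, 6/10, 7/10,
  97/100 and weight 1 at 55/100. All positive shifts lie inside \<open>(1/2, 1)\<close>.\<close>

definition kker :: "nat \<Rightarrow> real \<Rightarrow> real \<Rightarrow> real" where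
  "kker M \<kappa> u = 30 * bump M \<kappa> u +
     (4 * (bump M \<kappa> (u - 52/100) + bump M \<kappa> (u - 97/100) + bump M \<kappa> (u - 6/10) + bump M \<kappa> (u - 7/10)) + bump M \<kappa> (u - 55/100)) +
     (4 * (bump M \<kappa> (u + 52/100) + bump M \<kappa> (u + 97/100) + bump M \<kappa> (u + 6/10) + bump M \<kappa> (u + 7/10)) + bump M \<kappa> (u + 55/100))"

lemma kker_expansion:
  "kker M \<kappa> u = (\<Sum>j\<le>2*M. bwt M j * (ppoly ((real j - real M) * \<kappa>) * cos ((real j - real M) * \<kappa> * u)))"
proof -
  have pc: "ppoly g * cos (g * u) = 30 * cos (g * u) +
     (4 * (cos (g * (u - 52/100)) + cos (g * (u - 97/100)) + cos (g * (u - 6/10)) + cos (g * (u - 7/10))) + cos (g * (u - 55/100))) +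
     (4 * (cos (g * (u + 52/100)) + cos (g * (u + 97/100)) + cos (g * (u + 6/10)) + cos (g * (u + 7/10))) + cos (g * (u + 55/100)))" for g
    by (simp add: ppoly_def right_diff_distrib distrib_left cos_add cos_diff) (simp add: algebra_simps)
  show ?thesis unfolding pc kker_def bump_expansion
    by (simp add: sum.distrib[symmetric] sum_distrib_left distrib_left mult_ac)
qed

lemma kker_bounds: "kker M \<kappa> u \<ge> 0" "kker M \<kappa> u \<le> 64"
proof -
  have b: "0 \<le> bump M \<kappa> v \<and> bump M \<kappa> v \<le> 1" for v using bump_nonneg bump_le_1 by blast
  show "kker M \<kappa> u \<ge> 0" unfolding kker_def by (intro add_nonneg_nonneg mult_nonneg_nonneg bump_nonneg) auto
  show "kker M \<kappa> u \<le> 64" unfolding kker_def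
    using b[of u] b[of "u - 52/100"] b[of "u - 97/100"] b[of "u - 6/10"] b[of "u - 7/10"] b[of "u - 55/100"]
      b[of "u + 52/100"] b[of "u + 97/100"] b[of "u + 6/10"] b[of "u + 7/10"] b[of "u + 55/100"] by argo
qed

lemma kker_window:
  assumes C: "\<And>u v. 0 \<le> u \<Longrightarrow> u \<le> v \<Longrightarrow> \<bar>mmass u v - (v - u)\<bar> \<le> C"
    and g: "\<And>u v. 0 \<le> u \<Longrightarrow> u \<le> v \<Longrightarrow> v \<le> real J \<Longrightarrow> g v \<le> g u" "g J \<ge> 0" "g 0 = 1"
    and even: "\<And>u. g (- u) = g u" and nn: "\<And>u. g u \<ge> 0"
    and x: "x - real J \<ge> T / 2" "x + real J \<le> T" "T \<ge> 0"
  shows "(\<Sum>p\<in>logint (T / 2) T. lnn p / p * g (lnn p - x)) \<ge> 2 * (\<Sum>j<J. g (real j)) - 2 * (C + 1)"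
proof -
  let ?h = "\<lambda>p::nat. lnn p / p * g (lnn p - x)"
  have 1: "sum ?h (logint x (x + real J)) \<ge> (\<Sum>j<J. g (real j)) - (C + 1)"
    using unimodal_sums(1)[where g = g and J = J and C = C, OF C g(1,2), of x] g(3) x by (simp add: abs_le_iff)
  have "(\<Sum>p\<in>logint (x - real J) x. lnn p / p * g (x - lnn p)) \<ge> (\<Sum>j<J. g (real j)) - (C + 1)"
    using unimodal_sums(2)[where g = g and J = J and C = C, OF C g(1,2), of x] g(3) x by (simp add: abs_le_iff)
  moreover have "g (x - lnn p) = g (lnn p - x)" for p using even[of "lnn p - x"] by simp
  ultimately have 2: "sum ?h (logint (x - real J) x) \<ge> (\<Sum>j<J. g (real j)) - (C + 1)" by simp
  have "sum ?h (logint (x - real J) (x + real J)) \<le> sum ?h (logint (T / 2) T)"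
    using x nn by (intro sum_mono2[OF finite_logint]) (auto simp: logint_def prime_gt_0_nat Suc_leI intro!: mult_nonneg_nonneg)
  moreover have "sum ?h (logint (x - real J) (x + real J)) = sum ?h (logint (x - real J) x) + sum ?h (logint x (x + real J))"
    by (rule sum_logint_split) auto
  ultimately show ?thesis using 1 2 by argo
qed

text \<open>\<open>6528 = 64 * 102\<close> is the maximum of the kernel times the total damped mass
  of the primes in units of \<open>T\<close>. The two exponentials are the errors away from the
  peaks and beyond a quarter period; the right side is the scale of the main term.\<close>

lemma extremal_parameters:
  obtains L :: nat where "L \<ge> 100" "6528 * (exp (- (real L ^ 2) / 40000) + exp (- real L / 200)) \<le> 1 / (10 * real L)"
proof -
  have "eventually (\<lambda>x::real. 6528 * (exp (- (x ^ 2) / 40000) + exp (- x / 200)) \<le> 1 / (10 * x)) at_top"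
    by real_asymp
  then have "eventually (\<lambda>L::nat. 6528 * (exp (- (real L ^ 2) / 40000) + exp (- real L / 200)) \<le> 1 / (10 * real L)) sequentially"
    using filterlim_real_sequentially by (rule eventually_compose_filterlim)
  moreover have "eventually (\<lambda>L::nat. L \<ge> 100) sequentially" by (rule eventually_ge_at_top)
  ultimately have "eventually (\<lambda>L::nat. L \<ge> 100 \<and> 6528 * (exp (- (real L ^ 2) / 40000) + exp (- real L / 200)) \<le> 1 / (10 * real L)) sequentially"
    by eventually_elim auto
  then show ?thesis using that eventually_happens' sequentially_bot by blast
qed

text \<open>Off the window every shifted peak is at distance at least 1/200 from \<open>u\<close>,
  and \<open>u \<le> L / 4\<close> keeps all arguments within half a period. With
  \<open>M = L ^ 4\<close> the width of a bump is of order \<open>1 / L\<close>, so at distance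
  1/200 it is as small as \<open>beta\<close>.\<close>

lemma kker_off_window:
  assumes \<kappa>: "\<kappa> = 2 * pi / real L" and L: "L \<ge> 100" and M: "M = L ^ 4"
    and u: "0 \<le> u" "u \<le> real L / 4" "u \<le> 1/2 \<or> 1 < u" and beta: "beta = exp (- (real L ^ 2) / 40000)"
  shows "kker M \<kappa> u \<le> 30 * bump M \<kappa> u + 34 * beta" "u \<ge> 1/200 \<Longrightarrow> bump M \<kappa> u \<le> beta"
proof -
  have k0: "\<kappa> > 0" using \<kappa> L by simp
  have b: "bump M \<kappa> v \<le> beta" if v: "1/200 \<le> \<bar>v\<bar>" "\<bar>v\<bar> \<le> real L / 2" for v
  proof -
    have "\<kappa> * \<bar>v\<bar> \<le> \<kappa> * (real L / 2)" using v k0 by (intro mult_left_mono) auto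
    also have "\<dots> = pi" using L by (simp add: \<kappa>)
    finally have 1: "\<kappa> * \<bar>v\<bar> \<le> pi" .
    have eq200: "\<kappa> * (1/200) / 2 = pi / (200 * real L)" using L by (simp add: \<kappa>)
    have 2: "\<kappa> * (1/200) / 2 \<le> 1" unfolding eq200 using L pi_less_4 by (simp add: field_simps)
    have "bump M \<kappa> v \<le> exp (- real M * (\<kappa> * (1/200) / 2)\<^sup>2 / 4)"
      by (rule bump_le_exp) (use k0 v 1 2 in auto)
    also have "\<dots> \<le> beta"
    proof -
      have "(1 / (100 * real L))\<^sup>2 \<le> (\<kappa> * (1/200) / 2)\<^sup>2"
        unfolding eq200 using L pi_gt3 by (intro power_mono) (auto simp: field_simps)
      then have "real M * (1 / (100 * real L))\<^sup>2 \<le> real M * (\<kappa> * (1/200) / 2)\<^sup>2" by (intro mult_left_mono) auto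
      moreover have "real M * (1 / (100 * real L))\<^sup>2 = real L ^ 2 / 10000"
        using L by (simp add: M power2_eq_square power4_eq_xxxx field_simps)
      ultimately have "real L ^ 2 / 10000 \<le> real M * (\<kappa> * (1/200) / 2)\<^sup>2" by linarith
      then show ?thesis unfolding beta by simp
    qed
    finally show ?thesis .
  qed
  have L': "real L \<ge> 100" using L by simp
  show "bump M \<kappa> u \<le> beta" if "u \<ge> 1/200" using b[of u] u that L' by auto
  have m: "bump M \<kappa> (u - 52/100) \<le> beta" "bump M \<kappa> (u - 97/100) \<le> beta" "bump M \<kappa> (u - 6/10) \<le> beta"
     "bump M \<kappa> (u - 7/10) \<le> beta" "bump M \<kappa> (u - 55/100) \<le> beta"
     "bump M \<kappa> (u + 52/100) \<le> beta" "bump M \<kappa> (u + 97/100) \<le> beta" "bump M \<kappa> (u + 6/10) \<le> beta"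
     "bump M \<kappa> (u + 7/10) \<le> beta" "bump M \<kappa> (u + 55/100) \<le> beta"
    using u L' by (auto intro!: b)
  show "kker M \<kappa> u \<le> 30 * bump M \<kappa> u + 34 * beta" unfolding kker_def using m by argo
qed

text \<open>The coefficients \<open>bwt * ppoly\<close> of the kernel are nonnegative, so upper
  bounds for the individual twisted sums may be added up. Frequencies occur in pairs
  \<open>g\<close> and \<open>- g\<close> to turn exponentials into cosines; 64 bounds
  \<open>ppoly\<close>, and the binomial weights sum to 1.\<close>

lemma positivity_kker:
  fixes w v :: "nat \<Rightarrow> real" and f :: "nat \<Rightarrow> complex"
  assumes H: "\<And>g. g \<in> G \<Longrightarrow> Re (\<Sum>p\<in>A. of_real (w p) * f p * cis (- g * v p)) \<le> B"
    and G: "\<And>j. j \<le> 2 * M \<Longrightarrow> (real j - real M) * \<kappa> \<in> G \<and> - ((real j - real M) * \<kappa>) \<in> G"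
    and B: "B \<ge> 0"
  shows "(\<Sum>p\<in>A. w p * kker M \<kappa> (v p) * Re (f p)) \<le> 64 * B"
proof -
  let ?c = "\<lambda>j. bwt M j"
  let ?g = "\<lambda>j. (real j - real M) * \<kappa>"
  have aux: "Re (of_real y * z * cis (- t)) + Re (of_real y * z * cis t) = 2 * (y * cos t * Re z)" for y t z
    by (simp add: algebra_simps)
  have each: "(\<Sum>p\<in>A. w p * cos (?g j * v p) * Re (f p)) \<le> B" if j: "j \<le> 2 * M" for j
  proof -
    have "Re (\<Sum>p\<in>A. of_real (w p) * f p * cis (- ?g j * v p)) + Re (\<Sum>p\<in>A. of_real (w p) * f p * cis (- (- ?g j) * v p)) =
       2 * (\<Sum>p\<in>A. w p * cos (?g j * v p) * Re (f p))"
      unfolding Re_sum sum.distrib[symmetric] sum_distrib_left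
      by (intro sum.cong refl) (simp only: minus_minus mult_minus_left aux)
    then show ?thesis using H[of "?g j"] H[of "- ?g j"] G[OF j] by simp
  qed
  have "(\<Sum>p\<in>A. w p * kker M \<kappa> (v p) * Re (f p)) =
     (\<Sum>p\<in>A. \<Sum>j\<le>2*M. ?c j * ppoly (?g j) * (w p * cos (?g j * v p) * Re (f p)))"
    unfolding kker_expansion sum_distrib_left sum_distrib_right by (intro sum.cong refl) (simp add: mult_ac)
  also have "\<dots> = (\<Sum>j\<le>2*M. ?c j * ppoly (?g j) * (\<Sum>p\<in>A. w p * cos (?g j * v p) * Re (f p)))"
    by (subst sum.swap) (simp add: sum_distrib_left)
  also have "\<dots> \<le> (\<Sum>j\<le>2*M. ?c j * (64 * B))"
  proof (intro sum_mono)
    fix j assume "j \<in> {..2*M}"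
    then have "ppoly (?g j) * (\<Sum>p\<in>A. w p * cos (?g j * v p) * Re (f p)) \<le> ppoly (?g j) * B"
      using each ppoly_nonneg by (intro mult_left_mono) auto
    also have "\<dots> \<le> 64 * B" using ppoly_le B by (intro mult_right_mono) auto
    finally have "?c j * (ppoly (?g j) * (\<Sum>p\<in>A. w p * cos (?g j * v p) * Re (f p))) \<le> ?c j * (64 * B)"
      by (intro mult_left_mono) auto
    then show "?c j * ppoly (?g j) * (\<Sum>p\<in>A. w p * cos (?g j * v p) * Re (f p)) \<le> ?c j * (64 * B)" by (simp add: mult_ac)
  qed
  also have "\<dots> = 64 * B" by (simp only: sum_distrib_right[symmetric] sum_binomial_weights mult_1)
  finally show ?thesis .
qed

text \<open>If the twisted prime sums were bounded above while \<open>f\<close> is close to 1 on the primes in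
  \<open>[e^{T/2}, e^T]\<close>, then testing against the positive definite kernel would give a contradiction:
  its mass on \<open>[T/2, T]\<close> (17 bumps) beats the one near 0 (30 half bumps).\<close>

theorem extremal:
  "\<exists>\<epsilon>>0. \<exists>c>0. \<exists>G. finite G \<and> (\<exists>T1\<ge>1. \<forall>T\<ge>T1. \<forall>(f :: nat \<Rightarrow> complex) N.
     (\<forall>p. norm (f p) \<le> 1) \<longrightarrow> exp T \<le> real N \<longrightarrow>
     (\<forall>g\<in>G. Re (\<Sum>p\<in>primes_le (real N). of_real (lnn p / p * exp (- lnn p / (50 * T))) * f p * cis (- g * (lnn p / T))) \<le> \<epsilon> * T) \<longrightarrow>
     (\<Sum>p\<in>logint (T / 2) T. (1 - Re (f p)) * (lnn p / p)) \<ge> c * T)"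
proof -
  obtain C where C: "C \<ge> 1" "\<And>u v. 0 \<le> u \<Longrightarrow> u \<le> v \<Longrightarrow> \<bar>mmass u v - (v - u)\<bar> \<le> C" using mmass_bound by blast
  obtain L :: nat where L: "L \<ge> 100" "6528 * (exp (- (real L ^ 2) / 40000) + exp (- real L / 200)) \<le> 1 / (10 * real L)"
    by (rule extremal_parameters)
  define M where "M = L ^ 4"
  define \<kappa> where "\<kappa> = 2 * pi / real L"
  define \<epsilon> where "\<epsilon> = 1 / (2000 * real L)"
  define beta where "beta = exp (- (real L ^ 2) / 40000)"
  \<comment> \<open>The first bound makes the rounding in \<open>J\<close> harmless, the second
    allows \<open>T + C \<le> 2 * T\<close>, and the third is what the final contradiction
    requires.\<close>
  define T1 where "T1 = max (1000 * real L) (max C ((64 * (C + 1) + 4) * 10 * real L))"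
  have Lr: "real L \<ge> 100" using L by simp
  have k0: "\<kappa> > 0" using L by (simp add: \<kappa>_def)
  have e0: "\<epsilon> > 0" using L by (simp add: \<epsilon>_def)
  define G where "G = (\<lambda>j. (real j - real M) * \<kappa>) ` {..2*M} \<union> (\<lambda>j. - ((real j - real M) * \<kappa>)) ` {..2*M}"
  have G0: "finite G" by (simp add: G_def)
  have T10: "T1 \<ge> 1" using Lr by (simp add: T1_def)
  have "\<forall>T\<ge>T1. \<forall>(f :: nat \<Rightarrow> complex) N.
     (\<forall>p. norm (f p) \<le> 1) \<longrightarrow> exp T \<le> real N \<longrightarrow>
     (\<forall>g\<in>G. Re (\<Sum>p\<in>primes_le (real N). of_real (lnn p / p * exp (- lnn p / (50 * T))) * f p * cis (- g * (lnn p / T))) \<le> \<epsilon> * T) \<longrightarrow>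
     (\<Sum>p\<in>logint (T / 2) T. (1 - Re (f p)) * (lnn p / p)) \<ge> \<epsilon> * T"
  proof (intro allI impI)
    fix T and f :: "nat \<Rightarrow> complex" and N :: nat assume T: "T \<ge> T1" and f: "\<forall>p. norm (f p) \<le> 1" and N: "exp T \<le> real N"
    let ?v = "\<lambda>p::nat. lnn p / T"
    define m where "m p = lnn p / real p" for p :: nat
    define w where "w p = m p * exp (- lnn p / (50 * T))" for p
    let ?P = "primes_le (real N)" and ?W = "logint (T / 2) T"
    assume "\<forall>g\<in>G. Re (\<Sum>p\<in>?P. of_real (lnn p / p * exp (- lnn p / (50 * T))) * f p * cis (- g * ?v p)) \<le> \<epsilon> * T"
    then have H: "\<forall>g\<in>G. Re (\<Sum>p\<in>?P. of_real (w p) * f p * cis (- g * ?v p)) \<le> \<epsilon> * T"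
      by (simp only: w_def m_def)
    have Tb: "T \<ge> 1000 * real L" "T \<ge> C" "T \<ge> (64 * (C + 1) + 4) * 10 * real L" using T by (auto simp: T1_def)
    have T0: "T > 0" using Tb Lr by linarith
    have "(\<Sum>p\<in>?W. (1 - Re (f p)) * m p) \<ge> \<epsilon> * T"
    proof (rule ccontr)
      assume "\<not> ?thesis"
      then have small: "(\<Sum>p\<in>?W. (1 - Re (f p)) * m p) < \<epsilon> * T" by simp
      define k where "k p = kker M \<kappa> (?v p)" for p
      have kb: "k p \<ge> 0" "k p \<le> 64" for p using kker_bounds by (auto simp: k_def)
      have w0: "w p \<ge> 0" "w p \<le> m p" "m p \<ge> 0" if "prime p" for p
      proof -
        show m0: "m p \<ge> 0" using that by (simp add: m_def prime_gt_0_nat Suc_leI)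
        then show "w p \<ge> 0" by (simp add: w_def)
        have "exp (- lnn p / (50 * T)) \<le> 1" using that T0 by (simp add: prime_gt_0_nat Suc_leI)
        then show "w p \<le> m p" unfolding w_def using m0 by (rule mult_left_le)
      qed
      have U: "(\<Sum>p\<in>?P. w p * k p * Re (f p)) \<le> 64 * (\<epsilon> * T)"
        unfolding k_def by (rule positivity_kker[where G = G]) (use H T0 e0 in \<open>auto simp: G_def\<close>)
      have WP: "?W \<subseteq> ?P"
      proof
        fix p assume p: "p \<in> ?W"
        then have pr: "prime p" "lnn p \<le> T" by (auto simp: logint_def)
        then have "exp (lnn p) \<le> exp T" by (simp only: exp_le_cancel_iff)
        moreover have "exp (lnn p) = real p" using pr by (simp add: prime_gt_0_nat)
        ultimately show "p \<in> ?P" using pr N by (simp add: primes_le_def)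
      qed
      have Ref: "\<bar>Re (f p)\<bar> \<le> 1" for p using f abs_Re_le_cmod[of "f p"] order_trans by blast
      have primes: "prime p" if "p \<in> ?P" for p using that by (simp add: primes_le_def)
      have split: "(\<Sum>p\<in>?P. w p * k p * Re (f p)) = (\<Sum>p\<in>?W. w p * k p * Re (f p)) + (\<Sum>p\<in>?P - ?W. w p * k p * Re (f p))"
        using sum.subset_diff[OF WP, of "\<lambda>p. w p * k p * Re (f p)"] by simp
      have inW: "(\<Sum>p\<in>?W. w p * k p * Re (f p)) \<ge> (\<Sum>p\<in>?W. w p * k p) - 64 * (\<epsilon> * T)"
      proof -
        have "(\<Sum>p\<in>?W. w p * k p) - (\<Sum>p\<in>?W. w p * k p * Re (f p)) = (\<Sum>p\<in>?W. w p * k p * (1 - Re (f p)))"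
          by (simp add: sum_subtractf algebra_simps)
        also have "\<dots> \<le> (\<Sum>p\<in>?W. 64 * ((1 - Re (f p)) * m p))"
        proof (rule sum_mono)
          fix p assume "p \<in> ?W"
          then have p: "prime p" by (simp add: logint_def)
          have "w p * k p \<le> m p * 64" using w0[OF p] kb by (intro mult_mono) auto
          then have "w p * k p * (1 - Re (f p)) \<le> m p * 64 * (1 - Re (f p))"
            using Ref[of p] by (intro mult_right_mono) (auto simp: abs_le_iff)
          then show "w p * k p * (1 - Re (f p)) \<le> 64 * ((1 - Re (f p)) * m p)" by (simp add: mult_ac)
        qed
        also have "\<dots> \<le> 64 * (\<epsilon> * T)" using small by (simp only: sum_distrib_left[symmetric])
        finally show ?thesis by simp
      qed
      have outW: "(\<Sum>p\<in>?P - ?W. w p * k p * Re (f p)) \<ge> - (\<Sum>p\<in>?P - ?W. w p * k p)"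
      proof -
        have "- (w p * k p) \<le> w p * k p * Re (f p)" if "p \<in> ?P - ?W" for p
        proof -
          have "0 \<le> w p * k p" using w0 kb primes that by (intro mult_nonneg_nonneg) auto
          then have "w p * k p * (-1) \<le> w p * k p * Re (f p)" using Ref[of p] by (intro mult_left_mono) (auto simp: abs_le_iff)
          then show ?thesis by simp
        qed
        then have "(\<Sum>p\<in>?P - ?W. - (w p * k p)) \<le> (\<Sum>p\<in>?P - ?W. w p * k p * Re (f p))" by (rule sum_mono)
        then show ?thesis by (simp add: sum_negf)
      qed
      have main: "(\<Sum>p\<in>?W. w p * k p) - (\<Sum>p\<in>?P - ?W. w p * k p) \<le> 128 * (\<epsilon> * T)"
        using U split inW outW by linarith
      have beta0: "beta \<ge> 0" by (simp add: beta_def)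
      \<comment> \<open>Half width of the part of a bump that is counted. The centres lie between
        \<open>52/100 * T\<close> and \<open>97/100 * T\<close>, so these parts remain inside
        \<open>[T / 2, T]\<close>.\<close>
      define J where "J = nat \<lfloor>T / 100\<rfloor>"
      have J: "real J \<le> T / 100" "real J > T / 100 - 1"
      proof -
        have "real J = of_int \<lfloor>T / 100\<rfloor>" using T0 by (simp add: J_def)
        then show "real J \<le> T / 100" "real J > T / 100 - 1" using floor_correct[of "T / 100"] by linarith+
      qed
      have J2: "real J \<ge> T / 200" using J Tb Lr by linarith
      define g where "g u = bump M \<kappa> (u / T)" for u
      have gmono: "g v \<le> g u" if "0 \<le> u" "u \<le> v" "v \<le> real J" for u v
        unfolding g_def
      proof (rule bump_mono[OF k0])
        show "\<bar>u / T\<bar> \<le> \<bar>v / T\<bar>" using that T0 by (simp add: divide_right_mono)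
        have "v / T \<le> 1 / 100" using that J T0 by (simp add: field_simps)
        also have "\<dots> \<le> real L / 2" using Lr by simp
        finally have "\<kappa> * \<bar>v / T\<bar> \<le> \<kappa> * (real L / 2)" using that T0 k0 by (intro mult_left_mono) auto
        also have "\<dots> = pi" using L by (simp add: \<kappa>_def)
        finally show "\<kappa> * \<bar>v / T\<bar> \<le> pi" .
      qed
      have g0: "g 0 = 1" by (simp add: g_def)
      have gnn: "g u \<ge> 0" for u unfolding g_def by (rule bump_nonneg)
      have geven: "g (- u) = g u" for u unfolding g_def using bump_even[of M \<kappa> "u / T"] by simp
      define R where "R = (\<Sum>j<J. g (real j))"
      \<comment> \<open>Up to distance \<open>T / (5 * L)\<close> the bump is at least 1/2: there
        \<open>M\<close> times the squared half angle is at most 49/100.\<close>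
      have Rge: "R \<ge> T / (10 * real L) - 1"
      proof -
        define J' where "J' = nat \<lfloor>T / (5 * real L)\<rfloor>"
        have J': "real J' \<le> T / (5 * real L)" "real J' > T / (5 * real L) - 1" using T0 Lr by (auto simp: J'_def)
        have "T / (5 * real L) \<le> T / 200" using T0 Lr by (intro divide_left_mono) auto
        then have JJ: "J' \<le> J" using J' J2 by linarith
        have "g (real j) \<ge> 1/2" if "j < J'" for j
        proof -
          have "real j * (5 * real L) \<le> real J' * (5 * real L)" using that by (intro mult_right_mono) auto
          also have "\<dots> \<le> T" using J'(1) Lr by (simp add: field_simps)
          finally have "real j / T \<le> 1 / (5 * real L)" using T0 Lr by (simp add: field_simps)
          then have "\<kappa> * (real j / T) / 2 \<le> \<kappa> * (1 / (5 * real L)) / 2" using k0 by (intro divide_right_mono mult_left_mono) auto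
          also have "\<dots> = pi / (5 * real L ^ 2)" by (simp add: \<kappa>_def power2_eq_square)
          also have "\<dots> \<le> (7/10) / real L ^ 2" using pi_less_4 pi_approx Lr by (simp add: field_simps)
          finally have "(\<kappa> * (real j / T) / 2)\<^sup>2 \<le> ((7/10) / real L ^ 2)\<^sup>2" using k0 T0 by (intro power_mono) auto
          also have "\<dots> = (49/100) / real L ^ 4" by (simp add: power_divide)
          finally have sq: "(\<kappa> * (real j / T) / 2)\<^sup>2 \<le> (49/100) / real L ^ 4" .
          have "(49/100) / real L ^ 4 \<le> 2" 
          proof -
            have "1 \<le> real L ^ 4" using Lr by (intro one_le_power) simp
            then have "(49/100) / real L ^ 4 \<le> (49/100) / 1" using Lr by (intro divide_left_mono) auto
            then show ?thesis by simp
          qed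
          then have "g (real j) \<ge> 1 - real M * (\<kappa> * (real j / T) / 2)\<^sup>2"
            unfolding g_def using sq by (intro bump_ge) linarith
          moreover have "real M * (\<kappa> * (real j / T) / 2)\<^sup>2 \<le> real M * ((49/100) / real L ^ 4)"
            using sq by (intro mult_left_mono) auto
          moreover have "real M * ((49/100) / real L ^ 4) = 49/100" using L by (simp add: M_def)
          ultimately show ?thesis by linarith
        qed
        then have "(\<Sum>j<J'. 1/2) \<le> (\<Sum>j<J'. g (real j))" by (intro sum_mono) auto
        also have "\<dots> \<le> R" unfolding R_def using JJ gnn by (intro sum_mono2) auto
        finally have "real J' / 2 \<le> R" by simp
        then show ?thesis using J' by (simp add: field_simps)
      qed
      have win: "(\<Sum>p\<in>?W. m p * bump M \<kappa> (?v p - x)) \<ge> 2 * R - 2 * (C + 1)"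
        if x: "52/100 \<le> x" "x \<le> 97/100" for x
      proof -
        have "(\<Sum>p\<in>?W. m p * g (lnn p - x * T)) \<ge> 2 * (\<Sum>j<J. g (real j)) - 2 * (C + 1)"
          unfolding m_def
        proof (rule kker_window[where g = g and J = J and C = C, OF C(2) gmono gnn g0 geven gnn])
          have "52/100 * T \<le> x * T" "x * T \<le> 97/100 * T" using x T0 by (auto intro: mult_right_mono)
          then show "T / 2 \<le> x * T - real J" "x * T + real J \<le> T" using J T0 by linarith+
        qed (use T0 in auto)
        moreover have "g (lnn p - x * T) = bump M \<kappa> (?v p - x)" for p
          using T0 by (simp add: g_def diff_divide_distrib)
        ultimately show ?thesis by (simp add: R_def)
      qed
      \<comment> \<open>The shifted peaks have total weight 17 and count with both halves, giving
        \<open>34 * R\<close>. The damping factor is at least 98/100 on the window, and 34 times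
        98/100 exceeds 33.\<close>
      have Wlow: "(\<Sum>p\<in>?W. w p * k p) \<ge> 33 * R - 34 * (C + 1)"
      proof -
        have "(98/100) * (\<Sum>p\<in>?W. m p * k p) \<le> (\<Sum>p\<in>?W. w p * k p)"
          unfolding sum_distrib_left
        proof (rule sum_mono)
          fix p assume p: "p \<in> ?W"
          then have pr: "prime p" by (simp add: logint_def)
          have "98/100 \<le> 1 + (- lnn p / (50 * T))" using p T0 by (simp add: logint_def field_simps)
          also have "\<dots> \<le> exp (- lnn p / (50 * T))" by (rule exp_ge_add_one_self)
          finally have "m p * k p * (98/100) \<le> m p * k p * exp (- lnn p / (50 * T))"
            using w0[OF pr] kb by (intro mult_left_mono mult_nonneg_nonneg) auto
          then show "98/100 * (m p * k p) \<le> w p * k p" by (simp add: w_def mult_ac)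
        qed
        moreover have "(\<Sum>p\<in>?W. m p * k p) \<ge>
           4 * (\<Sum>p\<in>?W. m p * bump M \<kappa> (?v p - 52/100)) + 4 * (\<Sum>p\<in>?W. m p * bump M \<kappa> (?v p - 97/100)) +
           4 * (\<Sum>p\<in>?W. m p * bump M \<kappa> (?v p - 6/10)) + 4 * (\<Sum>p\<in>?W. m p * bump M \<kappa> (?v p - 7/10)) +
           (\<Sum>p\<in>?W. m p * bump M \<kappa> (?v p - 55/100))"
          unfolding sum_distrib_left sum.distrib[symmetric]
        proof (rule sum_mono)
          fix p assume p: "p \<in> ?W"
          then have pr: "prime p" by (simp add: logint_def)
          let ?b = "\<lambda>x. bump M \<kappa> (?v p - x)"
          have "4 * ?b (52/100) + 4 * ?b (97/100) + 4 * ?b (6/10) + 4 * ?b (7/10) + ?b (55/100) \<le> k p"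
            unfolding k_def kker_def
            using bump_nonneg[of M \<kappa> "?v p"] bump_nonneg[of M \<kappa> "?v p + 52/100"] bump_nonneg[of M \<kappa> "?v p + 97/100"]
              bump_nonneg[of M \<kappa> "?v p + 6/10"] bump_nonneg[of M \<kappa> "?v p + 7/10"] bump_nonneg[of M \<kappa> "?v p + 55/100"] by argo
          then have "m p * (4 * ?b (52/100) + 4 * ?b (97/100) + 4 * ?b (6/10) + 4 * ?b (7/10) + ?b (55/100)) \<le> m p * k p"
            using w0[OF pr] by (intro mult_left_mono) auto
          then show "4 * (m p * ?b (52/100)) + 4 * (m p * ?b (97/100)) + 4 * (m p * ?b (6/10)) +
             4 * (m p * ?b (7/10)) + m p * ?b (55/100) \<le> m p * k p"
            by (simp only: distrib_left mult.left_commute[of _ 4])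
        qed
        moreover have "R \<ge> 0" unfolding R_def by (intro sum_nonneg gnn)
        moreover note win[of "52/100"] win[of "97/100"] win[of "6/10"] win[of "7/10"] win[of "55/100"]
        ultimately show ?thesis using C(1) by simp
      qed
      let ?Q1 = "logint 0 (real J)" and ?Q3 = "{p\<in>?P. T * real L / 4 < lnn p}"
      have exp50: "1 - exp (- (1 / 50 :: real)) \<ge> 1 / 51"
      proof -
        have "exp (1/50 :: real) \<ge> 51/50" using exp_ge_add_one_self[of "1/50 :: real"] by simp
        then have "exp (- (1/50 :: real)) \<le> 50 / 51" by (simp add: exp_minus field_simps)
        then show ?thesis by simp
      qed
      \<comment> \<open>\<open>102 = 2 * 51\<close>: the factor 2 comes from
        \<open>T + C \<le> 2 * T\<close>, and 51 bounds the geometric series with ratio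
        \<open>exp (- 1/50)\<close>.\<close>
      have tail: "(\<Sum>p\<in>{p\<in>?P. Y < lnn p}. w p) \<le> 102 * T * exp (- Y / (50 * T))" if Y: "Y \<ge> 0" for Y
      proof -
        have "(\<Sum>p\<in>{p\<in>?P. Y < lnn p}. m p * exp (- (1/50) * lnn p / T)) \<le>
           (T + C) * exp (- (1/50) * Y / T) / (1 - exp (- (1/50)))"
          unfolding m_def by (rule exp_weighted_tail[OF C(2) T0 _ Y]) auto
        also have "\<dots> \<le> (2 * T) * exp (- (1/50) * Y / T) / (1 / 51)"
          using Tb exp50 T0 by (intro frac_le mult_right_mono) auto
        also have "- (1/50) * Y / T = - Y / (50 * T)" by simp
        finally show ?thesis by (simp add: w_def mult_ac)
      qed
      have lnpos: "lnn p > 0" if "prime p" for p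
        using prime_gt_1_nat[OF that] by simp
      have tot: "(\<Sum>p\<in>?P. w p) \<le> 102 * T"
      proof -
        have "?P = {p\<in>?P. 0 < lnn p}" using lnpos primes by auto
        then show ?thesis using tail[of 0] by simp
      qed
      have Q1: "(\<Sum>p\<in>?Q1. m p * g (lnn p)) \<le> R + (C + 1)"
        using unimodal_sums(1)[where g = g and J = J and C = C, OF C(2) gmono gnn, of 0] g0 by (simp add: abs_le_iff R_def m_def)
      \<comment> \<open>Off the window only the central peak matters, and as \<open>ln p > 0\<close>
        only one half of it: at most \<open>30 * R\<close>, which leaves a surplus of
        \<open>3 * R\<close>. The remaining points are either far from all peaks or beyond a quarter
        period, where only the damping helps.\<close>
      have off: "(\<Sum>p\<in>?P - ?W. w p * k p) \<le> 30 * (R + (C + 1)) + 64 * (102 * T * (beta + exp (- real L / 200)))"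
      proof -
        have each: "w p * k p \<le> (if p \<in> ?Q1 then 30 * (m p * g (lnn p)) else 0) + 64 * beta * w p +
             (if p \<in> ?Q3 then 64 * w p else 0)" if p: "p \<in> ?P - ?W" for p
        proof (cases "p \<in> ?Q3")
          case True
          have pr: "prime p" using p primes by auto
          have "w p * k p \<le> 64 * w p" using kb[of p] w0[OF pr] by (subst mult.commute) (intro mult_right_mono)
          moreover have "0 \<le> 64 * beta * w p" using w0(1)[OF pr] beta0 by simp
          moreover have "0 \<le> 30 * (m p * g (lnn p))" using w0(3)[OF pr] gnn by simp
          ultimately show ?thesis using True by auto
        next
          case False
          have pr: "prime p" using p primes by auto
          have u: "0 \<le> ?v p" "?v p \<le> real L / 4" "?v p \<le> 1/2 \<or> 1 < ?v p"
          proof -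
            show "0 \<le> ?v p" using pr T0 by (simp add: prime_gt_0_nat Suc_leI)
            show "?v p \<le> real L / 4" using False p T0 by (auto simp: field_simps not_less)
            have "\<not> (T / 2 < lnn p \<and> lnn p \<le> T)" using p pr by (auto simp: logint_def)
            then show "?v p \<le> 1/2 \<or> 1 < ?v p" using T0 by (auto simp: field_simps not_less not_le)
          qed
          have kk: "k p \<le> 30 * bump M \<kappa> (?v p) + 34 * beta"
            unfolding k_def by (rule kker_off_window(1)[OF \<kappa>_def L(1) M_def u beta_def])
          show ?thesis
          proof (cases "p \<in> ?Q1")
            case True
            have "w p * k p \<le> w p * (30 * bump M \<kappa> (?v p)) + w p * (34 * beta)"
              using mult_left_mono[OF kk w0(1)[OF pr]] by (simp add: distrib_left)
            also have "w p * (30 * bump M \<kappa> (?v p)) \<le> m p * (30 * bump M \<kappa> (?v p))"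
              using w0[OF pr] bump_nonneg by (intro mult_right_mono) auto
            also have "w p * (34 * beta) \<le> 64 * beta * w p" 
            proof -
              have "0 \<le> w p * beta" using w0(1)[OF pr] beta0 by simp
              then show ?thesis by (simp only: mult.left_commute[of "w p"] mult.commute[of beta] mult.assoc)
            qed
            finally have "w p * k p \<le> 30 * (m p * g (lnn p)) + 64 * beta * w p" by (simp add: g_def mult_ac)
            then show ?thesis using True False w0(1)[OF pr] by (simp only: if_True if_False)
          next
            case nQ: False
            have "lnn p > real J"
              using nQ pr lnpos[OF pr] by (auto simp: logint_def)
            then have "?v p \<ge> 1/200" using J2 T0 by (simp add: field_simps)
            then have "bump M \<kappa> (?v p) \<le> beta" by (rule kker_off_window(2)[OF \<kappa>_def L(1) M_def u beta_def])
            then have "k p \<le> 64 * beta" using kk by linarith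
            then have "w p * k p \<le> w p * (64 * beta)" using w0(1)[OF pr] by (intro mult_left_mono)
            then have "w p * k p \<le> 64 * beta * w p" by (simp add: mult_ac)
            then show ?thesis using nQ False by (simp only: if_False)
          qed
        qed
        have "(\<Sum>p\<in>?P - ?W. w p * k p) \<le> (\<Sum>p\<in>?P - ?W. (if p \<in> ?Q1 then 30 * (m p * g (lnn p)) else 0) + 64 * beta * w p +
             (if p \<in> ?Q3 then 64 * w p else 0))" by (rule sum_mono) (rule each)
        also have "\<dots> = (\<Sum>p\<in>(?P - ?W) \<inter> ?Q1. 30 * (m p * g (lnn p))) + (\<Sum>p\<in>?P - ?W. 64 * beta * w p) + (\<Sum>p\<in>(?P - ?W) \<inter> ?Q3. 64 * w p)"
          by (subst (1 2) sum.inter_restrict) (simp_all only: finite_Diff finite_primes_le sum.distrib)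
        also have "(\<Sum>p\<in>(?P - ?W) \<inter> ?Q1. 30 * (m p * g (lnn p))) \<le> (\<Sum>p\<in>?Q1. 30 * (m p * g (lnn p)))"
        proof (intro sum_mono2)
          fix p assume "p \<in> ?Q1 - (?P - ?W) \<inter> ?Q1"
          then have "prime p" by (simp add: logint_def)
          then show "0 \<le> 30 * (m p * g (lnn p))" using w0 gnn by (intro mult_nonneg_nonneg) auto
        qed auto
        also have "\<dots> \<le> 30 * (R + (C + 1))" using mult_left_mono[OF Q1, of 30] by (simp only: sum_distrib_left[symmetric])
        also have "(\<Sum>p\<in>?P - ?W. 64 * beta * w p) \<le> (\<Sum>p\<in>?P. 64 * beta * w p)"
          using w0(1) primes beta0 by (intro sum_mono2) auto
        also have "\<dots> \<le> 64 * beta * (102 * T)"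
          using mult_left_mono[OF tot, of "64 * beta"] beta0 by (subst sum_distrib_left[symmetric]) simp
        also have "(\<Sum>p\<in>(?P - ?W) \<inter> ?Q3. 64 * w p) \<le> (\<Sum>p\<in>?Q3. 64 * w p)"
          using w0(1) primes by (intro sum_mono2) auto
        also have "\<dots> \<le> 64 * (102 * T * exp (- real L / 200))"
        proof -
          have "- (T * real L / 4) / (50 * T) = - real L / 200" using T0 by simp
          then show ?thesis using tail[of "T * real L / 4"] T0 by (subst sum_distrib_left[symmetric]) simp
        qed
        finally show ?thesis by (simp add: algebra_simps)
      qed
      have "64 * (102 * T * (beta + exp (- real L / 200))) \<le> T * (1 / (10 * real L))"
      proof -
        have "T * (6528 * (beta + exp (- real L / 200))) \<le> T * (1 / (10 * real L))"
          unfolding beta_def using L(2) T0 by (intro mult_left_mono) auto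
        then show ?thesis by (simp add: mult_ac)
      qed
      then have "33 * R - 34 * (C + 1) - 30 * (R + (C + 1)) - T * (1 / (10 * real L)) \<le> 128 * (\<epsilon> * T)"
        using main Wlow off by argo
      moreover have "128 * (\<epsilon> * T) \<le> T * (1 / (10 * real L))" using T0 Lr by (simp add: \<epsilon>_def field_simps)
      moreover have "T / (10 * real L) = T * (1 / (10 * real L))" by simp
      ultimately have "T * (1 / (10 * real L)) \<le> 64 * (C + 1) + 3" using Rge by argo
      moreover have "T * (1 / (10 * real L)) \<ge> 64 * (C + 1) + 4" using Tb Lr by (simp add: field_simps)
      ultimately show False by linarith
    qed
    then show "(\<Sum>p\<in>?W. (1 - Re (f p)) * (lnn p / p)) \<ge> \<epsilon> * T" by (simp only: m_def)
  qed
  then show ?thesis using e0 G0 T10 by blast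
qed

section \<open>Non-principal characters do not pretend to be \<open>n powr (i t)\<close>\<close>

text \<open>Apply \<open>extremal\<close> to \<open>\<omega> p * dpow (Complex 0 t) p\<close>. The
  damping and the frequency \<open>g\<close> combine with \<open>1 / p\<close> to
  \<open>dpow\<close> at \<open>1 + 1 / (50 * T) + i (t + g / T)\<close>, where
  \<open>character_prime_sum_upper\<close> applies. There are finitely many \<open>g\<close>, so one
  \<open>N\<close> serves all of them.\<close>

theorem nonpretentious:
  "\<exists>c>0. \<exists>C\<ge>1. \<forall>q \<omega> t T. q > 0 \<longrightarrow> dchar q \<omega> \<longrightarrow> \<omega> \<noteq> principal q \<longrightarrow> T \<ge> C \<longrightarrow>
     C * (lnn q + ln (\<bar>t\<bar> + 2) + ln T) \<le> T \<longrightarrow>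
     (\<Sum>p\<in>logint (T / 2) T. (1 - Re (\<omega> p * dpow (Complex 0 t) p)) * (lnn p / p)) \<ge> c * T"
proof -
  obtain \<epsilon> c T1 :: real and G where e: "\<epsilon> > 0" "c > 0" "finite G" "T1 \<ge> 1"
    and ext0: "\<forall>T\<ge>T1. \<forall>f N. (\<forall>p. norm (f p :: complex) \<le> 1) \<longrightarrow> exp T \<le> real N \<longrightarrow>
     (\<forall>g\<in>G. Re (\<Sum>p\<in>primes_le (real N). of_real (lnn p / p * exp (- lnn p / (50 * T))) * f p * cis (- g * (lnn p / T))) \<le> \<epsilon> * T) \<longrightarrow>
     (\<Sum>p\<in>logint (T / 2) T. (1 - Re (f p)) * (lnn p / p)) \<ge> c * T"
    using extremal by (elim exE conjE) (rule that)
  note ext = ext0[THEN spec, THEN mp, THEN spec, THEN spec, THEN mp, THEN mp, THEN mp]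
  obtain C where C: "C \<ge> 0" "\<And>q \<omega> t r. q > 0 \<Longrightarrow> dchar q \<omega> \<Longrightarrow> \<omega> \<noteq> principal q \<Longrightarrow> 0 < r \<Longrightarrow> r \<le> 1/2 \<Longrightarrow>
     (\<forall>\<^sub>F N in sequentially. Re (\<Sum>p\<in>primes_le (real N). of_real (lnn p) * (\<omega> p * dpow (Complex (1 + r) t) p)) \<le>
        C * (lnn q + ln (\<bar>t\<bar> + 2) + ln (1 / r) + 1))"
    using character_prime_sum_upper by blast
  define B where "B = Max (insert 1 (abs ` G))"
  have B: "\<And>g. g \<in> G \<Longrightarrow> \<bar>g\<bar> \<le> B" "B \<ge> 1" using e by (auto simp: B_def)
  \<comment> \<open>\<open>T \<ge> exp 1\<close> gives \<open>ln T \<ge> 1\<close>, so that additive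
    constants such as \<open>ln 50\<close> and \<open>ln (2 * B)\<close> can be absorbed into a
    multiple of the logarithms; the second entry is the resulting multiple divided by
    \<open>\<epsilon>\<close>.\<close>
  define C' where "C' = max (T1 + exp 1) (2 * B + (C / \<epsilon>) * (ln 50 + ln (2 * B) + 3))"
  show ?thesis
  proof (rule exI[of _ c], intro conjI exI[of _ C'] allI impI)
    show "c > 0" by fact
    have "T1 + exp 1 \<le> C'" by (simp add: C'_def)
    then show "C' \<ge> 1" using e exp_gt_zero[of "1::real"] by linarith
    fix q \<omega> and t T :: real
    assume q: "q > 0" and w: "dchar q \<omega>" "\<omega> \<noteq> principal q" and T: "T \<ge> C'"
      and big: "C' * (lnn q + ln (\<bar>t\<bar> + 2) + ln T) \<le> T"
    have T': "T \<ge> T1" "T \<ge> exp 1" "T \<ge> 1" using T e exp_gt_zero[of "1::real"] unfolding C'_def by linarith+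
    define r where "r = 1 / (50 * T)"
    have r: "0 < r" "r \<le> 1/2" using T' by (auto simp: r_def field_simps)
    let ?f = "\<lambda>p. \<omega> p * dpow (Complex 0 t) p"
    have nf: "norm (?f p) \<le> 1" for p
    proof -
      have "real p powr (- Re (Complex 0 t)) \<le> 1" by (cases "p = 0") auto
      then have "norm (\<omega> p) * real p powr (- Re (Complex 0 t)) \<le> 1 * 1"
        by (intro mult_mono norm_dchar_le[OF q w(1)]) auto
      then show ?thesis by (simp add: norm_mult norm_dpow)
    qed
    have lnq: "lnn q \<ge> 0" using q by simp
    have bound: "C * (lnn q + ln (\<bar>t + g / T\<bar> + 2) + ln (1 / r) + 1) \<le> \<epsilon> * T" if g: "g \<in> G" for g
    proof -
      have "\<bar>t + g / T\<bar> + 2 \<le> 2 * B * (\<bar>t\<bar> + 2)"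
      proof -
        have "\<bar>g / T\<bar> \<le> \<bar>g\<bar>" using T' divide_left_mono[of 1 T "\<bar>g\<bar>"] by (simp add: abs_divide)
        then have "\<bar>t + g / T\<bar> + 2 \<le> \<bar>t\<bar> + B + 2" using B(1)[OF g] by linarith
        also have "\<dots> \<le> 2 * B * (\<bar>t\<bar> + 2)"
        proof -
          have "1 * \<bar>t\<bar> \<le> 2 * B * \<bar>t\<bar>" using B(2) by (intro mult_right_mono) auto
          then show ?thesis using B(2) by (simp add: algebra_simps)
        qed
        finally show ?thesis .
      qed
      then have "ln (\<bar>t + g / T\<bar> + 2) \<le> ln (2 * B * (\<bar>t\<bar> + 2))" by (intro ln_mono) auto
      also have "\<dots> = ln (2 * B) + ln (\<bar>t\<bar> + 2)" using B(2) by (intro ln_mult_pos) auto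
      finally have 1: "ln (\<bar>t + g / T\<bar> + 2) \<le> ln (2 * B) + ln (\<bar>t\<bar> + 2)" .
      have 2: "ln (1 / r) = ln 50 + ln T" using T' by (simp add: r_def ln_mult)
      define Y where "Y = lnn q + ln (\<bar>t\<bar> + 2) + ln T"
      have lnT: "ln T \<ge> 1" using T' by (simp add: ln_ge_iff)
      have Y: "Y \<ge> 1" unfolding Y_def using lnq lnT by (smt (verit) ln_ge_zero)
      define K where "K = ln 50 + ln (2 * B) + 1"
      have K: "K \<ge> 1" unfolding K_def using B(2) by (simp add: ln_ge_zero)
      have "lnn q + ln (\<bar>t + g / T\<bar> + 2) + ln (1 / r) + 1 \<le> Y + K" using 1 2 by (simp add: Y_def K_def)
      also have "\<dots> \<le> Y + K * Y" using mult_left_mono[of 1 Y K] Y K by linarith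
      also have "\<dots> = (K + 1) * Y" by (simp add: algebra_simps)
      finally have "C * (lnn q + ln (\<bar>t + g / T\<bar> + 2) + ln (1 / r) + 1) \<le> C * ((K + 1) * Y)"
        using C(1) by (intro mult_left_mono)
      also have "\<dots> = \<epsilon> * ((C / \<epsilon>) * (K + 1) * Y)" using e by simp
      also have "\<dots> \<le> \<epsilon> * (C' * Y)"
      proof (intro mult_left_mono mult_right_mono)
        have "(C / \<epsilon>) * (K + 1) \<le> (C / \<epsilon>) * (ln 50 + ln (2 * B) + 3)"
          using C(1) e by (intro mult_left_mono) (auto simp: K_def)
        also have "\<dots> \<le> C'" unfolding C'_def using B(2) by linarith
        finally show "(C / \<epsilon>) * (K + 1) \<le> C'" .
      qed (use Y e in auto)
      also have "\<dots> \<le> \<epsilon> * T" using big e by (intro mult_left_mono) (auto simp: Y_def)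
      finally show ?thesis .
    qed
    have "\<forall>\<^sub>F N in sequentially. \<forall>g\<in>G. Re (\<Sum>p\<in>primes_le (real N). of_real (lnn p) * (\<omega> p * dpow (Complex (1 + r) (t + g / T)) p)) \<le> \<epsilon> * T"
    proof (rule eventually_ball_finite[OF e(3)], rule ballI)
      fix g assume g: "g \<in> G"
      from C(2)[OF q w r, of "t + g / T"]
      show "\<forall>\<^sub>F N in sequentially. Re (\<Sum>p\<in>primes_le (real N). of_real (lnn p) * (\<omega> p * dpow (Complex (1 + r) (t + g / T)) p)) \<le> \<epsilon> * T"
        by eventually_elim (use bound[OF g] in linarith)
    qed
    moreover have "\<forall>\<^sub>F N in sequentially. exp T \<le> real N"
      using filterlim_real_sequentially by (auto simp: filterlim_at_top)
    ultimately have "\<forall>\<^sub>F N in sequentially. exp T \<le> real N \<and> (\<forall>g\<in>G. Re (\<Sum>p\<in>primes_le (real N). of_real (lnn p) * (\<omega> p * dpow (Complex (1 + r) (t + g / T)) p)) \<le> \<epsilon> * T)"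
      by eventually_elim auto
    then obtain N where N: "exp T \<le> real N"
      "\<And>g. g \<in> G \<Longrightarrow> Re (\<Sum>p\<in>primes_le (real N). of_real (lnn p) * (\<omega> p * dpow (Complex (1 + r) (t + g / T)) p)) \<le> \<epsilon> * T"
      using eventually_happens' sequentially_bot by blast
    show "(\<Sum>p\<in>logint (T / 2) T. (1 - Re (?f p)) * (lnn p / p)) \<ge> c * T"
    proof (rule ext[OF T'(1) _ N(1)], safe)
      show "norm (?f p) \<le> 1" for p by (rule nf)
      fix g assume g: "g \<in> G"
      have "of_real (lnn p / p * exp (- lnn p / (50 * T))) * ?f p * cis (- g * (lnn p / T)) =
          of_real (lnn p) * (\<omega> p * dpow (Complex (1 + r) (t + g / T)) p)" if p: "p \<in> primes_le (real N)" for p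
      proof -
        have p0: "p > 0" using p by (auto simp: primes_le_def prime_gt_0_nat)
        have "Complex (1 + r) (t + g / T) = of_real 1 + (of_real r + (Complex 0 t + Complex 0 (g / T)))"
          by (simp add: complex_eq_iff)
        then have "dpow (Complex (1 + r) (t + g / T)) p = dpow (of_real 1) p * (dpow (of_real r) p * (dpow (Complex 0 t) p * dpow (Complex 0 (g / T)) p))"
          by (simp only: dpow_add)
        also have "dpow (of_real 1) p = of_real (1 / real p)" using p0 by (simp only: dpow_of_real) (simp add: powr_minus_divide)
        also have "dpow (of_real r) p = of_real (exp (- lnn p / (50 * T)))"
          using p0 by (simp only: dpow_of_real) (simp add: powr_def r_def)
        also have "dpow (Complex 0 (g / T)) p = cis (- g * (lnn p / T))"
          using p0 by (simp add: dpow_def cis_conv_exp complex_eq_iff)  (simp add: exp_eq_polar complex_eq_iff)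
        finally show ?thesis by (simp add: mult_ac)
      qed
      then have "(\<Sum>p\<in>primes_le (real N). of_real (lnn p / p * exp (- lnn p / (50 * T))) * ?f p * cis (- g * (lnn p / T))) =
         (\<Sum>p\<in>primes_le (real N). of_real (lnn p) * (\<omega> p * dpow (Complex (1 + r) (t + g / T)) p))"
        by (intro sum.cong refl)
      then show "Re (\<Sum>p\<in>primes_le (real N). of_real (lnn p / p * exp (- lnn p / (50 * T))) * ?f p * cis (- g * (lnn p / T))) \<le> \<epsilon> * T"
        using N(2)[OF g] by simp
    qed
  qed
qed

section \<open>Rankin bounds and the saddle point\<close>

definition pint :: "real \<Rightarrow> real \<Rightarrow> nat set" where
  "pint y' y = {p. prime p \<and> y' \<le> real p \<and> real p \<le> y}"

lemma pint_subset: "pint y' y \<subseteq> primes_le y"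
  by (auto simp: pint_def primes_le_def)

lemma finite_pint [simp, intro]: "finite (pint y' y)"
  by (rule finite_subset[OF pint_subset]) auto

lemma prime_pint: "p \<in> pint y' y \<Longrightarrow> prime p"
  by (simp add: pint_def)

definition Zp :: "nat set \<Rightarrow> real \<Rightarrow> real" where
  "Zp A \<sigma> = (\<Prod>p\<in>A. 1 / (1 - npow p \<sigma>))"

lemma prime_powr_less_1: "prime p \<Longrightarrow> \<sigma> > 0 \<Longrightarrow> npow p \<sigma> < 1"
  by (intro powr_less_one) (auto simp: prime_gt_Suc_0_nat)

lemma Zp_has_sum:
  assumes "finite A" "\<And>p. p \<in> A \<Longrightarrow> prime p" "\<sigma> > 0"
  shows "((\<lambda>n. npow n \<sigma>) has_sum Zp A \<sigma>) (smooth A)"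
  unfolding Zp_def by (rule has_sum_smooth_powr) (use assms in auto)

lemma Zp_pos: "(\<And>p. p \<in> A \<Longrightarrow> prime p) \<Longrightarrow> \<sigma> > 0 \<Longrightarrow> Zp A \<sigma> > 0"
  unfolding Zp_def by (intro prod_pos) (auto simp: prime_powr_less_1)

lemma Zp_finite_sum_le:
  assumes A: "finite A" "\<And>p. p \<in> A \<Longrightarrow> prime p" and s: "\<sigma> > 0" and F: "finite F" "F \<subseteq> smooth A"
  shows "(\<Sum>n\<in>F. npow n \<sigma>) \<le> Zp A \<sigma>"
proof -
  have "((\<lambda>n. npow n \<sigma>) has_sum (\<Sum>n\<in>F. npow n \<sigma>)) F" using F by (intro has_sum_finite)
  then show ?thesis using F by (intro has_sum_mono2[OF _ Zp_has_sum[OF A s]]) auto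
qed

lemma rankin_upper:
  assumes A: "finite A" "\<And>p. p \<in> A \<Longrightarrow> prime p" and s: "\<sigma> > 0" and b: "\<beta> \<ge> 0"
    and F: "finite F" "F \<subseteq> smooth A" "\<And>n. n \<in> F \<Longrightarrow> real n \<le> exp L"
  shows "(\<Sum>n\<in>F. npow n \<sigma>) \<le> exp (\<beta> * L) * Zp A (\<sigma> + \<beta>)"
proof -
  have "(\<Sum>n\<in>F. npow n \<sigma>) \<le> (\<Sum>n\<in>F. exp (\<beta> * L) * npow n (\<sigma> + \<beta>))"
  proof (rule sum_mono)
    fix n assume n: "n \<in> F"
    then have n0: "real n > 0" using F smooth_pos by auto
    have "real n powr \<beta> \<le> exp L powr \<beta>" using F(3)[OF n] n0 b by (intro powr_mono2) auto
    also have "\<dots> = exp (\<beta> * L)" by (simp add: powr_def)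
    finally have "real n powr \<beta> * npow n (\<sigma> + \<beta>) \<le> exp (\<beta> * L) * npow n (\<sigma> + \<beta>)"
      by (intro mult_right_mono) auto
    then show "npow n \<sigma> \<le> exp (\<beta> * L) * npow n (\<sigma> + \<beta>)" by (simp add: powr_add[symmetric])
  qed
  also have "\<dots> = exp (\<beta> * L) * (\<Sum>n\<in>F. npow n (\<sigma> + \<beta>))" by (simp add: sum_distrib_left)
  also have "\<dots> \<le> exp (\<beta> * L) * Zp A (\<sigma> + \<beta>)" using A s b F by (intro mult_left_mono Zp_finite_sum_le) auto
  finally show ?thesis .
qed

lemma rankin_tail_infsum:
  assumes A: "finite A" "\<And>p. p \<in> A \<Longrightarrow> prime p" and s: "\<sigma> - \<beta> > 0" and b: "\<beta> \<ge> 0"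
  shows "(\<lambda>n. npow n \<sigma>) summable_on {n \<in> smooth A. real n > exp L}"
    "infsum (\<lambda>n. npow n \<sigma>) {n \<in> smooth A. real n > exp L} \<le> exp (- \<beta> * L) * Zp A (\<sigma> - \<beta>)"
proof -
  let ?T = "{n \<in> smooth A. real n > exp L}"
  have hs: "((\<lambda>n. npow n (\<sigma> - \<beta>)) has_sum Zp A (\<sigma> - \<beta>)) (smooth A)"
    by (rule Zp_has_sum[OF A s])
  then have sb: "(\<lambda>n. exp (- \<beta> * L) * npow n (\<sigma> - \<beta>)) summable_on smooth A"
    by (intro summable_on_cmult_right) (auto simp: summable_on_def)
  have le: "npow n \<sigma> \<le> exp (- \<beta> * L) * npow n (\<sigma> - \<beta>)" if n: "n \<in> ?T" for n
  proof -
    have n0: "real n > 0" using n smooth_pos by auto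
    have "exp L powr \<beta> \<le> real n powr \<beta>" using n b by (intro powr_mono2) auto
    then have "exp (\<beta> * L) \<le> real n powr \<beta>" by (simp add: powr_def)
    then have "exp (- \<beta> * L) * exp (\<beta> * L) * npow n \<sigma> \<le> exp (- \<beta> * L) * real n powr \<beta> * npow n \<sigma>"
      by (intro mult_right_mono mult_left_mono) auto
    then show ?thesis by (simp add: exp_minus powr_add[symmetric] mult.assoc)
  qed
  show sT: "(\<lambda>n. npow n \<sigma>) summable_on ?T"
  proof -
    have "(\<lambda>n. npow n \<sigma>) summable_on smooth A"
      using Zp_has_sum[OF A, of \<sigma>] s b by (auto simp: summable_on_def)
    then show ?thesis by (rule summable_on_subset_banach) auto
  qed
  have "infsum (\<lambda>n. npow n \<sigma>) ?T \<le> infsum (\<lambda>n. exp (- \<beta> * L) * npow n (\<sigma> - \<beta>)) (smooth A)"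
    by (rule infsum_mono_neutral[OF sT sb]) (use le in auto)
  also have "\<dots> = exp (- \<beta> * L) * Zp A (\<sigma> - \<beta>)"
    using hs by (simp add: infsum_cmult_right' infsumI)
  finally show "infsum (\<lambda>n. npow n \<sigma>) ?T \<le> exp (- \<beta> * L) * Zp A (\<sigma> - \<beta>)" .
qed

abbreviation smooth_le :: "nat set \<Rightarrow> real \<Rightarrow> nat set" where
  "smooth_le A z \<equiv> {n \<in> smooth A. real n \<le> z}"

lemma rankin_tail:
  assumes A: "finite A" "\<And>p. p \<in> A \<Longrightarrow> prime p" and s: "\<sigma> - \<beta> > 0" and b: "\<beta> \<ge> 0"
  shows "Zp A \<sigma> - (\<Sum>n\<in>(smooth_le A (exp L)). npow n \<sigma>) \<le> exp (- \<beta> * L) * Zp A (\<sigma> - \<beta>)"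
proof -
  let ?F = "smooth_le A (exp L)"
  have fin: "finite ?F" by (rule finite_subset[OF _ finite_nat_le_real(1)[of "exp L"]]) auto
  have "((\<lambda>n. npow n \<sigma>) has_sum (Zp A \<sigma> - (\<Sum>n\<in>?F. npow n \<sigma>))) (smooth A - ?F)"
    using fin s b A by (intro has_sum_Diff Zp_has_sum has_sum_finite) auto
  moreover have "smooth A - ?F = {n \<in> smooth A. real n > exp L}" by auto
  ultimately show ?thesis using rankin_tail_infsum(2)[OF A s b, of L] by (simp add: infsumI)
qed

text \<open>For \<open>ln p \<le> T\<close> the shift by \<open>1 / T\<close> increases
  \<open>npow p \<sigma>\<close> by a factor of at most \<open>1 + 2 * ln p / T\<close>. Since
  \<open>2 powr (- 1/2) \<le> 5/7\<close>, the new factors stay away from their pole by 2/7, which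
  yields the constant \<open>7 = 2 / (2/7)\<close>.\<close>

lemma Zp_ratio_upper:
  assumes A: "finite A" "\<And>p. p \<in> A \<Longrightarrow> prime p \<and> lnn p \<le> T" and s: "\<sigma> - 1 / T \<ge> 1/2" and T: "T > 0"
  shows "Zp A (\<sigma> - 1 / T) \<le> Zp A \<sigma> * exp (7 / T * (\<Sum>p\<in>A. lnn p * npow p \<sigma>))"
proof -
  have each: "1 / (1 - npow p (\<sigma> - 1 / T)) \<le> 1 / (1 - npow p \<sigma>) * exp (7 / T * (lnn p * npow p \<sigma>))"
    if p: "p \<in> A" for p
  proof -
    have p2: "real p \<ge> 2" "prime p" and lp: "lnn p \<le> T" using A(2)[OF p] by (auto dest: prime_ge_2_nat)
    have "1 / T > 0" using T by simp
    then have s0: "\<sigma> > 0" using s by linarith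
    define a where "a = npow p \<sigma>"
    define b where "b = npow p (\<sigma> - 1 / T)"
    have a01: "0 < a" "a < 1" using p2 prime_powr_less_1[OF p2(2) s0] by (auto simp: a_def)
    have "b \<le> npow p (1/2)" unfolding b_def using p2 s by (intro powr_mono) auto
    also have "\<dots> \<le> 2 powr (- (1/2))" using p2 by (intro powr_mono2') auto
    also have "2 powr (- (1/2)) = 1 / sqrt (2::real)" by (simp add: powr_minus_divide powr_half_sqrt)
    also have "\<dots> \<le> 5 / 7" using real_le_rsqrt[of "7/5" 2] by (simp add: field_simps power2_eq_square)
    finally have b: "b \<le> 5 / 7" .
    have "b = a * exp (lnn p / T)"
      using p2 T by (simp add: a_def b_def powr_def exp_add[symmetric] algebra_simps)
    also have "exp (lnn p / T) \<le> 1 + 2 * (lnn p / T)"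
    proof -
      define t where "t = lnn p / T"
      have t: "0 \<le> t" "t \<le> 1" using p2 lp T by (auto simp: t_def)
      have "exp t \<le> 1 + t + t\<^sup>2" by (rule exp_bound[OF t])
      also have "t\<^sup>2 \<le> t" using t by (simp add: power2_eq_square mult_left_le)
      finally show ?thesis by (simp add: t_def)
    qed
    finally have ba: "b - a \<le> a * (2 * (lnn p / T))" using a01 by (simp add: algebra_simps)
    have "(1 - a) / (1 - b) = 1 + (b - a) / (1 - b)" using b by (simp add: field_simps)
    also have "(b - a) / (1 - b) \<le> (a * (2 * (lnn p / T))) / (2 / 7)"
    proof (rule frac_le)
      show "0 \<le> a * (2 * (lnn p / T))" using a01 p2 T by simp
    qed (use b ba in auto)
    also have "\<dots> = 7 / T * (lnn p * a)" by simp
    also have "1 + 7 / T * (lnn p * a) \<le> exp (7 / T * (lnn p * a))" by (rule exp_ge_add_one_self)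
    finally have "(1 - a) / (1 - b) \<le> exp (7 / T * (lnn p * a))" by simp
    then have "(1 - a) / (1 - b) / (1 - a) \<le> exp (7 / T * (lnn p * a)) / (1 - a)" using a01 by (intro divide_right_mono) auto
    then show ?thesis using a01 by (simp add: a_def b_def)
  qed
  have "Zp A (\<sigma> - 1 / T) \<le> (\<Prod>p\<in>A. 1 / (1 - npow p \<sigma>) * exp (7 / T * (lnn p * npow p \<sigma>)))"
    unfolding Zp_def
  proof (rule prod_mono, safe)
    fix p assume p: "p \<in> A"
    then have "npow p (\<sigma> - 1 / T) < 1" using A(2)[OF p] s by (intro prime_powr_less_1) auto
    then show "0 \<le> 1 / (1 - npow p (\<sigma> - 1 / T))" by simp
  qed (rule each)
  also have "\<dots> = Zp A \<sigma> * exp (7 / T * (\<Sum>p\<in>A. lnn p * npow p \<sigma>))"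
    unfolding Zp_def by (simp only: prod.distrib exp_sum[OF A(1), symmetric] sum_distrib_left)
  finally show ?thesis .
qed

text \<open>A logarithmic interval of length \<open>C + 1\<close> has Mertens mass at least 1
  whatever the error term does. This replaces the prime number theorem at the cost of a constant
  factor.\<close>

lemma count_primes_lower:
  assumes C: "\<And>u v. 0 \<le> u \<Longrightarrow> u \<le> v \<Longrightarrow> \<bar>mmass u v - (v - u)\<bar> \<le> C" and v: "v \<ge> C + 1" "v > 0"
  shows "real (card (logint (v - (C + 1)) v)) \<ge> exp v / (exp (C + 1) * v)"
proof -
  have C0: "C \<ge> 0" using C[of 0 0] by simp
  have "1 \<le> mmass (v - (C + 1)) v" using C[of "v - (C+1)" v] v C0 by (simp add: abs_le_iff)
  also have "\<dots> \<le> (\<Sum>p\<in>logint (v - (C + 1)) v. v / exp (v - (C + 1)))"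
    unfolding mmass_def
  proof (rule sum_mono)
    fix p assume p: "p \<in> logint (v - (C + 1)) v"
    then have p': "prime p" "v - (C + 1) < lnn p" "lnn p \<le> v" by (auto simp: logint_def)
    then have "exp (v - (C + 1)) < real p" by (metis exp_less_cancel_iff exp_ln of_nat_0_less_iff prime_gt_0_nat)
    then show "lnn p / real p \<le> v / exp (v - (C + 1))" using p' v by (intro frac_le) auto
  qed
  also have "\<dots> = real (card (logint (v - (C + 1)) v)) * (v * exp (C + 1) / exp v)"
    by (simp add: exp_diff)
  finally have "1 \<le> real (card (logint (v - (C + 1)) v)) * (v * exp (C + 1) / exp v)" .
  then show ?thesis using v by (simp add: field_simps)
qed

text \<open>Only the primes just below \<open>exp T\<close> are exploited. For them
  \<open>p powr (- 1 / T)\<close> is at most 4/7, so each factor gains at least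
  \<open>exp (s' / 4)\<close> with \<open>s' = exp (- T * \<sigma>)\<close>, and
  \<open>count_primes_lower\<close> says how many there are.\<close>

lemma Zp_ratio_lower:
  assumes A: "finite A" "\<And>p. p \<in> A \<Longrightarrow> prime p" and s: "\<sigma> > 0" and T: "T > 0"
    and C: "\<And>u v. 0 \<le> u \<Longrightarrow> u \<le> v \<Longrightarrow> \<bar>mmass u v - (v - u)\<bar> \<le> C" and TC: "T \<ge> 4 * (C + 1)"
    and sub: "logint (T - (C + 1)) T \<subseteq> A"
  shows "Zp A (\<sigma> + 1 / T) * exp (exp (T * (1 - \<sigma>)) / (4 * exp (C + 1) * T)) \<le> Zp A \<sigma>"
proof -
  let ?B = "logint (T - (C + 1)) T"
  define s' where "s' = exp (- T * \<sigma>)"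
  have s': "0 < s'" "s' \<le> 1" using s T by (auto simp: s'_def)
  have each: "1 / (1 - npow p (\<sigma> + 1 / T)) * (if p \<in> ?B then exp (s' / 4) else 1) \<le> 1 / (1 - npow p \<sigma>)"
    if p: "p \<in> A" for p
  proof -
    have pr: "prime p" using A(2)[OF p] .
    define a where "a = npow p \<sigma>"
    define b where "b = npow p (\<sigma> + 1 / T)"
    have a: "0 < a" "a < 1" using prime_powr_less_1[OF pr s] pr by (auto simp: a_def prime_gt_0_nat)
    have ba: "b \<le> a" "0 < b" unfolding a_def b_def using pr T by (auto intro!: powr_mono simp: prime_gt_0_nat Suc_leI)
    have key: "(1 - a) * (if p \<in> ?B then exp (s' / 4) else 1) \<le> 1 - b"
    proof (cases "p \<in> ?B")
      case True
      then have lp: "T - (C + 1) < lnn p" "lnn p \<le> T" by (auto simp: logint_def)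
      have C0: "C \<ge> 0" using C[of 0 0] by simp
      have b_eq: "b = a * exp (- lnn p / T)"
        using pr by (simp add: a_def b_def powr_def exp_add[symmetric] algebra_simps prime_gt_0_nat)
      have "lnn p / T \<ge> 3/4" using lp TC T by (simp add: field_simps)
      then have "exp (- lnn p / T) \<le> exp (- (3/4))" by simp
      also have "\<dots> \<le> 4 / 7"
        using exp_ge_add_one_self[of "3/4 :: real"] by (simp add: exp_minus field_simps)
      finally have "b \<le> a * (4 / 7)" unfolding b_eq using a by (intro mult_left_mono) auto
      moreover have "s' \<le> a"
        using lp s pr T by (simp add: s'_def a_def powr_def prime_gt_0_nat mult_right_mono)
      moreover have "exp (s' / 4) \<le> 1 + (3/8) * s'"
      proof -
        have "exp (s' / 4) \<le> 1 + s' / 4 + (s' / 4)\<^sup>2" using s' by (intro exp_bound) auto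
        also have "(s' / 4)\<^sup>2 \<le> s' / 8"
          using s' mult_left_le[of s' s'] by (simp add: power2_eq_square)
        finally show ?thesis by simp
      qed
      then have "(1 - a) * exp (s' / 4) \<le> (1 - a) * (1 + (3/8) * s')" using a by (intro mult_left_mono) auto
      moreover have "(1 - a) * (1 + (3/8) * s') \<le> 1 - a + (3/8) * s'"
        using a s' mult_nonneg_nonneg[of a s'] by (simp add: algebra_simps)
      ultimately have "(1 - a) * exp (s' / 4) \<le> 1 - b" using a by linarith
      then show ?thesis using True by (simp only: if_True)
    qed (use ba in auto)
    have "1 - b > 0" using ba a by linarith
    then have "1 / (1 - b) * (if p \<in> ?B then exp (s' / 4) else 1) \<le> 1 / (1 - a)"
      using key a by (simp add: field_simps)
    then show ?thesis by (simp add: a_def b_def)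
  qed
  have "Zp A (\<sigma> + 1 / T) * (\<Prod>p\<in>A. if p \<in> ?B then exp (s' / 4) else 1) \<le> Zp A \<sigma>"
    unfolding Zp_def prod.distrib[symmetric]
  proof (rule prod_mono, safe)
    fix p assume p: "p \<in> A"
    then have "npow p (\<sigma> + 1 / T) < 1" using A(2)[OF p] s T by (intro prime_powr_less_1) (auto simp: add_pos_pos)
    then show "0 \<le> 1 / (1 - npow p (\<sigma> + 1 / T)) * (if p \<in> ?B then exp (s' / 4) else 1)" by simp
  qed (rule each)
  moreover have "(\<Prod>p\<in>A. if p \<in> ?B then exp (s' / 4) else 1) = exp (s' / 4) ^ card ?B"
    using A sub by (simp add: prod.If_cases Int_absorb1)
  moreover have "exp (s' / 4) ^ card ?B \<ge> exp (exp (T * (1 - \<sigma>)) / (4 * exp (C + 1) * T))"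
  proof -
    have C0: "C \<ge> 0" using C[of 0 0] by simp
    have "exp T / (exp (C + 1) * T) * (s' / 4) \<le> real (card ?B) * (s' / 4)"
      using count_primes_lower[OF C, of T] TC T C0 s' by (intro mult_right_mono) auto
    moreover have "exp T / (exp (C + 1) * T) * (s' / 4) = exp (T * (1 - \<sigma>)) / (4 * exp (C + 1) * T)"
      by (simp add: s'_def right_diff_distrib exp_diff exp_minus field_simps)
    ultimately have "exp (T * (1 - \<sigma>)) / (4 * exp (C + 1) * T) \<le> real (card ?B) * (s' / 4)" by argo
    then have "exp (exp (T * (1 - \<sigma>)) / (4 * exp (C + 1) * T)) \<le> exp (real (card ?B) * (s' / 4))"
      by (rule exp_le_cancel_iff[THEN iffD2])
    then show ?thesis by (simp only: exp_of_nat_mult)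
  qed
  moreover have "Zp A (\<sigma> + 1 / T) > 0" using A s T by (intro Zp_pos) (auto simp: add_pos_pos)
  ultimately show ?thesis by (smt (verit) mult_left_mono)
qed

lemma sum_pint_ln_powr_le:
  assumes C: "\<And>u v. 0 \<le> u \<Longrightarrow> u \<le> v \<Longrightarrow> \<bar>mmass u v - (v - u)\<bar> \<le> C" and T: "T \<ge> C" "T > 0"
    and A: "A \<subseteq> logint 0 T"
  shows "\<sigma> \<le> 1 \<Longrightarrow> (\<Sum>p\<in>A. lnn p * npow p \<sigma>) \<le> 2 * T * exp (T * (1 - \<sigma>))"
    and "\<sigma> \<ge> 1 \<Longrightarrow> (\<Sum>p\<in>A. lnn p * npow p \<sigma>) \<le> 2 * T"
proof -
  have "(\<Sum>p\<in>A. lnn p / p) \<le> mmass 0 T"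
    unfolding mmass_def using A by (intro sum_mono2[OF finite_logint]) (auto simp: logint_def)
  also have "\<dots> \<le> 2 * T" using C[of 0 T] T by (simp add: abs_le_iff)
  finally have m: "(\<Sum>p\<in>A. lnn p / p) \<le> 2 * T" .
  show "(\<Sum>p\<in>A. lnn p * npow p \<sigma>) \<le> 2 * T * exp (T * (1 - \<sigma>))" if s: "\<sigma> \<le> 1"
  proof -
    have "(\<Sum>p\<in>A. lnn p * npow p \<sigma>) \<le> (\<Sum>p\<in>A. lnn p / p * exp (T * (1 - \<sigma>)))"
    proof (rule sum_mono)
      fix p assume "p \<in> A"
      then have p: "prime p" "lnn p \<le> T" "p > 0" using A by (auto simp: logint_def prime_gt_0_nat)
      have "npow p \<sigma> = exp (lnn p * (1 - \<sigma>)) / p"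
        using p by (simp add: powr_def exp_diff algebra_simps exp_minus field_simps)
      also have "\<dots> \<le> exp (T * (1 - \<sigma>)) / p" using p s by (intro divide_right_mono) (auto intro: mult_right_mono)
      finally have "lnn p * npow p \<sigma> \<le> lnn p * (exp (T * (1 - \<sigma>)) / p)"
        using p by (intro mult_left_mono) (auto simp: Suc_leI)
      then show "lnn p * npow p \<sigma> \<le> lnn p / p * exp (T * (1 - \<sigma>))" by simp
    qed
    also have "\<dots> = (\<Sum>p\<in>A. lnn p / p) * exp (T * (1 - \<sigma>))" by (simp add: sum_distrib_right)
    also have "\<dots> \<le> 2 * T * exp (T * (1 - \<sigma>))" using m by (intro mult_right_mono) auto
    finally show ?thesis .
  qed
  show "(\<Sum>p\<in>A. lnn p * npow p \<sigma>) \<le> 2 * T" if s: "\<sigma> \<ge> 1"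
  proof -
    have "(\<Sum>p\<in>A. lnn p * npow p \<sigma>) \<le> (\<Sum>p\<in>A. lnn p / p)"
    proof (rule sum_mono)
      fix p assume "p \<in> A"
      then have p: "prime p" "p > 0" using A by (auto simp: logint_def prime_gt_0_nat)
      have "npow p \<sigma> \<le> real p powr (-1)" using p s by (intro powr_mono) (auto simp: Suc_leI)
      also have "\<dots> = 1 / p" using p by (simp add: powr_minus_divide)
      finally have "lnn p * npow p \<sigma> \<le> lnn p * (1 / p)"
        using p by (intro mult_left_mono) (auto simp: Suc_leI)
      then show "lnn p * npow p \<sigma> \<le> lnn p / p" by simp
    qed
    then show ?thesis using m by linarith
  qed
qed

section \<open>The share of an Euler product carried by a finite set, and the saddle point\<close>

definition Theta :: "nat set \<Rightarrow> nat set \<Rightarrow> real \<Rightarrow> real" where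
  "Theta A F \<sigma> = (\<Sum>n\<in>F. npow n \<sigma>) * (\<Prod>p\<in>A. 1 - npow p \<sigma>)"

lemma Theta_eq: "Theta A F \<sigma> = (\<Sum>n\<in>F. npow n \<sigma>) / Zp A \<sigma>"
  unfolding Theta_def Zp_def by (simp add: prod_dividef)

lemma Theta_deriv:
  assumes A: "finite A" "\<And>p. p \<in> A \<Longrightarrow> prime p" and F: "finite F" "\<And>n. n \<in> F \<Longrightarrow> n > 0" and s: "\<sigma> > 0"
  shows "(Theta A F has_real_derivative
     (\<Prod>p\<in>A. 1 - npow p \<sigma>) * ((\<Sum>n\<in>F. npow n \<sigma>) * (\<Sum>p\<in>A. lnn p * npow p \<sigma> / (1 - npow p \<sigma>))
       - (\<Sum>n\<in>F. lnn n * npow n \<sigma>))) (at \<sigma>)"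
proof -
  have d: "((\<lambda>u. npow n u) has_real_derivative (- (lnn n * npow n \<sigma>))) (at \<sigma>)" if "n > 0" for n :: nat
    using that by (auto intro!: derivative_eq_intros simp: powr_def)
  have d1: "((\<lambda>u. \<Sum>n\<in>F. npow n u) has_real_derivative (\<Sum>n\<in>F. - (lnn n * npow n \<sigma>))) (at \<sigma>)"
    by (rule DERIV_sum) (rule d, rule F)
  have d2: "((\<lambda>u. \<Prod>p\<in>A. 1 - npow p u) has_real_derivative
     ((\<Prod>p\<in>A. 1 - npow p \<sigma>) * (\<Sum>p\<in>A. (lnn p * npow p \<sigma>) / (1 - npow p \<sigma>)))) (at \<sigma>)"
  proof (rule has_field_derivative_prod')
    fix p assume p: "p \<in> A"
    then have "npow p \<sigma> < 1" using A s prime_powr_less_1 by blast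
    then show "1 - npow p \<sigma> \<noteq> 0" by simp
    have "p > 0" using A(2)[OF p] prime_gt_0_nat by blast
    from DERIV_diff[OF DERIV_const d[OF this]]
    show "((\<lambda>u. 1 - npow p u) has_real_derivative lnn p * npow p \<sigma>) (at \<sigma>)" by simp
  qed
  show ?thesis unfolding Theta_def
    by (rule DERIV_cong[OF DERIV_mult[OF d1 d2]]) (simp add: sum_negf algebra_simps)
qed

text \<open>\<open>ln n\<close> is at least the sum of \<open>ln p\<close> over the primes of
  \<open>A\<close> dividing \<open>n\<close>, and every product \<open>p * m\<close> with
  \<open>m \<le> exp (L - T)\<close> stays below \<open>exp L\<close>. In the derivative of
  \<open>Theta\<close> this cancels the main term except for the part carried by \<open>n\<close>
  between \<open>exp (L - T)\<close> and \<open>exp L\<close>.\<close>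

lemma sum_ln_lower:
  assumes A: "finite A" "\<And>p. p \<in> A \<Longrightarrow> prime p \<and> lnn p \<le> T"
  shows "(\<Sum>n\<in>(smooth_le A (exp L)). lnn n * npow n \<sigma>) \<ge>
     (\<Sum>p\<in>A. lnn p * npow p \<sigma>) * (\<Sum>n\<in>(smooth_le A (exp (L - T))). npow n \<sigma>)"
proof -
  let ?F = "smooth_le A (exp L)" and ?G = "smooth_le A (exp (L - T))"
  have fin: "finite ?F" "finite ?G"
    by (rule finite_subset[OF _ finite_nat_le_real(1)[of "exp L"]], force)
      (rule finite_subset[OF _ finite_nat_le_real(1)[of "exp (L - T)"]], force)
  have lnge: "(\<Sum>p\<in>A. if p dvd n then lnn p else 0) \<le> lnn n" if n: "n \<in> ?F" for n
  proof -
    have n0: "n > 0" using n smooth_pos by auto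
    have dv: "\<Prod>{p\<in>A. p dvd n} dvd n" using A by (intro prime_prod_dvd) auto
    have "(\<Sum>p\<in>A. if p dvd n then lnn p else 0) = (\<Sum>p\<in>{p\<in>A. p dvd n}. lnn p)"
      using A by (simp add: sum.inter_filter)
    also have "\<dots> = ln (\<Prod>p\<in>{p\<in>A. p dvd n}. real p)"
      using A by (subst ln_prod) (auto simp: prime_gt_0_nat)
    also have "\<dots> \<le> lnn n"
    proof (rule ln_mono)
      show "0 < (\<Prod>p\<in>{p\<in>A. p dvd n}. real p)" using A by (intro prod_pos) (auto simp: prime_gt_0_nat)
      have "real (\<Prod>{p\<in>A. p dvd n}) \<le> real n" using dvd_imp_le[OF dv n0] by (rule of_nat_mono)
      then show "(\<Prod>p\<in>{p\<in>A. p dvd n}. real p) \<le> real n" by (simp only: of_nat_prod)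
    qed
    finally show ?thesis .
  qed
  have "(\<Sum>p\<in>A. lnn p * npow p \<sigma>) * (\<Sum>n\<in>?G. npow n \<sigma>) =
     (\<Sum>p\<in>A. lnn p * (\<Sum>m\<in>?G. npow (p * m) \<sigma>))"
    unfolding sum_distrib_right unfolding sum_distrib_left by (simp add: powr_mult mult_ac)
  also have "\<dots> \<le> (\<Sum>p\<in>A. lnn p * (\<Sum>n\<in>{n\<in>?F. p dvd n}. npow n \<sigma>))"
  proof (intro sum_mono mult_left_mono)
    fix p assume p: "p \<in> A"
    then have pr: "prime p" "lnn p \<le> T" using A by auto
    then show "0 \<le> lnn p" by (simp add: prime_gt_0_nat Suc_leI)
    have inj: "inj_on (\<lambda>m. p * m) ?G" using pr by (auto simp: inj_on_def prime_gt_0_nat)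
    have "(\<Sum>m\<in>?G. npow (p * m) \<sigma>) = (\<Sum>n\<in>(\<lambda>m. p * m) ` ?G. npow n \<sigma>)"
      by (simp add: sum.reindex[OF inj])
    also have "\<dots> \<le> (\<Sum>n\<in>{n\<in>?F. p dvd n}. npow n \<sigma>)"
    proof (rule sum_mono2)
      show "(\<lambda>m. p * m) ` ?G \<subseteq> {n\<in>?F. p dvd n}"
      proof
        fix n assume "n \<in> (\<lambda>m. p * m) ` ?G"
        then obtain m where m: "n = p * m" "m \<in> smooth A" "real m \<le> exp (L - T)" by auto
        have "n \<in> smooth A" using m p pr by (simp add: smooth_mult prime_in_smooth)
        moreover have "real n \<le> exp L"
        proof -
          have "real p = exp (lnn p)" using pr by (simp add: prime_gt_0_nat)
          also have "\<dots> \<le> exp T" using pr by simp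
          finally have "real p * real m \<le> exp T * exp (L - T)" using m by (intro mult_mono) auto
          then show ?thesis using m by (simp add: exp_add[symmetric])
        qed
        ultimately show "n \<in> {n\<in>?F. p dvd n}" using m by simp
      qed
    qed (use fin in auto)
    finally show "(\<Sum>m\<in>?G. npow (p * m) \<sigma>) \<le> (\<Sum>n\<in>{n\<in>?F. p dvd n}. npow n \<sigma>)" .
  qed
  also have "\<dots> = (\<Sum>p\<in>A. \<Sum>n\<in>?F. (if p dvd n then lnn p else 0) * npow n \<sigma>)"
  proof (rule sum.cong[OF refl])
    fix p
    have "(\<Sum>n\<in>{n\<in>?F. p dvd n}. npow n \<sigma>) = (\<Sum>n\<in>?F. if p dvd n then npow n \<sigma> else 0)"
      using fin by (intro sum.inter_filter) auto
    then show "lnn p * (\<Sum>n\<in>{n\<in>?F. p dvd n}. npow n \<sigma>) =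
        (\<Sum>n\<in>?F. (if p dvd n then lnn p else 0) * npow n \<sigma>)"
      by (simp only:) (simp add: sum_distrib_left if_distrib if_distribR cong: if_cong)
  qed
  also have "\<dots> = (\<Sum>n\<in>?F. (\<Sum>p\<in>A. if p dvd n then lnn p else 0) * npow n \<sigma>)"
    by (subst sum.swap) (simp add: sum_distrib_right)
  also have "\<dots> \<le> (\<Sum>n\<in>?F. lnn n * npow n \<sigma>)"
    using lnge by (intro sum_mono mult_right_mono) auto
  finally show ?thesis .
qed

lemma pint_le_T: "p \<in> pint y' (exp T) \<Longrightarrow> prime p \<and> lnn p \<le> T"
proof -
  assume p: "p \<in> pint y' (exp T)"
  then have "real p \<le> exp T" "real p > 0" by (auto simp: pint_def prime_gt_0_nat)
  then have "lnn p \<le> ln (exp T)" by (intro ln_mono) auto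
  then show ?thesis using p by (simp add: prime_pint)
qed

lemma pint_subset_logint: "pint y' (exp T) \<subseteq> logint 0 T"
proof
  fix p assume "p \<in> pint y' (exp T)"
  then have "prime p" "lnn p \<le> T" using pint_le_T by blast+
  then show "p \<in> logint 0 T" using prime_gt_1_nat[of p] by (simp add: logint_def)
qed

lemma logint_subset_pint: "ln y' \<le> u \<Longrightarrow> y' > 0 \<Longrightarrow> v \<le> T \<Longrightarrow> logint u v \<subseteq> pint y' (exp T)"
proof
  fix p assume a: "ln y' \<le> u" "y' > 0" "v \<le> T" "p \<in> logint u v"
  then have p: "prime p" "ln y' \<le> lnn p" "lnn p \<le> T" by (auto simp: logint_def)
  then have "p > 0" by (simp add: prime_gt_0_nat)
  then have "exp (ln y') \<le> exp (lnn p)" "exp (lnn p) \<le> exp T" using p by (simp_all only: exp_le_cancel_iff)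
  then show "p \<in> pint y' (exp T)" using p a \<open>p > 0\<close> by (simp add: pint_def)
qed

text \<open>\<open>Theta A F \<sigma>\<close> is the share of the Euler product carried by \<open>n \<le> exp L\<close>. Rankin's bounds force it to grow
  from \<open>1/4\<close> to \<open>3/4\<close> within an interval of length \<open>O(ln T / T)\<close>; where its derivative is at least the mean slope,
  a large share is carried by the \<open>n\<close> within a factor \<open>exp T\<close> of \<open>exp L\<close>.\<close>

lemma saddle_point:
  assumes C: "\<And>u v. 0 \<le> u \<Longrightarrow> u \<le> v \<Longrightarrow> \<bar>mmass u v - (v - u)\<bar> \<le> C" "C \<ge> 1"
    and Cp: "\<And>P. finite P \<Longrightarrow> (\<forall>p\<in>P. p \<ge> (2::nat)) \<Longrightarrow> (\<Sum>p\<in>P. lnn p * (real p powr (-3/2))) \<le> Cp" "Cp \<ge> 0"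
    and A: "A = pint y' (exp T)" "y' \<ge> 1" "ln y' \<le> T / 2"
    and L: "L = X - 2 * (C + 1) - T"
    and T1: "T \<ge> 4 * (C + 1)" and T2: "T \<ge> 8 * ln (8 * exp (C + 1) * X)"
    and T3: "T \<ge> 2 * ln (128 * exp (C + 1) * T) * (4 * Cp + 1)"
    and X: "16 * exp (C + 1) * T \<le> X" "28 * T \<le> X"
  obtains \<alpha> where "7/8 \<le> \<alpha>" "\<alpha> < 1" "X / (16 * T) \<le> exp (T * (1 - \<alpha>))" "exp (T * (1 - \<alpha>)) \<le> 8 * exp (C + 1) * X"
    "(\<Sum>n\<in>{n\<in>smooth A. exp (L - T) < real n \<and> real n \<le> exp L}. npow n \<alpha>) \<ge> Zp A \<alpha> / X ^ 2"
proof -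
  define F where "F = (smooth_le A (exp L))"
  define G where "G = (smooth_le A (exp (L - T)))"
  define C1 where "C1 = exp (C + 1)"
  have C1: "C1 \<ge> 1" "C1 > 0" using C by (auto simp: C1_def)
  have T0: "T \<ge> 8" "T > 0" using T1 C by auto
  have X0: "X \<ge> 28" "X > 0" using X T0 by auto
  have Ap: "\<And>p. p \<in> A \<Longrightarrow> prime p" "\<And>p. p \<in> A \<Longrightarrow> prime p \<and> lnn p \<le> T" and fA: "finite A"
    unfolding A(1) using pint_le_T by (blast, blast, simp)
  have Al: "A \<subseteq> logint 0 T" unfolding A by (rule pint_subset_logint)
  have lA: "logint (T - (C + 1)) T \<subseteq> A" unfolding A(1)
    by (rule logint_subset_pint) (use A T1 C in auto)
  have fin: "finite F" "finite G" unfolding F_def G_def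
    by (rule finite_subset[OF _ finite_nat_le_real(1)[of "exp L"]], force)
      (rule finite_subset[OF _ finite_nat_le_real(1)[of "exp (L - T)"]], force)
  have Fpos: "n > 0" if "n \<in> F" for n using that smooth_pos by (auto simp: F_def)
  let ?S = "\<lambda>\<sigma>. \<Sum>p\<in>A. lnn p * npow p \<sigma>"
  have Zpos: "Zp A \<sigma> > 0" if "\<sigma> > 0" for \<sigma> using Zp_pos[of A \<sigma>] Ap that by blast
  have e2: "exp (2::real) \<ge> 4"
  proof -
    have "exp (2::real) = exp 1 * exp 1" by (simp add: exp_add[symmetric])
    moreover have "exp (1::real) \<ge> 2" using exp_ge_add_one_self[of "1::real"] by simp
    then have "exp (1::real) * exp 1 \<ge> 2 * 2" by (intro mult_mono) auto
    ultimately show ?thesis by simp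
  qed
  then have exp_m2: "exp (-2::real) \<le> 1/4" unfolding exp_minus by (simp add: field_simps)
  \<comment> \<open>If at least a quarter of the product lies beyond \<open>exp L\<close>, Rankin's
    bound with shift \<open>1 / T\<close> forces the prime sum at \<open>\<sigma>\<close> to be of
    order \<open>X\<close>; for \<open>\<sigma> \<ge> 1\<close> it is only of order
    \<open>T\<close>.\<close>
  have up: "\<sigma> < 1 \<and> X / (16 * T) \<le> exp (T * (1 - \<sigma>))" if th: "Theta A F \<sigma> \<le> 3/4" and s: "\<sigma> - 1 / T \<ge> 1/2" for \<sigma>
  proof -
    have "1 / T > 0" using T0 by simp
    then have s0: "\<sigma> > 0" "\<sigma> - 1 / T > 0" "1 / T \<ge> 0" using s by linarith+
    have "Zp A \<sigma> - (\<Sum>n\<in>F. npow n \<sigma>) \<le> exp (- (1 / T) * L) * Zp A (\<sigma> - 1 / T)"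
      unfolding F_def by (rule rankin_tail) (use fA Ap s0 in auto)
    also have "\<dots> \<le> exp (- (1 / T) * L) * (Zp A \<sigma> * exp (7 / T * ?S \<sigma>))"
      by (intro mult_left_mono Zp_ratio_upper) (use fA Ap s T0 in auto)
    also have "(\<Sum>n\<in>F. npow n \<sigma>) = Theta A F \<sigma> * Zp A \<sigma>" using Zpos[OF s0(1)] by (simp add: Theta_eq)
    finally have "(1 - Theta A F \<sigma>) * Zp A \<sigma> \<le> exp (- (1 / T) * L) * exp (7 / T * ?S \<sigma>) * Zp A \<sigma>" by (simp add: algebra_simps)
    then have "1 - Theta A F \<sigma> \<le> exp (- (1 / T) * L) * exp (7 / T * ?S \<sigma>)"
      using Zpos[OF s0(1)] mult_le_cancel_right_pos by blast
    also have "\<dots> = exp ((7 * ?S \<sigma> - L) / T)" unfolding exp_add[symmetric] by (simp add: diff_divide_distrib)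
    finally have "exp (-2) \<le> exp ((7 * ?S \<sigma> - L) / T)" using th exp_m2 by linarith
    then have "-2 \<le> (7 * ?S \<sigma> - L) / T" by simp
    then have "7 * ?S \<sigma> \<ge> L - 2 * T" using T0 by (simp add: field_simps)
    then have SX: "?S \<sigma> \<ge> X / 8" using L T1 X(2) by argo
    have TC: "T \<ge> C" using T1 C by simp
    have "\<sigma> < 1"
    proof (rule ccontr)
      assume "\<not> \<sigma> < 1"
      then have "?S \<sigma> \<le> 2 * T" using sum_pint_ln_powr_le(2)[OF C(1) TC T0(2) Al] by simp
      then show False using SX X(2) T0 by argo
    qed
    moreover have "?S \<sigma> \<le> 2 * T * exp (T * (1 - \<sigma>))"
      using sum_pint_ln_powr_le(1)[OF C(1) TC T0(2) Al] \<open>\<sigma> < 1\<close> by simp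
    then have "X / 8 \<le> 2 * T * exp (T * (1 - \<sigma>))" using SX by linarith
    then have "X / (16 * T) \<le> exp (T * (1 - \<sigma>))" using T0 by (simp add: field_simps)
    ultimately show ?thesis by blast
  qed
  \<comment> \<open>If at least a quarter lies below \<open>exp L\<close>, the Euler product cannot
    drop by more than about \<open>exp (L / T)\<close> when \<open>\<sigma>\<close> moves by
    \<open>1 / T\<close>. Since the primes near \<open>exp T\<close> alone cause a definite drop,
    \<open>exp (T * (1 - \<sigma>))\<close> is bounded.\<close>
  have low: "exp (T * (1 - \<sigma>)) \<le> 8 * C1 * X \<and> \<sigma> \<ge> 7/8" if th: "Theta A F \<sigma> \<ge> 1/4" and s0: "\<sigma> > 0" for \<sigma>
  proof -
    define E where "E = exp (exp (T * (1 - \<sigma>)) / (4 * C1 * T))"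
    have sT: "\<sigma> + 1 / T > 0" using s0 T0 by (simp add: add_pos_pos)
    have "(\<Sum>n\<in>F. npow n \<sigma>) \<le> exp (1 / T * L) * Zp A (\<sigma> + 1 / T)"
      by (rule rankin_upper) (use fA Ap s0 T0 fin in \<open>auto simp: F_def\<close>)
    then have "Theta A F \<sigma> * Zp A \<sigma> \<le> exp (1 / T * L) * Zp A (\<sigma> + 1 / T)" using Zpos[OF s0] by (simp add: Theta_eq)
    moreover have "1/4 * Zp A \<sigma> \<le> Theta A F \<sigma> * Zp A \<sigma>" using th Zpos[OF s0] by (intro mult_right_mono) auto
    moreover have "Zp A (\<sigma> + 1 / T) * E \<le> Zp A \<sigma>"
      unfolding E_def C1_def by (rule Zp_ratio_lower[OF fA Ap(1) s0 T0(2) C(1) T1 lA])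
    ultimately have "1/4 * (Zp A (\<sigma> + 1 / T) * E) \<le> exp (1 / T * L) * Zp A (\<sigma> + 1 / T)" by linarith
    then have "Zp A (\<sigma> + 1 / T) * (1/4 * E) \<le> Zp A (\<sigma> + 1 / T) * exp (1 / T * L)" by (simp add: mult_ac)
    then have "1/4 * E \<le> exp (1 / T * L)" using Zpos[OF sT] mult_le_cancel_left_pos by blast
    moreover have "4 * exp (1 / T * L) \<le> exp 2 * exp (1 / T * L)" using e2 by (intro mult_right_mono) auto
    ultimately have "E \<le> exp (2 + 1 / T * L)" unfolding exp_add by linarith
    then have "exp (T * (1 - \<sigma>)) / (4 * C1 * T) \<le> 2 + 1 / T * L" unfolding E_def by simp
    then have "exp (T * (1 - \<sigma>)) \<le> (2 + 1 / T * L) * (4 * C1 * T)"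
      using C1 T0 by (simp only: pos_divide_le_eq zero_less_mult_iff zero_less_numeral simp_thms)
    also have "\<dots> = 4 * C1 * (2 * T + L)" using T0 by (simp add: field_simps)
    also have "\<dots> \<le> 4 * C1 * (2 * X)" using C1 L X T1 T0 C by (intro mult_left_mono) auto
    finally have 1: "exp (T * (1 - \<sigma>)) \<le> 8 * C1 * X" by simp
    then have "ln (exp (T * (1 - \<sigma>))) \<le> ln (8 * C1 * X)" by (intro ln_mono) auto
    then have "T * (1 - \<sigma>) \<le> T * (1 / 8)" using T2 by (simp add: C1_def)
    then have "1 - \<sigma> \<le> 1 / 8" using T0 mult_le_cancel_left_pos by blast
    then show ?thesis using 1 by simp
  qed
  have cont: "continuous_on {a..b} (Theta A F)" if "a > 0" for a b
    by (intro DERIV_atLeastAtMost_imp_continuous_on exI) (rule Theta_deriv, use fA Ap fin Fpos that in auto)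
  have th_half: "Theta A F (1/2) < 1/4" using low[of "1/2"] by force
  have "1 / T \<le> 1 / 8" using T0 by (intro divide_left_mono) auto
  then have th_one: "Theta A F 1 > 3/4" using up[of 1] by force
  obtain \<sigma>0 where s0: "1/2 \<le> \<sigma>0" "\<sigma>0 \<le> 1" "Theta A F \<sigma>0 = 1/4"
    using IVT'[of "Theta A F" "1/2" "1/4" 1] cont th_half th_one by auto
  obtain \<sigma>1 where s1: "\<sigma>0 \<le> \<sigma>1" "\<sigma>1 \<le> 1" "Theta A F \<sigma>1 = 3/4"
    using IVT'[of "Theta A F" \<sigma>0 "3/4" 1] cont[of \<sigma>0 1] s0 th_one by auto
  have s0': "exp (T * (1 - \<sigma>0)) \<le> 8 * C1 * X" "\<sigma>0 \<ge> 7/8" using low[of \<sigma>0] s0 by auto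
  have s1': "\<sigma>1 < 1" "X / (16 * T) \<le> exp (T * (1 - \<sigma>1))" using up[of \<sigma>1] s1 s0' \<open>1 / T \<le> 1 / 8\<close> by auto
  have lt: "\<sigma>0 < \<sigma>1" using s0 s1 by (cases "\<sigma>0 = \<sigma>1") auto
  have "\<exists>z>\<sigma>0. z < \<sigma>1 \<and> Theta A F \<sigma>1 - Theta A F \<sigma>0 = (\<sigma>1 - \<sigma>0) * ((\<Prod>p\<in>A. 1 - npow p z) *
      ((\<Sum>n\<in>F. npow n z) * (\<Sum>p\<in>A. lnn p * npow p z / (1 - npow p z))
       - (\<Sum>n\<in>F. lnn n * npow n z)))"
    by (rule MVT2[OF lt]) (rule Theta_deriv, use fA Ap fin Fpos s0' in auto)
  then obtain \<alpha> where a: "\<sigma>0 < \<alpha>" "\<alpha> < \<sigma>1" and mv: "1/2 = (\<sigma>1 - \<sigma>0) * ((\<Prod>p\<in>A. 1 - npow p \<alpha>) *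
      ((\<Sum>n\<in>F. npow n \<alpha>) * (\<Sum>p\<in>A. lnn p * npow p \<alpha> / (1 - npow p \<alpha>))
       - (\<Sum>n\<in>F. lnn n * npow n \<alpha>)))"
    using s0 s1 by auto
  have a78: "7/8 \<le> \<alpha>" "\<alpha> < 1" "\<alpha> > 0" using a s0' s1' by auto
  have "X / (16 * T) \<le> exp (T * (1 - \<sigma>1))" by fact
  also have "\<dots> \<le> exp (T * (1 - \<alpha>))" using a T0 by simp
  finally have ea1: "X / (16 * T) \<le> exp (T * (1 - \<alpha>))" .
  have "exp (T * (1 - \<alpha>)) \<le> exp (T * (1 - \<sigma>0))" using a T0 by simp
  also have "\<dots> \<le> 8 * C1 * X" by fact
  finally have ea2: "exp (T * (1 - \<alpha>)) \<le> 8 * C1 * X" .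
  define N where "N = (\<Sum>n\<in>F. npow n \<alpha>)"
  define N' where "N' = (\<Sum>n\<in>G. npow n \<alpha>)"
  define W where "W = (\<Sum>n\<in>{n\<in>smooth A. exp (L - T) < real n \<and> real n \<le> exp L}. npow n \<alpha>)"
  define Z where "Z = Zp A \<alpha>"
  have Z0: "Z > 0" using Zpos a78 by (simp add: Z_def)
  have NZ: "N \<le> Z" "N \<ge> 0" unfolding N_def Z_def
    by (rule Zp_finite_sum_le) (use fA Ap a78 fin in \<open>auto simp: F_def intro: sum_nonneg\<close>)
  have GF: "G \<subseteq> F" using T0 by (auto simp: F_def G_def intro: order_trans)
  have "F - G = {n\<in>smooth A. exp (L - T) < real n \<and> real n \<le> exp L}" by (auto simp: F_def G_def)
  then have W_eq: "W = N - N'" unfolding W_def N_def N'_def using sum_diff[OF fin(1) GF, of "\<lambda>n. npow n \<alpha>"] by simp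
  let ?R = "\<Sum>p\<in>A. lnn p * npow p \<alpha> * npow p \<alpha> / (1 - npow p \<alpha>)"
  have split: "(\<Sum>p\<in>A. lnn p * npow p \<alpha> / (1 - npow p \<alpha>)) = ?S \<alpha> + ?R"
    unfolding sum.distrib[symmetric]
  proof (rule sum.cong[OF refl])
    fix p assume p: "p \<in> A"
    have "npow p \<alpha> < 1" using prime_powr_less_1 Ap(1)[OF p] a78 by blast
    then show "lnn p * npow p \<alpha> / (1 - npow p \<alpha>) = lnn p * npow p \<alpha> + lnn p * npow p \<alpha> * npow p \<alpha> / (1 - npow p \<alpha>)"
      by (simp add: field_simps)
  qed
  \<comment> \<open>Terms of second order in \<open>npow p \<alpha>\<close>; as
    \<open>2 * \<alpha> \<ge> 3/2\<close> they add up to a constant.\<close>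
  have R: "?R \<le> 4 * Cp"
  proof -
    have "?R \<le> (\<Sum>p\<in>A. 4 * (lnn p * real p powr (- 3/2)))"
    proof (rule sum_mono)
      fix p assume p: "p \<in> A"
      then have p2: "real p \<ge> 2" "p > 0" using Ap(1)[OF p] by (auto dest: prime_ge_2_nat)
      have "npow p \<alpha> \<le> npow p (3/4)" using p2 a78 by (intro powr_mono) auto
      also have "\<dots> \<le> 2 powr (- (3/4))" using p2 by (intro powr_mono2') auto
      also have "\<dots> \<le> 2 powr (- (1/2))" by (intro powr_mono) auto
      also have "2 powr (- (1/2)) = 1 / sqrt (2::real)" by (simp add: powr_minus_divide powr_half_sqrt)
      also have "\<dots> \<le> 3 / 4" using real_le_rsqrt[of "4/3" 2] by (simp add: field_simps power2_eq_square)
      finally have b: "1 / 4 \<le> 1 - npow p \<alpha>" by simp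
      have "npow p \<alpha> * npow p \<alpha> = real p powr (- 2 * \<alpha>)" by (simp add: powr_add[symmetric])
      also have "\<dots> \<le> real p powr (- 3/2)" using p2 a78 by (intro powr_mono) auto
      finally have c: "npow p \<alpha> * npow p \<alpha> \<le> real p powr (- 3/2)" .
      have "lnn p * (npow p \<alpha> * npow p \<alpha>) / (1 - npow p \<alpha>) \<le> lnn p * real p powr (- 3/2) / (1 / 4)"
        using b c p2 by (intro frac_le mult_left_mono) auto
      then show "lnn p * npow p \<alpha> * npow p \<alpha> / (1 - npow p \<alpha>) \<le> 4 * (lnn p * real p powr (- 3/2))"
        by (simp add: mult_ac)
    qed
    also have "\<dots> = 4 * (\<Sum>p\<in>A. lnn p * real p powr (- 3/2))" by (simp add: sum_distrib_left)
    also have "\<dots> \<le> 4 * Cp" using Cp(1)[OF fA] Ap by (simp add: prime_ge_2_nat)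
    finally show ?thesis .
  qed
  have SX: "?S \<alpha> \<le> 16 * T * C1 * X"
  proof -
    have "?S \<alpha> \<le> 2 * T * exp (T * (1 - \<alpha>))"
      using sum_pint_ln_powr_le(1)[OF C(1) _ T0(2) Al, of \<alpha>] T1 C a78 by simp
    also have "\<dots> \<le> 2 * T * (8 * C1 * X)" using ea2 T0 by (intro mult_left_mono) auto
    finally show ?thesis by (simp add: mult_ac)
  qed
  have "(\<Sum>n\<in>F. lnn n * npow n \<alpha>) \<ge> ?S \<alpha> * N'"
    unfolding F_def N'_def G_def by (rule sum_ln_lower) (use fA Ap in auto)
  then have "N * (?S \<alpha> + ?R) - (\<Sum>n\<in>F. lnn n * npow n \<alpha>) \<le> ?S \<alpha> * W + N * ?R"
    unfolding W_eq by (simp add: algebra_simps)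
  also have "\<dots> \<le> 16 * T * C1 * X * W + Z * (4 * Cp)"
  proof (intro add_mono mult_right_mono SX)
    show "0 \<le> W" unfolding W_def by (intro sum_nonneg) auto
    have "N * ?R \<le> N * (4 * Cp)" by (intro mult_left_mono R NZ)
    also have "\<dots> \<le> Z * (4 * Cp)" using NZ Cp by (intro mult_right_mono) auto
    finally show "N * ?R \<le> Z * (4 * Cp)" .
  qed
  finally have der: "N * (?S \<alpha> + ?R) - (\<Sum>n\<in>F. lnn n * npow n \<alpha>) \<le> 16 * T * C1 * X * W + Z * (4 * Cp)" .
  have PZ: "(\<Prod>p\<in>A. 1 - npow p \<alpha>) = 1 / Z" unfolding Z_def Zp_def by (simp add: prod_dividef)
  \<comment> \<open>Both end points confine \<open>exp (T * (1 - \<sigma>))\<close> to multiples of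
    \<open>X\<close> that differ by a factor \<open>O(T)\<close>, so the interval has length
    \<open>O(ln T / T)\<close> and the mean slope of \<open>Theta\<close> is large.\<close>
  have wd: "T * (\<sigma>1 - \<sigma>0) \<le> ln (128 * C1 * T)"
  proof -
    have "exp (T * (\<sigma>1 - \<sigma>0)) = exp (T * (1 - \<sigma>0)) / exp (T * (1 - \<sigma>1))" by (simp add: exp_diff[symmetric] algebra_simps)
    also have "\<dots> \<le> (8 * C1 * X) / (X / (16 * T))" using s0' s1' C1 X0 T0 by (intro frac_le) auto
    also have "\<dots> = 128 * C1 * T" using X0 T0 by (simp add: field_simps)
    finally have "ln (exp (T * (\<sigma>1 - \<sigma>0))) \<le> ln (128 * C1 * T)" by (intro ln_mono) auto
    then show ?thesis by simp
  qed
  define D where "D = N * (?S \<alpha> + ?R) - (\<Sum>n\<in>F. lnn n * npow n \<alpha>)"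
  have "1/2 = (\<sigma>1 - \<sigma>0) * (1 / Z * D)" using mv unfolding split PZ D_def N_def .
  then have Zeq: "Z = 2 * (\<sigma>1 - \<sigma>0) * D" using Z0 by (simp add: field_simps)
  have "Z * T = 2 * (T * (\<sigma>1 - \<sigma>0)) * D" by (subst Zeq) (simp add: algebra_simps)
  moreover have D0: "D > 0"
  proof (rule ccontr)
    assume "\<not> D > 0"
    then have "(\<sigma>1 - \<sigma>0) * (1 / Z * D) \<le> 0" using lt Z0 by (intro mult_nonneg_nonpos) (auto simp: field_simps)
    then show False using \<open>1/2 = (\<sigma>1 - \<sigma>0) * (1 / Z * D)\<close> by linarith
  qed
  then have "2 * (T * (\<sigma>1 - \<sigma>0)) * D \<le> 2 * ln (128 * C1 * T) * D" using wd by (intro mult_right_mono mult_left_mono) auto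
  ultimately have "Z * T \<le> 2 * ln (128 * C1 * T) * D" by linarith
  moreover have "Z * (2 * ln (128 * C1 * T) * (4 * Cp + 1)) \<le> Z * T" using T3 Z0 unfolding C1_def by (intro mult_left_mono) auto
  moreover have l0: "ln (128 * C1 * T) > 0"
  proof -
    have "1 < 128 * C1 * T" using C1 T0 by (smt (verit) mult_less_cancel_left2 mult_le_cancel_left1)
    then show ?thesis by simp
  qed
  ultimately have "Z * (2 * ln (128 * C1 * T) * (4 * Cp + 1)) \<le> 2 * ln (128 * C1 * T) * D" "2 * ln (128 * C1 * T) > 0" by linarith+
  moreover define l where "l = 2 * ln (128 * C1 * T)"
  ultimately have "Z * (l * (4 * Cp + 1)) \<le> l * D" "l > 0" by (simp_all only: l_def)
  then have "l * (Z * (4 * Cp + 1)) \<le> l * D" by (simp only: mult.left_commute)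
  then have "Z * (4 * Cp + 1) \<le> D" using \<open>l > 0\<close> by (rule mult_left_le_imp_le)
  then have ZW: "Z \<le> 16 * T * C1 * X * W" using der unfolding D_def by (simp add: algebra_simps)
  also have "\<dots> \<le> X ^ 2 * W"
  proof (rule mult_right_mono)
    show "16 * T * C1 * X \<le> X ^ 2" using X(1) X0 unfolding C1_def power2_eq_square by (intro mult_right_mono) (auto simp: mult_ac)
    show "0 \<le> W" unfolding W_def by (intro sum_nonneg) auto
  qed
  finally have "W \<ge> Z / X ^ 2" using X0 by (simp add: field_simps)
  then show ?thesis using that[of \<alpha>] a78 ea1 ea2 unfolding W_def Z_def C1_def by blast
qed

section \<open>Counting smooth numbers at the saddle point\<close>

text \<open>Carries the output of \<open>saddle_point\<close>. The window ends at
  \<open>exp (X - 2 * (C + 1) - T)\<close> instead of \<open>exp X\<close> in order to leave room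
  for two further prime factors.\<close>

locale saddle =
  fixes C X T y' \<alpha> :: real and A :: "nat set"
  assumes mass: "\<And>u v. 0 \<le> u \<Longrightarrow> u \<le> v \<Longrightarrow> \<bar>mmass u v - (v - u)\<bar> \<le> C" and C: "C \<ge> 1"
    and A: "A = pint y' (exp T)" and y': "y' \<ge> 1" "ln y' \<le> T / 2"
    and T: "T \<ge> 4 * (C + 1)" and X: "16 * exp (C + 1) * T \<le> X" "28 * T \<le> X" "exp (C + 1) ^ 2 \<le> X"
    and \<alpha>: "7/8 \<le> \<alpha>" "\<alpha> < 1" and ea: "X / (16 * T) \<le> exp (T * (1 - \<alpha>))" "exp (T * (1 - \<alpha>)) \<le> 8 * exp (C + 1) * X"
    and window: "(\<Sum>n\<in>{n\<in>smooth A. exp (X - 2 * (C + 1) - T - T) < real n \<and> real n \<le> exp (X - 2 * (C + 1) - T)}. npow n \<alpha>) \<ge> Zp A \<alpha> / X ^ 2"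
begin

lemma basics:
  shows "finite A" "p \<in> A \<Longrightarrow> prime p" "p \<in> A \<Longrightarrow> prime p \<and> lnn p \<le> T" "T \<ge> 8" "X \<ge> 28" "\<alpha> > 0" "Zp A \<alpha> > 0"
proof -
  show "finite A" "p \<in> A \<Longrightarrow> prime p \<and> lnn p \<le> T" and pr: "p \<in> A \<Longrightarrow> prime p" for p
    unfolding A using pint_le_T by (simp, blast, blast)
  show T8: "T \<ge> 8" using T C by argo
  show "X \<ge> 28" using X(2) T8 by linarith
  show a: "\<alpha> > 0" using \<alpha> by linarith
  show "Zp A \<alpha> > 0" by (rule Zp_pos) (use pr a in auto)
qed

lemma finite_smooth_le: "finite (smooth_le A z)"
  by (rule finite_subset[OF _ finite_nat_le_real(1)[of z]]) auto

lemma logint_sub: "T / 2 \<le> u \<Longrightarrow> v \<le> T \<Longrightarrow> logint u v \<subseteq> A"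
  unfolding A by (rule logint_subset_pint) (use y' in auto)

lemma powr_le_dist:
  assumes "n > 0" shows "exp (X * \<alpha>) * npow n \<alpha> = exp (\<alpha> * (X - lnn n))"
  using assms by (simp add: powr_def exp_add[symmetric] algebra_simps)

text \<open>Each \<open>m\<close> in the window is completed by two primes from \<open>A\<close>, roughly as large as possible, to an element of
  \<open>smooth A\<close> not exceeding \<open>exp X\<close>.\<close>

lemma count_lower:
  "real (card (smooth_le A (exp X))) \<ge> exp (X * \<alpha>) * Zp A \<alpha> / X ^ 7"
proof -
  define Win where "Win = {n\<in>smooth A. exp (X - 2 * (C + 1) - T - T) < real n \<and> real n \<le> exp (X - 2 * (C + 1) - T)}"
  define d where "d m = X - lnn m" for m :: nat
  \<comment> \<open>Two primes with logarithm at most \<open>e m\<close> fill the gap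
    \<open>d m\<close> between \<open>m\<close> and \<open>exp X\<close> without exceeding it; the
    cap \<open>T\<close> keeps them in \<open>A\<close>.\<close>
  define e where "e m = min (d m / 2) T" for m :: nat
  define P where "P m = logint (e m - (C + 1)) (e m)" for m
  define Tri where "Tri = (SIGMA m:Win. P m \<times> P m)"
  define f where "f = (\<lambda>(m :: nat, p :: nat, r :: nat). m * p * r)"
  let ?N = "smooth_le A (exp X)"
  define C1 where "C1 = exp (C + 1)"
  have C1: "C1 \<ge> 1" using C by (simp add: C1_def)
  have finW: "finite Win" unfolding Win_def
    by (rule finite_subset[OF _ finite_smooth_le[of "exp (X - 2 * (C + 1) - T)"]]) auto
  have finT: "finite Tri" unfolding Tri_def P_def using finW by auto
  have d: "m > 0" "2 * (C + 1) + T \<le> d m" "d m \<le> 2 * (C + 1) + 2 * T" if m: "m \<in> Win" for m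
  proof -
    show m0: "m > 0" using m smooth_pos by (auto simp: Win_def)
    have "ln (exp (X - 2 * (C + 1) - T - T)) \<le> lnn m" "lnn m \<le> ln (exp (X - 2 * (C + 1) - T))"
      using m m0 by (auto simp: Win_def simp del: ln_exp intro!: ln_mono)
    then show "2 * (C + 1) + T \<le> d m" "d m \<le> 2 * (C + 1) + 2 * T" unfolding d_def ln_exp by linarith+
  qed
  have e: "C + 1 \<le> e m" "e m \<le> T" "T / 2 \<le> e m - (C + 1)" "2 * e m \<le> d m" "d m - 2 * (C + 1) \<le> 2 * e m" "d m \<ge> 0" if m: "m \<in> Win" for m
    using d[OF m] T C unfolding e_def min_def by (auto split: if_splits)
  have Psub: "P m \<subseteq> A" if m: "m \<in> Win" for m unfolding P_def using e[OF m] by (intro logint_sub) auto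
  have Ple: "p > 0 \<and> real p \<le> exp (e m)" if "p \<in> P m" for p m
  proof -
    have p: "prime p" "lnn p \<le> e m" using that by (auto simp: P_def logint_def)
    then have "p > 0" by (simp add: prime_gt_0_nat)
    moreover have "exp (lnn p) \<le> exp (e m)" using p by (simp only: exp_le_cancel_iff)
    ultimately show ?thesis by simp
  qed
  have im: "f ` Tri \<subseteq> ?N"
  proof
    fix n assume "n \<in> f ` Tri"
    then obtain m p r where n: "n = m * p * r" "m \<in> Win" "p \<in> P m" "r \<in> P m" by (auto simp: Tri_def f_def)
    have "p \<in> A" "r \<in> A" using Psub n by blast+
    then have "n \<in> smooth A" using n basics(2) by (auto simp: Win_def intro!: smooth_mult simp: prime_in_smooth)
    moreover have "real n \<le> exp X"
    proof -
      have "real n \<le> exp (lnn m) * exp (e m) * exp (e m)"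
      unfolding n(1) of_nat_mult using Ple[OF n(3)] Ple[OF n(4)] d(1)[OF n(2)] by (intro mult_mono) auto
    then have "real n \<le> exp (lnn m + e m + e m)" by (simp only: exp_add)
    also have "\<dots> \<le> exp X" using e(4)[OF n(2)] by (simp add: d_def)
      finally show ?thesis .
    qed
    ultimately show "n \<in> ?N" by simp
  qed
  \<comment> \<open>A triple is determined by its product and its two primes, and a number up to
    \<open>exp X\<close> has at most \<open>2 * X\<close> prime factors to choose them from.\<close>
  have fibre: "real (card {t \<in> Tri. f t = n}) \<le> (2 * X) ^ 2" if n: "n \<in> ?N" for n
  proof -
    have n0: "n > 0" using n smooth_pos by auto
    let ?g = "\<lambda>(m :: nat, p :: nat, r :: nat). (p, r)"
    have "inj_on ?g {t \<in> Tri. f t = n}" using n0 by (auto simp: inj_on_def f_def)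
    moreover have "?g ` {t \<in> Tri. f t = n} \<subseteq> prime_factors n \<times> prime_factors n"
      using n0 by (auto simp: Tri_def f_def P_def logint_def in_prime_factors_iff)
    ultimately have "card {t \<in> Tri. f t = n} \<le> card (prime_factors n \<times> prime_factors n)"
      by (intro card_inj_on_le[of ?g]) auto
    also have "\<dots> = card (prime_factors n) ^ 2" by (simp add: card_cartesian_product power2_eq_square)
    finally have 1: "card {t \<in> Tri. f t = n} \<le> card (prime_factors n) ^ 2" .
    have "2 ^ card (prime_factors n) = (\<Prod>p\<in>prime_factors n. (2::nat))" by simp
    also have "\<dots> \<le> \<Prod>(prime_factors n)" by (intro prod_mono) (auto simp: in_prime_factors_iff prime_ge_2_nat)
    also have "\<dots> \<le> n" by (intro dvd_imp_le prime_prod_dvd n0) (auto simp: in_prime_factors_iff)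
    finally have "2 ^ card (prime_factors n) \<le> n" .
    then have "real (2 ^ card (prime_factors n)) \<le> real n" by (rule of_nat_mono)
    then have "2 ^ card (prime_factors n) \<le> real n" by (simp only: of_nat_power of_nat_numeral)
    also have "real n \<le> exp X" using n by simp
    finally have "2 ^ card (prime_factors n) \<le> exp X" .
    then have "ln (2 ^ card (prime_factors n)) \<le> ln (exp X)" by (intro ln_mono) auto
    then have "real (card (prime_factors n)) * ln 2 \<le> X" by (simp add: ln_realpow)
    moreover have "real (card (prime_factors n)) * (1/2) \<le> real (card (prime_factors n)) * ln 2"
      using ln2_ge_two_thirds by (intro mult_left_mono) auto
    ultimately have "real (card (prime_factors n)) \<le> 2 * X" by linarith
    then have "real (card (prime_factors n)) ^ 2 \<le> (2 * X) ^ 2" by (intro power_mono) auto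
    moreover have "real (card {t \<in> Tri. f t = n}) \<le> real (card (prime_factors n) ^ 2)" using 1 by (rule of_nat_mono)
    ultimately show ?thesis unfolding of_nat_power by linarith
  qed
  have "real (card Tri) = (\<Sum>t\<in>Tri. 1)" by simp
  also have "\<dots> = (\<Sum>n\<in>f ` Tri. \<Sum>t\<in>{t. t \<in> Tri \<and> f t = n}. 1)" by (rule sum.image_gen[OF finT])
  also have "\<dots> = (\<Sum>n\<in>f ` Tri. real (card {t \<in> Tri. f t = n}))" by simp
  also have "\<dots> \<le> (\<Sum>n\<in>f ` Tri. (2 * X) ^ 2)" using im by (intro sum_mono fibre) auto
  also have "\<dots> = real (card (f ` Tri)) * (2 * X) ^ 2" by simp
  also have "\<dots> \<le> real (card ?N) * (2 * X) ^ 2"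
    using im finite_smooth_le by (intro mult_right_mono) (auto intro: card_mono)
  finally have upper: "real (card Tri) \<le> real (card ?N) * (2 * X) ^ 2" .
  have each: "exp (X * \<alpha>) * npow m \<alpha> / (C1 ^ 4 * T ^ 2) \<le> real (card (P m)) ^ 2" if m: "m \<in> Win" for m
  proof -
    have e0: "e m > 0" using e[OF m] C by linarith
    have "exp (e m) / (C1 * T) \<le> exp (e m) / (C1 * e m)"
      using e[OF m] e0 C1 basics by (intro divide_left_mono mult_left_mono) auto
    also have "\<dots> \<le> real (card (P m))" unfolding P_def C1_def
      using count_primes_lower[OF mass, of "e m"] e[OF m] e0 by simp
    finally have "(exp (e m) / (C1 * T)) ^ 2 \<le> real (card (P m)) ^ 2" using C1 basics by (intro power_mono) auto
    moreover have "exp (X * \<alpha>) * npow m \<alpha> / (C1 ^ 4 * T ^ 2) \<le> (exp (e m) / (C1 * T)) ^ 2"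
    proof -
      have "\<alpha> * d m \<le> 1 * d m" using e[OF m] \<alpha> by (intro mult_right_mono) auto
      then have "exp (\<alpha> * d m) \<le> exp (2 * (C + 1) + 2 * e m)" using e(5)[OF m] by simp
      also have "\<dots> = C1 ^ 2 * exp (e m) ^ 2" by (simp only: C1_def exp_add exp_double)
      finally have "exp (\<alpha> * d m) / (C1 ^ 4 * T ^ 2) \<le> C1 ^ 2 * exp (e m) ^ 2 / (C1 ^ 4 * T ^ 2)" by (intro divide_right_mono) auto
      also have "\<dots> = (exp (e m) / (C1 * T)) ^ 2" using C1 by (simp add: field_simps power_eq_if)
      finally show ?thesis unfolding powr_le_dist[OF d(1)[OF m]] d_def .
    qed
    ultimately show ?thesis by linarith
  qed
  have "exp (X * \<alpha>) * (Zp A \<alpha> / X ^ 2) / (C1 ^ 4 * T ^ 2) \<le> exp (X * \<alpha>) * (\<Sum>m\<in>Win. npow m \<alpha>) / (C1 ^ 4 * T ^ 2)"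
    using window unfolding Win_def by (intro divide_right_mono mult_left_mono) auto
  also have "\<dots> = (\<Sum>m\<in>Win. exp (X * \<alpha>) * npow m \<alpha> / (C1 ^ 4 * T ^ 2))"
    by (simp add: sum_distrib_left sum_divide_distrib)
  also have "\<dots> \<le> (\<Sum>m\<in>Win. real (card (P m)) ^ 2)" by (intro sum_mono each)
  also have "\<dots> = real (card Tri)"
    unfolding Tri_def using finW by (subst card_SigmaI) (auto simp: P_def card_cartesian_product power2_eq_square)
  finally have low: "exp (X * \<alpha>) * (Zp A \<alpha> / X ^ 2) / (C1 ^ 4 * T ^ 2) \<le> real (card ?N) * (2 * X) ^ 2" using upper by linarith
  have X0: "X > 0" "T > 0" using basics by auto
  \<comment> \<open>The loss of \<open>X ^ 7\<close> splits as follows: two powers from the window,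
    two from the fibres, and three bounded here for the density of primes.\<close>
  have c: "4 * C1 ^ 4 * T ^ 2 \<le> X ^ 3"
  proof -
    have "(C1 ^ 2) * (16 * C1 * T) ^ 2 \<le> X * X ^ 2" using X X0 C1 unfolding C1_def by (intro mult_mono power_mono) auto
    then have "256 * C1 ^ 4 * T ^ 2 \<le> X ^ 3" by (simp add: power_mult_distrib power_eq_if mult_ac)
    moreover have "C1 ^ 4 * T ^ 2 \<ge> 0" using C1 X0 by simp
    ultimately show ?thesis by linarith
  qed
  let ?E = "exp (X * \<alpha>) * Zp A \<alpha>"
  have E0: "?E \<ge> 0" using basics(7) by simp
  have "?E / (X ^ 2 * (C1 ^ 4 * T ^ 2) * (4 * X ^ 2)) \<le> real (card ?N)"
    using low X0 C1 by (simp add: field_simps power_mult_distrib)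
  moreover have "?E / X ^ 7 \<le> ?E / (X ^ 2 * (C1 ^ 4 * T ^ 2) * (4 * X ^ 2))"
  proof (intro divide_left_mono E0)
    have "X ^ 4 * (4 * C1 ^ 4 * T ^ 2) \<le> X ^ 4 * X ^ 3" by (intro mult_left_mono c) auto
    then show "X ^ 2 * (C1 ^ 4 * T ^ 2) * (4 * X ^ 2) \<le> X ^ 7" by (simp add: power_eq_if mult_ac)
  qed (use X0 C1 in auto)
  ultimately show ?thesis by linarith
qed

lemma sum_rankin:
  assumes F: "finite F" "F \<subseteq> smooth B" and B: "B \<subseteq> A"
  shows "(\<Sum>n\<in>F. exp (X * \<alpha>) * npow n \<alpha>) \<le> exp (X * \<alpha>) * Zp B \<alpha>"
  unfolding sum_distrib_left[symmetric]
  by (intro mult_left_mono Zp_finite_sum_le) (use F B basics(1,2,6) finite_subset in auto)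

text \<open>If \<open>n\<close> has a prime factor \<open>p \<ge> 1 / \<eta>\<close>, then for fixed
  \<open>m = n / p\<close> this \<open>p\<close> lies in an interval of length about
  \<open>2 * \<eta> * D m\<close>; as \<open>D m \<ge> 1 / (2 * \<eta>)\<close>, the rounding error
  1 is of the same order. Otherwise all prime factors are below \<open>exp (T / 2)\<close>, and the
  Euler product lacks the primes near \<open>exp T\<close>, which costs the exponential
  factor.\<close>

lemma boundary_count:
  assumes eta: "0 < \<eta>" "\<eta> \<le> 1/2" "ln (1 / \<eta>) \<le> T / 2"
  shows "real (card {n \<in> smooth A. exp (X - \<eta>) \<le> real n \<and> real n \<le> exp (X + \<eta>)}) \<le>
    exp (X * \<alpha>) * Zp A \<alpha> * (80 * exp (C + 1) * X * \<eta> + 2 * exp (- (X / (16 * exp (C + 1) * T ^ 2))))"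
proof -
  let ?B = "{n \<in> smooth A. exp (X - \<eta>) \<le> real n \<and> real n \<le> exp (X + \<eta>)}"
  let ?As = "{p \<in> A. real p < 1 / \<eta>}"
  define C1 where "C1 = exp (C + 1)"
  define D where "D m = exp X / real m" for m :: nat
  define M where "M = {m \<in> smooth A. 1 / (2 * \<eta>) \<le> D m \<and> D m \<le> 2 * exp T}"
  define I where "I m = {p :: nat. exp (- \<eta>) * D m \<le> real p \<and> real p \<le> exp \<eta> * D m}" for m
  have ex: "exp (- \<eta>) \<ge> 1/2" "exp \<eta> - exp (- \<eta>) \<le> 3 * \<eta>" "exp \<eta> \<le> 2"
  proof -
    show 1: "exp (- \<eta>) \<ge> 1/2" using exp_ge_add_one_self[of "- \<eta>"] eta by linarith
    have "exp \<eta> \<le> 1 + \<eta> + \<eta>\<^sup>2" using eta by (intro exp_bound) auto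
    also have "\<eta>\<^sup>2 \<le> \<eta> * (1/2)" unfolding power2_eq_square using eta by (intro mult_left_mono) auto
    finally have 2: "exp \<eta> \<le> 1 + 3/2 * \<eta>" by simp
    then show "exp \<eta> - exp (- \<eta>) \<le> 3 * \<eta>" using exp_ge_add_one_self[of "- \<eta>"] eta by linarith
    show "exp \<eta> \<le> 2" using 2 eta by linarith
  qed
  have finM: "finite M"
  proof (rule finite_subset[OF _ finite_nat_le_real(1)[of "exp X * (2 * \<eta>)"]], rule subsetI)
    fix m assume m: "m \<in> M"
    then have "real m > 0" using smooth_pos by (auto simp: M_def)
    then show "m \<in> {n. real n \<le> exp X * (2 * \<eta>)}" using m eta by (simp add: M_def D_def field_simps)
  qed
  have Ifin: "finite (I m)" for m unfolding I_def
    by (rule finite_subset[OF _ finite_nat_le_real(1)[of "exp \<eta> * D m"]]) auto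
  have cardI: "real (card (I m)) \<le> exp \<eta> * D m - exp (- \<eta>) * D m + 1" if "m \<in> M" for m
  proof -
    have D0: "D m \<ge> 0" by (simp add: D_def)
    have "I m \<subseteq> {nat \<lceil>exp (- \<eta>) * D m\<rceil>..nat \<lfloor>exp \<eta> * D m\<rfloor>}" by (auto simp: I_def le_nat_floor ceiling_le_iff nat_le_iff)
    then have "card (I m) \<le> card {nat \<lceil>exp (- \<eta>) * D m\<rceil>..nat \<lfloor>exp \<eta> * D m\<rfloor>}" by (intro card_mono) auto
    also have "\<dots> = Suc (nat \<lfloor>exp \<eta> * D m\<rfloor>) - nat \<lceil>exp (- \<eta>) * D m\<rceil>" by simp
    finally have 1: "card (I m) \<le> Suc (nat \<lfloor>exp \<eta> * D m\<rfloor>) - nat \<lceil>exp (- \<eta>) * D m\<rceil>" .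
    have le: "exp (- \<eta>) * D m \<le> exp \<eta> * D m" using D0 eta by (intro mult_right_mono) auto
    have "real (nat \<lfloor>exp \<eta> * D m\<rfloor>) \<le> exp \<eta> * D m" "real (nat \<lceil>exp (- \<eta>) * D m\<rceil>) \<ge> exp (- \<eta>) * D m"
      using D0 by (auto simp: real_nat_ceiling_ge)
    moreover have "real (card (I m)) \<le> max 0 (real (Suc (nat \<lfloor>exp \<eta> * D m\<rfloor>)) - real (nat \<lceil>exp (- \<eta>) * D m\<rceil>))"
      using 1 by linarith
    ultimately show ?thesis using le by (auto simp: max_def split: if_splits)
  qed
  have eachm: "real (card (I m)) \<le> 80 * C1 * X * \<eta> * (exp (X * \<alpha>) * npow m \<alpha>)" if m: "m \<in> M" for m
  proof -
    have m0: "m > 0" and Dm: "1 / (2 * \<eta>) \<le> D m" "D m \<le> 2 * exp T" using m smooth_pos by (auto simp: M_def)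
    have D0: "D m > 0" using m0 by (simp add: D_def)
    have "1 \<le> 2 * \<eta> * D m" using Dm(1) eta by (simp add: field_simps)
    moreover have "(exp \<eta> - exp (- \<eta>)) * D m \<le> 3 * \<eta> * D m" using D0 ex by (intro mult_right_mono) auto
    ultimately have 1: "real (card (I m)) \<le> 5 * \<eta> * D m" using cardI[OF m] by (simp add: algebra_simps)
    have "D m = D m powr \<alpha> * D m powr (1 - \<alpha>)" using D0 by (simp add: powr_add[symmetric])
    also have "D m powr (1 - \<alpha>) \<le> (2 * exp T) powr (1 - \<alpha>)" using Dm D0 \<alpha> by (intro powr_mono2) auto
    also have "(2 * exp T) powr (1 - \<alpha>) = 2 powr (1 - \<alpha>) * exp T powr (1 - \<alpha>)" by (simp add: powr_mult)
    also have "exp T powr (1 - \<alpha>) = exp (T * (1 - \<alpha>))" by (simp add: powr_def mult.commute)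
    also have "2 powr (1 - \<alpha>) \<le> 2 powr 1" using \<alpha> by (intro powr_mono) auto
    also have "D m powr \<alpha> = exp (X * \<alpha>) * npow m \<alpha>"
      using m0 by (simp add: D_def powr_def exp_add[symmetric] ln_div algebra_simps)
    finally have "D m \<le> exp (X * \<alpha>) * npow m \<alpha> * (2 * exp (T * (1 - \<alpha>)))" using D0 by simp
    also have "\<dots> \<le> exp (X * \<alpha>) * npow m \<alpha> * (2 * (8 * C1 * X))" unfolding C1_def using ea(2) by (intro mult_left_mono) auto
    finally have "5 * \<eta> * D m \<le> 5 * \<eta> * (exp (X * \<alpha>) * npow m \<alpha> * (2 * (8 * C1 * X)))" using eta by (intro mult_left_mono) auto
    with 1 show ?thesis by (simp add: algebra_simps)
  qed
  have sub: "?B \<subseteq> (\<lambda>(m, p). m * p) ` (SIGMA m:M. I m) \<union> (smooth_le ?As (exp (X + \<eta>)))"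
  proof
    fix n assume n: "n \<in> ?B"
    then have n0: "n > 0" using smooth_pos by auto
    show "n \<in> (\<lambda>(m, p). m * p) ` (SIGMA m:M. I m) \<union> (smooth_le ?As (exp (X + \<eta>)))"
    proof (cases "\<exists>p\<in>prime_factors n. real p \<ge> 1 / \<eta>")
      case False
      then have "n \<in> smooth ?As" using n by (auto simp: smooth_def not_le)
      then show ?thesis using n by simp
    next
      case True
      then obtain p where p: "p \<in> prime_factors n" "real p \<ge> 1 / \<eta>" by blast
      then obtain m where m: "n = p * m" by (auto simp: in_prime_factors_iff)
      have pA: "p \<in> A" using n p by (auto simp: smooth_def)
      have p0: "real p > 0" "m > 0" using m n0 by (auto intro: Nat.gr0I)
      have mS: "m \<in> smooth A" using n m smooth_mult_iff by auto
      have "real p \<le> exp (lnn p)" using p0 by simp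
      also have "\<dots> \<le> exp T" using basics(3)[OF pA] by (simp only: exp_le_cancel_iff)
      finally have pT: "real p \<le> exp T" .
      have lo: "exp (- \<eta>) * D m \<le> real p" and hi: "real p \<le> exp \<eta> * D m"
        using n p0 unfolding m D_def by (auto simp: exp_add exp_diff exp_minus field_simps)
      have "1 / (2 * \<eta>) \<le> D m"
      proof -
        have "1 / \<eta> \<le> exp \<eta> * D m" using hi p by linarith
        also have "\<dots> \<le> 2 * D m" using ex by (intro mult_right_mono) (auto simp: D_def)
        finally show ?thesis by simp
      qed
      moreover have "D m \<le> 2 * exp T"
      proof -
        have "1/2 * D m \<le> exp (- \<eta>) * D m" using ex by (intro mult_right_mono) (auto simp: D_def)
        then show ?thesis using lo pT by linarith
      qed
      ultimately have "m \<in> M" using mS by (simp add: M_def)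
      moreover have "p \<in> I m" using lo hi by (simp add: I_def)
      ultimately have "n \<in> (\<lambda>(m, p). m * p) ` (SIGMA m:M. I m)" using m by (auto simp: mult.commute intro!: image_eqI[of _ _ "(m, p)"])
      then show ?thesis by blast
    qed
  qed
  let ?F = "(smooth_le ?As (exp (X + \<eta>)))"
  have finF: "finite ?F" by (rule finite_subset[OF _ finite_nat_le_real(1)[of "exp (X + \<eta>)"]]) auto
  have finS: "finite (SIGMA m:M. I m)" using finM Ifin by auto
  have "card ?B \<le> card ((\<lambda>(m, p). m * p) ` (SIGMA m:M. I m) \<union> ?F)" by (rule card_mono[OF _ sub]) (use finS finF in auto)
  also have "\<dots> \<le> card ((\<lambda>(m, p). m * p) ` (SIGMA m:M. I m)) + card ?F" by (rule card_Un_le)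
  also have "\<dots> \<le> card (SIGMA m:M. I m) + card ?F" using card_image_le[OF finS] by simp
  finally have "real (card ?B) \<le> real (card (SIGMA m:M. I m) + card ?F)" by (simp only: of_nat_le_iff)
  then have 1: "real (card ?B) \<le> real (card (SIGMA m:M. I m)) + real (card ?F)" by simp
  have "real (card (SIGMA m:M. I m)) = (\<Sum>m\<in>M. real (card (I m)))" using finM Ifin by (simp add: card_SigmaI)
  also have "\<dots> \<le> (\<Sum>m\<in>M. 80 * C1 * X * \<eta> * (exp (X * \<alpha>) * npow m \<alpha>))" by (intro sum_mono eachm)
  also have "\<dots> = 80 * C1 * X * \<eta> * (\<Sum>m\<in>M. exp (X * \<alpha>) * npow m \<alpha>)" by (simp only: sum_distrib_left)
  also have "\<dots> \<le> 80 * C1 * X * \<eta> * (exp (X * \<alpha>) * Zp A \<alpha>)"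
    using basics(5) eta finM by (intro mult_left_mono sum_rankin) (auto simp: M_def C1_def)
  finally have 2: "real (card (SIGMA m:M. I m)) \<le> 80 * C1 * X * \<eta> * (exp (X * \<alpha>) * Zp A \<alpha>)" .
  have Zs: "Zp ?As \<alpha> \<le> Zp A \<alpha> * exp (- (X / (16 * C1 * T ^ 2)))"
  proof -
    let ?P = "logint (T - (C + 1)) T"
    have PA: "?P \<subseteq> A" using T C by (intro logint_sub) auto
    have dis: "?As \<inter> ?P = {}"
    proof -
      have "real p \<ge> 1 / \<eta>" if "p \<in> ?P" for p
      proof -
        have "T - (C + 1) < lnn p" "p > 0" using that by (auto simp: logint_def prime_gt_0_nat)
        then have "ln (1 / \<eta>) \<le> lnn p" using eta(3) T C by argo
        then have "exp (ln (1 / \<eta>)) \<le> exp (lnn p)" by (simp only: exp_le_cancel_iff)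
        then show ?thesis using eta \<open>p > 0\<close> by simp
      qed
      then show ?thesis by force
    qed
    have z: "npow p \<alpha> < 1" if "p \<in> A" for p using prime_powr_less_1 basics(2)[OF that] basics(6) by blast
    have ge: "exp (npow p \<alpha>) \<le> 1 / (1 - npow p \<alpha>)" if "p \<in> A" for p
    proof -
      have "1 - npow p \<alpha> \<le> exp (- (npow p \<alpha>))" using exp_ge_add_one_self[of "- (npow p \<alpha>)"] by simp
      then show ?thesis using z[OF that] by (simp add: exp_minus field_simps)
    qed
    have T0: "T > 0" using basics by linarith
    have s: "X / (16 * C1 * T ^ 2) \<le> (\<Sum>p\<in>?P. npow p \<alpha>)"
    proof -
      have "X / (16 * C1 * T ^ 2) = X / (16 * T) * (1 / (C1 * T))" by (simp add: power2_eq_square)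
      also have "\<dots> \<le> exp (T * (1 - \<alpha>)) * (1 / (C1 * T))" using ea(1) T0 by (intro mult_right_mono) (auto simp: C1_def)
      also have "\<dots> = exp T / (C1 * T) * exp (- (T * \<alpha>))" by (simp add: right_diff_distrib exp_diff exp_minus field_simps)
      also have "\<dots> \<le> real (card ?P) * exp (- (T * \<alpha>))" unfolding C1_def
        by (intro mult_right_mono count_primes_lower[OF mass]) (use T C in auto)
      also have "\<dots> = (\<Sum>p\<in>?P. exp (- (T * \<alpha>)))" by simp
      also have "\<dots> \<le> (\<Sum>p\<in>?P. npow p \<alpha>)"
        using basics(6) by (intro sum_mono) (auto simp: logint_def powr_def prime_gt_0_nat mult_ac)
      finally show ?thesis .
    qed
    have nn: "0 \<le> 1 / (1 - npow p \<alpha>)" "1 \<le> 1 / (1 - npow p \<alpha>)" if "p \<in> A" for p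
      using z[OF that] by (auto simp: field_simps)
    have "Zp ?As \<alpha> * exp (X / (16 * C1 * T ^ 2)) \<le> Zp ?As \<alpha> * exp (\<Sum>p\<in>?P. npow p \<alpha>)"
      using s Zp_pos[of ?As \<alpha>] basics(2,6) by (intro mult_left_mono) (auto intro: less_imp_le)
    also have "\<dots> = Zp ?As \<alpha> * (\<Prod>p\<in>?P. exp (npow p \<alpha>))" by (simp add: exp_sum)
    also have "\<dots> \<le> Zp ?As \<alpha> * Zp ?P \<alpha>"
      unfolding Zp_def[of ?P] using Zp_pos[of ?As \<alpha>] basics(2,6) ge PA by (intro mult_left_mono prod_mono) (auto intro: less_imp_le)
    also have "\<dots> = Zp (?As \<union> ?P) \<alpha>" unfolding Zp_def using dis basics(1) by (subst prod.union_disjoint) auto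
    also have "\<dots> \<le> Zp A \<alpha>" unfolding Zp_def
      by (rule prod_mono2) (use basics(1) PA nn in auto)
    finally show ?thesis by (simp add: exp_minus field_simps)
  qed
  have "real (card ?F) = (\<Sum>n\<in>?F. 1)" by simp
  also have "\<dots> \<le> (\<Sum>n\<in>?F. 2 * (exp (X * \<alpha>) * npow n \<alpha>))"
  proof (rule sum_mono)
    fix n assume n: "n \<in> ?F"
    then have n0: "n > 0" using smooth_pos by auto
    have "lnn n \<le> ln (exp (X + \<eta>))" using n n0 by (intro ln_mono) auto
    then have "\<alpha> * (X - lnn n) \<ge> \<alpha> * (- \<eta>)" using basics(6) by (intro mult_left_mono) auto
    moreover have "\<alpha> * (- \<eta>) \<ge> 1 * (- \<eta>)" using \<alpha> eta by (intro mult_right_mono_neg) auto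
    ultimately have "exp (- \<eta>) \<le> exp (\<alpha> * (X - lnn n))" by simp
    then show "1 \<le> 2 * (exp (X * \<alpha>) * npow n \<alpha>)" using powr_le_dist[OF n0] ex by linarith
  qed
  also have "\<dots> = 2 * (\<Sum>n\<in>?F. exp (X * \<alpha>) * npow n \<alpha>)" by (simp only: sum_distrib_left)
  also have "\<dots> \<le> 2 * (exp (X * \<alpha>) * Zp ?As \<alpha>)" using finF by (intro mult_left_mono sum_rankin) auto
  also have "\<dots> \<le> 2 * (exp (X * \<alpha>) * (Zp A \<alpha> * exp (- (X / (16 * C1 * T ^ 2)))))" by (intro mult_left_mono Zs) auto
  finally have 3: "real (card ?F) \<le> 2 * (exp (X * \<alpha>) * (Zp A \<alpha> * exp (- (X / (16 * C1 * T ^ 2)))))" .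
  show ?thesis using 1 2 3 unfolding C1_def by (simp add: algebra_simps)
qed

text \<open>\<open>norm (1 - z * w)\<close> is at least its real part
  \<open>(1 - z) + z * (1 - Re w)\<close>, so each prime saves about
  \<open>z * (1 - Re w) / 3\<close> in the exponent. For \<open>ln p > T / 2\<close> the weight
  \<open>npow p \<alpha>\<close> is at least \<open>exp (T / 2 * (1 - \<alpha>)) / p\<close>; this
  turns the mass \<open>c * T\<close> into the square root in the exponent.\<close>

lemma euler_norm_le:
  assumes w: "\<And>p. norm (w p) \<le> 1" and k: "(\<Sum>p\<in>logint (T / 2) T. (1 - Re (w p)) * (lnn p / p)) \<ge> c * T" and c: "c \<ge> 0"
  shows "norm (\<Prod>p\<in>A. 1 / (1 - of_real (npow p \<alpha>) * w p)) \<le> Zp A \<alpha> * exp (- (c / 3 * sqrt (X / (16 * T))))"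
proof -
  have T0: "T > 0" using basics by linarith
  have wr: "0 \<le> 1 - Re (w p)" "1 - Re (w p) \<le> 2" for p
    using w[of p] abs_Re_le_cmod[of "w p"] by linarith+
  have each: "norm (1 / (1 - of_real (npow p \<alpha>) * w p)) \<le> 1 / (1 - npow p \<alpha>) * exp (- (1 / 3 * (npow p \<alpha> * (1 - Re (w p)))))"
    if p: "p \<in> A" for p
  proof -
    define z where "z = npow p \<alpha>"
    have z: "0 \<le> z" "z < 1" using prime_powr_less_1[OF basics(2)[OF p] basics(6)] by (auto simp: z_def)
    define v where "v = z * (1 - Re (w p))"
    have "v \<le> 1 * 2" unfolding v_def using z wr by (intro mult_mono) auto
    then have v: "0 \<le> v" "v \<le> 2" using z wr by (auto simp: v_def)
    have "1 - v / (1 + v) \<le> exp (- (v / (1 + v)))" using exp_ge_add_one_self[of "- (v / (1 + v))"] by simp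
    also have "exp (- (v / (1 + v))) \<le> exp (- (1 / 3 * v))" using v divide_left_mono[of "1 + v" 3 v] by simp
    finally have e: "1 / (1 + v) \<le> exp (- (1 / 3 * v))" using v by (simp add: field_simps)
    have "(1 - z) * (1 + v) \<le> (1 - z) + v" using z v mult_nonneg_nonneg[of z v] by (simp add: algebra_simps)
    also have "\<dots> = Re (1 - of_real z * w p)" by (simp add: v_def algebra_simps)
    also have "\<dots> \<le> norm (1 - of_real z * w p)" by (rule complex_Re_le_cmod)
    finally have le: "(1 - z) * (1 + v) \<le> norm (1 - of_real z * w p)" .
    have "0 < (1 - z) * (1 + v)" using z v by simp
    then have "1 / norm (1 - of_real z * w p) \<le> 1 / ((1 - z) * (1 + v))" using le z v by (intro divide_left_mono mult_pos_pos) linarith+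
    also have "\<dots> = 1 / (1 - z) * (1 / (1 + v))" by simp
    also have "\<dots> \<le> 1 / (1 - z) * exp (- (1 / 3 * v))" using e z by (intro mult_left_mono) auto
    finally show ?thesis by (simp add: norm_divide z_def v_def)
  qed
  have fin: "finite A" by (rule basics)
  have "norm (\<Prod>p\<in>A. 1 / (1 - of_real (npow p \<alpha>) * w p)) = (\<Prod>p\<in>A. norm (1 / (1 - of_real (npow p \<alpha>) * w p)))"
    by (simp add: prod_norm)
  also have "\<dots> \<le> (\<Prod>p\<in>A. 1 / (1 - npow p \<alpha>) * exp (- (1 / 3 * (npow p \<alpha> * (1 - Re (w p))))))"
    by (intro prod_mono conjI each) auto
  also have "\<dots> = Zp A \<alpha> * exp (\<Sum>p\<in>A. - (1 / 3 * (npow p \<alpha> * (1 - Re (w p)))))"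
    unfolding Zp_def by (simp only: prod.distrib exp_sum[OF fin])
  also have "\<dots> \<le> Zp A \<alpha> * exp (- (c / 3 * sqrt (X / (16 * T))))"
  proof (intro mult_left_mono)
    have "sqrt (X / (16 * T)) \<le> sqrt (exp (T * (1 - \<alpha>)))" using ea by simp
    also have "\<dots> = exp (T / 2 * (1 - \<alpha>))"
    proof -
      have "exp (T * (1 - \<alpha>)) = exp (T / 2 * (1 - \<alpha>)) ^ 2" by (simp add: exp_double[symmetric])
      then show ?thesis by simp
    qed
    finally have sq: "sqrt (X / (16 * T)) \<le> exp (T / 2 * (1 - \<alpha>))" .
    have "c * sqrt (X / (16 * T)) \<le> c * exp (T / 2 * (1 - \<alpha>))" using sq c by (rule mult_left_mono)
    also have "\<dots> = exp (T / 2 * (1 - \<alpha>)) / T * (c * T)" using T0 by simp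
    also have "\<dots> \<le> exp (T / 2 * (1 - \<alpha>)) / T * (\<Sum>p\<in>logint (T / 2) T. (1 - Re (w p)) * (lnn p / p))"
      using k T0 by (intro mult_left_mono) auto
    also have "\<dots> = (\<Sum>p\<in>logint (T / 2) T. exp (T / 2 * (1 - \<alpha>)) / T * ((1 - Re (w p)) * (lnn p / p)))"
      by (rule sum_distrib_left)
    also have "\<dots> \<le> (\<Sum>p\<in>logint (T / 2) T. npow p \<alpha> * (1 - Re (w p)))"
    proof (rule sum_mono)
      fix p assume "p \<in> logint (T / 2) T"
      then have p: "prime p" "T / 2 \<le> lnn p" "lnn p \<le> T" "p > 0" by (auto simp: logint_def prime_gt_0_nat)
      have "exp (T / 2 * (1 - \<alpha>)) / T * (lnn p / p) = exp (T / 2 * (1 - \<alpha>)) * (lnn p / T) / p" by simp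
      also have "\<dots> \<le> exp (T / 2 * (1 - \<alpha>)) * 1 / p" using p T0 by (intro divide_right_mono mult_left_mono) auto
      also have "\<dots> \<le> exp (lnn p * (1 - \<alpha>)) * 1 / p" using p \<alpha> by (intro divide_right_mono mult_right_mono) (auto intro!: mult_right_mono)
      also have "\<dots> = npow p \<alpha>" using p by (simp add: powr_def right_diff_distrib exp_diff exp_minus field_simps)
      finally have "exp (T / 2 * (1 - \<alpha>)) / T * (lnn p / p) * (1 - Re (w p)) \<le> npow p \<alpha> * (1 - Re (w p))"
        by (intro mult_right_mono wr)
      then show "exp (T / 2 * (1 - \<alpha>)) / T * ((1 - Re (w p)) * (lnn p / p)) \<le> npow p \<alpha> * (1 - Re (w p))"
        by (simp only: mult_ac)
    qed
    also have "\<dots> \<le> (\<Sum>p\<in>A. npow p \<alpha> * (1 - Re (w p)))"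
      by (intro sum_mono2[OF fin] logint_sub) (use wr in auto)
    finally have "c / 3 * sqrt (X / (16 * T)) \<le> 1 / 3 * (\<Sum>p\<in>A. npow p \<alpha> * (1 - Re (w p)))" by simp
    then show "exp (\<Sum>p\<in>A. - (1 / 3 * (npow p \<alpha> * (1 - Re (w p))))) \<le> exp (- (c / 3 * sqrt (X / (16 * T))))"
      by (simp only: sum_negf sum_distrib_left[symmetric] exp_le_cancel_iff neg_le_iff_le)
  qed (use basics(7) in auto)
  finally show ?thesis .
qed

end

section \<open>Smoothed counting in residue classes\<close>

lemma has_sum_finite_sum:
  fixes f :: "'j \<Rightarrow> 'b \<Rightarrow> 'c :: {topological_comm_monoid_add, t2_space}"
  assumes "finite J" "\<And>j. j \<in> J \<Longrightarrow> (f j has_sum F j) S"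
  shows "((\<lambda>n. \<Sum>j\<in>J. f j n) has_sum (\<Sum>j\<in>J. F j)) S"
  using assms
proof (induction J rule: finite_induct)
  case (insert j J)
  then show ?case by (simp add: has_sum_add)
qed simp

text \<open>With \<open>u = X - ln n\<close> this is a smoothed indicator of
  \<open>n \<le> exp X\<close>: the interval contains the peak at 0 exactly when
  \<open>0 \<le> u \<le> V\<close>. It stops at \<open>u - V\<close> because the periodic bump has
  further peaks. The factor \<open>exp (\<alpha> * w)\<close> moves all frequencies to the line
  \<open>Re s = \<alpha>\<close>.\<close>

definition wsmooth :: "real \<Rightarrow> nat \<Rightarrow> real \<Rightarrow> real \<Rightarrow> real \<Rightarrow> real" where
  "wsmooth \<alpha> M \<kappa> V u = integral {u - V..u} (\<lambda>w. exp (\<alpha> * w) * bump M \<kappa> w)"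

lemma continuous_bump_weight: "continuous_on S (\<lambda>w. exp (\<alpha> * w) * bump M \<kappa> w)"
  unfolding bump_def by (intro continuous_intros) auto

lemma bump_weight_nonneg: "exp (\<alpha> * w) * bump M \<kappa> w \<ge> 0"
  by (simp add: bump_nonneg)

lemma wsmooth_nonneg: "wsmooth \<alpha> M \<kappa> V u \<ge> 0"
  unfolding wsmooth_def by (intro integral_nonneg integrable_continuous_interval continuous_bump_weight bump_weight_nonneg)

lemma wsmooth_ge:
  assumes "\<eta> \<le> u" "u - V \<le> - \<eta>"
  shows "wsmooth \<alpha> M \<kappa> V u \<ge> integral {-\<eta>..\<eta>} (\<lambda>w. exp (\<alpha> * w) * bump M \<kappa> w)"
  unfolding wsmooth_def
  by (rule integral_subset_le) (use assms in \<open>auto intro!: integrable_continuous_interval continuous_bump_weight simp: bump_nonneg\<close>)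

lemma wsmooth_le_bound:
  assumes V: "V \<ge> 0" and b: "\<And>w. u - V \<le> w \<Longrightarrow> w \<le> u \<Longrightarrow> exp (\<alpha> * w) * bump M \<kappa> w \<le> B"
  shows "wsmooth \<alpha> M \<kappa> V u \<le> V * B"
proof -
  have "norm (wsmooth \<alpha> M \<kappa> V u) \<le> B * (u - (u - V))" unfolding wsmooth_def
    by (rule integral_bound) (use V b bump_weight_nonneg in \<open>auto intro!: continuous_bump_weight\<close>)
  then show ?thesis by (simp add: mult.commute)
qed

lemma wsmooth_le_trivial:
  assumes "V \<ge> 0" "\<alpha> \<ge> 0"
  shows "wsmooth \<alpha> M \<kappa> V u \<le> V * exp (\<alpha> * u)"
proof (rule wsmooth_le_bound)
  fix w assume "w \<le> u"
  then have "exp (\<alpha> * w) * bump M \<kappa> w \<le> exp (\<alpha> * u) * 1"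
    using assms by (intro mult_mono bump_le_1 bump_nonneg) (auto intro: mult_left_mono)
  then show "exp (\<alpha> * w) * bump M \<kappa> w \<le> exp (\<alpha> * u)" by simp
qed (use assms in auto)

context
  fixes \<kappa> \<eta> :: real and M :: nat and \<delta> :: real
  assumes k: "\<kappa> > 0" and eta: "0 < \<eta>" "\<kappa> * \<eta> / 2 \<le> 1"
  defines "\<delta> \<equiv> exp (- real M * (\<kappa> * \<eta> / 2)\<^sup>2 / 4)"
begin

lemma wsmooth_le_far:
  assumes "V \<ge> 0" "\<alpha> \<ge> 0" "u \<le> - \<eta>" "\<kappa> * (V - u) \<le> pi"
  shows "wsmooth \<alpha> M \<kappa> V u \<le> V * (exp (\<alpha> * u) * \<delta>)"
proof (rule wsmooth_le_bound)
  fix w assume w: "u - V \<le> w" "w \<le> u"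
  have "\<kappa> * \<bar>w\<bar> \<le> \<kappa> * (V - u)" using w assms k eta by (intro mult_left_mono) auto
  then have "bump M \<kappa> w \<le> \<delta>" unfolding \<delta>_def
    using w assms k eta by (intro bump_le_exp) auto
  then show "exp (\<alpha> * w) * bump M \<kappa> w \<le> exp (\<alpha> * u) * \<delta>"
    using w assms by (intro mult_mono bump_nonneg) (auto intro: mult_left_mono)
qed (use assms in auto)

lemma wsmooth_le_near:
  assumes V: "V \<ge> 0" and a: "0 \<le> \<alpha>" "\<alpha> \<le> 1" and u: "u \<le> Y" "0 \<le> Y" "\<kappa> * Y \<le> pi" "\<kappa> * (V - u) \<le> pi"
  shows "wsmooth \<alpha> M \<kappa> V u \<le> integral {-\<eta>..\<eta>} (\<lambda>w. exp (\<alpha> * w) * bump M \<kappa> w) + V * (exp Y * \<delta>)"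
proof -
  let ?g = "\<lambda>w. exp (\<alpha> * w) * bump M \<kappa> w"
  let ?I = "{-\<eta>..\<eta>}" and ?J = "{u - V..u}"
  have g: "?g integrable_on {a..b}" for a b by (intro integrable_continuous_interval continuous_bump_weight)
  have gI: "?g integrable_on ?I \<inter> ?J" unfolding Int_atLeastAtMost by (rule g)
  then have rI: "(\<lambda>w. if w \<in> ?I then ?g w else 0) integrable_on ?J" by (simp only: integrable_restrict_Int)
  have "wsmooth \<alpha> M \<kappa> V u \<le> integral ?J (\<lambda>w. (if w \<in> ?I then ?g w else 0) + exp Y * \<delta>)"
    unfolding wsmooth_def
  proof (intro integral_le g integrable_add rI integrable_const_ivl)
    fix w assume w: "w \<in> ?J"
    show "?g w \<le> (if w \<in> ?I then ?g w else 0) + exp Y * \<delta>"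
    proof (cases "w \<in> ?I")
      case False
      then have "\<eta> \<le> \<bar>w\<bar>" by auto
      have "\<bar>w\<bar> \<le> max Y (V - u)" using w u by auto
      then have "\<kappa> * \<bar>w\<bar> \<le> \<kappa> * max Y (V - u)" using k by (intro mult_left_mono) auto
      also have "\<dots> \<le> pi" using u by (auto simp: max_def)
      finally have "bump M \<kappa> w \<le> \<delta>" unfolding \<delta>_def using k eta \<open>\<eta> \<le> \<bar>w\<bar>\<close> by (intro bump_le_exp) auto
      moreover have "\<alpha> * w \<le> Y"
      proof -
        have "\<alpha> * w \<le> \<alpha> * Y" using a w u by (intro mult_left_mono) auto
        also have "\<dots> \<le> 1 * Y" using a u by (intro mult_right_mono) auto
        finally show ?thesis by simp
      qed
      ultimately have "?g w \<le> exp Y * \<delta>" by (intro mult_mono bump_nonneg) auto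
      then show ?thesis using False by (simp only: if_False add_0)
    next
      case True
      then show ?thesis by (simp only: if_True \<delta>_def) simp
    qed
  qed
  also have "\<dots> = integral ?J (\<lambda>w. if w \<in> ?I then ?g w else 0) + integral ?J (\<lambda>_. exp Y * \<delta>)"
    by (rule integral_add[OF rI integrable_const_ivl])
  also have "integral ?J (\<lambda>w. if w \<in> ?I then ?g w else 0) = integral (?I \<inter> ?J) ?g" by (rule integral_restrict_Int)
  also have "\<dots> \<le> integral ?I ?g" by (rule integral_subset_le) (use g gI bump_weight_nonneg in auto)
  also have "integral ?J (\<lambda>_. exp Y * \<delta>) = V * (exp Y * \<delta>)" using V by simp
  finally show ?thesis by simp
qed

text \<open>On \<open>[0, h]\<close> the bump is at least 1/2 by Bernoulli's inequality. The
  integral is the normalising constant by which the smoothed count will be divided.\<close>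

lemma bump_mass_ge:
  assumes h: "0 < h" "h \<le> \<eta>" "real M * (\<kappa> * h / 2)\<^sup>2 \<le> 1/2" and a: "\<alpha> \<ge> 0"
  shows "integral {-\<eta>..\<eta>} (\<lambda>w. exp (\<alpha> * w) * bump M \<kappa> w) \<ge> h / 2"
proof -
  let ?g = "\<lambda>w. exp (\<alpha> * w) * bump M \<kappa> w"
  have g: "?g integrable_on {a..b}" for a b by (intro integrable_continuous_interval continuous_bump_weight)
  have "h / 2 = integral {0..h} (\<lambda>_. 1 / 2)" using h by simp
  also have "\<dots> \<le> integral {0..h} ?g"
  proof (intro integral_le g integrable_const_ivl)
    fix w assume w: "w \<in> {0..h}"
    have le: "\<kappa> * w / 2 \<le> \<kappa> * h / 2" "0 \<le> \<kappa> * w / 2" using w k by auto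
    then have "(\<kappa> * w / 2)\<^sup>2 \<le> (\<kappa> * h / 2)\<^sup>2" by (intro power_mono)
    moreover have "(\<kappa> * h / 2)\<^sup>2 \<le> 1"
    proof -
      have "\<kappa> * h / 2 \<le> \<kappa> * \<eta> / 2" using h k by simp
      then have "\<kappa> * h / 2 \<le> 1" using eta by linarith
      then show ?thesis using h k by (intro power_le_one) auto
    qed
    ultimately have "bump M \<kappa> w \<ge> 1 - real M * (\<kappa> * w / 2)\<^sup>2" by (intro bump_ge) linarith
    moreover have "real M * (\<kappa> * w / 2)\<^sup>2 \<le> real M * (\<kappa> * h / 2)\<^sup>2" using \<open>(\<kappa> * w / 2)\<^sup>2 \<le> (\<kappa> * h / 2)\<^sup>2\<close> by (intro mult_left_mono) auto
    ultimately have b: "bump M \<kappa> w \<ge> 1/2" using h by linarith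
    have "1 * bump M \<kappa> w \<le> ?g w" using w a by (intro mult_right_mono bump_nonneg) auto
    then show "1 / 2 \<le> ?g w" using b by linarith
  qed
  also have "\<dots> \<le> integral {-\<eta>..\<eta>} ?g" by (rule integral_subset_le) (use g h bump_weight_nonneg in auto)
  finally show ?thesis .
qed

end

lemma integral_exp_cos:
  fixes s :: complex
  assumes s: "s \<noteq> 0" and ab: "a \<le> b"
  shows "((\<lambda>w. exp (Re s * w) * cos (Im s * w)) has_integral Re ((exp (s * of_real b) - exp (s * of_real a)) / s)) {a..b}"
proof -
  have "((\<lambda>w. exp (s * of_real w)) has_integral (exp (s * of_real b) / s - exp (s * of_real a) / s)) {a..b}"
  proof (rule fundamental_theorem_of_calculus[OF ab])
    fix x assume "x \<in> {a..b}"
    have "((\<lambda>w. exp (s * w) / s) has_field_derivative exp (s * of_real x)) (at (of_real x))"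
      using s by (auto intro!: derivative_eq_intros)
    then show "((\<lambda>w. exp (s * of_real w) / s) has_vector_derivative exp (s * of_real x)) (at x within {a..b})"
      by (rule has_vector_derivative_real_field)
  qed
  from has_integral_linear[OF this bounded_linear_Re]
  show ?thesis by (simp add: o_def Re_exp diff_divide_distrib)
qed

lemma wsmooth_expansion:
  fixes M :: nat and \<kappa> :: real
  assumes a: "\<alpha> > 0" and V: "V \<ge> 0" and n: "n > 0"
  defines "s \<equiv> \<lambda>j. Complex \<alpha> ((real j - real M) * \<kappa>)"
  shows "wsmooth \<alpha> M \<kappa> V (X - lnn n) = Re (\<Sum>j\<le>2*M. of_real (bwt M j) *
     ((1 - exp (- s j * of_real V)) / s j * exp (s j * of_real X) * dpow (s j) n))"
proof -
  let ?u = "X - lnn n"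
  have Rr: "Re (of_real r * z) = r * Re z" for r z by simp
  have s0: "s j \<noteq> 0" for j using a by (simp add: s_def complex_eq_iff)
  have "((\<lambda>w. \<Sum>j\<le>2*M. bwt M j * (exp (Re (s j) * w) * cos (Im (s j) * w))) has_integral
    (\<Sum>j\<le>2*M. bwt M j * Re ((exp (s j * of_real ?u) - exp (s j * of_real (?u - V))) / s j))) {?u - V..?u}"
    using V s0 by (intro has_integral_sum has_integral_mult_right integral_exp_cos) auto
  moreover have "(\<Sum>j\<le>2*M. bwt M j * (exp (Re (s j) * w) * cos (Im (s j) * w))) = exp (\<alpha> * w) * bump M \<kappa> w" for w
    unfolding bump_expansion sum_distrib_left s_def by (rule sum.cong[OF refl]) (simp add: mult_ac)
  ultimately have "wsmooth \<alpha> M \<kappa> V ?u = (\<Sum>j\<le>2*M. bwt M j * Re ((exp (s j * of_real ?u) - exp (s j * of_real (?u - V))) / s j))"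
    unfolding wsmooth_def by (simp add: integral_unique)
  also have "\<dots> = (\<Sum>j\<le>2*M. Re (of_real (bwt M j) * ((1 - exp (- s j * of_real V)) / s j * exp (s j * of_real X) * dpow (s j) n)))"
  proof (rule sum.cong[OF refl])
    fix j
    have "exp (s j * of_real (?u - V)) = exp (s j * of_real ?u) * exp (- s j * of_real V)"
      by (simp only: exp_add[symmetric]) (simp add: algebra_simps)
    moreover have "exp (s j * of_real ?u) = exp (s j * of_real X) * dpow (s j) n"
      using n by (simp add: dpow_def exp_add[symmetric] algebra_simps)
    ultimately have "(exp (s j * of_real ?u) - exp (s j * of_real (?u - V))) / s j =
        (1 - exp (- s j * of_real V)) / s j * exp (s j * of_real X) * dpow (s j) n"
      by (simp add: algebra_simps diff_divide_distrib)
    then show "bwt M j * Re ((exp (s j * of_real ?u) - exp (s j * of_real (?u - V))) / s j) =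
      Re (of_real (bwt M j) * ((1 - exp (- s j * of_real V)) / s j * exp (s j * of_real X) * dpow (s j) n))"
      by (simp only: Rr)
  qed
  also have "\<dots> = Re (\<Sum>j\<le>2*M. of_real (bwt M j) * ((1 - exp (- s j * of_real V)) / s j * exp (s j * of_real X) * dpow (s j) n))"
    by (rule Re_sum[symmetric])
  finally show ?thesis .
qed

text \<open>Deviation of a residue class from its expected share. On integers prime to
  \<open>q\<close>, for \<open>a\<close> prime to \<open>q\<close>, it is the average over the
  characters with the principal one removed, so only non-principal Euler products enter its
  sums.\<close>

definition classdev :: "nat \<Rightarrow> nat \<Rightarrow> nat \<Rightarrow> real" where
  "classdev q a n = (if [n = a] (mod q) then 1 else 0) - 1 / real (totient q)"

lemma abs_classdev_le: "q > 0 \<Longrightarrow> \<bar>classdev q a n\<bar> \<le> 1"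
proof -
  assume "q > 0"
  then have "real (totient q) \<ge> 1" by (simp add: Suc_leI)
  then have "0 \<le> 1 / real (totient q)" "1 / real (totient q) \<le> 1" by (auto simp: divide_le_eq)
  then show ?thesis by (auto simp: classdev_def)
qed

lemma coprime_smooth:
  assumes "\<And>p. p \<in> A \<Longrightarrow> coprime p q" "n \<in> smooth A"
  shows "coprime n q"
proof (rule ccontr)
  assume "\<not> coprime n q"
  then obtain p where p: "prime p" "p dvd n" "p dvd q" using prime_factor_nat[of "gcd n q"] unfolding coprime_iff_gcd_eq_1 gcd_greatest_iff by blast
  then have "p \<in> A" using assms(2) by (auto simp: smooth_def in_prime_factors_iff)
  then have "coprime p q" using assms(1) by blast
  then show False using p by (metis coprime_common_divisor dvd_refl not_prime_unit)
qed

lemma classdev_has_sum: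
  assumes A: "finite A" "\<And>p. p \<in> A \<Longrightarrow> prime p" "\<And>p. p \<in> A \<Longrightarrow> coprime p q" and q: "q > 0" and a: "coprime a q" and s: "Re s > 0"
    and B: "\<And>\<omega>. dchar q \<omega> \<Longrightarrow> \<omega> \<noteq> principal q \<Longrightarrow> norm (\<Prod>p\<in>A. 1 / (1 - \<omega> p * dpow s p)) \<le> B" and B0: "B \<ge> 0"
  shows "\<exists>F. ((\<lambda>n. of_real (classdev q a n) * dpow s n) has_sum F) (smooth A) \<and> norm F \<le> B"
proof -
  let ?O = "{\<omega>. dchar q \<omega>} - {principal q}"
  let ?ph = "of_nat (totient q) :: complex"
  have ph: "?ph \<noteq> 0" "real (totient q) > 0" using q by auto
  have finO: "finite ?O" using finite_dchar[OF q] by auto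
  define F where "F = (\<Sum>\<omega>\<in>?O. cnj (\<omega> a) / ?ph * (\<Prod>p\<in>A. 1 / (1 - \<omega> p * dpow s p)))"
  have e: "((\<lambda>n. \<omega> n * dpow s n) has_sum (\<Prod>p\<in>A. 1 / (1 - \<omega> p * dpow s p))) (smooth A)" if w: "\<omega> \<in> ?O" for \<omega>
  proof (rule euler_smooth(1))
    show "norm (\<omega> p * dpow s p) < 1" if p: "p \<in> A" for p
    proof -
      have "norm (\<omega> p * dpow s p) \<le> 1 * real p powr (- Re s)"
        unfolding norm_mult norm_dpow using w q by (intro mult_right_mono norm_dchar_le) auto
      also have "\<dots> < 1" using prime_powr_less_1[OF A(2)[OF p] s] by simp
      finally show ?thesis .
    qed
    show "\<omega> (m * n) * dpow s (m * n) = \<omega> m * dpow s m * (\<omega> n * dpow s n)" for m n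
      using w dcharD(1)[of q \<omega> m n] by (simp add: dpow_mult)
    show "\<omega> 1 * dpow s 1 = 1" using w dcharD(4)[of q \<omega>] by simp
  qed (use A in auto)
  have "((\<lambda>n. \<Sum>\<omega>\<in>?O. cnj (\<omega> a) / ?ph * (\<omega> n * dpow s n)) has_sum F) (smooth A)"
    unfolding F_def by (intro has_sum_finite_sum finO has_sum_cmult_right e)
  moreover have "(\<Sum>\<omega>\<in>?O. cnj (\<omega> a) / ?ph * (\<omega> n * dpow s n)) = of_real (classdev q a n) * dpow s n" if n: "n \<in> smooth A" for n
  proof -
    have cn: "coprime n q" by (rule coprime_smooth[OF A(3) n])
    have "(\<Sum>\<omega>\<in>?O. \<omega> n * cnj (\<omega> a)) = (\<Sum>\<omega> | dchar q \<omega>. \<omega> n * cnj (\<omega> a)) - 1"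
      using finite_dchar[OF q] dchar_principal[of q] cn a by (subst sum_diff1) (auto simp: principal_def)
    then have "(\<Sum>\<omega>\<in>?O. \<omega> n * cnj (\<omega> a)) / ?ph = of_real (classdev q a n)"
      using ph unfolding dchar_orthogonality[OF q cn a] classdev_def by (auto simp: diff_divide_distrib)
    moreover have "(\<Sum>\<omega>\<in>?O. cnj (\<omega> a) / ?ph * (\<omega> n * dpow s n)) = (\<Sum>\<omega>\<in>?O. \<omega> n * cnj (\<omega> a)) / ?ph * dpow s n"
      unfolding sum_divide_distrib sum_distrib_right by (rule sum.cong[OF refl]) simp
    ultimately show ?thesis by simp
  qed
  ultimately have "((\<lambda>n. of_real (classdev q a n) * dpow s n) has_sum F) (smooth A)" by (simp cong: has_sum_cong)
  moreover have "norm F \<le> B"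
  proof -
    have "norm F \<le> (\<Sum>\<omega>\<in>?O. B / real (totient q))" unfolding F_def
    proof (intro sum_norm_le)
      fix \<omega> assume w: "\<omega> \<in> ?O"
      have "norm (cnj (\<omega> a)) * norm (\<Prod>p\<in>A. 1 / (1 - \<omega> p * dpow s p)) \<le> 1 * B"
        using w norm_dchar_le[OF q, of \<omega> a] by (intro mult_mono B) auto
      then show "norm (cnj (\<omega> a) / ?ph * (\<Prod>p\<in>A. 1 / (1 - \<omega> p * dpow s p))) \<le> B / real (totient q)"
        unfolding norm_mult norm_divide using ph by (simp add: divide_right_mono)
    qed
    also have "\<dots> = real (card ?O) * (B / real (totient q))" by simp
    also have "\<dots> \<le> real (totient q) * (B / real (totient q))"
    proof (rule mult_right_mono)
      have "card ?O \<le> card {\<omega>. dchar q \<omega>}" by (rule card_mono[OF finite_dchar[OF q]]) auto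
      then show "real (card ?O) \<le> real (totient q)" using card_dchar[OF q] by simp
    qed (use B0 in auto)
    finally show ?thesis using ph by simp
  qed
  ultimately show ?thesis by blast
qed

context saddle
begin

text \<open>Each frequency contributes an Euler product bounded by \<open>B\<close>, times an
  integral kernel bounded by \<open>3 * exp (X * \<alpha>)\<close> since
  \<open>2 / (7/8) < 3\<close>. The binomial weights sum to 1, so the number of frequencies does not
  enter.\<close>

lemma smoothed_deviation:
  assumes q: "q > 0" and cop: "\<And>p. p \<in> A \<Longrightarrow> coprime p q" and a: "coprime a q" and V: "V \<ge> 0" and B0: "B \<ge> 0"
    and B: "\<And>\<omega> t. dchar q \<omega> \<Longrightarrow> \<omega> \<noteq> principal q \<Longrightarrow> \<bar>t\<bar> \<le> real M * \<kappa> \<Longrightarrow> norm (\<Prod>p\<in>A. 1 / (1 - \<omega> p * dpow (Complex \<alpha> t) p)) \<le> B"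
    and k: "\<kappa> \<ge> 0"
  shows "\<exists>D. ((\<lambda>n. classdev q a n * wsmooth \<alpha> M \<kappa> V (X - lnn n)) has_sum D) (smooth A) \<and> \<bar>D\<bar> \<le> 3 * exp (X * \<alpha>) * B"
proof -
  define s where "s = (\<lambda>j. Complex \<alpha> ((real j - real M) * \<kappa>))"
  define K where "K j = (1 - exp (- s j * of_real V)) / s j * exp (s j * of_real X)" for j
  define b where "b j = bwt M j" for j
  have "\<exists>F. ((\<lambda>n. of_real (classdev q a n) * dpow (s j) n) has_sum F) (smooth A) \<and> norm F \<le> B" if j: "j \<le> 2 * M" for j
  proof (rule classdev_has_sum)
    have "\<bar>real j - real M\<bar> \<le> real M" using j by auto
    then have "\<bar>(real j - real M) * \<kappa>\<bar> \<le> real M * \<kappa>" using k by (simp add: abs_mult mult_right_mono)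
    then show "norm (\<Prod>p\<in>A. 1 / (1 - \<omega> p * dpow (s j) p)) \<le> B" if "dchar q \<omega>" "\<omega> \<noteq> principal q" for \<omega>
      unfolding s_def by (rule B[OF that])
  qed (use q cop a basics(1,2,6) B0 in \<open>auto simp: s_def\<close>)
  then obtain F where F: "\<And>j. j \<le> 2 * M \<Longrightarrow> ((\<lambda>n. of_real (classdev q a n) * dpow (s j) n) has_sum F j) (smooth A)"
    "\<And>j. j \<le> 2 * M \<Longrightarrow> norm (F j) \<le> B" by metis
  have "((\<lambda>n. \<Sum>j\<le>2*M. of_real (b j) * K j * (of_real (classdev q a n) * dpow (s j) n)) has_sum (\<Sum>j\<le>2*M. of_real (b j) * K j * F j)) (smooth A)"
    by (intro has_sum_finite_sum has_sum_cmult_right F) auto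
  from has_sum_Re[OF this]
  have "((\<lambda>n. Re (\<Sum>j\<le>2*M. of_real (b j) * K j * (of_real (classdev q a n) * dpow (s j) n))) has_sum Re (\<Sum>j\<le>2*M. of_real (b j) * K j * F j)) (smooth A)" .
  moreover have "Re (\<Sum>j\<le>2*M. of_real (b j) * K j * (of_real (classdev q a n) * dpow (s j) n)) = classdev q a n * wsmooth \<alpha> M \<kappa> V (X - lnn n)"
    if n: "n \<in> smooth A" for n
  proof -
    have "(\<Sum>j\<le>2*M. of_real (b j) * K j * (of_real (classdev q a n) * dpow (s j) n)) =
        of_real (classdev q a n) * (\<Sum>j\<le>2*M. of_real (b j) * ((1 - exp (- s j * of_real V)) / s j * exp (s j * of_real X) * dpow (s j) n))"
      unfolding sum_distrib_left by (rule sum.cong[OF refl]) (simp add: K_def mult_ac)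
    then show ?thesis
      using wsmooth_expansion[OF basics(6) V smooth_pos[OF n], of M \<kappa> X] unfolding s_def b_def by simp
  qed
  ultimately have "((\<lambda>n. classdev q a n * wsmooth \<alpha> M \<kappa> V (X - lnn n)) has_sum Re (\<Sum>j\<le>2*M. of_real (b j) * K j * F j)) (smooth A)"
    by (simp cong: has_sum_cong)
  moreover have "\<bar>Re (\<Sum>j\<le>2*M. of_real (b j) * K j * F j)\<bar> \<le> 3 * exp (X * \<alpha>) * B"
  proof -
    have "\<bar>Re (\<Sum>j\<le>2*M. of_real (b j) * K j * F j)\<bar> \<le> norm (\<Sum>j\<le>2*M. of_real (b j) * K j * F j)" by (rule abs_Re_le_cmod)
    also have "\<dots> \<le> (\<Sum>j\<le>2*M. b j * (3 * exp (X * \<alpha>) * B))"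
    proof (rule sum_norm_le)
      fix j assume j: "j \<in> {..2*M}"
      have b0: "b j \<ge> 0" by (simp add: b_def)
      have ns: "norm (s j) \<ge> 7/8" using \<alpha>(1) abs_Re_le_cmod[of "s j"] by (simp add: s_def)
      have "norm (exp (- s j * of_real V)) \<le> 1" using basics(6) V by (simp add: norm_exp_eq_Re s_def)
      then have "norm (1 - exp (- s j * of_real V)) \<le> 2" using norm_triangle_ineq4[of 1 "exp (- s j * of_real V)"] unfolding norm_one by linarith
      then have "norm (1 - exp (- s j * of_real V)) / norm (s j) \<le> 2 / (7/8)" using ns by (intro frac_le) auto
      also have "2 / (7/8) \<le> (3::real)" by simp
      finally have n1: "norm (1 - exp (- s j * of_real V)) / norm (s j) \<le> 3" .
      have "norm (K j) = norm (1 - exp (- s j * of_real V)) / norm (s j) * exp (X * \<alpha>)"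
        by (simp add: K_def norm_mult norm_divide norm_exp_eq_Re s_def mult.commute)
      also have "\<dots> \<le> 3 * exp (X * \<alpha>)" using n1 by (rule mult_right_mono) auto
      finally have "norm (K j) * norm (F j) \<le> 3 * exp (X * \<alpha>) * B" using F(2)[of j] j by (intro mult_mono) auto
      then have "b j * (norm (K j) * norm (F j)) \<le> b j * (3 * exp (X * \<alpha>) * B)" using b0 by (rule mult_left_mono)
      then show "norm (of_real (b j) * K j * F j) \<le> b j * (3 * exp (X * \<alpha>) * B)" using b0 by (simp add: norm_mult mult.assoc)
    qed
    also have "\<dots> = (\<Sum>j\<le>2*M. b j) * (3 * exp (X * \<alpha>) * B)" by (rule sum_distrib_right[symmetric])
    also have "(\<Sum>j\<le>2*M. b j) = 1" unfolding b_def by (rule sum_binomial_weights)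
    finally show ?thesis by simp
  qed
  ultimately show ?thesis by blast
qed

end

lemma sum_classdev:
  assumes "finite S"
  shows "(\<Sum>n\<in>S. classdev q a n) = real (card {n\<in>S. [n = a] (mod q)}) - real (card S) / real (totient q)"
proof -
  have "(\<Sum>n\<in>S. classdev q a n) = (\<Sum>n\<in>S. if [n = a] (mod q) then 1 else 0) - real (card S) / real (totient q)"
    unfolding classdev_def sum_subtractf by simp
  also have "(\<Sum>n\<in>S. if [n = a] (mod q) then 1 else (0::real)) = (\<Sum>n\<in>{n\<in>S. [n = a] (mod q)}. 1)"
    using assms by (intro sum.inter_filter[symmetric])
  finally show ?thesis by simp
qed

section \<open>From the smoothed to the sharp count\<close>

context saddle
begin

lemma one_le_weight:
  assumes "n > 0" "real n \<le> exp (X + \<eta>)" "0 \<le> \<eta>" "\<eta> \<le> 1/2"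
  shows "1 \<le> 2 * (exp (X * \<alpha>) * npow n \<alpha>)"
proof -
  have "lnn n \<le> ln (exp (X + \<eta>))" using assms by (intro ln_mono) auto
  then have "\<alpha> * (X - lnn n) \<ge> \<alpha> * (- \<eta>)" using basics(6) by (intro mult_left_mono) auto
  moreover have "\<alpha> * (- \<eta>) \<ge> 1 * (- \<eta>)" using \<alpha> assms by (intro mult_right_mono_neg) auto
  ultimately have "exp (- \<eta>) \<le> exp (\<alpha> * (X - lnn n))" by simp
  moreover have "exp (- \<eta>) \<ge> 1/2" using exp_ge_add_one_self[of "- \<eta>"] assms by linarith
  ultimately show ?thesis using powr_le_dist[OF assms(1)] by linarith
qed

text \<open>Beyond \<open>exp (X ^ 2)\<close> the periodic bump may peak again and its decay is of
  no use. Rankin's trick with shift \<open>1 / T\<close> gains \<open>exp (- X ^ 2 / T)\<close>,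
  while the Euler product grows by at most \<open>exp (O(X))\<close> at the saddle point.\<close>

lemma tail_weight:
  shows "(\<lambda>n. npow n \<alpha>) summable_on {n \<in> smooth A. real n > exp (X ^ 2)}"
    "infsum (\<lambda>n. npow n \<alpha>) {n \<in> smooth A. real n > exp (X ^ 2)} \<le> Zp A \<alpha> * exp (112 * exp (C + 1) * X - X ^ 2 / T)"
proof -
  have T0: "T > 0" using basics by linarith
  have "1 / T \<le> 1 / 8" using basics by (intro divide_left_mono) auto
  then have s: "\<alpha> - 1 / T \<ge> 1/2" using \<alpha> by linarith
  have pos: "\<alpha> - 1 / T > 0" "1 / T \<ge> 0" using s T0 by auto
  show "(\<lambda>n. npow n \<alpha>) summable_on {n \<in> smooth A. real n > exp (X ^ 2)}"
    by (rule rankin_tail_infsum(1)[OF basics(1) basics(2) pos])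
  have "infsum (\<lambda>n. npow n \<alpha>) {n \<in> smooth A. real n > exp (X ^ 2)} \<le> exp (- (1 / T) * X ^ 2) * Zp A (\<alpha> - 1 / T)"
    by (rule rankin_tail_infsum(2)[OF basics(1) basics(2) pos])
  also have "\<dots> \<le> exp (- (1 / T) * X ^ 2) * (Zp A \<alpha> * exp (7 / T * (\<Sum>p\<in>A. lnn p * npow p \<alpha>)))"
    by (intro mult_left_mono Zp_ratio_upper) (use basics(1,3) s T0 in auto)
  also have "\<dots> \<le> exp (- (1 / T) * X ^ 2) * (Zp A \<alpha> * exp (112 * exp (C + 1) * X))"
  proof -
    have "(\<Sum>p\<in>A. lnn p * npow p \<alpha>) \<le> 2 * T * exp (T * (1 - \<alpha>))"
      using T C T0 \<alpha> pint_subset_logint by (intro sum_pint_ln_powr_le(1)[OF mass]) (auto simp: A)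
    also have "\<dots> \<le> 2 * T * (8 * exp (C + 1) * X)" using ea T0 by (intro mult_left_mono) auto
    finally have "7 / T * (\<Sum>p\<in>A. lnn p * npow p \<alpha>) \<le> 7 / T * (2 * T * (8 * exp (C + 1) * X))"
      using T0 by (intro mult_left_mono) auto
    also have "\<dots> = 112 * exp (C + 1) * X" using T0 by simp
    finally show ?thesis using basics(7) by (intro mult_left_mono) auto
  qed
  also have "\<dots> = Zp A \<alpha> * exp (112 * exp (C + 1) * X - X ^ 2 / T)" by (simp add: exp_diff exp_minus field_simps)
  finally show "infsum (\<lambda>n. npow n \<alpha>) {n \<in> smooth A. real n > exp (X ^ 2)} \<le> Zp A \<alpha> * exp (112 * exp (C + 1) * X - X ^ 2 / T)" .
qed

text \<open>For \<open>n\<close> below \<open>exp (X - \<eta>)\<close> the smoothed weight is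
  \<open>cs\<close> up to a negligible error; \<open>boundary_count\<close> covers the layer around
  \<open>exp X\<close>; further out the weight is small by the decay of the bump, and beyond
  \<open>exp (X ^ 2)\<close> by \<open>tail_weight\<close>. The hypotheses on \<open>M\<close> make
  the bump at distance \<open>\<eta>\<close> as small as \<open>exp (- X ^ 3 / 16)\<close>, which
  outweighs every factor \<open>exp X\<close>.\<close>

lemma class_count_close:
  assumes q: "q > 0" and cop: "\<And>p. p \<in> A \<Longrightarrow> coprime p q" and a: "coprime a q"
    and eta: "0 < \<eta>" "\<eta> \<le> 1/2" "ln (1 / \<eta>) \<le> T / 2" and \<epsilon>: "\<epsilon> \<ge> 0"
    and M: "X ^ 3 \<le> real M * (\<eta> / X ^ 2) ^ 2" "real M * (\<eta> / X ^ 2) ^ 2 \<le> 2 * X ^ 3"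
    and B: "\<And>\<omega> t. dchar q \<omega> \<Longrightarrow> \<omega> \<noteq> principal q \<Longrightarrow> \<bar>t\<bar> \<le> real M / X ^ 2 \<Longrightarrow> norm (\<Prod>p\<in>A. 1 / (1 - \<omega> p * dpow (Complex \<alpha> t) p)) \<le> Zp A \<alpha> * \<epsilon>"
  shows "\<bar>real (card {n \<in> smooth A. real n \<le> exp X \<and> [n = a] (mod q)}) - real (card (smooth_le A (exp X))) / real (totient q)\<bar> \<le>
    exp (X * \<alpha>) * Zp A \<alpha> * (2 * X ^ 2 / \<eta> * (3 * \<epsilon> + 3 * ((X + 1) * (exp X * exp (- (X ^ 3 / 16)))) + (X + 1) * exp (112 * exp (C + 1) * X - X ^ 2 / T))
      + (80 * exp (C + 1) * X * \<eta> + 2 * exp (- (X / (16 * exp (C + 1) * T ^ 2)))))"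
proof -
  \<comment> \<open>The period is then \<open>2 * pi * X ^ 2\<close>, so for all \<open>n\<close> up
    to \<open>exp (X ^ 2)\<close> the interval of integration meets no peak other than the one at
    0.\<close>
  define \<kappa> where "\<kappa> = 1 / X ^ 2"
  \<comment> \<open>The lower end of the interval is \<open>- 1 - ln n\<close>, below
    \<open>- \<eta>\<close> for every \<open>n \<ge> 1\<close>.\<close>
  define V where "V = X + 1"
  define W where "W n = wsmooth \<alpha> M \<kappa> V (X - lnn n)" for n :: nat
  define d where "d = classdev q a"
  define \<delta> where "\<delta> = exp (- real M * (\<kappa> * \<eta> / 2)\<^sup>2 / 4)"
  define cs where "cs = integral {-\<eta>..\<eta>} (\<lambda>w. exp (\<alpha> * w) * bump M \<kappa> w)"
  define j where "j = V * (exp X * \<delta>)"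
  define E where "E = exp (X * \<alpha>) * Zp A \<alpha>"
  define R where "R = exp (112 * exp (C + 1) * X - X ^ 2 / T)"
  let ?S0 = "smooth_le A (exp X)"
  let ?F = "(smooth_le A (exp (X + \<eta>)))"
  let ?Bd = "{n \<in> smooth A. exp (X - \<eta>) \<le> real n \<and> real n \<le> exp (X + \<eta>)}"
  let ?Tl = "{n \<in> smooth A. real n > exp (X ^ 2)}"
  let ?WT = "V * exp (X * \<alpha>) * (\<delta> * Zp A \<alpha> + infsum (\<lambda>n. npow n \<alpha>) ?Tl)"
  have X28: "X \<ge> 28" and X0: "X > 0" using basics by auto
  have V0: "V \<ge> 0" using X0 by (simp add: V_def)
  have E0: "E > 0" using basics(7) by (simp add: E_def)
  have k0: "\<kappa> > 0" using X0 by (simp add: \<kappa>_def)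
  have XX: "X + 2 \<le> X ^ 2" "1 \<le> X ^ 2"
  proof -
    have "28 * X \<le> X * X" using X28 X0 by (intro mult_right_mono) auto
    then show "X + 2 \<le> X ^ 2" "1 \<le> X ^ 2" unfolding power2_eq_square using X28 by linarith+
  qed
  have kpi: "\<kappa> * z \<le> pi" if "z \<le> 2 * X ^ 2" for z
  proof -
    have "\<kappa> * z \<le> \<kappa> * (2 * X ^ 2)" using k0 that by (intro mult_left_mono) auto
    also have "\<dots> = 2" using X0 by (simp add: \<kappa>_def)
    finally show ?thesis using pi_ge_two by linarith
  qed
  have ke: "\<kappa> * \<eta> / 2 \<le> 1"
  proof -
    have "\<kappa> \<le> 1" using XX(2) by (simp add: \<kappa>_def divide_le_eq)
    then have "\<kappa> * \<eta> \<le> 1 * 1" using eta k0 by (intro mult_mono) auto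
    then show ?thesis by simp
  qed
  have \<delta>_nn: "\<delta> \<ge> 0" by (simp add: \<delta>_def)
  have kE: "\<kappa> * \<eta> = \<eta> / X ^ 2" by (simp add: \<kappa>_def)
  have \<delta>_le: "\<delta> \<le> exp (- (X ^ 3 / 16))"
    using M(1) unfolding \<delta>_def kE by (simp add: power_divide)
  \<comment> \<open>The length used for the half height is \<open>\<eta> / X ^ 2\<close>: the upper
    hypothesis on \<open>M\<close> makes the loss in Bernoulli's inequality at most
    \<open>1 / (2 * X)\<close>.\<close>
  have cs: "cs \<ge> \<eta> / (2 * X ^ 2)"
  proof -
    have "cs \<ge> (\<eta> / X ^ 2) / 2" unfolding cs_def
    proof (rule bump_mass_ge[OF k0 eta(1) ke])
      show "0 < \<eta> / X ^ 2" using eta X0 by simp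
      have "\<eta> / X ^ 2 \<le> \<eta> / 1" using eta XX by (intro divide_left_mono) auto
      then show "\<eta> / X ^ 2 \<le> \<eta>" by simp
      have "real M * (\<kappa> * (\<eta> / X ^ 2) / 2)\<^sup>2 = real M * (\<eta> / X ^ 2) ^ 2 * (1 / (4 * X ^ 4))"
        by (simp add: \<kappa>_def power_divide power_mult_distrib power_mult[symmetric])
      also have "\<dots> \<le> 2 * X ^ 3 * (1 / (4 * X ^ 4))" using M(2) by (intro mult_right_mono) auto
      also have "\<dots> = 1 / (2 * X)" using X0 by (simp add: power_eq_if field_simps)
      also have "\<dots> \<le> 1 / 2" using X28 by simp
      finally show "real M * (\<kappa> * (\<eta> / X ^ 2) / 2)\<^sup>2 \<le> 1/2" .
    qed (use basics(6) in auto)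
    then show ?thesis by simp
  qed
  have cs0: "cs > 0" by (rule less_le_trans[OF _ cs]) (use eta X0 in simp)
  have Wnn: "W n \<ge> 0" for n unfolding W_def by (rule wsmooth_nonneg)
  have dle: "\<bar>d n\<bar> \<le> 1" for n unfolding d_def by (rule abs_classdev_le[OF q])
  have j0: "j \<ge> 0" using V0 by (simp add: j_def \<delta>_def)
  have Wnear: "W n \<le> cs + j" if n: "n \<in> ?F" for n
  proof -
    have n0: "n > 0" using n smooth_pos by auto
    have "lnn n \<le> ln (exp (X + \<eta>))" using n n0 by (intro ln_mono) auto
    then have l: "lnn n \<le> X + \<eta>" "lnn n \<ge> 0" using n0 by (auto simp: Suc_leI)
    show ?thesis unfolding W_def cs_def j_def \<delta>_def
      by (rule wsmooth_le_near[OF k0 eta(1) ke V0]) (use basics(6) \<alpha> l X0 XX eta in \<open>auto simp: V_def intro!: kpi\<close>)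
  qed
  have Wge: "W n \<ge> cs" if n: "n \<in> ?F" "n \<notin> ?Bd" for n
  proof -
    have n0: "n > 0" using n smooth_pos by auto
    have "real n \<le> exp (X - \<eta>)" using n by auto
    then have "lnn n \<le> ln (exp (X - \<eta>))" using n0 by (intro ln_mono) auto
    then have l: "lnn n \<le> X - \<eta>" "lnn n \<ge> 0" using n0 by (auto simp: Suc_leI)
    show ?thesis unfolding W_def cs_def by (rule wsmooth_ge) (use l eta in \<open>auto simp: V_def\<close>)
  qed
  \<comment> \<open>A summable majorant of the weights beyond \<open>exp (X + \<eta>)\<close>: the
    decay \<open>\<delta>\<close> is available everywhere except on the far tail, which is weighted
    in full.\<close>
  define wt where "wt n = V * exp (X * \<alpha>) * (\<delta> * npow n \<alpha> + (if n \<in> ?Tl then npow n \<alpha> else 0))" for n :: nat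
  have Wtail: "W n \<le> wt n" if n: "n \<in> smooth A - ?F" for n
  proof -
    have n0: "n > 0" and ns: "n \<in> smooth A" using n smooth_pos by auto
    have w: "exp (X * \<alpha>) * npow n \<alpha> = exp (\<alpha> * (X - lnn n))" by (rule powr_le_dist[OF n0])
    have "real n \<ge> exp (X + \<eta>)" using n by auto
    then have "lnn n \<ge> ln (exp (X + \<eta>))" using n0 by (intro ln_mono) auto
    then have l: "lnn n \<ge> X + \<eta>" by simp
    show ?thesis
    proof (cases "n \<in> ?Tl")
      case True
      have "W n \<le> V * exp (\<alpha> * (X - lnn n))" unfolding W_def by (rule wsmooth_le_trivial[OF V0]) (use basics(6) in auto)
      also have "\<dots> \<le> wt n" unfolding w[symmetric] wt_def using True V0 by (simp add: algebra_simps \<delta>_def)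
      finally show ?thesis .
    next
      case False
      then have "real n \<le> exp (X ^ 2)" using ns by auto
      then have "lnn n \<le> ln (exp (X ^ 2))" using n0 by (intro ln_mono) auto
      then have l2: "lnn n \<le> X ^ 2" by simp
      have "W n \<le> V * (exp (\<alpha> * (X - lnn n)) * \<delta>)" unfolding W_def \<delta>_def
        by (rule wsmooth_le_far[OF k0 eta(1) ke V0]) (use basics(6) l l2 X28 XX in \<open>auto simp: V_def intro!: kpi\<close>)
      also have "\<dots> = wt n" unfolding w[symmetric] wt_def if_not_P[OF False] by (simp add: mult_ac)
      finally show ?thesis .
    qed
  qed
  have wtnn: "wt n \<ge> 0" for n using V0 by (auto simp: wt_def \<delta>_def)
  have wt_sum: "(wt has_sum ?WT) (smooth A)"
    unfolding wt_def
  proof (intro has_sum_cmult_right has_sum_add)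
    show "((\<lambda>n. npow n \<alpha>) has_sum Zp A \<alpha>) (smooth A)" by (rule Zp_has_sum) (use basics(1,2,6) in auto)
    have "((\<lambda>n. npow n \<alpha>) has_sum infsum (\<lambda>n. npow n \<alpha>) ?Tl) ?Tl"
      using tail_weight(1) by (rule has_sum_infsum)
    then show "((\<lambda>n. if n \<in> ?Tl then npow n \<alpha> else 0) has_sum infsum (\<lambda>n. npow n \<alpha>) ?Tl) (smooth A)"
      by (rule has_sum_cong_neutral[THEN iffD1, rotated -1]) auto
  qed
  have wt_le: "?WT \<le> E * (V * (\<delta> + R))"
  proof -
    have "?WT \<le> V * exp (X * \<alpha>) * (\<delta> * Zp A \<alpha> + Zp A \<alpha> * R)"
      unfolding R_def using V0 tail_weight(2) by (intro mult_left_mono) auto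
    then show ?thesis by (simp add: E_def algebra_simps)
  qed
  obtain D where D: "((\<lambda>n. d n * W n) has_sum D) (smooth A)" "\<bar>D\<bar> \<le> 3 * exp (X * \<alpha>) * (Zp A \<alpha> * \<epsilon>)"
  proof -
    have "\<exists>D. ((\<lambda>n. classdev q a n * wsmooth \<alpha> M \<kappa> V (X - lnn n)) has_sum D) (smooth A) \<and> \<bar>D\<bar> \<le> 3 * exp (X * \<alpha>) * (Zp A \<alpha> * \<epsilon>)"
      by (rule smoothed_deviation) (use q cop a V0 k0 \<epsilon> basics(7) B in \<open>auto simp: \<kappa>_def\<close>)
    then show thesis using that unfolding d_def W_def by blast
  qed
  have finF: "finite ?F" and finS0: "finite ?S0" by (rule finite_smooth_le)+
  define D1 where "D1 = (\<Sum>n\<in>?F. d n * W n)"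
  have tail: "((\<lambda>n. d n * W n) has_sum (D - D1)) (smooth A - ?F)"
    unfolding D1_def by (intro has_sum_Diff D(1) has_sum_finite finF) auto
  have tail_le: "\<bar>D - D1\<bar> \<le> E * (V * (\<delta> + R))"
  proof -
    have b: "- wt n \<le> d n * W n" "d n * W n \<le> wt n" if n: "n \<in> smooth A - ?F" for n
    proof -
      have "\<bar>d n * W n\<bar> \<le> 1 * wt n" unfolding abs_mult using Wtail[OF n] Wnn[of n] by (intro mult_mono dle) auto
      then show "- wt n \<le> d n * W n" "d n * W n \<le> wt n" by linarith+
    qed
    have "D - D1 \<le> ?WT"
      by (rule has_sum_mono_neutral[OF tail wt_sum]) (use b wtnn in auto)
    moreover have "((\<lambda>n. - (d n * W n)) has_sum (- (D - D1))) (smooth A - ?F)" using tail by (simp add: has_sum_uminus)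
    then have "- (D - D1) \<le> ?WT"
    proof (rule has_sum_mono_neutral[OF _ wt_sum])
      show "- (d n * W n) \<le> wt n" if "n \<in> (smooth A - ?F) \<inter> smooth A" for n using b(1)[of n] that by auto
    qed (use wtnn in auto)
    ultimately show ?thesis using wt_le by linarith
  qed
  have S0F: "?S0 \<subseteq> ?F"
  proof
    fix n assume n: "n \<in> ?S0"
    have "exp X \<le> exp (X + \<eta>)" using eta by simp
    then show "n \<in> ?F" using n by (auto intro: order_trans)
  qed
  have "(\<Sum>n\<in>?S0. d n) = (\<Sum>n\<in>?F. if n \<in> ?S0 then d n else 0)"
    unfolding sum.inter_restrict[OF finF, symmetric] Int_absorb1[OF S0F] ..
  then have D1_eq: "D1 - cs * (\<Sum>n\<in>?S0. d n) = (\<Sum>n\<in>?F. d n * W n - cs * (if n \<in> ?S0 then d n else 0))"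
    unfolding D1_def by (simp only: sum_subtractf sum_distrib_left)
  have "\<bar>D1 - cs * (\<Sum>n\<in>?S0. d n)\<bar> \<le> (\<Sum>n\<in>?F. j + (if n \<in> ?Bd then cs else 0))"
    unfolding D1_eq
  proof (rule order_trans[OF sum_abs], rule sum_mono)
    fix n assume n: "n \<in> ?F"
    define i where "i = (if n \<in> ?S0 then 1 else 0 :: real)"
    have "d n * W n - cs * (if n \<in> ?S0 then d n else 0) = d n * (W n - cs * i)" by (simp add: i_def algebra_simps)
    moreover have "\<bar>W n - cs * i\<bar> \<le> j + (if n \<in> ?Bd then cs else 0)"
    proof (cases "n \<in> ?Bd")
      case True
      then show ?thesis using Wnear[OF n] Wnn[of n] cs0 j0 by (simp only: if_True) (auto simp: i_def abs_le_iff)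
    next
      case False
      have "real n < exp (X - \<eta>)" using False n by auto
      also have "\<dots> \<le> exp X" using eta by simp
      finally have "i = 1" using n by (simp add: i_def)
      then show ?thesis using Wnear[OF n] Wge[OF n False] False j0 by (simp only: if_False)
    qed
    then have "\<bar>d n\<bar> * \<bar>W n - cs * i\<bar> \<le> 1 * (j + (if n \<in> ?Bd then cs else 0))"
      by (intro mult_mono dle) auto
    ultimately show "\<bar>d n * W n - cs * (if n \<in> ?S0 then d n else 0)\<bar> \<le> j + (if n \<in> ?Bd then cs else 0)"
      by (simp only: abs_mult mult_1)
  qed
  also have "\<dots> = j * real (card ?F) + cs * real (card ?Bd)"
  proof -
    have "(\<Sum>n\<in>?F. if n \<in> ?Bd then cs else 0) = (\<Sum>n\<in>?F \<inter> ?Bd. cs)" using finF by (simp only: sum.If_cases Int_def) simp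
    moreover have "?F \<inter> ?Bd = ?Bd" by auto
    ultimately show ?thesis by (simp add: sum.distrib mult.commute)
  qed
  finally have near: "\<bar>D1 - cs * (\<Sum>n\<in>?S0. d n)\<bar> \<le> j * real (card ?F) + cs * real (card ?Bd)" .
  have cardF: "real (card ?F) \<le> 2 * E"
  proof -
    have "real (card ?F) = (\<Sum>n\<in>?F. 1)" by simp
    also have "\<dots> \<le> (\<Sum>n\<in>?F. 2 * (exp (X * \<alpha>) * npow n \<alpha>))"
      using eta smooth_pos by (intro sum_mono one_le_weight) auto
    also have "\<dots> = 2 * (\<Sum>n\<in>?F. exp (X * \<alpha>) * npow n \<alpha>)" by (simp only: sum_distrib_left)
    also have "\<dots> \<le> 2 * E" unfolding E_def using finF by (intro mult_left_mono sum_rankin) auto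
    finally show ?thesis .
  qed
  define Q where "Q = 3 * \<epsilon> + 3 * ((X + 1) * (exp X * exp (- (X ^ 3 / 16)))) + (X + 1) * R"
  have "cs * \<bar>\<Sum>n\<in>?S0. d n\<bar> = \<bar>cs * (\<Sum>n\<in>?S0. d n)\<bar>" using cs0 by (simp add: abs_mult)
  also have "\<dots> \<le> \<bar>D\<bar> + \<bar>D - D1\<bar> + \<bar>D1 - cs * (\<Sum>n\<in>?S0. d n)\<bar>" by linarith
  also have "\<dots> \<le> E * (3 * \<epsilon>) + E * (V * (\<delta> + R)) + (j * (2 * E) + cs * real (card ?Bd))"
  proof (intro add_mono tail_le)
    show "\<bar>D\<bar> \<le> E * (3 * \<epsilon>)" using D(2) by (simp add: E_def mult_ac)
    show "\<bar>D1 - cs * (\<Sum>n\<in>?S0. d n)\<bar> \<le> j * (2 * E) + cs * real (card ?Bd)"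
      using near mult_left_mono[OF cardF j0] by linarith
  qed
  also have "\<dots> = E * (3 * \<epsilon> + V * \<delta> + V * R + 2 * j) + cs * real (card ?Bd)" by (simp add: algebra_simps)
  also have "\<dots> \<le> E * Q + cs * real (card ?Bd)"
  proof -
    have "1 * \<delta> \<le> exp X * exp (- (X ^ 3 / 16))" using \<delta>_le X0 by (intro mult_mono) (auto simp: \<delta>_nn)
    then have "V * \<delta> \<le> (X + 1) * (exp X * exp (- (X ^ 3 / 16)))" using V0 unfolding V_def by (intro mult_left_mono) auto
    moreover have "j \<le> (X + 1) * (exp X * exp (- (X ^ 3 / 16)))" unfolding j_def V_def using \<delta>_le X0 by (intro mult_left_mono) auto
    ultimately have "3 * \<epsilon> + V * \<delta> + V * R + 2 * j \<le> Q" unfolding Q_def V_def by argo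
    then show ?thesis using E0 by (intro add_right_mono mult_left_mono) auto
  qed
  finally have "cs * \<bar>\<Sum>n\<in>?S0. d n\<bar> \<le> E * Q + cs * real (card ?Bd)" .
  then have "\<bar>\<Sum>n\<in>?S0. d n\<bar> \<le> E * Q / cs + real (card ?Bd)" using cs0 by (simp add: field_simps)
  also have "\<dots> \<le> E * Q / (\<eta> / (2 * X ^ 2)) + real (card ?Bd)"
  proof (intro add_right_mono divide_left_mono cs)
    show "0 \<le> E * Q" using E0 \<epsilon> X0 by (auto simp: Q_def R_def)
    show "0 < cs * (\<eta> / (2 * X ^ 2))" using cs0 eta X0 by simp
  qed
  also have "\<dots> \<le> E * Q / (\<eta> / (2 * X ^ 2)) + E * (80 * exp (C + 1) * X * \<eta> + 2 * exp (- (X / (16 * exp (C + 1) * T ^ 2))))"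
    unfolding E_def by (intro add_left_mono boundary_count eta)
  also have "E * Q / (\<eta> / (2 * X ^ 2)) = E * (2 * X ^ 2 / \<eta> * Q)" by (simp add: mult_ac)
  finally have "\<bar>\<Sum>n\<in>?S0. d n\<bar> \<le> E * (2 * X ^ 2 / \<eta> * Q + (80 * exp (C + 1) * X * \<eta> + 2 * exp (- (X / (16 * exp (C + 1) * T ^ 2)))))"
    by (simp only: distrib_left)
  moreover have "(\<Sum>n\<in>?S0. d n) = real (card {n \<in> smooth A. real n \<le> exp X \<and> [n = a] (mod q)}) - real (card ?S0) / real (totient q)"
    unfolding d_def sum_classdev[OF finS0] by (simp add: conj_assoc)
  ultimately show ?thesis unfolding Q_def R_def E_def by simp
qed

end

section \<open>The range of small y\<close>

lemma powr_exp_decay: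
  fixes a b d :: real
  assumes "b > 0" "d > 0"
  shows "((\<lambda>X. X powr a * exp (- (b * X powr d))) \<longlongrightarrow> 0) at_top"
  using assms by real_asymp

lemma powr_exp_decay_le:
  fixes a b d e :: real
  assumes "b > 0" "d > 0" "e > 0"
  shows "eventually (\<lambda>X. X powr a * exp (- (b * X powr d)) \<le> e) at_top"
  using order_tendstoD(2)[OF powr_exp_decay[OF assms(1,2), of a] assms(3)] by eventually_elim simp

definition errterm :: "real \<Rightarrow> real \<Rightarrow> real \<Rightarrow> real \<Rightarrow> real" where
  "errterm C1 \<epsilon> X T = 3 * \<epsilon> + 3 * ((X + 1) * (exp X * exp (- (X ^ 3 / 16)))) + (X + 1) * exp (112 * C1 * X - X ^ 2 / T)"

text \<open>\<open>b\<close> will be \<open>K''\<close>. The exponent \<open>36/5 + b\<close> is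
  \<open>7 + 1/5 + b\<close>: the loss in \<open>count_lower\<close>, the saving to be proved, and a
  bound for \<open>totient q\<close>. The boundary term is of size \<open>X * \<eta>\<close> with
  \<open>\<eta> = X powr (- (9 + b))\<close>, leaving \<open>X powr (- 4/5)\<close> to spare.
  Everything else is exponentially small in \<open>X powr (3/8)\<close>, \<open>X powr (1/2)\<close>
  or \<open>X\<close>, which is where \<open>T \<le> X powr (1/4)\<close> enters.\<close>

lemma errterm_small:
  fixes b c C1 :: real
  assumes c: "c > 0" and C1: "C1 > 0"
  shows "eventually (\<lambda>X. \<forall>T. 0 < T \<longrightarrow> T \<le> X powr (1/4) \<longrightarrow>
     2 * X ^ 2 / X powr (- (9 + b)) * errterm C1 (exp (- (c / 3 * sqrt (X / (16 * T))))) X T +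
       (80 * C1 * X * X powr (- (9 + b)) + 2 * exp (- (X / (16 * C1 * T ^ 2)))) \<le> X powr (- (36/5 + b))) at_top"
proof -
  define u where "u = 11 + b + (36/5 + b)"
  have e1: "eventually (\<lambda>X. X powr u * exp (- (c / 12 * X powr (3/8))) \<le> 1 / 100) at_top"
    and e2: "eventually (\<lambda>X. X powr (u + 1) * exp (- (1 * X powr 1)) \<le> 1 / 100) at_top"
    and e3: "eventually (\<lambda>X. X powr (36/5 + b) * exp (- (1 / (16 * C1) * X powr (1/2))) \<le> 1 / 100) at_top"
    by (rule powr_exp_decay_le; use c C1 in simp)+
  have e4: "eventually (\<lambda>X::real. X - X ^ 3 / 16 \<le> - X) at_top" by real_asymp
  have e5: "eventually (\<lambda>X. 112 * C1 * X - X powr (7/4) \<le> - X) at_top" using C1 by real_asymp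
  have e6: "eventually (\<lambda>X. 80 * C1 * X powr (- (4/5)) \<le> 1 / 100) at_top" using C1 by real_asymp
  show ?thesis using e1 e2 e3 e4 e5 e6 eventually_ge_at_top[of 1]
  proof eventually_elim
    case (elim X)
    show ?case
    proof (intro allI impI)
      fix T assume T: "0 < T" "T \<le> X powr (1/4)"
      have X: "X \<ge> 1" "X > 0" using elim by auto
      define P where "P = X powr (36/5 + b)"
      have P: "P > 0" using X by (simp add: P_def)
      have pre: "2 * X ^ 2 / X powr (- (9 + b)) = 2 * X powr (11 + b)"
      proof -
        have "2 * X ^ 2 / X powr (- (9 + b)) = 2 * (X powr 2 * X powr (9 + b))"
          unfolding powr_minus divide_inverse inverse_inverse_eq using X by (simp add: powr_numeral)
        also have "\<dots> = 2 * X powr (11 + b)" unfolding powr_add[symmetric] by simp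
        finally show ?thesis .
      qed
      have uP: "X powr (11 + b) * P = X powr u" by (simp only: P_def u_def powr_add)
      have eps: "exp (- (c / 3 * sqrt (X / (16 * T)))) \<le> exp (- (c / 12 * X powr (3/8)))"
      proof -
        have "X powr (3/4) / 16 \<le> X / (16 * T)"
        proof -
          have "X powr (3/4) * T \<le> X powr (3/4) * X powr (1/4)" using T by (intro mult_left_mono) auto
          also have "\<dots> = X" using X by (simp add: powr_add[symmetric])
          finally show ?thesis using T by (simp add: field_simps)
        qed
        then have "sqrt (X powr (3/4) / 16) \<le> sqrt (X / (16 * T))" by (rule real_sqrt_le_mono)
        moreover have "sqrt (X powr (3/4) / 16) = X powr (3/8) / 4"
        proof (rule real_sqrt_unique)
          have "(X powr (3/8)) ^ 2 = X powr (3/4)" using X by (simp add: powr_power)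
          then show "(X powr (3/8) / 4) ^ 2 = X powr (3/4) / 16" by (simp add: power_divide)
        qed simp
        ultimately have "c / 3 * (X powr (3/8) / 4) \<le> c / 3 * sqrt (X / (16 * T))" using c by (intro mult_left_mono) auto
        then show ?thesis by simp
      qed
      have t1: "X powr (11 + b) * P * exp (- (c / 3 * sqrt (X / (16 * T)))) \<le> 1 / 100"
      proof -
        have "X powr u * exp (- (c / 3 * sqrt (X / (16 * T)))) \<le> X powr u * exp (- (c / 12 * X powr (3/8)))" using eps by (intro mult_left_mono) auto
        then show ?thesis unfolding uP using elim(1) by linarith
      qed
      have t23: "X powr (11 + b) * P * ((X + 1) * z) \<le> 2 / 100" if z: "z \<le> exp (- X)" "z \<ge> 0" for z
      proof -
        have "X powr u * ((X + 1) * z) \<le> X powr u * ((2 * X) * exp (- X))" using X z by (intro mult_left_mono mult_mono) auto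
        also have "\<dots> = 2 * (X powr (u + 1) * exp (- (1 * X powr 1)))" using X by (simp add: powr_add)
        finally show ?thesis unfolding uP using elim(2) by linarith
      qed
      have t2: "X powr (11 + b) * P * ((X + 1) * (exp X * exp (- (X ^ 3 / 16)))) \<le> 2 / 100"
      proof (rule t23)
        have "exp X * exp (- (X ^ 3 / 16)) = exp (X - X ^ 3 / 16)" unfolding exp_add[symmetric] by simp
        then show "exp X * exp (- (X ^ 3 / 16)) \<le> exp (- X)" using elim(4) by simp
      qed simp
      have t3: "X powr (11 + b) * P * ((X + 1) * exp (112 * C1 * X - X ^ 2 / T)) \<le> 2 / 100"
      proof (rule t23)
        have "X powr (7/4) * T \<le> X powr (7/4) * X powr (1/4)" using T by (intro mult_left_mono) auto
        also have "\<dots> = X ^ 2" using X by (simp add: powr_add[symmetric] powr_numeral)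
        finally have "X powr (7/4) \<le> X ^ 2 / T" using T by (simp add: field_simps)
        then show "exp (112 * C1 * X - X ^ 2 / T) \<le> exp (- X)" using elim(5) by simp
      qed simp
      have t4: "P * (80 * C1 * X * X powr (- (9 + b))) \<le> 1 / 100"
      proof -
        have "P * (80 * C1 * X * X powr (- (9 + b))) = 80 * C1 * (P * (X powr 1 * X powr (- (9 + b))))" using X by simp
        also have "P * (X powr 1 * X powr (- (9 + b))) = X powr (- (4/5))" unfolding P_def powr_add[symmetric] by simp
        also have "80 * C1 * X powr (- (4/5)) \<le> 1 / 100" using elim(6) .
        finally show ?thesis .
      qed
      have t5: "P * exp (- (X / (16 * C1 * T ^ 2))) \<le> 1 / 100"
      proof -
        have "T ^ 2 \<le> (X powr (1/4)) ^ 2" using T by (intro power_mono) auto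
        also have "\<dots> = X powr (1/2)" using X by (simp add: powr_power)
        finally have "X powr (1/2) * T ^ 2 \<le> X powr (1/2) * X powr (1/2)" by (intro mult_left_mono) auto
        also have "\<dots> = X" using X by (simp add: powr_add[symmetric])
        finally have "X powr (1/2) \<le> X / T ^ 2" using T by (simp add: field_simps)
        then have "1 / (16 * C1) * X powr (1/2) \<le> 1 / (16 * C1) * (X / T ^ 2)" using C1 by (intro mult_left_mono) auto
        then have "exp (- (X / (16 * C1 * T ^ 2))) \<le> exp (- (1 / (16 * C1) * X powr (1/2)))" by simp
        then have "P * exp (- (X / (16 * C1 * T ^ 2))) \<le> P * exp (- (1 / (16 * C1) * X powr (1/2)))" using P by (intro mult_left_mono) auto
        then show ?thesis using elim(3) unfolding P_def by linarith
      qed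
      let ?L = "2 * X ^ 2 / X powr (- (9 + b)) * errterm C1 (exp (- (c / 3 * sqrt (X / (16 * T))))) X T +
       (80 * C1 * X * X powr (- (9 + b)) + 2 * exp (- (X / (16 * C1 * T ^ 2))))"
      have expand: "(2 * r * (3 * x1 + 3 * x2 + x3) + (x4 + 2 * x5)) * P = 6 * (r * P * x1) + 6 * (r * P * x2) + 2 * (r * P * x3) + P * x4 + 2 * (P * x5)"
        for r x1 x2 x3 x4 x5 :: real by (simp add: algebra_simps)
      have "?L * P \<le> 1"
      proof -
        have "?L * P = 6 * (X powr (11 + b) * P * exp (- (c / 3 * sqrt (X / (16 * T))))) + 6 * (X powr (11 + b) * P * ((X + 1) * (exp X * exp (- (X ^ 3 / 16)))))
          + 2 * (X powr (11 + b) * P * ((X + 1) * exp (112 * C1 * X - X ^ 2 / T))) + P * (80 * C1 * X * X powr (- (9 + b))) + 2 * (P * exp (- (X / (16 * C1 * T ^ 2))))"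
          unfolding pre errterm_def by (rule expand)
        then show ?thesis using t1 t2 t3 t4 t5 by argo
      qed
      then have "?L \<le> 1 / P" using P by (simp add: pos_le_divide_eq)
      also have "1 / P = X powr (- (36/5 + b))" unfolding P_def powr_minus_divide ..
      finally show "?L \<le> X powr (- (36/5 + b))" .
    qed
  qed
qed

lemma coprime_pint:
  assumes "\<forall>p\<in>prime_factors q. real p < y'" "q > 0" "p \<in> pint y' y"
  shows "coprime p q"
proof -
  have p: "prime p" "y' \<le> real p" using assms(3) by (auto simp: pint_def)
  have "\<not> p dvd q"
  proof
    assume "p dvd q"
    then have "p \<in> prime_factors q" using p assms(2) by (simp add: in_prime_factors_iff)
    then have "real p < y'" using assms(1) by blast
    then show False using p by simp
  qed
  then show ?thesis using p by (intro prime_imp_coprime)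
qed

definition classes_close :: "nat set \<Rightarrow> real \<Rightarrow> nat \<Rightarrow> nat \<Rightarrow> real \<Rightarrow> bool" where
  "classes_close A z q a \<epsilon> \<longleftrightarrow>
     \<bar>real (card {n \<in> smooth A. real n \<le> z \<and> [n = a] (mod q)}) - real (card (smooth_le A z)) / real (totient q)\<bar>
       \<le> \<epsilon> * (real (card (smooth_le A z)) / real (totient q))"

definition equidistributed :: "real \<Rightarrow> real \<Rightarrow> real \<Rightarrow> (real \<Rightarrow> real) \<Rightarrow> (real \<Rightarrow> real) \<Rightarrow> bool" where
  "equidistributed X0 K' K'' lo hi \<longleftrightarrow> (\<forall>X y' T q a. X \<ge> X0 \<longrightarrow> 1 \<le> y' \<longrightarrow> ln y' \<le> K' * ln X \<longrightarrow> lo X \<le> T \<longrightarrow> T \<le> hi X \<longrightarrow>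
       q > 0 \<longrightarrow> real q \<le> X powr K'' \<longrightarrow> (\<forall>p\<in>prime_factors q. real p < y') \<longrightarrow> coprime a q \<longrightarrow>
       classes_close (pint y' (exp T)) (exp X) q a (X powr (- 1/5)))"

text \<open>\<open>K \<ge> 2 * K'\<close> puts \<open>y'\<close> below \<open>exp (T / 2)\<close>,
  so all primes used in the saddle point argument and in \<open>nonpretentious\<close> belong to
  \<open>A\<close>. \<open>K \<ge> K0 * K''\<close> lets \<open>T\<close> dominate
  \<open>ln q\<close>, the logarithm of the largest frequency, and
  \<open>ln (1 / \<eta>)\<close>.\<close>

theorem small_y_regime:
  "\<exists>K0\<ge>1. \<forall>K' K'' K. K'' > 0 \<longrightarrow> K \<ge> 2 * K' \<longrightarrow> K \<ge> K0 \<longrightarrow> K \<ge> K0 * K'' \<longrightarrow>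
     (\<exists>X0. equidistributed X0 K' K'' (\<lambda>X. K * ln X) (\<lambda>X. X powr (1/4)))"
proof -
  obtain c C2 where c: "c > 0" "C2 \<ge> (1::real)" and np: "\<And>q \<omega> t T. q > 0 \<Longrightarrow> dchar q \<omega> \<Longrightarrow> \<omega> \<noteq> principal q \<Longrightarrow> T \<ge> C2 \<Longrightarrow>
     C2 * (lnn q + ln (\<bar>t\<bar> + 2) + ln T) \<le> T \<Longrightarrow>
     (\<Sum>p\<in>logint (T / 2) T. (1 - Re (\<omega> p * dpow (Complex 0 t) p)) * (lnn p / p)) \<ge> c * T"
    using nonpretentious by blast
  obtain C where C: "C \<ge> 1" and mass: "\<And>u v. 0 \<le> u \<Longrightarrow> u \<le> v \<Longrightarrow> \<bar>mmass u v - (v - u)\<bar> \<le> C"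
    using mmass_bound by blast
  obtain Cp where Cp: "Cp \<ge> 0" "\<And>P. finite P \<Longrightarrow> (\<forall>p\<in>P. p \<ge> (2::nat)) \<Longrightarrow> (\<Sum>p\<in>P. lnn p * (real p powr (-3/2))) \<le> Cp"
    using prime_power_excess_bounded by blast
  define C1 where "C1 = exp (C + 1)"
  have C1: "C1 > 0" by (simp add: C1_def)
  have "eventually (\<lambda>T. T \<ge> 2 * ln (128 * C1 * T) * (4 * Cp + 1)) at_top" using C1 Cp(1) by real_asymp
  then obtain T0 where T0: "\<And>T. T \<ge> T0 \<Longrightarrow> T \<ge> 2 * ln (128 * C1 * T) * (4 * Cp + 1)" by (auto simp: eventually_at_top_linorder)
  have "\<exists>X0. equidistributed X0 K' K'' (\<lambda>X. K * ln X) (\<lambda>X. X powr (1/4))"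
    if K: "K'' > 0" "K \<ge> 2 * K'" "K \<ge> 50 * C2" "K \<ge> 50 * C2 * K''" for K' K'' K :: real
  proof -
    have K50: "K \<ge> 50" using K(3) c(2) by linarith
    have K50': "K \<ge> 50 * K''"
    proof -
      have "50 * 1 * K'' \<le> 50 * C2 * K''" using K(1) c(2) by (intro mult_right_mono mult_left_mono) auto
      then show ?thesis using K(4) by simp
    qed
    let ?P = "\<lambda>X. ln X \<ge> 1 \<and> ln X \<ge> T0 \<and> ln X \<ge> 4 * (C + 1) \<and> X \<ge> 8 * C1 \<and> 16 * C1 * X powr (1/4) \<le> X \<and> 28 * X powr (1/4) \<le> X
       \<and> C1 ^ 2 \<le> X \<and> X \<ge> 4"
    let ?Q = "\<lambda>X T. 2 * X ^ 2 / X powr (- (9 + K'')) * errterm C1 (exp (- (c / 3 * sqrt (X / (16 * T))))) X T +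
       (80 * C1 * X * X powr (- (9 + K'')) + 2 * exp (- (X / (16 * C1 * T ^ 2)))) \<le> X powr (- (36/5 + K''))"
    have "eventually ?P at_top" using C1 by (intro eventually_conj; real_asymp)
    then have "eventually (\<lambda>X. ?P X \<and> (\<forall>T. 0 < T \<longrightarrow> T \<le> X powr (1/4) \<longrightarrow> ?Q X T)) at_top"
      using errterm_small[OF c(1) C1, of K''] by (rule eventually_conj)
    then obtain X0 where X0: "\<And>X. X \<ge> X0 \<Longrightarrow> ?P X \<and> (\<forall>T. 0 < T \<longrightarrow> T \<le> X powr (1/4) \<longrightarrow> ?Q X T)"
      unfolding eventually_at_top_linorder by blast
    show ?thesis unfolding equidistributed_def
    proof (rule exI[of _ X0], intro allI impI)
      fix X y' T :: real and q a :: nat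
      assume X: "X \<ge> X0" and y': "1 \<le> y'" "ln y' \<le> K' * ln X" and TT: "K * ln X \<le> T" "T \<le> X powr (1/4)"
        and q: "q > 0" "real q \<le> X powr K''" "\<forall>p\<in>prime_factors q. real p < y'" and a: "coprime a q"
      define A where "A = pint y' (exp T)"
      have Xs: "ln X \<ge> 1" "ln X \<ge> T0" "ln X \<ge> 4 * (C + 1)" "X \<ge> 8 * C1" "16 * C1 * X powr (1/4) \<le> X" "28 * X powr (1/4) \<le> X" "C1 ^ 2 \<le> X" "X \<ge> 4"
        using X0[OF X] by blast+
      have Xp: "X > 0" "X \<ge> 1" using Xs by linarith+
      have KT: "K * ln X \<ge> 50 * ln X" using K50 Xs by (intro mult_right_mono) auto
      then have T50: "T \<ge> 50 * ln X" using TT by linarith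
      then have Tp: "T > 0" "T \<ge> T0" "T \<ge> 4 * (C + 1)" "T \<ge> 1" using Xs by linarith+
      have main: "?Q X T"
        using X0[OF X] Tp TT by blast
      have TX: "16 * C1 * T \<le> X" "28 * T \<le> X" "T \<le> X"
      proof -
        have "16 * C1 * T \<le> 16 * C1 * X powr (1/4)" using C1 TT by (intro mult_left_mono) auto
        then show "16 * C1 * T \<le> X" using Xs by linarith
        show "28 * T \<le> X" using TT Xs by linarith
        then show "T \<le> X" using Tp by linarith
      qed
      have lny: "ln y' \<le> T / 2"
      proof -
        have "K' * ln X \<le> K / 2 * ln X" using K Xs by (intro mult_right_mono) auto
        then show ?thesis using y' TT by linarith
      qed
      have T2: "T \<ge> 8 * ln (8 * exp (C + 1) * X)"
      proof -
        have "ln (8 * C1 * X) \<le> ln (X * X)" using Xs C1 Xp by (intro ln_mono mult_right_mono) auto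
        also have "\<dots> = 2 * ln X" using Xp by (simp add: ln_mult)
        finally show ?thesis using T50 Xs unfolding C1_def by linarith
      qed
      obtain \<alpha> where al: "7/8 \<le> \<alpha>" "\<alpha> < 1" "X / (16 * T) \<le> exp (T * (1 - \<alpha>))" "exp (T * (1 - \<alpha>)) \<le> 8 * exp (C + 1) * X"
        "(\<Sum>n\<in>{n\<in>smooth A. exp (X - 2 * (C + 1) - T - T) < real n \<and> real n \<le> exp (X - 2 * (C + 1) - T)}. npow n \<alpha>) \<ge> Zp A \<alpha> / X ^ 2"
        by (rule saddle_point[OF mass C Cp(2) Cp(1) A_def y'(1) lny refl Tp(3) T2 T0[OF Tp(2), unfolded C1_def] TX(1)[unfolded C1_def] TX(2)])
      interpret saddle C X T y' \<alpha> A
        by unfold_locales (use mass C A_def y' lny Tp TX Xs al in \<open>simp_all add: C1_def\<close>)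
      define \<eta> where "\<eta> = X powr (- (9 + K''))"
      define \<epsilon> where "\<epsilon> = exp (- (c / 3 * sqrt (X / (16 * T))))"
      have eta0: "\<eta> > 0" using Xp by (simp add: \<eta>_def)
      have eta: "\<eta> \<le> 1/2"
      proof -
        have "\<eta> \<le> X powr (-1)" unfolding \<eta>_def using Xp K by (intro powr_mono) auto
        also have "\<dots> \<le> 1 / 2" using Xs by (simp add: powr_minus_divide divide_le_eq)
        finally show ?thesis .
      qed
      have lneta: "ln (1 / \<eta>) \<le> T / 2"
      proof -
        have "ln (1 / \<eta>) = (9 + K'') * ln X" unfolding \<eta>_def using Xp by (simp add: ln_div ln_powr algebra_simps)
        also have "\<dots> \<le> K / 2 * ln X" using K50 K50' Xs by (intro mult_right_mono) auto
        finally show ?thesis using TT by linarith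
      qed
      \<comment> \<open>The power of the bump demanded by \<open>class_count_close\<close>; rounding
        it up at most doubles it. It is polynomial in \<open>X\<close>, hence so are the frequencies
        up to \<open>M / X ^ 2\<close>.\<close>
      define m where "m = X ^ 3 / (\<eta> / X ^ 2) ^ 2"
      have m_eq: "m = X powr (25 + 2 * K'')"
      proof -
        have "m = X ^ 7 / \<eta> ^ 2" using Xp by (simp add: m_def power_divide power_mult[symmetric] power_eq_if)
        also have "\<eta> ^ 2 = X powr (- (18 + 2 * K''))" using Xp by (simp add: \<eta>_def powr_power algebra_simps)
        also have "X ^ 7 / X powr (- (18 + 2 * K'')) = X powr 7 * X powr (18 + 2 * K'')"
          unfolding powr_minus using Xp by (simp add: powr_numeral field_simps)
        finally show ?thesis by (simp add: powr_add[symmetric])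
      qed
      have m1: "m \<ge> 1" unfolding m_eq using Xp K by (intro ge_one_powr_ge_zero) auto
      define M where "M = nat \<lceil>m\<rceil>"
      have M: "m \<le> real M" "real M \<le> 2 * m" unfolding M_def using m1 by linarith+
      have s0: "(\<eta> / X ^ 2) ^ 2 > 0" using eta0 Xp by simp
      have mX: "m * (\<eta> / X ^ 2) ^ 2 = X ^ 3" using eta0 Xp unfolding m_def by (simp add: field_simps)
      have M1: "X ^ 3 \<le> real M * (\<eta> / X ^ 2) ^ 2" unfolding mX[symmetric] using M s0 by (intro mult_right_mono) auto
      have "real M * (\<eta> / X ^ 2) ^ 2 \<le> 2 * m * (\<eta> / X ^ 2) ^ 2" using M s0 by (intro mult_right_mono) auto
      then have M2: "real M * (\<eta> / X ^ 2) ^ 2 \<le> 2 * X ^ 3" using mX by (simp add: mult.assoc)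
      have cop: "coprime p q" if "p \<in> A" for p using coprime_pint[OF q(3,1)] that unfolding A_def .
      have eps0: "\<epsilon> \<ge> 0" by (simp add: \<epsilon>_def)
      have Bd: "norm (\<Prod>p\<in>A. 1 / (1 - \<omega> p * dpow (Complex \<alpha> t) p)) \<le> Zp A \<alpha> * \<epsilon>"
        if w: "dchar q \<omega>" "\<omega> \<noteq> principal q" and t: "\<bar>t\<bar> \<le> real M / X ^ 2" for \<omega> t
      proof -
        define w where "w p = \<omega> p * dpow (Complex 0 t) p" for p
        have nw: "norm (w p) \<le> 1" for p
        proof -
          have "norm (dpow (Complex 0 t) p) \<le> 1" by (simp add: norm_dpow)
          then have "norm (\<omega> p) * norm (dpow (Complex 0 t) p) \<le> 1 * 1" by (intro mult_mono norm_dchar_le[OF q(1) w(1)]) auto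
          then show ?thesis by (simp add: w_def norm_mult)
        qed
        have "\<bar>t\<bar> + 2 \<le> X powr (25 + 2 * K'')"
        proof -
          have "real M / X ^ 2 \<le> 2 * m / X ^ 2" using M by (intro divide_right_mono) auto
          moreover have "4 * (2 * m) \<le> X * X * (2 * m)" using Xs m1 mult_mono[of 4 X 1 X] by (intro mult_right_mono) auto
          then have "2 * m / X ^ 2 \<le> m / 2" using Xp by (simp add: field_simps power2_eq_square)
          moreover have "m \<ge> 4"
          proof -
            have "X powr 1 \<le> m" unfolding m_eq using Xp K by (intro powr_mono) auto
            then show ?thesis using Xs Xp by simp
          qed
          ultimately show ?thesis using t unfolding m_eq by linarith
        qed
        then have "ln (\<bar>t\<bar> + 2) \<le> ln (X powr (25 + 2 * K''))" by (intro ln_mono) auto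
        then have l1: "ln (\<bar>t\<bar> + 2) \<le> (25 + 2 * K'') * ln X" using Xp by (simp add: ln_powr)
        have "lnn q \<le> ln (X powr K'')" using q by (intro ln_mono) auto
        then have l2: "lnn q \<le> K'' * ln X" using Xp by (simp add: ln_powr)
        have l3: "ln T \<le> ln X" using TX Tp by (intro ln_mono) auto
        have "lnn q + ln (\<bar>t\<bar> + 2) + ln T \<le> (26 + 3 * K'') * ln X" using l1 l2 l3 by (simp add: algebra_simps)
        then have "C2 * (lnn q + ln (\<bar>t\<bar> + 2) + ln T) \<le> C2 * ((26 + 3 * K'') * ln X)" using c by (intro mult_left_mono) auto
        also have "\<dots> = (26 * C2 + 3 * (C2 * K'')) * ln X" by (simp add: algebra_simps)
        also have "\<dots> \<le> K * ln X"
        proof (rule mult_right_mono)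
          \<comment> \<open>The constant 50 leaves room: \<open>26 * C2\<close> is at most 26/50 of
            \<open>K\<close>, and \<open>3 * (C2 * K'')\<close> at most 3/50 of it.\<close>
          have "C2 * K'' \<ge> 0" "50 * (C2 * K'') \<le> K" using K(4) c K(1) by (auto simp: mult.assoc)
          then show "26 * C2 + 3 * (C2 * K'') \<le> K" using K(3) c by linarith
        qed (use Xs in auto)
        finally have cond: "C2 * (lnn q + ln (\<bar>t\<bar> + 2) + ln T) \<le> T" using TT by linarith
        have "K * 1 \<le> K * ln X" using Xs K50 by (intro mult_left_mono) auto
        then have "T \<ge> C2" using TT K(3) c by linarith
        then have "(\<Sum>p\<in>logint (T / 2) T. (1 - Re (w p)) * (lnn p / p)) \<ge> c * T"
          unfolding w_def by (intro np[OF q(1) w]) (use cond in auto)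
        then have "norm (\<Prod>p\<in>A. 1 / (1 - of_real (npow p \<alpha>) * w p)) \<le> Zp A \<alpha> * \<epsilon>"
          unfolding \<epsilon>_def using c by (intro euler_norm_le nw) auto
        moreover have "of_real (npow p \<alpha>) * w p = \<omega> p * dpow (Complex \<alpha> t) p" for p
        proof -
          have "Complex \<alpha> t = of_real \<alpha> + Complex 0 t" by (simp add: complex_eq_iff)
          then have "dpow (Complex \<alpha> t) p = of_real (npow p \<alpha>) * dpow (Complex 0 t) p" by (simp only: dpow_add dpow_of_real)
          then show ?thesis by (simp add: w_def mult_ac)
        qed
        ultimately show ?thesis by simp
      qed
      let ?N = "real (card (smooth_le A (exp X)))"
      let ?d = "\<bar>real (card {n \<in> smooth A. real n \<le> exp X \<and> [n = a] (mod q)}) - ?N / real (totient q)\<bar>"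
      have "?d \<le> exp (X * \<alpha>) * Zp A \<alpha> * (2 * X ^ 2 / \<eta> * (3 * \<epsilon> + 3 * ((X + 1) * (exp X * exp (- (X ^ 3 / 16)))) + (X + 1) * exp (112 * exp (C + 1) * X - X ^ 2 / T))
        + (80 * exp (C + 1) * X * \<eta> + 2 * exp (- (X / (16 * exp (C + 1) * T ^ 2)))))"
        by (rule class_count_close[OF q(1) cop a eta0 eta lneta eps0 M1 M2 Bd])
      also have "\<dots> \<le> exp (X * \<alpha>) * Zp A \<alpha> * X powr (- (36/5 + K''))"
        using main basics(7) unfolding \<eta>_def \<epsilon>_def C1_def errterm_def by (intro mult_left_mono) auto
      also have "\<dots> = exp (X * \<alpha>) * Zp A \<alpha> / X ^ 7 * (X powr (- 1/5) * X powr (- K''))"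
      proof -
        have "X powr (- (36/5 + K'')) = X powr (-7) * (X powr (- 1/5) * X powr (- K''))" by (simp add: powr_add[symmetric])
        also have "X powr (-7) = 1 / X ^ 7" using Xp by (simp add: powr_minus_divide powr_numeral)
        finally show ?thesis by simp
      qed
      also have "\<dots> \<le> ?N * (X powr (- 1/5) * X powr (- K''))" using count_lower by (intro mult_right_mono) auto
      also have "\<dots> \<le> ?N * (X powr (- 1/5) * (1 / real (totient q)))"
      proof (intro mult_left_mono)
        have "real (totient q) \<le> X powr K''" using q totient_le[of q] by linarith
        then have "1 / X powr K'' \<le> 1 / real (totient q)" using q Xp by (intro divide_left_mono) auto
        then show "X powr (- K'') \<le> 1 / real (totient q)" by (simp add: powr_minus_divide)
      qed auto
      finally show "classes_close (pint y' (exp T)) (exp X) q a (X powr (- 1/5))"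
        unfolding classes_close_def A_def[symmetric] by (simp add: mult_ac)
    qed
  qed
  note main = this
  show ?thesis
  proof (rule exI[of _ "50 * C2"], intro conjI allI impI)
    show "50 * C2 \<ge> 1" using c by simp
  qed (rule main)
qed

section \<open>Sieving in arithmetic progressions\<close>

lemma count_progression:
  assumes m: "m > 0" and z: "z \<ge> 0"
  shows "\<bar>real (card {n::nat. 0 < n \<and> real n \<le> z \<and> [n = c] (mod m)}) - z / real m\<bar> \<le> 1"
proof -
  \<comment> \<open>A representative in \<open>{1..m}\<close> rather than \<open>{0..<m}\<close>,
    because only positive \<open>n\<close> are counted.\<close>
  define r where "r = (if c mod m = 0 then m else c mod m)"
  have r: "0 < r" "r \<le> m" "r mod m = c mod m" using m by (auto simp: r_def less_imp_le)
  define K where "K = nat (\<lfloor>(z - real r) / real m\<rfloor> + 1)"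
  have m0: "real m > 0" using m by simp
  have "(z - real r) / real m \<ge> - 1" using r z m0 by (simp add: field_simps)
  then have fl: "\<lfloor>(z - real r) / real m\<rfloor> + 1 \<ge> 0" by linarith
  have "bij_betw (\<lambda>k. r + k * m) {..<K} {n::nat. 0 < n \<and> real n \<le> z \<and> [n = c] (mod m)}"
  proof (rule bij_betw_imageI)
    show "inj_on (\<lambda>k. r + k * m) {..<K}" using m by (auto simp: inj_on_def)
    show "(\<lambda>k. r + k * m) ` {..<K} = {n::nat. 0 < n \<and> real n \<le> z \<and> [n = c] (mod m)}"
    proof (intro equalityI subsetI)
      fix n assume "n \<in> (\<lambda>k. r + k * m) ` {..<K}"
      then obtain k where k: "k < K" "n = r + k * m" by auto
      have "int k \<le> \<lfloor>(z - real r) / real m\<rfloor>" using k(1) fl by (simp add: K_def zless_nat_eq_int_zless)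
      then have "real k \<le> (z - real r) / real m" by (simp add: le_floor_iff)
      then have "real n \<le> z" using m0 k by (simp add: field_simps)
      moreover have "[n = c] (mod m)" using r k by (simp add: unique_euclidean_semiring_class.cong_def)
      ultimately show "n \<in> {n::nat. 0 < n \<and> real n \<le> z \<and> [n = c] (mod m)}" using r k by simp
    next
      fix n assume n: "n \<in> {n::nat. 0 < n \<and> real n \<le> z \<and> [n = c] (mod m)}"
      then have nm: "n mod m = r mod m" using r by (simp add: unique_euclidean_semiring_class.cong_def)
      have "r \<le> n"
      proof (cases "c mod m = 0")
        case True
        then have "m dvd n" using nm r(3) by (simp add: dvd_eq_mod_eq_0)
        then show ?thesis using True n by (simp add: r_def dvd_imp_le)
      next
        case False
        then have "r = n mod m" using nm r by (simp add: r_def)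
        then show ?thesis by simp
      qed
      then obtain k where k: "n = r + k * m"
        using nm by (metis mod_eq_dvd_iff_nat dvd_def le_add_diff_inverse mult.commute)
      have "real k \<le> (z - real r) / real m" using n m0 k by (simp add: field_simps)
      then have "int k \<le> \<lfloor>(z - real r) / real m\<rfloor>" by (simp add: le_floor_iff)
      then have "k < K" by (simp add: K_def zless_nat_eq_int_zless)
      then show "n \<in> (\<lambda>k. r + k * m) ` {..<K}" using k by blast
    qed
  qed
  then have "card {n::nat. 0 < n \<and> real n \<le> z \<and> [n = c] (mod m)} = K"
    using bij_betw_same_card by fastforce
  moreover have "real K = of_int \<lfloor>(z - real r) / real m\<rfloor> + 1" using fl by (simp add: K_def)
  moreover have "(z - real r) / real m = z / real m - real r / real m" by (simp add: diff_divide_distrib)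
  moreover have "0 \<le> real r / real m" "real r / real m \<le> 1" using r m0 by auto
  ultimately show ?thesis by linarith
qed

section \<open>Legendre's sieve in a reduced residue class\<close>

definition rough_class :: "real \<Rightarrow> real \<Rightarrow> nat \<Rightarrow> nat \<Rightarrow> nat set" where
  "rough_class w z q b = {n. 0 < n \<and> real n \<le> z \<and> [n = b] (mod q) \<and> (\<forall>p. prime p \<longrightarrow> p dvd n \<longrightarrow> w \<le> real p)}"

lemma finite_rough_class [simp, intro]: "finite (rough_class w z q b)"
  by (rule finite_subset[OF _ finite_nat_le_real(1)[of z]]) (auto simp: rough_class_def)

definition primes_lt :: "real \<Rightarrow> nat set" where
  "primes_lt w = {p. prime p \<and> real p < w}"

lemma finite_primes_lt [simp, intro]: "finite (primes_lt w)"
  by (rule finite_subset[of _ "primes_le w"]) (auto simp: primes_lt_def primes_le_def)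

definition mprod :: "real \<Rightarrow> real" where
  "mprod w = (\<Prod>p\<in>primes_lt w. 1 - 1 / real p)"

text \<open>Since every prime factor of \<open>q\<close> is below \<open>w\<close>, the primes
  dividing \<open>q\<close> complete the sieve product to \<open>mprod w\<close> and turn
  \<open>q\<close> into \<open>totient q\<close>. The main term is thus the total density divided
  evenly among the reduced classes.\<close>

lemma rough_factor:
  assumes "real q > 0" "\<forall>p\<in>prime_factors q. real p < w"
  shows "(\<Prod>p\<in>{p\<in>primes_lt w. \<not> p dvd q}. 1 - 1 / real p) / real q = mprod w / real (totient q)"
proof -
  let ?P = "{p\<in>primes_lt w. \<not> p dvd q}"
  have sub: "prime_factors q \<subseteq> primes_lt w" using assms(2) by (auto simp: primes_lt_def)
  have eq: "primes_lt w - prime_factors q = ?P" using assms(1) by (auto simp: primes_lt_def in_prime_factors_iff)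
  have "mprod w = (\<Prod>p\<in>primes_lt w - prime_factors q. 1 - 1 / real p) * (\<Prod>p\<in>prime_factors q. 1 - 1 / real p)"
    unfolding mprod_def by (rule prod.subset_diff[OF sub finite_primes_lt])
  then have mp: "mprod w = (\<Prod>p\<in>?P. 1 - 1 / real p) * (\<Prod>p\<in>prime_factors q. 1 - 1 / real p)" unfolding eq .
  have B: "(\<Prod>p\<in>prime_factors q. 1 - 1 / real p) > 0"
  proof (intro prod_pos ballI)
    fix p assume "p \<in> prime_factors q"
    then have "real p > 1" using prime_gt_1_nat by (auto simp: in_prime_factors_iff)
    then show "0 < 1 - 1 / real p" by simp
  qed
  have "a / real q = a * b / (real q * b)" if "b > 0" for a b :: real using that by simp
  from this[OF B] show ?thesis unfolding mp totient_formula2 .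
qed

text \<open>For \<open>d \<le> z\<close> the error 1 is at most the stated power. For
  \<open>d > z\<close> there is nothing to count, and the main term is at most
  \<open>z / d \<le> (z / d) powr (1 - \<delta>)\<close>. Uniformity in \<open>d\<close> lets the
  errors for all square-free \<open>d\<close> add up to an Euler product.\<close>

lemma card_multiples_in_class:
  assumes q: "q > 0" and D: "d > 0" "coprime d q" and z: "z > 0" and s: "0 \<le> \<delta>" "\<delta> < 1"
  shows "\<bar>real (card {n::nat. 0 < n \<and> real n \<le> z \<and> [n = b] (mod q) \<and> d dvd n}) - z / (real q * real d)\<bar> \<le> (z / real d) powr (1 - \<delta>)"
proof -
  let ?S = "{n::nat. 0 < n \<and> real n \<le> z \<and> [n = b] (mod q) \<and> d dvd n}"
  have q1: "real q \<ge> 1" using q by simp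
  show ?thesis
  proof (cases "real d \<le> z")
    case True
    obtain c where c: "[c = b] (mod q)" "[c = 0] (mod d)"
      using binary_chinese_remainder_nat[of q d b 0] D by (auto simp: coprime_commute)
    have "[n = b] (mod q) \<and> d dvd n \<longleftrightarrow> [n = c] (mod (q * d))" for n
    proof -
      have "[n = c] (mod (q * d)) \<longleftrightarrow> [n = c] (mod q) \<and> [n = c] (mod d)"
        using D by (meson cong_dvd_modulus_nat coprime_cong_mult_nat coprime_commute dvd_triv_left dvd_triv_right)
      moreover have "[n = c] (mod q) \<longleftrightarrow> [n = b] (mod q)" using c(1) by (meson cong_sym cong_trans)
      moreover have "[n = c] (mod d) \<longleftrightarrow> [n = 0] (mod d)" using c(2) by (meson cong_sym cong_trans)
      ultimately show ?thesis by (simp add: cong_0_iff)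
    qed
    then have eq: "?S = {n::nat. 0 < n \<and> real n \<le> z \<and> [n = c] (mod (q * d))}" by auto
    have "\<bar>real (card ?S) - z / real (q * d)\<bar> \<le> 1" unfolding eq by (rule count_progression) (use q D z in auto)
    also have "1 \<le> (z / real d) powr (1 - \<delta>)" using True D s by (intro ge_one_powr_ge_zero) auto
    finally show ?thesis by simp
  next
    case False
    then have "n \<notin> ?S" for n using D by (auto dest!: dvd_imp_le)
    then have e: "?S = {}" by blast
    have x: "0 < z / real d" "z / real d \<le> 1" using False D z by auto
    have "z / (real q * real d) \<le> z / (1 * real d)" using q1 D z by (intro divide_left_mono mult_right_mono) auto
    also have "\<dots> = (z / real d) powr 1" by (simp only: powr_one[OF less_imp_le[OF x(1)]] mult_1)
    also have "\<dots> \<le> (z / real d) powr (1 - \<delta>)" using x s by (intro powr_mono') auto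
    finally show ?thesis unfolding e using q1 D z by simp
  qed
qed

abbreviation recip :: "real \<Rightarrow> real" where
  "recip z \<equiv> \<Sum>p\<in>primes_le z. 1 / real p"

text \<open>Legendre's sieve with all square-free divisors, Rankin's trick taming the remainder.\<close>

lemma rough_class_count:
  assumes q: "q > 0" "\<forall>p\<in>prime_factors q. real p < w" and b: "coprime b q" and z: "z > 0" and W: "W \<ge> 3" "w \<le> W"
  shows "\<bar>real (card (rough_class w z q b)) - z * mprod w / real (totient q)\<bar> \<le>
    z * exp (- ln z / ln W + 3 * recip W)"
proof -
  let ?N = "\<lambda>D. {n::nat. 0 < n \<and> real n \<le> z \<and> [n = b] (mod q) \<and> \<Prod>D dvd n}"
  define P where "P = {p\<in>primes_lt w. \<not> p dvd q}"
  \<comment> \<open>With this exponent \<open>p powr \<delta>\<close> is at most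
    \<open>exp 1 \<le> 3\<close> for all primes up to \<open>W\<close>, so the Rankin product costs
    only three times the sum of reciprocals; \<open>W \<ge> 3\<close> ensures
    \<open>\<delta> < 1\<close>.\<close>
  define \<delta> where "\<delta> = 1 / ln W"
  have "exp (1::real) \<le> 3" by (rule exp_le)
  then have lnW: "ln W \<ge> 1" using W by (subst ln_ge_iff) auto
  have "ln W > 1"
  proof -
    have "exp (1::real) < 3" using e_less_272 by simp
    then have "ln (exp 1) < ln W" using W by (subst ln_less_cancel_iff) auto
    then show ?thesis by simp
  qed
  then have \<delta>: "0 \<le> \<delta>" "\<delta> < 1" by (auto simp: \<delta>_def)
  have finP: "finite P" and pP: "\<And>p. p \<in> P \<Longrightarrow> prime p \<and> real p < w \<and> \<not> p dvd q" by (auto simp: P_def primes_lt_def)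
  have pd: "(z / x) powr (1 - \<delta>) = z powr (1 - \<delta>) * x powr (- (1 - \<delta>))" if "x \<ge> 0" for x
  proof -
    have "(z / x) powr (1 - \<delta>) = z powr (1 - \<delta>) / x powr (1 - \<delta>)" using that z by (intro powr_divide)
    then show ?thesis by (simp only: powr_minus divide_inverse)
  qed
  let ?U = "{n::nat. 0 < n \<and> real n \<le> z \<and> [n = b] (mod q)}"
  have finU: "finite ?U" by (rule finite_subset[OF _ finite_nat_le_real(1)[of z]]) auto
  have copn: "coprime n q" if "n \<in> ?U" for n using that b by (auto dest: cong_imp_coprime cong_sym)
  have R_eq: "rough_class w z q b = {n\<in>?U. \<forall>p\<in>P. \<not> p dvd n}"
  proof (intro equalityI subsetI)
    fix n assume n: "n \<in> rough_class w z q b"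
    have "\<not> p dvd n" if "p \<in> P" for p using n pP[OF that] by (auto simp: rough_class_def)
    then show "n \<in> {n\<in>?U. \<forall>p\<in>P. \<not> p dvd n}" using n by (auto simp: rough_class_def)
  next
    fix n assume n: "n \<in> {n\<in>?U. \<forall>p\<in>P. \<not> p dvd n}"
    have "w \<le> real p" if p: "prime p" "p dvd n" for p
    proof (rule ccontr)
      assume "\<not> w \<le> real p"
      then have "p dvd q" using n p by (auto simp: P_def primes_lt_def)
      then show False using copn[of n] n p by (metis (no_types, lifting) coprime_common_divisor mem_Collect_eq not_prime_unit)
    qed
    then show "n \<in> rough_class w z q b" using n by (auto simp: rough_class_def)
  qed
  have dv: "(\<Prod>D dvd n) \<longleftrightarrow> (\<forall>p\<in>D. p dvd n)" if D: "D \<subseteq> P" for D n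
  proof
    assume "\<Prod>D dvd n"
    then show "\<forall>p\<in>D. p dvd n" using finP D by (meson dvd_prodI dvd_trans finite_subset)
  next
    assume "\<forall>p\<in>D. p dvd n"
    then show "\<Prod>D dvd n" using D pP finP by (intro prime_prod_dvd) (auto intro: finite_subset)
  qed
  have ind: "(if \<forall>p\<in>P. \<not> p dvd n then 1 else 0) = (\<Sum>D\<in>Pow P. (-1) ^ card D * (if \<Prod>D dvd n then 1 else 0 :: real))" for n
  proof -
    have "(if \<forall>p\<in>P. \<not> p dvd n then 1 else 0) = (\<Prod>p\<in>P. (- (if p dvd n then 1 else 0)) + (1::real))"
      using finP by (auto simp: prod_zero_iff)
    also have "\<dots> = (\<Sum>D\<in>Pow P. (\<Prod>p\<in>D. - (if p dvd n then 1 else 0)) * (\<Prod>p\<in>P - D. 1))"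
      by (rule prod_add[OF finP])
    also have "\<dots> = (\<Sum>D\<in>Pow P. (-1) ^ card D * (if \<Prod>D dvd n then 1 else 0 :: real))"
    proof (rule sum.cong[OF refl])
      fix D assume D: "D \<in> Pow P"
      have "(\<Prod>p\<in>D. (if p dvd n then 1 else 0::real)) = (if \<Prod>D dvd n then 1 else 0)"
      proof (cases "\<forall>p\<in>D. p dvd n")
        case True
        then show ?thesis using dv[of D n] D by simp
      next
        case False
        then obtain p where "p \<in> D" "\<not> p dvd n" by blast
        moreover have "finite D" using D finP by (auto intro: finite_subset)
        ultimately have "(\<Prod>p\<in>D. (if p dvd n then 1 else 0::real)) = 0" by (intro prod_zero) auto
        then show ?thesis using dv[of D n] D False by simp
      qed
      then show "(\<Prod>p\<in>D. - (if p dvd n then 1 else 0)) * (\<Prod>p\<in>P - D. 1) = (-1) ^ card D * (if \<Prod>D dvd n then 1 else 0 :: real)"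
        by (simp add: prod_uminus)
    qed
    finally show ?thesis .
  qed
  have "real (card (rough_class w z q b)) = (\<Sum>n\<in>?U. if \<forall>p\<in>P. \<not> p dvd n then 1 else 0)"
    unfolding R_eq using finU by (simp add: sum.If_cases Int_def conj_assoc)
  also have "\<dots> = (\<Sum>D\<in>Pow P. (-1) ^ card D * (\<Sum>n\<in>?U. if \<Prod>D dvd n then 1 else 0))"
    unfolding ind by (subst sum.swap) (simp add: sum_distrib_left)
  also have "\<dots> = (\<Sum>D\<in>Pow P. (-1) ^ card D * real (card (?N D)))"
    using finU by (simp add: sum.If_cases Int_def conj_assoc)
  finally have card_eq: "real (card (rough_class w z q b)) = (\<Sum>D\<in>Pow P. (-1) ^ card D * real (card (?N D)))" .
  have "z * mprod w / real (totient q) = z / real q * (\<Prod>p\<in>P. - (1 / real p) + 1)"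
  proof -
    have m2: "(\<Prod>p\<in>P. 1 - 1 / real p) / real q = mprod w / real (totient q)"
      unfolding P_def by (rule rough_factor) (use q in auto)
    have "z / real q * (\<Prod>p\<in>P. - (1 / real p) + 1) = z * ((\<Prod>p\<in>P. 1 - 1 / real p) / real q)" by simp
    also have "\<dots> = z * mprod w / real (totient q)" unfolding m2 by simp
    finally show ?thesis ..
  qed
  also have "(\<Prod>p\<in>P. - (1 / real p) + 1) = (\<Sum>D\<in>Pow P. (\<Prod>p\<in>D. - (1 / real p)) * (\<Prod>p\<in>P - D. 1))"
    by (rule prod_add[OF finP])
  also have "z / real q * \<dots> = (\<Sum>D\<in>Pow P. (-1) ^ card D * (z / (real q * real (\<Prod>D))))"
    unfolding sum_distrib_left
  proof (rule sum.cong[OF refl])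
    fix D
    have "(\<Prod>p\<in>D. - (1 / real p)) = (-1) ^ card D * (1 / real (\<Prod>D))" by (simp add: prod_uminus prod_dividef)
    then show "z / real q * ((\<Prod>p\<in>D. - (1 / real p)) * (\<Prod>p\<in>P - D. 1)) = (-1) ^ card D * (z / (real q * real (\<Prod>D)))" by simp
  qed
  finally have main_eq: "z * mprod w / real (totient q) = (\<Sum>D\<in>Pow P. (-1) ^ card D * (z / (real q * real (\<Prod>D))))" .
  have "\<bar>real (card (rough_class w z q b)) - z * mprod w / real (totient q)\<bar> =
     \<bar>\<Sum>D\<in>Pow P. (-1) ^ card D * (real (card (?N D)) - z / (real q * real (\<Prod>D)))\<bar>"
    unfolding card_eq main_eq sum_subtractf[symmetric] right_diff_distrib ..
  also have "\<dots> \<le> (\<Sum>D\<in>Pow P. (z / real (\<Prod>D)) powr (1 - \<delta>))"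
  proof (rule order_trans[OF sum_abs], rule sum_mono)
    fix D assume D: "D \<in> Pow P"
    have pos: "\<Prod>D > 0" using D pP by (intro prod_pos) (auto simp: prime_gt_0_nat)
    have "coprime p q" if "p \<in> D" for p using D pP[of p] that by (intro prime_imp_coprime) auto
    then have cop: "coprime (\<Prod>D) q" by (intro prod_coprime_left)
    have "\<bar>real (card (?N D)) - z / (real q * real (\<Prod>D))\<bar> \<le> (z / real (\<Prod>D)) powr (1 - \<delta>)"
      by (rule card_multiples_in_class[OF q(1) pos cop z \<delta>])
    then show "\<bar>(-1) ^ card D * (real (card (?N D)) - z / (real q * real (\<Prod>D)))\<bar> \<le> (z / real (\<Prod>D)) powr (1 - \<delta>)"
      by (simp only: abs_mult power_abs) simp
  qed
  also have "\<dots> = (\<Sum>D\<in>Pow P. z powr (1 - \<delta>) * ((\<Prod>p\<in>D. npow p (1 - \<delta>)) * (\<Prod>p\<in>P - D. 1)))"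
  proof (rule sum.cong[OF refl])
    fix D
    have "(z / real (\<Prod>D)) powr (1 - \<delta>) = z powr (1 - \<delta>) * (real (\<Prod>D) powr (- (1 - \<delta>)))"
      by (rule pd) (rule of_nat_0_le_iff)
    also have "real (\<Prod>D) powr (- (1 - \<delta>)) = (\<Prod>p\<in>D. npow p (1 - \<delta>))"
      by (simp add: prod_powr_distrib)
    finally show "(z / real (\<Prod>D)) powr (1 - \<delta>) = z powr (1 - \<delta>) * ((\<Prod>p\<in>D. npow p (1 - \<delta>)) * (\<Prod>p\<in>P - D. 1))" by simp
  qed
  also have "\<dots> = z powr (1 - \<delta>) * (\<Prod>p\<in>P. npow p (1 - \<delta>) + 1)"
    unfolding sum_distrib_left[symmetric] prod_add[OF finP] ..
  also have "\<dots> \<le> z powr (1 - \<delta>) * (\<Prod>p\<in>P. exp (3 * (1 / real p)))"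
  proof (intro mult_left_mono prod_mono conjI)
    fix p assume p: "p \<in> P"
    then have p': "prime p" "real p < W" "real p > 0" using pP[OF p] W by (auto simp: prime_gt_0_nat)
    have "real p powr \<delta> \<le> W powr \<delta>" using p' \<delta> by (intro powr_mono2) auto
    also have "\<dots> = exp 1" using W lnW by (simp add: powr_def \<delta>_def)
    also have "\<dots> \<le> 3" by (rule exp_le)
    finally have "real p powr \<delta> * (1 / real p) \<le> 3 * (1 / real p)" using p' by (intro mult_right_mono) auto
    moreover have "npow p (1 - \<delta>) = real p powr \<delta> * (1 / real p)"
    proof -
      have "npow p (1 - \<delta>) = real p powr (\<delta> - 1)" by simp
      also have "\<dots> = real p powr \<delta> * (1 / real p)" unfolding powr_diff using p' by simp
      finally show ?thesis .
    qed
    ultimately show "npow p (1 - \<delta>) + 1 \<le> exp (3 * (1 / real p))"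
      using exp_ge_add_one_self[of "3 * (1 / real p)"] by linarith
  qed auto
  also have "(\<Prod>p\<in>P. exp (3 * (1 / real p))) = exp (3 * (\<Sum>p\<in>P. 1 / real p))"
    unfolding sum_distrib_left by (rule exp_sum[OF finP, symmetric])
  also have "z powr (1 - \<delta>) * \<dots> \<le> z powr (1 - \<delta>) * exp (3 * recip W)"
  proof -
    have "(\<Sum>p\<in>P. 1 / real p) \<le> recip W"
      using pP W by (intro sum_mono2) (force simp: primes_le_def)+
    then show ?thesis by (intro mult_left_mono) auto
  qed
  also have "z powr (1 - \<delta>) = z * exp (- ln z / ln W)"
  proof -
    have "z powr (1 - \<delta>) = z powr (1 + - \<delta>)" by simp
    also have "\<dots> = z * z powr (- \<delta>)" unfolding powr_add using z by simp
    also have "z powr (- \<delta>) = exp (- ln z / ln W)" using z by (simp add: powr_def \<delta>_def)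
    finally show ?thesis .
  qed
  also have "z * exp (- ln z / ln W) * exp (3 * recip W) = z * exp (- ln z / ln W + 3 * recip W)"
    by (simp only: exp_add mult.assoc)
  finally show ?thesis .
qed

section \<open>Sums of reciprocals and products over small primes\<close>

lemma primes_le_eq_logint: "W \<ge> 1 \<Longrightarrow> primes_le W = logint 0 (ln W)"
proof -
  assume W: "W \<ge> 1"
  have "real p \<le> W \<longleftrightarrow> lnn p \<le> ln W" "0 < lnn p" if "prime p" for p
  proof -
    have "real p > 1" using prime_gt_1_nat[OF that] by simp
    then show "real p \<le> W \<longleftrightarrow> lnn p \<le> ln W" "0 < lnn p" using W by (auto simp: ln_gt_zero)
  qed
  then show ?thesis by (auto simp: primes_le_def logint_def)
qed

text \<open>A dyadic block \<open>2 ^ k < ln p \<le> 2 ^ (k + 1)\<close> has Mertens mass at most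
  \<open>2 ^ k + C\<close>, so it contributes at most \<open>1 + C\<close> to the sum of
  reciprocals. About \<open>log 2 (ln W)\<close> blocks are needed.\<close>

lemma prime_reciprocals:
  "\<exists>C\<ge>1. \<forall>W\<ge>exp 1. recip W \<le> C * (1 + ln (ln W))"
proof -
  obtain C where C: "C \<ge> 1" and mass: "\<And>u v. 0 \<le> u \<Longrightarrow> u \<le> v \<Longrightarrow> \<bar>mmass u v - (v - u)\<bar> \<le> C"
    using mmass_bound by blast
  define B where "B = (\<Sum>p\<in>logint 0 1. 1 / real p)"
  have B: "B \<ge> 0" by (simp add: B_def sum_nonneg)
  have dyadic: "(\<Sum>p\<in>logint 0 (2 ^ k). 1 / real p) \<le> B + real k * (1 + C)" for k
  proof (induction k)
    case (Suc k)
    have "2 ^ k * (\<Sum>p\<in>logint (2 ^ k) (2 ^ Suc k). 1 / real p) \<le> mmass (2 ^ k) (2 ^ Suc k)"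
      unfolding mmass_def sum_distrib_left
    proof (rule sum_mono)
      fix p assume "p \<in> logint (2 ^ k) (2 ^ Suc k)"
      then have "2 ^ k \<le> lnn p" by (simp add: logint_def)
      then show "2 ^ k * (1 / real p) \<le> lnn p / real p" by (simp add: divide_right_mono)
    qed
    also have "\<dots> \<le> 2 ^ k + C" using mass[of "2 ^ k" "2 ^ Suc k"] by (simp add: abs_le_iff)
    also have "\<dots> \<le> 2 ^ k * (1 + C)"
    proof -
      have "1 * C \<le> 2 ^ k * C" using C by (intro mult_right_mono) auto
      then show ?thesis by (simp add: algebra_simps)
    qed
    finally have "(\<Sum>p\<in>logint (2 ^ k) (2 ^ Suc k). 1 / real p) \<le> 1 + C" by (rule mult_left_le_imp_le) simp
    moreover have "(\<Sum>p\<in>logint 0 (2 ^ Suc k). 1 / real p) = (\<Sum>p\<in>logint 0 (2 ^ k). 1 / real p) + (\<Sum>p\<in>logint (2 ^ k) (2 ^ Suc k). 1 / real p)"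
      by (rule sum_logint_split) auto
    ultimately show ?case using Suc by (simp add: algebra_simps)
  qed (simp add: B_def)
  show ?thesis
  proof (intro exI[of _ "B + 3 * (1 + C)"] conjI allI impI)
    show "B + 3 * (1 + C) \<ge> 1" using B C by simp
    fix W :: real assume eW: "W \<ge> exp 1"
    then have "W > 0" using exp_gt_zero[of 1] by linarith
    then have W: "ln W \<ge> 1" using eW by (simp add: ln_ge_iff)
    have W1: "W \<ge> 1" using eW exp_ge_add_one_self[of "1::real"] by linarith
    define k where "k = nat \<lceil>log 2 (ln W)\<rceil>"
    have lg: "log 2 (ln W) \<ge> 0" using W by simp
    have k: "log 2 (ln W) \<le> real k" "real k \<le> log 2 (ln W) + 1" unfolding k_def using lg by linarith+
    have "ln W = 2 powr log 2 (ln W)" using W by simp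
    also have "\<dots> \<le> 2 powr real k" using k by (intro powr_mono) auto
    finally have "ln W \<le> 2 ^ k" by (simp add: powr_realpow)
    then have "primes_le W \<subseteq> logint 0 (2 ^ k)" unfolding primes_le_eq_logint[OF W1] by (auto simp: logint_def)
    then have "recip W \<le> (\<Sum>p\<in>logint 0 (2 ^ k). 1 / real p)" by (intro sum_mono2) (simp_all add: finite_logint)
    also have "\<dots> \<le> B + real k * (1 + C)" by (rule dyadic)
    also have "real k \<le> 1 + 2 * ln (ln W)"
    proof -
      have "log 2 (ln W) = ln (ln W) / ln 2" by (simp add: log_def)
      also have "\<dots> \<le> ln (ln W) / (1/2)" using W ln2_ge_two_thirds by (intro divide_left_mono) auto
      finally show ?thesis using k by simp
    qed
    also have "B + (1 + 2 * ln (ln W)) * (1 + C) \<le> (B + 3 * (1 + C)) * (1 + ln (ln W))"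
    proof -
      have "ln (ln W) \<ge> 0" using W by simp
      then have "0 \<le> B * ln (ln W)" "0 \<le> C * ln (ln W)" using B C by auto
      then show ?thesis using \<open>ln (ln W) \<ge> 0\<close> C by (simp add: algebra_simps)
    qed
    finally show "recip W \<le> (B + 3 * (1 + C)) * (1 + ln (ln W))" using C by simp
  qed
qed

lemma mprod_pos: "mprod w > 0"
  unfolding mprod_def
proof (intro prod_pos ballI)
  fix p assume "p \<in> primes_lt w"
  then have "real p > 1" using prime_gt_1_nat by (auto simp: primes_lt_def)
  then show "0 < 1 - 1 / real p" by simp
qed

lemma mprod_lower:
  assumes "w \<le> W"
  shows "mprod w \<ge> exp (- (2 * recip W))"
proof -
  have "exp (- (2 * recip W)) \<le> exp (\<Sum>p\<in>primes_lt w. - (2 * (1 / real p)))"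
  proof -
    have "(\<Sum>p\<in>primes_lt w. 1 / real p) \<le> recip W"
      using assms by (intro sum_mono2) (auto simp: primes_lt_def primes_le_def)
    then show ?thesis by (simp only: sum_negf sum_distrib_left[symmetric] exp_le_cancel_iff)
  qed
  also have "\<dots> = (\<Prod>p\<in>primes_lt w. exp (- (2 * (1 / real p))))" by (rule exp_sum) simp
  also have "\<dots> \<le> mprod w" unfolding mprod_def
  proof (intro prod_mono conjI)
    fix p assume "p \<in> primes_lt w"
    then have p: "real p \<ge> 2" by (auto simp: primes_lt_def dest: prime_ge_2_nat)
    have "1 / (1 - 1 / real p) \<le> 1 + 2 * (1 / real p)" using p by (simp add: field_simps)
    also have "\<dots> \<le> exp (2 * (1 / real p))" by (rule exp_ge_add_one_self)
    finally show "exp (- (2 * (1 / real p))) \<le> 1 - 1 / real p" using p by (simp add: exp_minus field_simps)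
  qed auto
  finally show ?thesis .
qed

text \<open>The Euler product over the primes below \<open>w\<close> expands to a sum containing
  \<open>1 / n\<close> for all \<open>n < w\<close>, hence is at least a harmonic sum.\<close>

lemma mprod_upper:
  assumes w: "w > 1"
  shows "mprod w \<le> 1 / ln w"
proof -
  define N where "N = nat (\<lceil>w\<rceil> - 1)"
  have N: "real N < w" "w \<le> real N + 1" unfolding N_def using w by linarith+
  have pr: "prime p" if "p \<in> primes_lt w" for p using that by (simp add: primes_lt_def)
  have "ln w \<le> ln (real N + 1)" using w N by (intro ln_mono) auto
  also have "\<dots> \<le> harm N" by (rule ln_le_harm)
  also have "\<dots> = (\<Sum>n\<in>{1..N}. npow n 1)"
    unfolding harm_def by (rule sum.cong[OF refl]) (simp add: powr_minus)
  also have "\<dots> \<le> Zp (primes_lt w) 1"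
  proof (rule Zp_finite_sum_le)
    show "{1..N} \<subseteq> smooth (primes_lt w)"
    proof
      fix n assume n: "n \<in> {1..N}"
      have "p \<in> primes_lt w" if "p \<in> prime_factors n" for p
      proof -
        have "prime p" "p dvd n" using that by (auto simp: in_prime_factors_iff)
        then have "p \<le> N" using n dvd_imp_le[of p n] by auto
        then show ?thesis using \<open>prime p\<close> N by (simp add: primes_lt_def)
      qed
      then show "n \<in> smooth (primes_lt w)" using n by (auto simp: smooth_def)
    qed
  qed (use pr in auto)
  also have "Zp (primes_lt w) 1 = 1 / mprod w" unfolding Zp_def mprod_def
    by (simp add: prod_dividef powr_minus_divide)
  finally show ?thesis using mprod_pos[of w] w by (simp add: field_simps)
qed

section \<open>Propagation of equidistribution to larger n\<close>

text \<open>Partial summation kept one-sided on purpose. Applied to \<open>\<epsilon> - c\<close>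
  and \<open>\<epsilon> + c\<close> it bounds the weighted discrepancy by exactly
  \<open>\<epsilon>\<close> times the weighted count plus a boundary term, whereas a bound on
  absolute values would multiply the main term by a constant in every step of the later
  induction.\<close>

lemma abel_lower:
  fixes f g :: "nat \<Rightarrow> real"
  assumes U: "t < U" and D: "\<And>u. t \<le> u \<Longrightarrow> u \<le> U \<Longrightarrow> (\<Sum>m\<in>{t<..u}. f m) \<ge> - B"
    and g: "\<And>m. t < m \<Longrightarrow> m \<le> U \<Longrightarrow> g m \<ge> 0" "\<And>m. t < m \<Longrightarrow> Suc m \<le> U \<Longrightarrow> g (Suc m) \<le> g m"
  shows "(\<Sum>m\<in>{t<..U}. f m * g m) \<ge> - (B * g (Suc t))"
proof -
  have "(\<Sum>m\<in>{t<..u}. f m * g m) + B * g (Suc t) \<ge> g u * ((\<Sum>m\<in>{t<..u}. f m) + B)" if "Suc t \<le> u" "u \<le> U" for u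
    using that
  proof (induction u rule: dec_induct)
    case base
    have "{t<..Suc t} = {Suc t}" by auto
    then show ?case by (simp add: algebra_simps)
  next
    case (step u)
    have e: "{t<..Suc u} = insert (Suc u) {t<..u}" using step by auto
    have "g (Suc u) * ((\<Sum>m\<in>{t<..u}. f m) + B) \<le> g u * ((\<Sum>m\<in>{t<..u}. f m) + B)"
      using g(2)[of u] D[of u] step by (intro mult_right_mono) auto
    then show ?case using step unfolding e by (simp add: algebra_simps)
  qed
  from this[of U] have "(\<Sum>m\<in>{t<..U}. f m * g m) + B * g (Suc t) \<ge> g U * ((\<Sum>m\<in>{t<..U}. f m) + B)" using U by simp
  moreover have "g U * ((\<Sum>m\<in>{t<..U}. f m) + B) \<ge> 0" using g(1)[of U] D[of U] U by (intro mult_nonneg_nonneg) auto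
  ultimately show ?thesis by linarith
qed

section \<open>Smooth numbers and prime powers up to an integer bound\<close>

definition upto_smooth :: "nat set \<Rightarrow> nat \<Rightarrow> nat set" where
  "upto_smooth A u = {n \<in> smooth A. n \<le> u}"

lemma finite_upto_smooth [simp, intro]: "finite (upto_smooth A u)"
  by (rule finite_subset[of _ "{..u}"]) (auto simp: upto_smooth_def)

lemma upto_smooth_pos: "n \<in> upto_smooth A u \<Longrightarrow> 0 < n \<and> n \<le> u"
  using smooth_pos by (auto simp: upto_smooth_def)

lemma card_upto_smooth_le: "card (upto_smooth A u) \<le> u"
proof -
  have "upto_smooth A u \<subseteq> {1..u}" using upto_smooth_pos by (auto simp: Suc_leI)
  then have "card (upto_smooth A u) \<le> card {1..u}" by (intro card_mono) auto
  then show ?thesis by simp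
qed

lemma sum_upto_smooth_split:
  assumes "t \<le> u"
  shows "(\<Sum>m\<in>{t<..u}. if m \<in> smooth A then h m else 0) = sum h (upto_smooth A u) - (sum h (upto_smooth A t) :: real)"
proof -
  have "(\<Sum>m\<in>{t<..u}. if m \<in> smooth A then h m else 0) = sum h {m\<in>{t<..u}. m \<in> smooth A}"
    by (rule sum.inter_filter[symmetric]) simp
  also have "{m\<in>{t<..u}. m \<in> smooth A} = upto_smooth A u - upto_smooth A t" using assms by (auto simp: upto_smooth_def)
  also have "sum h \<dots> = sum h (upto_smooth A u) - sum h (upto_smooth A t)"
    using assms by (intro sum_diff) (auto simp: upto_smooth_def)
  finally show ?thesis .
qed

definition smooth_primepows :: "nat set \<Rightarrow> nat \<Rightarrow> nat set" where
  "smooth_primepows A z = {d \<in> upto_smooth A z. primepow d}"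

lemma finite_smooth_primepows [simp, intro]: "finite (smooth_primepows A z)"
  by (simp add: smooth_primepows_def)

lemma card_smooth_primepows:
  assumes A: "finite A" "\<And>p. p \<in> A \<Longrightarrow> prime p" and z: "z > 0"
  shows "real (card (smooth_primepows A z)) \<le> real (card A) * log 2 (real z)"
proof -
  let ?k = "nat \<lfloor>log 2 (real z)\<rfloor>"
  have sub: "smooth_primepows A z \<subseteq> (\<lambda>(p, k). p ^ k) ` (A \<times> {1..?k})"
  proof
    fix d assume "d \<in> smooth_primepows A z"
    then have d: "d \<in> smooth A" "d \<le> z" "primepow d" by (auto simp: smooth_primepows_def upto_smooth_def)
    then obtain p k where pk: "prime p" "k > 0" "d = p ^ k" by (auto simp: primepow_def)
    then have "p \<in> prime_factors d" using d smooth_pos by (auto simp: in_prime_factors_iff)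
    then have pA: "p \<in> A" using d by (auto simp: smooth_def)
    have "2 ^ k \<le> p ^ k" using prime_ge_2_nat[OF pk(1)] by (intro power_mono) auto
    also have "p ^ k \<le> z" using d(2) pk(3) by simp
    finally have "2 ^ k \<le> z" .
    then have "real (2 ^ k) \<le> real z" by (rule of_nat_mono)
    then have "2 powr real k \<le> real z" by (simp add: powr_realpow)
    then have "real k \<le> log 2 (real z)" using z by (simp add: le_log_iff)
    then have "k \<le> ?k" by (rule le_nat_floor)
    then show "d \<in> (\<lambda>(p, k). p ^ k) ` (A \<times> {1..?k})" using pA pk by (auto simp: Suc_leI intro!: image_eqI[of _ _ "(p, k)"])
  qed
  have "card (smooth_primepows A z) \<le> card ((\<lambda>(p, k). p ^ k) ` (A \<times> {1..?k}))" using A by (intro card_mono sub) auto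
  also have "\<dots> \<le> card (A \<times> {1..?k})" using A by (intro card_image_le) auto
  also have "\<dots> = card A * ?k" by (simp add: card_cartesian_product)
  finally have "real (card (smooth_primepows A z)) \<le> real (card A * ?k)" by (rule of_nat_mono)
  also have "\<dots> = real (card A) * real ?k" by simp
  also have "\<dots> \<le> real (card A) * log 2 (real z)" using z by (intro mult_left_mono) (auto simp: Suc_leI)
  finally show ?thesis .
qed

text \<open>The number 1 is left out because \<open>ln 1 = 0\<close>. The identity is applied to the
  discrepancy and also to the constant 1, where it returns the exact count.\<close>

lemma mangoldt_expand:
  fixes f :: "nat \<Rightarrow> real"
  shows "(\<Sum>n\<in>upto_smooth A z - {1}. f n) =
    (\<Sum>d\<in>smooth_primepows A z. mangoldt d * (\<Sum>m\<in>upto_smooth A (z div d). f (d * m) / ln (real (d * m))))"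
proof -
  let ?S = "upto_smooth A z - {1}" and ?D = "smooth_primepows A z"
  have n1: "n > 1" if "n \<in> ?S" for n using that upto_smooth_pos[of n A z] by auto
  have "(\<Sum>n\<in>?S. f n) = (\<Sum>n\<in>?S. \<Sum>d\<in>?D. if d dvd n then mangoldt d * (f n / lnn n) else 0)"
  proof (rule sum.cong[OF refl])
    fix n assume n: "n \<in> ?S"
    have "lnn n > 0" using n1[OF n] by simp
    then have fn: "f n = lnn n * (f n / lnn n)" by simp
    have "lnn n = (\<Sum>d | d dvd n. mangoldt d)" using n1[OF n] by (simp add: mangoldt_sum)
    also have "\<dots> = (\<Sum>d\<in>{d\<in>?D. d dvd n}. mangoldt d)"
    proof (rule sum.mono_neutral_right)
      show "finite {d. d dvd n}" using n1[OF n] by auto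
      show "\<forall>d\<in>{d. d dvd n} - {d\<in>?D. d dvd n}. mangoldt d = (0::real)"
      proof
        fix d assume d: "d \<in> {d. d dvd n} - {d\<in>?D. d dvd n}"
        then obtain e where e: "n = d * e" by auto
        have "d \<le> n" using d n1[OF n] by (intro dvd_imp_le) auto
        moreover have "n \<le> z" using n by (simp add: upto_smooth_def)
        ultimately have dz: "d \<le> z" by (rule order_trans)
        have dsm: "d \<in> smooth A"
          using n e smooth_mult_iff[of d e A] by (auto simp: upto_smooth_def)
        then have "\<not> primepow d" using d dz dsm by (auto simp: smooth_primepows_def upto_smooth_def)
        then show "mangoldt d = (0::real)" by (simp add: mangoldt_def)
      qed
    qed auto
    finally have "f n = (\<Sum>d\<in>{d\<in>?D. d dvd n}. mangoldt d) * (f n / lnn n)" using fn by (simp only:)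
    also have "\<dots> = (\<Sum>d\<in>{d\<in>?D. d dvd n}. mangoldt d * (f n / lnn n))" by (rule sum_distrib_right)
    also have "\<dots> = (\<Sum>d\<in>?D. if d dvd n then mangoldt d * (f n / lnn n) else 0)" by (rule sum.inter_filter) simp
    finally show "f n = (\<Sum>d\<in>?D. if d dvd n then mangoldt d * (f n / lnn n) else 0)" .
  qed
  also have "\<dots> = (\<Sum>d\<in>?D. \<Sum>n\<in>?S. if d dvd n then mangoldt d * (f n / lnn n) else 0)" by (rule sum.swap)
  also have "\<dots> = (\<Sum>d\<in>?D. mangoldt d * (\<Sum>m\<in>upto_smooth A (z div d). f (d * m) / ln (real (d * m))))"
  proof (rule sum.cong[OF refl])
    fix d assume d: "d \<in> ?D"
    have dS: "d \<in> smooth A" "d > 1" using d primepow_gt_Suc_0[of d] by (auto simp: smooth_primepows_def upto_smooth_def)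
    have "(\<Sum>n\<in>?S. if d dvd n then mangoldt d * (f n / lnn n) else 0) = (\<Sum>n\<in>{n\<in>?S. d dvd n}. mangoldt d * (f n / lnn n))"
      by (rule sum.inter_filter[symmetric]) simp
    also have "\<dots> = mangoldt d * (\<Sum>n\<in>{n\<in>?S. d dvd n}. f n / lnn n)" by (rule sum_distrib_left[symmetric])
    also have "{n\<in>?S. d dvd n} = (\<lambda>m. d * m) ` upto_smooth A (z div d)"
    proof (intro equalityI subsetI)
      fix n assume n: "n \<in> {n\<in>?S. d dvd n}"
      then obtain m where m: "n = d * m" by auto
      then have "m \<in> smooth A" "m \<le> z div d"
        using n dS smooth_mult_iff[of d m A] by (auto simp: upto_smooth_def less_eq_div_iff_mult_less_eq mult.commute)
      then show "n \<in> (\<lambda>m. d * m) ` upto_smooth A (z div d)" using m by (auto simp: upto_smooth_def)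
    next
      fix n assume "n \<in> (\<lambda>m. d * m) ` upto_smooth A (z div d)"
      then obtain m where m: "n = d * m" "m \<in> smooth A" "m \<le> z div d" by (auto simp: upto_smooth_def)
      then have "n \<in> smooth A" "n \<le> z" using dS smooth_mult by (auto simp: less_eq_div_iff_mult_less_eq mult.commute)
      moreover have "n \<noteq> 1" using m dS by auto
      ultimately show "n \<in> {n\<in>?S. d dvd n}" using m by (auto simp: upto_smooth_def)
    qed
    also have "(\<Sum>n\<in>(\<lambda>m. d * m) ` upto_smooth A (z div d). f n / lnn n) = (\<Sum>m\<in>upto_smooth A (z div d). f (d * m) / ln (real (d * m)))"
      using dS by (subst sum.reindex) (auto simp: inj_on_def)
    finally show "(\<Sum>n\<in>?S. if d dvd n then mangoldt d * (f n / lnn n) else 0) = mangoldt d * (\<Sum>m\<in>upto_smooth A (z div d). f (d * m) / ln (real (d * m)))" .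
  qed
  finally show ?thesis .
qed

lemma classdev_shift:
  assumes q: "q > 0" and d: "coprime d q" and b: "coprime b q"
  obtains b' where "coprime b' q" "\<And>m. classdev q b (d * m) = classdev q b' m"
proof -
  obtain e where e: "[d * e = 1] (mod q)" using cong_solve_coprime_nat[OF d] by auto
  define b' where "b' = e * b"
  have db: "[d * b' = b] (mod q)"
    using cong_scalar_right[OF e, of b] by (simp add: b'_def mult.assoc)
  have "coprime (d * b') q" using db b by (meson cong_imp_coprime cong_sym)
  then have cb: "coprime b' q" by simp
  have "[d * m = b] (mod q) \<longleftrightarrow> [m = b'] (mod q)" for m
  proof -
    have "[d * m = b] (mod q) \<longleftrightarrow> [d * m = d * b'] (mod q)" using db by (meson cong_sym cong_trans)
    also have "\<dots> \<longleftrightarrow> [m = b'] (mod q)" using d by (rule cong_mult_lcancel_nat)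
    finally show ?thesis .
  qed
  then show thesis using that[OF cb] by (simp add: classdev_def)
qed

text \<open>Writing \<open>1 = (\<Sum>d | d dvd n. mangoldt d) / ln n\<close> reduces the discrepancy up to \<open>z\<close> to the
  discrepancies up to \<open>z / d \<le> z / 2\<close>; the relative error grows only through the terms \<open>n = d m\<close> with \<open>m \<le> t\<close>.\<close>

lemma discrepancy_propagates:
  assumes A: "finite A" "\<And>p. p \<in> A \<Longrightarrow> prime p" "\<And>p. p \<in> A \<Longrightarrow> coprime p q" and q: "q > 0"
    and t: "t \<ge> 1" "t \<le> z1" and eps: "\<epsilon> \<ge> 0" "\<kappa> \<ge> 0" "\<epsilon> + \<kappa> * log 2 (real Zm) \<le> 1"
    and base: "\<And>u b. t \<le> u \<Longrightarrow> u \<le> z1 \<Longrightarrow> coprime b q \<Longrightarrow> \<bar>\<Sum>n\<in>upto_smooth A u. classdev q b n\<bar> \<le> \<epsilon> * real (card (upto_smooth A u))"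
    and cost: "\<And>z. z1 < z \<Longrightarrow> z \<le> Zm \<Longrightarrow> 1 + 3 * real t * (real (card A) * log 2 (real z)) \<le> \<kappa> * real (card (upto_smooth A z))"
    and z: "t \<le> z" "z \<le> Zm" and b: "coprime b q"
  shows "\<bar>\<Sum>n\<in>upto_smooth A z. classdev q b n\<bar> \<le> (\<epsilon> + \<kappa> * log 2 (real z)) * real (card (upto_smooth A z))"
  using z b
proof (induction z arbitrary: b rule: less_induct)
  case (less z)
  let ?N = "\<lambda>u. real (card (upto_smooth A u))"
  show ?case
  proof (cases "z \<le> z1")
    case True
    have "\<bar>\<Sum>n\<in>upto_smooth A z. classdev q b n\<bar> \<le> \<epsilon> * ?N z" by (rule base) (use less True in auto)
    also have "\<dots> \<le> (\<epsilon> + \<kappa> * log 2 (real z)) * ?N z" using less.prems t eps by (intro mult_right_mono) auto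
    finally show ?thesis .
  next
    case False
    then have z2: "z \<ge> 2" using t by linarith
    \<comment> \<open>The relative error granted at \<open>z / 2\<close>, hence at every
      \<open>z div d\<close>; the difference \<open>\<kappa>\<close> to the claim at
      \<open>z\<close> is what one step may cost.\<close>
    define \<epsilon>' where "\<epsilon>' = \<epsilon> + \<kappa> * (log 2 (real z) - 1)"
    have lg: "log 2 (real z) \<ge> 1" using z2 by simp
    have e0: "\<epsilon>' \<ge> 0" using lg eps by (simp add: \<epsilon>'_def)
    have e1: "\<epsilon>' \<le> 1"
    proof -
      have "log 2 (real z) \<le> log 2 (real Zm)" using z2 less.prems by (subst log_le_cancel_iff) auto
      then have "log 2 (real z) - 1 \<le> log 2 (real Zm)" by linarith
      then have "\<kappa> * (log 2 (real z) - 1) \<le> \<kappa> * log 2 (real Zm)" using eps by (intro mult_left_mono)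
      then show ?thesis using eps unfolding \<epsilon>'_def by linarith
    qed
    have IH: "\<bar>\<Sum>n\<in>upto_smooth A u. classdev q b' n\<bar> \<le> \<epsilon>' * ?N u" if u: "t \<le> u" "2 * u \<le> z" and b': "coprime b' q" for u b'
    proof -
      have uz: "u < z" using u t by linarith
      have "\<bar>\<Sum>n\<in>upto_smooth A u. classdev q b' n\<bar> \<le> (\<epsilon> + \<kappa> * log 2 (real u)) * ?N u"
        by (rule less.IH) (use u uz b' less.prems in auto)
      also have "\<dots> \<le> \<epsilon>' * ?N u"
      proof (rule mult_right_mono)
        have "log 2 (real u) + 1 = log 2 (2 * real u)" using u t by (simp add: log_mult)
        also have "\<dots> \<le> log 2 (real z)" using u t by (subst log_le_cancel_iff) auto
        finally have "\<kappa> * log 2 (real u) \<le> \<kappa> * (log 2 (real z) - 1)" using eps by (intro mult_left_mono) auto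
        then show "\<epsilon> + \<kappa> * log 2 (real u) \<le> \<epsilon>'" by (simp add: \<epsilon>'_def)
      qed simp
      finally show ?thesis .
    qed
    \<comment> \<open>No information is available for \<open>m \<le> t\<close>; those terms are
      bounded trivially by \<open>t / ln d\<close>, and the boundary term of the partial summation
      costs twice as much.\<close>
    have inner: "\<bar>\<Sum>m\<in>upto_smooth A (z div d). classdev q b (d * m) / ln (real (d * m))\<bar> \<le>
        \<epsilon>' * (\<Sum>m\<in>upto_smooth A (z div d). 1 / ln (real (d * m))) + 3 * real t / lnn d" if d: "d \<in> smooth_primepows A z" for d
    proof -
      have dS: "d \<in> smooth A" "d > 1" using d primepow_gt_Suc_0[of d] by (auto simp: smooth_primepows_def upto_smooth_def)
      have cd: "coprime d q" by (rule coprime_smooth[OF A(3) dS(1)])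
      obtain b' where b': "coprime b' q" "\<And>m. classdev q b (d * m) = classdev q b' m"
        by (rule classdev_shift[OF q cd less.prems(3)]) (rule that)
      define c where "c = classdev q b'"
      define g where "g m = 1 / ln (real (d * m))" for m
      define U where "U = z div d"
      have c1: "\<bar>c m\<bar> \<le> 1" for m unfolding c_def by (rule abs_classdev_le[OF q])
      have ld: "lnn d > 0" using dS by simp
      have g0: "g m \<ge> 0" "g m \<le> 1 / lnn d" if "m > 0" for m
      proof -
        have "d \<le> d * m" using that by simp
        then have "real d \<le> real (d * m)" by (rule of_nat_mono)
        then have le: "lnn d \<le> ln (real (d * m))" using dS that by (intro ln_mono) auto
        then show "g m \<le> 1 / lnn d" unfolding g_def using ld by (intro divide_left_mono) auto
        show "g m \<ge> 0" unfolding g_def using le ld by simp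
      qed
      have gdec: "g (Suc m) \<le> g m" if "m > 0" for m
      proof -
        have "ln (real (d * m)) \<ge> lnn d" using dS that by (intro ln_mono) auto
        then have "ln (real (d * m)) > 0" using ld by linarith
        moreover have "ln (real (d * m)) \<le> ln (real (d * Suc m))" using dS that by (intro ln_mono) auto
        ultimately show ?thesis unfolding g_def by (intro divide_left_mono) auto
      qed
      have small: "\<bar>\<Sum>m\<in>upto_smooth A u. c m * g m\<bar> \<le> real t / lnn d" if "u \<le> t" for u
      proof -
        have "\<bar>\<Sum>m\<in>upto_smooth A u. c m * g m\<bar> \<le> (\<Sum>m\<in>upto_smooth A u. 1 / lnn d)"
        proof (rule order_trans[OF sum_abs], rule sum_mono)
          fix m assume "m \<in> upto_smooth A u"
          then have "m > 0" using upto_smooth_pos by blast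
          have "\<bar>c m\<bar> * \<bar>g m\<bar> \<le> 1 * (1 / lnn d)" using g0[OF \<open>m > 0\<close>] by (intro mult_mono c1) auto
          then show "\<bar>c m * g m\<bar> \<le> 1 / lnn d" by (simp add: abs_mult)
        qed
        also have "\<dots> = real (card (upto_smooth A u)) / lnn d" by simp
        also have "\<dots> \<le> real t / lnn d"
          using ld card_upto_smooth_le[of A u] that by (intro divide_right_mono) auto
        finally show ?thesis .
      qed
      have gsum0: "(\<Sum>m\<in>upto_smooth A u. g m) \<ge> 0" for u using g0 upto_smooth_pos by (intro sum_nonneg) blast
      have td: "real t / lnn d \<ge> 0" using ld by simp
      have "\<bar>\<Sum>m\<in>upto_smooth A U. c m * g m\<bar> \<le> \<epsilon>' * (\<Sum>m\<in>upto_smooth A U. g m) + 3 * (real t / lnn d)"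
      proof (cases "U \<le> t")
        case True
        then show ?thesis using small[of U] mult_nonneg_nonneg[OF e0 gsum0[of U]] td by linarith
      next
        case False
        have U2: "2 * u \<le> z" if "u \<le> U" for u
        proof -
          have "2 * u \<le> d * U" using that dS by (intro mult_mono) auto
          also have "\<dots> \<le> z" by (simp add: U_def)
          finally show ?thesis .
        qed
        \<comment> \<open>Both signs \<open>s\<close> are needed. The summands
          \<open>\<epsilon>' - s * c m\<close> have partial sums bounded below by
          \<open>- 2 * t\<close>, the negative part stemming only from the start at
          \<open>t\<close>.\<close>
        have key: "(\<Sum>m\<in>{t<..U}. (if m \<in> smooth A then \<epsilon>' - s * c m else 0) * g m) \<ge> - (2 * real t * g (Suc t))"
          if s: "\<bar>s\<bar> = 1" for s :: real
        proof (rule abel_lower)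
          fix u assume u: "t \<le> u" "u \<le> U"
          have e4: "(\<Sum>m\<in>{t<..u}. if m \<in> smooth A then \<epsilon>' - s * c m else 0) =
             (\<Sum>m\<in>upto_smooth A u. \<epsilon>' - s * c m) - (\<Sum>m\<in>upto_smooth A t. \<epsilon>' - s * c m)"
            by (rule sum_upto_smooth_split[OF u(1)])
          have b2: "\<bar>s * (\<Sum>m\<in>upto_smooth A v. c m)\<bar> \<le> \<epsilon>' * ?N v" if "t \<le> v" "v \<le> U" for v
            using IH[OF that(1) U2[OF that(2)] b'(1)] s unfolding c_def abs_mult by simp
          have e3: "(\<Sum>m\<in>upto_smooth A v. \<epsilon>' - s * c m) = \<epsilon>' * ?N v - s * (\<Sum>m\<in>upto_smooth A v. c m)" for v
            by (simp add: sum_subtractf sum_distrib_left)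
          have "t \<le> U" using False by simp
          have "(\<Sum>m\<in>{t<..u}. if m \<in> smooth A then \<epsilon>' - s * c m else 0) \<ge> - (2 * (\<epsilon>' * ?N t))"
            unfolding e4 e3 using b2[OF u, THEN abs_le_D1] b2[OF order_refl \<open>t \<le> U\<close>, THEN abs_le_D2] by linarith
          moreover have "\<epsilon>' * ?N t \<le> 1 * real t" using e0 e1 card_upto_smooth_le[of A t] by (intro mult_mono) auto
          ultimately show "(\<Sum>m\<in>{t<..u}. if m \<in> smooth A then \<epsilon>' - s * c m else 0) \<ge> - (2 * real t)" by linarith
        qed (use False g0 gdec in auto)
        have conv: "(\<Sum>m\<in>{t<..U}. (if m \<in> smooth A then \<epsilon>' - s * c m else 0) * g m) =
            \<epsilon>' * ((\<Sum>m\<in>upto_smooth A U. g m) - (\<Sum>m\<in>upto_smooth A t. g m)) - s * ((\<Sum>m\<in>upto_smooth A U. c m * g m) - (\<Sum>m\<in>upto_smooth A t. c m * g m))" for s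
        proof -
          have "(\<Sum>m\<in>{t<..U}. (if m \<in> smooth A then \<epsilon>' - s * c m else 0) * g m) = (\<Sum>m\<in>{t<..U}. if m \<in> smooth A then \<epsilon>' * g m - s * (c m * g m) else 0)"
            by (rule sum.cong[OF refl]) (simp add: algebra_simps)
          also have "\<dots> = (\<Sum>m\<in>upto_smooth A U. \<epsilon>' * g m - s * (c m * g m)) - (\<Sum>m\<in>upto_smooth A t. \<epsilon>' * g m - s * (c m * g m))"
            using False by (intro sum_upto_smooth_split) auto
          finally show ?thesis by (simp add: sum_subtractf sum_distrib_left[symmetric] algebra_simps)
        qed
        have "2 * real t * g (Suc t) \<le> 2 * real t * (1 / lnn d)" using g0(2)[of "Suc t"] by (intro mult_left_mono) auto
        then have k: "- (2 * (real t / lnn d)) \<le> - (2 * real t * g (Suc t))" by simp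
        define G where "G = (\<Sum>m\<in>upto_smooth A U. g m)"
        define G' where "G' = (\<Sum>m\<in>upto_smooth A t. g m)"
        define H where "H = (\<Sum>m\<in>upto_smooth A U. c m * g m) - (\<Sum>m\<in>upto_smooth A t. c m * g m)"
        have "- (2 * (real t / lnn d)) \<le> \<epsilon>' * (G - G') - 1 * H"
          using k key[of 1] unfolding conv G_def G'_def H_def by linarith
        moreover have "- (2 * (real t / lnn d)) \<le> \<epsilon>' * (G - G') - (-1) * H"
          using k key[of "-1"] unfolding conv G_def G'_def H_def by linarith
        moreover have "\<epsilon>' * (G - G') \<le> \<epsilon>' * G" using gsum0[of t] e0 by (intro mult_left_mono) (auto simp: G'_def)
        ultimately have "\<bar>H\<bar> \<le> \<epsilon>' * G + 2 * (real t / lnn d)" by (simp add: abs_le_iff)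
        then show ?thesis using small[of t] unfolding H_def G_def by (simp add: abs_le_iff)
      qed
      then show ?thesis unfolding U_def c_def g_def b'(2) by simp
    qed
    have ml: "0 \<le> (mangoldt d :: real)" "mangoldt d / lnn d \<le> (1::real)" if d: "d \<in> smooth_primepows A z" for d
    proof -
      have pp: "primepow d" using d by (simp add: smooth_primepows_def)
      then have d1: "d > 1" using primepow_gt_Suc_0[of d] by simp
      obtain p k where pk: "prime p" "k > 0" "d = p ^ k" using pp by (auto simp: primepow_def)
      then have "aprimedivisor d = p" by (simp add: aprimedivisor_prime_power)
      moreover have "p dvd d" using pk by auto
      then have "p \<le> d" using d1 by (intro dvd_imp_le) auto
      ultimately have ap: "real (aprimedivisor d) \<le> real d" "real (aprimedivisor d) > 1" using prime_gt_1_nat[OF pk(1)] by auto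
      then have "ln (real (aprimedivisor d)) \<le> lnn d" "0 < ln (real (aprimedivisor d))" by (auto intro: ln_mono)
      moreover have "(mangoldt d :: real) = ln (real (aprimedivisor d))" using pp by (simp add: mangoldt_def)
      ultimately show "0 \<le> (mangoldt d :: real)" "mangoldt d / lnn d \<le> (1::real)" using d1 by (simp_all only: divide_le_eq_1) auto
    qed
    have "1 \<in> upto_smooth A z" using z2 by (simp add: upto_smooth_def)
    then have sp: "(\<Sum>n\<in>upto_smooth A z. h n) = h 1 + (\<Sum>n\<in>upto_smooth A z - {1}. h n)" for h :: "nat \<Rightarrow> real"
      by (intro sum.remove) auto
    have "\<bar>\<Sum>n\<in>upto_smooth A z - {1}. classdev q b n\<bar> \<le>
      (\<Sum>d\<in>smooth_primepows A z. mangoldt d * (\<epsilon>' * (\<Sum>m\<in>upto_smooth A (z div d). 1 / ln (real (d * m))) + 3 * real t / lnn d))"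
      unfolding mangoldt_expand
    proof (rule order_trans[OF sum_abs], rule sum_mono)
      fix d assume d: "d \<in> smooth_primepows A z"
      show "\<bar>mangoldt d * (\<Sum>m\<in>upto_smooth A (z div d). classdev q b (d * m) / ln (real (d * m)))\<bar> \<le>
          mangoldt d * (\<epsilon>' * (\<Sum>m\<in>upto_smooth A (z div d). 1 / ln (real (d * m))) + 3 * real t / lnn d)"
        unfolding abs_mult using ml(1)[OF d] inner[OF d] by (simp add: mult_left_mono)
    qed
    also have "\<dots> = \<epsilon>' * (\<Sum>d\<in>smooth_primepows A z. mangoldt d * (\<Sum>m\<in>upto_smooth A (z div d). 1 / ln (real (d * m))))
        + 3 * real t * (\<Sum>d\<in>smooth_primepows A z. mangoldt d / lnn d)"
      unfolding sum_distrib_left sum.distrib[symmetric] distrib_left by (rule sum.cong[OF refl]) (simp add: mult_ac sum_distrib_left)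
    \<comment> \<open>Read backwards for the constant 1, the expansion turns the weighted counts
      into the count up to \<open>z\<close>, so the factor \<open>\<epsilon>'\<close> is passed on
      unchanged.\<close>
    also have "(\<Sum>d\<in>smooth_primepows A z. mangoldt d * (\<Sum>m\<in>upto_smooth A (z div d). 1 / ln (real (d * m)))) = (\<Sum>n\<in>upto_smooth A z - {1}. 1)"
      by (rule mangoldt_expand[symmetric])
    also have "\<epsilon>' * (\<Sum>n\<in>upto_smooth A z - {1}. 1) + 3 * real t * (\<Sum>d\<in>smooth_primepows A z. mangoldt d / lnn d)
        \<le> \<epsilon>' * ?N z + 3 * real t * (real (card A) * log 2 (real z))"
    proof (intro add_mono mult_left_mono e0)
      have "card (upto_smooth A z - {1}) \<le> card (upto_smooth A z)" by (intro card_mono) auto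
      then show "(\<Sum>n\<in>upto_smooth A z - {1}. 1) \<le> ?N z" by simp
      have "(\<Sum>d\<in>smooth_primepows A z. mangoldt d / lnn d) \<le> (\<Sum>d\<in>smooth_primepows A z. 1)" by (intro sum_mono ml)
      also have "\<dots> = real (card (smooth_primepows A z))" by simp
      also have "\<dots> \<le> real (card A) * log 2 (real z)" by (rule card_smooth_primepows) (use A z2 in auto)
      finally show "(\<Sum>d\<in>smooth_primepows A z. mangoldt d / lnn d) \<le> real (card A) * log 2 (real z)" .
    qed simp
    finally have "\<bar>\<Sum>n\<in>upto_smooth A z. classdev q b n\<bar> \<le> 1 + \<epsilon>' * ?N z + 3 * real t * (real (card A) * log 2 (real z))"
      unfolding sp using abs_classdev_le[OF q, of b 1] by linarith
    also have "\<dots> \<le> \<epsilon>' * ?N z + \<kappa> * ?N z" using cost[of z] False less.prems by linarith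
    also have "\<dots> = (\<epsilon> + \<kappa> * log 2 (real z)) * ?N z" by (simp add: \<epsilon>'_def algebra_simps)
    finally show ?thesis .
  qed
qed

section \<open>The range of large y\<close>

lemma harm_le_ln: "n > 0 \<Longrightarrow> (harm n :: real) \<le> 1 + lnn n"
proof -
  assume "n > 0"
  then obtain k where k: "n = Suc k" by (cases n) auto
  have "harm (Suc k) - ln (real (Suc k)) \<le> harm (Suc 0) - ln (real (Suc 0))"
    using decseq_harm_diff_ln by (rule decseqD) simp
  then show ?thesis using k by (simp add: harm_expand)
qed

text \<open>A rough number that is not \<open>A\<close>-smooth has a prime factor
  \<open>p > exp T\<close>, and its cofactor is at most \<open>t1\<close>. For each cofactor the
  possible \<open>p\<close> are bounded by sieving at the higher level \<open>w\<close>, which gains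
  \<open>1 / ln w\<close>; summing over the cofactors costs only the factor
  \<open>1 + ln t1\<close>.\<close>

lemma class_count_rough:
  assumes A: "A = pint y' (exp T)" and q: "q > 0" "\<forall>p\<in>prime_factors q. real p < y'" and a: "coprime a q"
    and W: "W \<ge> 3" "y' \<le> W" and w: "w \<ge> 3" "y' \<le> w" "w \<le> exp T" and z: "z > 0" "z \<le> exp T * t1" and t1: "t1 \<ge> 1"
  shows "\<bar>real (card {n \<in> smooth A. real n \<le> z \<and> [n = a] (mod q)}) - z * mprod y' / real (totient q)\<bar> \<le>
    z * exp (- ln z / ln W + 3 * recip W) +
    z * ((1 + ln t1) * (1 / (real (totient q) * ln w) + exp (- T / ln w + 3 * recip w)))"
proof -
  let ?R = "rough_class y' z q a" and ?N = "{n \<in> smooth A. real n \<le> z \<and> [n = a] (mod q)}"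
  let ?e = "1 / (real (totient q) * ln w) + exp (- T / ln w + 3 * recip w)"
  define M where "M = nat \<lfloor>t1\<rfloor>"
  define P where "P m = {p::nat. prime p \<and> exp T < real p \<and> real p \<le> z / real m \<and> [m * p = a] (mod q)}" for m :: nat
  have M: "M > 0" "real M \<le> t1" using t1 by (auto simp: M_def)
  have lw: "ln w > 0" using w by simp
  have ph: "real (totient q) > 0" using q by simp
  have e0: "?e \<ge> 0" using lw ph by simp
  have NR: "?N \<subseteq> ?R"
    using smooth_pos by (auto simp: rough_class_def smooth_def A pint_def in_prime_factors_iff)
  have finP: "finite (P m)" for m unfolding P_def
    by (rule finite_subset[OF _ finite_nat_le_real(1)[of "z / real m"]]) auto
  have bad: "?R - ?N \<subseteq> (\<Union>m\<in>{1..M}. (\<lambda>p. m * p) ` P m)"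
  proof
    fix n assume n: "n \<in> ?R - ?N"
    then have n0: "n > 0" and nz: "real n \<le> z" and cong: "[n = a] (mod q)" and rough: "\<And>p. prime p \<Longrightarrow> p dvd n \<Longrightarrow> y' \<le> real p"
      by (auto simp: rough_class_def)
    have "n \<notin> smooth A" using n nz cong by blast
    then obtain p where p: "prime p" "p dvd n" "p \<notin> A" using n0 by (auto simp: smooth_def in_prime_factors_iff)
    then have pT: "real p > exp T" using rough[OF p(1,2)] by (auto simp: A pint_def)
    obtain m where m: "n = m * p" using p(2) by (metis dvd_def mult.commute)
    have m0: "m > 0" using n0 m by (cases m) auto
    have "real m * exp T \<le> real m * real p" using pT by (intro mult_left_mono) auto
    also have "\<dots> \<le> exp T * t1" using nz z m by simp
    finally have "real m \<le> t1" by (simp add: mult.commute)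
    then have mM: "m \<in> {1..M}" using m0 by (auto simp: M_def le_nat_floor)
    have "real p \<le> z / real m" using nz m m0 by (simp add: field_simps)
    then have "p \<in> P m" using p pT cong m by (simp add: P_def)
    then show "n \<in> (\<Union>m\<in>{1..M}. (\<lambda>p. m * p) ` P m)" using mM m by blast
  qed
  have cardP: "real (card (P m)) \<le> z / real m * ?e" if m: "m \<in> {1..M}" for m
  proof (cases "P m = {}")
    case True
    then show ?thesis using e0 z by simp
  next
    case False
    then obtain p0 where p0: "p0 \<in> P m" by blast
    have zm: "z / real m > 0" using z m by simp
    have "[a = m * p0] (mod q)" using p0 unfolding P_def by (auto intro: cong_sym)
    then have cmp: "coprime (m * p0) q" using a by (rule cong_imp_coprime)
    then have cm: "coprime m q" "coprime p0 q" by auto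
    have sub: "P m \<subseteq> rough_class w (z / real m) q p0"
    proof
      fix p assume p: "p \<in> P m"
      have "[m * p = m * p0] (mod q)" using p p0 unfolding P_def by (auto intro: cong_trans cong_sym)
      then have "[p = p0] (mod q)" using cm(1) by (simp add: cong_mult_lcancel_nat)
      moreover have "w \<le> real r" if "prime r" "r dvd p" for r
      proof -
        have "r = p" using that p primes_dvd_imp_eq by (auto simp: P_def)
        then show ?thesis using p w by (simp add: P_def)
      qed
      ultimately show "p \<in> rough_class w (z / real m) q p0" using p by (auto simp: rough_class_def P_def prime_gt_0_nat)
    qed
    have pw: "\<forall>p\<in>prime_factors q. real p < w" using q w by force
    have "real (card (P m)) \<le> real (card (rough_class w (z / real m) q p0))" by (intro of_nat_mono card_mono sub) auto
    also have "\<dots> \<le> z / real m * mprod w / real (totient q) + z / real m * exp (- ln (z / real m) / ln w + 3 * recip w)"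
      using rough_class_count[OF q(1) pw cm(2) zm w(1) order_refl] by (simp add: abs_le_iff)
    also have "\<dots> \<le> z / real m * ?e"
    proof -
      have "mprod w / real (totient q) \<le> 1 / ln w / real (totient q)"
        using mprod_upper[of w] w ph by (intro divide_right_mono) auto
      then have "mprod w / real (totient q) \<le> 1 / (real (totient q) * ln w)" by (simp add: mult.commute)
      then have 1: "z / real m * (mprod w / real (totient q)) \<le> z / real m * (1 / (real (totient q) * ln w))"
        using zm by (intro mult_left_mono) auto
      have "exp T \<le> z / real m" using p0 by (simp add: P_def)
      then have "T \<le> ln (z / real m)" using zm by (simp add: ln_ge_iff)
      then have "- ln (z / real m) / ln w \<le> - T / ln w" using lw by (simp add: divide_right_mono)
      then have 2: "z / real m * exp (- ln (z / real m) / ln w + 3 * recip w) \<le> z / real m * exp (- T / ln w + 3 * recip w)"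
        using zm by (intro mult_left_mono) auto
      show ?thesis using 1 2 unfolding distrib_left by simp
    qed
    finally show ?thesis .
  qed
  have "real (card (?R - ?N)) \<le> real (card (\<Union>m\<in>{1..M}. (\<lambda>p. m * p) ` P m))"
    using finP by (intro of_nat_mono card_mono bad) auto
  also have "\<dots> \<le> real (\<Sum>m\<in>{1..M}. card ((\<lambda>p. m * p) ` P m))" by (intro of_nat_mono card_UN_le) auto
  also have "\<dots> \<le> (\<Sum>m\<in>{1..M}. z / real m * ?e)"
    unfolding of_nat_sum
  proof (rule sum_mono)
    fix m assume m: "m \<in> {1..M}"
    have "real (card ((\<lambda>p. m * p) ` P m)) \<le> real (card (P m))" using finP by (intro of_nat_mono card_image_le)
    then show "real (card ((\<lambda>p. m * p) ` P m)) \<le> z / real m * ?e" using cardP[OF m] by linarith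
  qed
  also have "\<dots> = harm M * (z * ?e)" unfolding harm_def sum_distrib_right by (rule sum.cong[OF refl]) (simp add: divide_inverse mult_ac)
  also have "\<dots> \<le> (1 + ln t1) * (z * ?e)"
  proof (rule mult_right_mono)
    have "lnn M \<le> ln t1" using M by (intro ln_mono) auto
    then show "harm M \<le> 1 + ln t1" using harm_le_ln[OF M(1)] by linarith
  qed (use z e0 in auto)
  finally have badc: "real (card (?R - ?N)) \<le> z * ((1 + ln t1) * ?e)" by (simp only: mult_ac)
  have "card ?R = card ?N + card (?R - ?N)" using NR by (subst card_Un_disjoint[symmetric]) (auto intro: finite_subset[OF NR] arg_cong[of _ _ card])
  then have cc: "real (card ?R) = real (card ?N) + real (card (?R - ?N))" by simp
  have "\<bar>real (card ?R) - z * mprod y' / real (totient q)\<bar> \<le> z * exp (- ln z / ln W + 3 * recip W)"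
    by (rule rough_class_count) (use q a z W in auto)
  then show ?thesis using badc cc by (simp add: abs_le_iff)
qed

lemma smooth_le_eq_upto: "z \<ge> 0 \<Longrightarrow> (smooth_le A z) = upto_smooth A (nat \<lfloor>z\<rfloor>)"
  by (auto simp: upto_smooth_def le_nat_floor) (metis le_nat_iff of_nat_nat_take_bit_eq floor_of_nat le_floor_iff nat_floor_neg of_nat_le_iff of_nat_0_le_iff zero_le_floor le_nat_iff of_int_of_nat_eq)

theorem large_y_regime:
  assumes K: "K' > 0" "K'' > 0"
  shows "\<exists>X0. equidistributed X0 K' K'' (\<lambda>X. X powr (1/4)) (\<lambda>X. X)"
proof -
  obtain C where C: "C \<ge> 1" "\<And>W. W \<ge> exp 1 \<Longrightarrow> recip W \<le> C * (1 + ln (ln W))"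
    using prime_reciprocals by blast
  \<comment> \<open>With \<open>l = ln X\<close> this bounds the relative error of the sieve count.
    The last summand comes from primes above \<open>exp T\<close> and dominates:
    \<open>exp (- l / 4)\<close> from \<open>1 / T\<close> and \<open>exp (l / 100)\<close> from
    \<open>1 / V\<close>, times a power of \<open>l\<close>. The exponent 22/100 lies between 1/5
    and 24/100.\<close>
  define F where "F l = exp (K'' * l) * (exp (- (l\<^sup>2 / K') + l / 50) + (1 + 2 * l ^ 3) * exp (- l\<^sup>2 + 3 * C * (1 + l))) * exp (l / 100)
      + (1 + 2 * l ^ 3) * l\<^sup>2 * exp (- (l / 4) + l / 100)" for l :: real
  have "eventually (\<lambda>l. C * (1 + ln (K' * l)) \<le> l / 200) at_top" using K C(1) by real_asymp
  moreover have "eventually (\<lambda>l. F l \<le> exp (- (22 / 100 * l))) at_top"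
  proof -
    have "eventually (\<lambda>l::real. exp (- l) + (1 + 2 * l ^ 3) * exp (- (2 * l)) + (1 + 2 * l ^ 3) * l\<^sup>2 * exp (- (l / 4) + l / 100) \<le> exp (- (22 / 100 * l))) at_top"
      by real_asymp
    then show ?thesis using eventually_ge_at_top[of "K' * (K'' + 2)"] eventually_ge_at_top[of "K'' + 6 * C + 3"] eventually_ge_at_top[of 1]
    proof eventually_elim
      case (elim l)
      have "K' * (K'' + 2) * l \<le> l * l" using elim by (intro mult_right_mono) auto
      then have "(K'' + 2) * l \<le> l\<^sup>2 / K'" using K by (simp add: field_simps power2_eq_square)
      then have E1: "exp (K'' * l + (- (l\<^sup>2 / K') + l / 50) + l / 100) \<le> exp (- l)" using elim(4) by (simp add: algebra_simps)
      have "(K'' + 6 * C + 3) * l \<le> l\<^sup>2" unfolding power2_eq_square using elim by (intro mult_right_mono) auto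
      moreover have "3 * C * (1 + l) \<le> 3 * C * (2 * l)" using elim C(1) by (intro mult_left_mono) auto
      ultimately have E2: "exp (K'' * l + (- l\<^sup>2 + 3 * C * (1 + l)) + l / 100) \<le> exp (- (2 * l))" using elim(4) by (simp add: algebra_simps)
      have "F l = exp (K'' * l + (- (l\<^sup>2 / K') + l / 50) + l / 100) + (1 + 2 * l ^ 3) * exp (K'' * l + (- l\<^sup>2 + 3 * C * (1 + l)) + l / 100)
          + (1 + 2 * l ^ 3) * l\<^sup>2 * exp (- (l / 4) + l / 100)"
        unfolding F_def exp_add by (simp only: distrib_left distrib_right mult_ac)
      also have "\<dots> \<le> exp (- l) + (1 + 2 * l ^ 3) * exp (- (2 * l)) + (1 + 2 * l ^ 3) * l\<^sup>2 * exp (- (l / 4) + l / 100)"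
        using elim(4) by (intro add_mono E1 mult_left_mono E2) auto
      finally show ?case using elim(1) by linarith
    qed
  qed
  moreover have "eventually (\<lambda>l. 104 * exp ((2 + K'') * l - l ^ 3 + l / 100) \<le> exp (- (22 / 100 * l))) at_top" using K by real_asymp
  moreover have "eventually (\<lambda>l::real. 5 * exp (- (22 / 100 * l)) \<le> exp (- (l / 5))) at_top" by real_asymp
  moreover have "eventually (\<lambda>l. exp (l / 4) / l\<^sup>2 \<ge> K' * l) at_top" using K by real_asymp
  moreover have "eventually (\<lambda>l. K' * l \<ge> 2) at_top" using K by real_asymp
  moreover have "eventually (\<lambda>l::real. l ^ 3 + 2 \<le> exp l) at_top" by real_asymp
  ultimately have "eventually (\<lambda>l. C * (1 + ln (K' * l)) \<le> l / 200 \<and> F l \<le> exp (- (22 / 100 * l)) \<and>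
      104 * exp ((2 + K'') * l - l ^ 3 + l / 100) \<le> exp (- (22 / 100 * l)) \<and> 5 * exp (- (22 / 100 * l)) \<le> exp (- (l / 5)) \<and>
      exp (l / 4) / l\<^sup>2 \<ge> K' * l \<and> K' * l \<ge> 2 \<and> l ^ 3 + 2 \<le> exp l \<and> l \<ge> 10) at_top"
    using eventually_ge_at_top[of 10] by (intro eventually_conj)
  then obtain l0 where l0: "\<And>l. l \<ge> l0 \<Longrightarrow> C * (1 + ln (K' * l)) \<le> l / 200 \<and> F l \<le> exp (- (22 / 100 * l)) \<and>
      104 * exp ((2 + K'') * l - l ^ 3 + l / 100) \<le> exp (- (22 / 100 * l)) \<and> 5 * exp (- (22 / 100 * l)) \<le> exp (- (l / 5)) \<and>
      exp (l / 4) / l\<^sup>2 \<ge> K' * l \<and> K' * l \<ge> 2 \<and> l ^ 3 + 2 \<le> exp l \<and> l \<ge> 10"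
    unfolding eventually_at_top_linorder by blast
  show ?thesis unfolding equidistributed_def
  proof (rule exI[of _ "exp l0"], intro allI impI)
    fix X y' T :: real and q a :: nat
    assume X: "X \<ge> exp l0" and y': "1 \<le> y'" "ln y' \<le> K' * ln X" and T: "X powr (1/4) \<le> T" "T \<le> X"
      and q: "q > 0" "real q \<le> X powr K''" "\<forall>p\<in>prime_factors q. real p < y'" and a: "coprime a q"
    define l where "l = ln X"
    have X0: "X > 0" using X exp_gt_zero[of l0] by linarith
    have Xl: "X = exp l" using X0 by (simp add: l_def)
    have "l \<ge> l0" using X X0 by (simp add: l_def ln_ge_iff)
    note L = l0[OF this]
    have L1: "C * (1 + ln (K' * l)) \<le> l / 200" and L2: "F l \<le> exp (- (22 / 100 * l))"
      and L3: "104 * exp ((2 + K'') * l - l ^ 3 + l / 100) \<le> exp (- (22 / 100 * l))"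
      and L4: "5 * exp (- (22 / 100 * l)) \<le> exp (- (l / 5))" and L5: "exp (l / 4) / l\<^sup>2 \<ge> K' * l"
      and L6: "K' * l \<ge> 2" and L7: "l ^ 3 + 2 \<le> exp l" and L8: "l \<ge> 10"
      using L by blast+
    define A where "A = pint y' (exp T)"
    define ph where "ph = real (totient q)"
    define V where "V = mprod y'"
    \<comment> \<open>Large enough for the sieve at level \<open>W\<close>, since
      \<open>ln t0 / ln W = l ^ 2 / K'\<close>, and still far below \<open>exp X\<close> because
      \<open>X = exp l\<close>.\<close>
    define t0 where "t0 = exp (l ^ 3)"
    define W where "W = exp (K' * l)"
    \<comment> \<open>\<open>ln w\<close> is smaller than \<open>T\<close> only by the factor
      \<open>l ^ 2\<close>, so the gain \<open>1 / ln w\<close> is nearly \<open>1 / T\<close>,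
      while \<open>T / ln w = l ^ 2\<close> keeps the sieve error negligible.\<close>
    define w where "w = exp (T / l\<^sup>2)"
    define \<epsilon>1 where "\<epsilon>1 = exp (- (22 / 100 * l))"
    have T4: "exp (l / 4) \<le> T" using T(1) X0 unfolding powr_def l_def by simp
    have T0: "T \<ge> 1" using T4 exp_ge_add_one_self[of "l / 4"] L8 by linarith
    have l2: "l\<^sup>2 \<ge> 1" "l\<^sup>2 > 0" using L8 by (auto simp: one_le_power)
    have ph: "ph \<ge> 1" "ph \<le> exp (K'' * l)"
    proof -
      show "ph \<ge> 1" using q by (simp add: ph_def Suc_leI)
      have "X powr K'' = exp (K'' * l)" using X0 by (simp add: powr_def l_def)
      then show "ph \<le> exp (K'' * l)" using q totient_le[of q] unfolding ph_def by linarith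
    qed
    have V0: "V > 0" by (simp add: V_def mprod_pos)
    have e13: "exp (1::real) \<le> 3" by (rule exp_le)
    have e2: "(3::real) \<le> exp 2"
      using exp_ge_add_one_self[of "2::real"] by simp
    have yW: "y' \<le> W"
    proof -
      have "exp (ln y') \<le> exp (K' * l)" using y'(2) by (simp only: exp_le_cancel_iff l_def)
      then show ?thesis unfolding W_def using y'(1) by simp
    qed
    have W3: "W \<ge> 3" using L6 e2 unfolding W_def by (meson exp_le_cancel_iff order_trans)
    have lnw: "ln w = T / l\<^sup>2" by (simp add: w_def)
    have lw: "K' * l \<le> T / l\<^sup>2"
    proof -
      have "exp (l / 4) / l\<^sup>2 \<le> T / l\<^sup>2" using T4 by (intro divide_right_mono) auto
      then show ?thesis using L5 by linarith
    qed
    have Ww: "W \<le> w" unfolding W_def w_def using lw by simp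
    have w3: "w \<ge> 3" "y' \<le> w" using W3 yW Ww by linarith+
    have wT: "w \<le> exp T"
    proof -
      have "T / l\<^sup>2 \<le> T / 1" using T0 l2 by (intro divide_left_mono) auto
      then show ?thesis by (simp add: w_def)
    qed
    have SW: "recip W \<le> l / 200"
    proof -
      have "exp 1 \<le> W" using e13 W3 by linarith
      then have "recip W \<le> C * (1 + ln (ln W))" by (rule C(2))
      also have "ln W = K' * l" by (simp add: W_def)
      finally show ?thesis using L1 by linarith
    qed
    have Sw: "recip w \<le> C * (1 + l)"
    proof -
      have "recip w \<le> C * (1 + ln (ln w))" using C(2)[of w] e13 w3 by simp
      also have "\<dots> \<le> C * (1 + l)"
      proof -
        have "T / l\<^sup>2 \<le> X / 1" using T l2 T0 by (intro frac_le) auto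
        moreover have "T / l\<^sup>2 > 0" using T0 l2 by simp
        ultimately have "ln (T / l\<^sup>2) \<le> l" unfolding l_def by (intro ln_mono) auto
        then show ?thesis unfolding lnw using C(1) by (intro mult_left_mono) auto
      qed
      finally show ?thesis .
    qed
    have Vlow: "1 / V \<le> exp (l / 100)"
    proof -
      have "exp (- (l / 100)) \<le> exp (- (2 * recip W))" using SW by simp
      also have "\<dots> \<le> V" unfolding V_def by (rule mprod_lower[OF yW])
      finally show ?thesis using V0 by (simp add: exp_minus field_simps)
    qed
    have t0: "t0 \<ge> 2" "t0 > 0"
    proof -
      have "l ^ 3 \<ge> 1" using L8 by (intro one_le_power) auto
      then show "t0 \<ge> 2" using exp_ge_add_one_self[of "l ^ 3"] unfolding t0_def by linarith
      then show "t0 > 0" by linarith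
    qed
    let ?e1 = "exp (- (l\<^sup>2 / K') + l / 50)" and ?e2 = "exp (- l\<^sup>2 + 3 * C * (1 + l))" and ?c = "1 + 2 * l ^ 3"
    \<comment> \<open>The modulus is kept general because modulus 1 yields the count without
      congruence condition, to which the class is then compared.\<close>
    have close: "\<bar>real (card {n \<in> smooth A. real n \<le> u \<and> [n = b] (mod q')}) - u * V / real (totient q')\<bar> \<le> \<epsilon>1 * (u * V / real (totient q'))"
      if u: "t0 \<le> u" "u \<le> exp T * t0\<^sup>2" and q': "q' > 0" "\<forall>p\<in>prime_factors q'. real p < y'" "real (totient q') \<le> exp (K'' * l)" "coprime b q'" for u q' b
    proof -
      have u0: "u > 0" using u t0 by linarith
      have p0: "real (totient q') > 0" using q' by simp
      have lt1: "1 + ln (t0\<^sup>2) = 1 + 2 * l ^ 3" by (simp add: t0_def ln_realpow)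
      have "ln t0 \<le> ln u" using u t0 by (intro ln_mono) auto
      then have lnu: "l ^ 3 \<le> ln u" by (simp add: t0_def)
      have eW: "exp (- ln u / ln W + 3 * recip W) \<le> ?e1"
      proof -
        have "l\<^sup>2 / K' = l ^ 3 / (K' * l)" using L8 K by (simp add: power2_eq_square power3_eq_cube)
        also have "\<dots> \<le> ln u / (K' * l)" using lnu L6 by (intro divide_right_mono) auto
        finally have "- ln u / ln W \<le> - (l\<^sup>2 / K')" by (simp add: W_def)
        then show ?thesis using SW L8 by simp
      qed
      have ew: "exp (- T / ln w + 3 * recip w) \<le> ?e2"
      proof -
        have "- T / ln w = - l\<^sup>2" unfolding lnw using T0 l2 by simp
        then show ?thesis using Sw by simp
      qed
      have t11: "t0\<^sup>2 \<ge> 1" using t0 by (intro one_le_power) auto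
      have "\<bar>real (card {n \<in> smooth A. real n \<le> u \<and> [n = b] (mod q')}) - u * V / real (totient q')\<bar> \<le>
        u * exp (- ln u / ln W + 3 * recip W) +
        u * ((1 + ln (t0\<^sup>2)) * (1 / (real (totient q') * ln w) + exp (- T / ln w + 3 * recip w)))"
        unfolding V_def by (rule class_count_rough[OF A_def q'(1,2,4) W3 yW w3 wT u0 u(2) t11])
      also have "\<dots> \<le> u * ?e1 + u * (?c * (1 / (real (totient q') * ln w) + ?e2))"
        unfolding lt1 using eW ew u0 L8 by (intro add_mono mult_left_mono) auto
      also have "\<dots> = (u * V / real (totient q')) * (1 / V * (real (totient q') * (?e1 + ?c * ?e2) + ?c * (1 / ln w)))"
        using V0 p0 by (simp add: algebra_simps)
      also have "\<dots> \<le> (u * V / real (totient q')) * \<epsilon>1"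
      proof (rule mult_left_mono)
        have "1 / ln w \<le> l\<^sup>2 * exp (- (l / 4))"
        proof -
          have "1 / ln w = l\<^sup>2 / T" by (simp add: lnw)
          also have "\<dots> \<le> l\<^sup>2 / exp (l / 4)" using T4 T0 by (intro divide_left_mono) auto
          finally show ?thesis unfolding exp_minus divide_inverse .
        qed
        then have "1 / V * (real (totient q') * (?e1 + ?c * ?e2) + ?c * (1 / ln w))
          \<le> exp (l / 100) * (exp (K'' * l) * (?e1 + ?c * ?e2) + ?c * (l\<^sup>2 * exp (- (l / 4))))"
          using Vlow q' L8 V0 T0 l2 lnw by (intro mult_mono add_mono mult_right_mono mult_left_mono) auto
        also have "\<dots> = F l" unfolding F_def exp_add by (simp add: algebra_simps)
        also have "\<dots> \<le> \<epsilon>1" using L2 by (simp add: \<epsilon>1_def)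
        finally show "1 / V * (real (totient q') * (?e1 + ?c * ?e2) + ?c * (1 / ln w)) \<le> \<epsilon>1" .
      qed (use u0 V0 in auto)
      finally show ?thesis by (simp only: mult.commute)
    qed
    have eps1: "\<epsilon>1 > 0" "\<epsilon>1 \<le> 1/10"
    proof -
      show "\<epsilon>1 > 0" by (simp add: \<epsilon>1_def)
      have "exp (- (l / 5)) \<le> 1 / 2"
      proof -
        have "exp (l / 5) \<ge> 2" using exp_ge_add_one_self[of "l / 5"] L8 by linarith
        then show ?thesis by (simp add: exp_minus field_simps)
      qed
      then show "\<epsilon>1 \<le> 1/10" using L4 unfolding \<epsilon>1_def by linarith
    qed
    have Nlow: "u * V / 2 \<le> real (card (smooth_le A u))" "\<bar>real (card (smooth_le A u)) - u * V\<bar> \<le> \<epsilon>1 * (u * V)"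
      if u: "t0 \<le> u" "u \<le> exp T * t0\<^sup>2" for u
    proof -
      have "exp (K'' * l) \<ge> 1" using K L8 by simp
      then show c: "\<bar>real (card (smooth_le A u)) - u * V\<bar> \<le> \<epsilon>1 * (u * V)" using close[OF u, of 1 0] by simp
      have "u * V \<ge> 0" using u t0 V0 by simp
      then have "\<epsilon>1 * (u * V) \<le> 1/10 * (u * V)" using eps1 by (intro mult_right_mono) auto
      then show "u * V / 2 \<le> real (card (smooth_le A u))" using c \<open>u * V \<ge> 0\<close> by (simp add: abs_le_iff)
    qed
    define t where "t = nat \<lceil>t0\<rceil>"
    \<comment> \<open>Past this point the count of smooth numbers, about
      \<open>exp T * t0 ^ 2 * V\<close>, exceeds the cost \<open>t0 * exp T * X\<close> of a
      propagation step by a large factor, as \<open>t0\<close> outgrows all powers of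
      \<open>X\<close>.\<close>
    define z1 where "z1 = nat \<lfloor>exp T * t0\<^sup>2\<rfloor>"
    define Zm where "Zm = nat \<lfloor>exp X\<rfloor>"
    \<comment> \<open>Two errors \<open>\<epsilon>1\<close>, one for the class and one for the whole
      count, taken relative to a count of at least \<open>u * V / 2\<close>.\<close>
    define \<epsilon> where "\<epsilon> = 4 * \<epsilon>1 / ph"
    \<comment> \<open>Solves
      \<open>13 * (t0 * exp T * X) = \<kappa> * (exp T * t0 ^ 2 * V / 4)\<close>: the cost of one
      step against the lower bound for the count.\<close>
    define \<kappa> where "\<kappa> = 52 * X / (t0 * V)"
    have tt: "t0 \<le> real t" "real t \<le> 2 * t0" unfolding t_def using t0 by linarith+
    have y2: "exp T \<ge> 2" using exp_ge_add_one_self[of T] T0 by linarith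
    have yt: "exp T * t0\<^sup>2 \<ge> 4 * t0"
    proof -
      have "2 * (2 * t0) \<le> exp T * (t0 * t0)" using y2 t0 by (intro mult_mono) auto
      then show ?thesis by (simp add: power2_eq_square)
    qed
    have z1: "exp T * t0\<^sup>2 / 2 \<le> real z1" "real z1 \<le> exp T * t0\<^sup>2"
    proof -
      show "real z1 \<le> exp T * t0\<^sup>2" unfolding z1_def using t0 by simp
      have "exp T * t0\<^sup>2 - 1 \<le> real z1" unfolding z1_def using yt t0 by linarith
      then show "exp T * t0\<^sup>2 / 2 \<le> real z1" using yt t0 by linarith
    qed
    have ex: "exp X \<ge> 1" using X0 by simp
    have Zm: "real Zm \<le> exp X" unfolding Zm_def using ex by linarith
    have prA: "\<And>p. p \<in> A \<Longrightarrow> prime p" and finA: "finite A" by (auto simp: A_def prime_pint)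
    have copA: "coprime p q" if "p \<in> A" for p using coprime_pint[OF q(3,1)] that unfolding A_def .
    have cardA: "real (card A) \<le> exp T"
    proof -
      have "A \<subseteq> {1..nat \<lfloor>exp T\<rfloor>}" by (auto simp: A_def pint_def prime_gt_0_nat Suc_leI le_nat_floor)
      then have "card A \<le> card {1..nat \<lfloor>exp T\<rfloor>}" by (intro card_mono) auto
      then have "real (card A) \<le> real (nat \<lfloor>exp T\<rfloor>)" unfolding card_atLeastAtMost by (intro of_nat_mono) simp
      also have "\<dots> \<le> exp T" by (rule of_nat_floor) simp
      finally show ?thesis .
    qed
    have lg: "log 2 (real z) \<le> 2 * X" if "z > 0" "z \<le> Zm" for z
    proof -
      have "real z \<le> exp X" using that Zm by linarith
      then have "lnn z \<le> ln (exp X)" using that by (intro ln_mono) auto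
      then have "lnn z / ln 2 \<le> X / (1/2)" using X0 ln2_ge_two_thirds that by (intro frac_le) auto
      then show ?thesis by (simp add: log_def)
    qed
    have Zm0: "Zm > 0" unfolding Zm_def using ex by linarith
    have k0: "\<kappa> \<ge> 0" using X0 t0 V0 by (simp add: \<kappa>_def)
    have k_le: "\<kappa> * log 2 (real Zm) \<le> \<epsilon>1 / ph"
    proof -
      have "\<kappa> * log 2 (real Zm) \<le> \<kappa> * (2 * X)" using lg[of Zm] Zm0 k0 by (intro mult_left_mono) auto
      also have "\<dots> = 104 * X\<^sup>2 / t0 * (1 / V)" by (simp add: \<kappa>_def power2_eq_square)
      also have "\<dots> \<le> 104 * X\<^sup>2 / t0 * exp (l / 100)" using Vlow t0 by (intro mult_left_mono) auto
      also have "104 * X\<^sup>2 / t0 * exp (l / 100) = 104 * exp ((2 + K'') * l - l ^ 3 + l / 100) / exp (K'' * l)"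
      proof -
        have X2: "X\<^sup>2 = exp (2 * l)" unfolding Xl by (simp add: exp_double)
        have "104 * X\<^sup>2 / t0 * exp (l / 100) = 104 * exp (2 * l - l ^ 3 + l / 100)" by (simp only: X2 t0_def exp_add exp_diff)
        also have "exp (2 * l - l ^ 3 + l / 100) = exp ((2 + K'') * l - l ^ 3 + l / 100) / exp (K'' * l)"
          unfolding exp_diff[symmetric] by (simp add: algebra_simps)
        finally show ?thesis by simp
      qed
      also have "\<dots> \<le> \<epsilon>1 / exp (K'' * l)" using L3 unfolding \<epsilon>1_def by (intro divide_right_mono) auto
      also have "\<dots> \<le> \<epsilon>1 / ph" using ph eps1 by (intro divide_left_mono) auto
      finally show ?thesis .
    qed
    have tot: "\<epsilon> + \<kappa> * log 2 (real Zm) \<le> X powr (- 1/5) / ph"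
    proof -
      have "\<epsilon> + \<kappa> * log 2 (real Zm) \<le> 5 * \<epsilon>1 / ph" using k_le unfolding \<epsilon>_def by (simp add: add_divide_distrib[symmetric])
      also have "\<dots> \<le> X powr (- 1/5) / ph"
        using L4 ph X0 unfolding \<epsilon>1_def by (intro divide_right_mono) (auto simp: powr_def l_def)
      finally show ?thesis .
    qed
    have tot1: "\<epsilon> + \<kappa> * log 2 (real Zm) \<le> 1"
    proof -
      have "X powr (- 1/5) \<le> 1" using Xl L8 by (simp add: powr_def)
      then have "X powr (- 1/5) / ph \<le> 1" using ph by simp
      then show ?thesis using tot by linarith
    qed
    have upto: "upto_smooth A u = (smooth_le A (real u))" for u by (auto simp: upto_smooth_def)
    have t1: "t \<ge> 1" using tt t0 by linarith
    have tz1: "t \<le> z1"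
    proof -
      have "real t \<le> real z1" using tt z1 yt by linarith
      then show ?thesis by simp
    qed
    have tZ: "t \<le> Zm"
    proof -
      have "2 * t0 + 1 \<le> exp 2 * t0" using e2 t0 mult_right_mono[OF e2, of t0] by linarith
      also have "\<dots> = exp (l ^ 3 + 2)" by (simp add: t0_def exp_add)
      also have "\<dots> \<le> exp X" using L7 Xl by simp
      finally have "t \<le> \<lfloor>exp X\<rfloor>" using tt by linarith
      then show ?thesis by (simp add: Zm_def)
    qed
    have "\<bar>\<Sum>n\<in>upto_smooth A Zm. classdev q a n\<bar> \<le> (\<epsilon> + \<kappa> * log 2 (real Zm)) * real (card (upto_smooth A Zm))"
    proof (rule discrepancy_propagates[OF finA prA copA q(1) t1 tz1 _ k0 tot1 _ _ tZ order_refl a])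
      show "\<epsilon> \<ge> 0" using eps1 ph by (simp add: \<epsilon>_def)
      fix u b assume u: "t \<le> u" "u \<le> z1" and b: "coprime b q"
      have "t0 \<le> real u" using u tt by linarith
      moreover have "real u \<le> exp T * t0\<^sup>2" using u z1 by linarith
      ultimately have ur: "t0 \<le> real u" "real u \<le> exp T * t0\<^sup>2" by auto
      let ?N = "real (card (smooth_le A (real u)))" and ?Na = "real (card {n \<in> smooth A. real n \<le> real u \<and> [n = b] (mod q)})"
      have c1: "\<bar>?Na - real u * V / ph\<bar> \<le> \<epsilon>1 * (real u * V / ph)"
        using close[OF ur q(1,3) _ b] ph by (simp add: ph_def)
      have c2: "\<bar>?N / ph - real u * V / ph\<bar> \<le> \<epsilon>1 * (real u * V / ph)"
      proof -
        have "\<bar>?N / ph - real u * V / ph\<bar> = \<bar>?N - real u * V\<bar> / ph" using ph by (simp add: diff_divide_distrib[symmetric] abs_divide)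
        also have "\<dots> \<le> \<epsilon>1 * (real u * V) / ph" using Nlow(2)[OF ur] ph by (intro divide_right_mono) auto
        finally show ?thesis by simp
      qed
      have "\<bar>?Na - ?N / ph\<bar> \<le> 2 * (\<epsilon>1 * (real u * V / ph))"
      proof -
        have "\<bar>x - z\<bar> \<le> 2 * d" if "\<bar>x - y\<bar> \<le> d" "\<bar>z - y\<bar> \<le> d" for x y z d :: real using that by linarith
        from this[OF c1 c2] show ?thesis .
      qed
      also have "\<dots> = 4 * \<epsilon>1 / ph * (real u * V / 2)" by simp
      also have "\<dots> \<le> 4 * \<epsilon>1 / ph * ?N" using Nlow(1)[OF ur] eps1 ph by (intro mult_left_mono) auto
      finally show "\<bar>\<Sum>n\<in>upto_smooth A u. classdev q b n\<bar> \<le> \<epsilon> * real (card (upto_smooth A u))"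
        unfolding sum_classdev[OF finite_upto_smooth] unfolding \<epsilon>_def ph_def[symmetric] upto by (simp add: conj_assoc)
    next
      fix z assume z: "z1 < z" "z \<le> Zm"
      have z1r: "t0 \<le> real z1" using z1 yt by linarith
      have "exp T * t0\<^sup>2 / 2 * V / 2 \<le> real z1 * V / 2" using z1 V0 by (intro divide_right_mono mult_right_mono) auto
      also have "\<dots> \<le> real (card (upto_smooth A z1))" unfolding upto using Nlow(1)[OF z1r z1(2)] .
      also have "\<dots> \<le> real (card (upto_smooth A z))" using z by (intro of_nat_mono card_mono) (auto simp: upto_smooth_def)
      finally have N: "exp T * t0\<^sup>2 / 2 * V / 2 \<le> real (card (upto_smooth A z))" .
      have "3 * real t * (real (card A) * log 2 (real z)) \<le> 3 * (2 * t0) * (exp T * (2 * X))"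
        using tt t0 cardA lg[of z] z t1 tz1 by (intro mult_mono) auto
      moreover have "1 \<le> t0 * (exp T * X)"
      proof -
        have "1 * (1 * 1) \<le> t0 * (exp T * X)" using t0 y2 T0 L7 L8 Xl by (intro mult_mono) auto
        then show ?thesis by simp
      qed
      ultimately have "1 + 3 * real t * (real (card A) * log 2 (real z)) \<le> 13 * (t0 * (exp T * X))" by (simp add: algebra_simps)
      also have "\<dots> = \<kappa> * (exp T * t0\<^sup>2 / 2 * V / 2)" using t0 V0 by (simp add: \<kappa>_def power2_eq_square field_simps)
      also have "\<dots> \<le> \<kappa> * real (card (upto_smooth A z))" using N k0 by (rule mult_left_mono)
      finally show "1 + 3 * real t * (real (card A) * log 2 (real z)) \<le> \<kappa> * real (card (upto_smooth A z))" .
    qed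
    also have "\<dots> \<le> X powr (- 1/5) / ph * real (card (upto_smooth A Zm))" using tot by (intro mult_right_mono) auto
    finally have "\<bar>\<Sum>n\<in>upto_smooth A Zm. classdev q a n\<bar> \<le> X powr (- 1/5) * (real (card (upto_smooth A Zm)) / ph)" by simp
    then show "classes_close (pint y' (exp T)) (exp X) q a (X powr (- 1/5))"
      unfolding classes_close_def A_def[symmetric] sum_classdev[OF finite_upto_smooth] unfolding Zm_def smooth_le_eq_upto[symmetric, OF exp_ge_zero] ph_def
      by (simp add: conj_assoc)
  qed
qed

section \<open>Combining the two ranges\<close>

lemma S_range_eq: "S_range y' y = smooth (pint y' y)"
  by (auto simp: S_range_def smooth_def pint_def)

lemma relative_error:
  fixes P Q f :: real
  assumes "P > 0" "f > 0"
  shows "Q = P / f * (1 + (Q * f / P - 1))" and "\<bar>Q - P / f\<bar> \<le> e * (P / f) \<Longrightarrow> \<bar>Q * f / P - 1\<bar> \<le> e"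
proof -
  show eq: "Q = P / f * (1 + (Q * f / P - 1))" using assms by simp
  assume "\<bar>Q - P / f\<bar> \<le> e * (P / f)"
  moreover have "\<bar>Q - P / f\<bar> = \<bar>Q * f / P - 1\<bar> * (P / f)"
  proof -
    have "Q - P / f = (Q * f / P - 1) * (P / f)" using assms by (simp add: field_simps)
    then show ?thesis using assms by (simp add: abs_mult)
  qed
  ultimately have "\<bar>Q * f / P - 1\<bar> * (P / f) \<le> e * (P / f)" by linarith
  then show "\<bar>Q * f / P - 1\<bar> \<le> e" using assms by (simp only: mult_le_cancel_right_pos divide_pos_pos)
qed

theorem theorem5p1:
  shows "\<exists>K0 C0 :: real. \<forall>K' K'' K :: real.
    K' > 0 \<longrightarrow> K'' > 0 \<longrightarrow> K > max (2 * K') 2 \<longrightarrow> K \<ge> K0 \<longrightarrow> K / K'' \<ge> C0 \<longrightarrow>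
    (\<exists>C :: real. \<forall>(x :: real) (y' :: real) (y :: real) (q :: nat) (a :: int).
       x \<ge> 2 \<longrightarrow> 1 \<le> y' \<longrightarrow> y' \<le> ln x powr K' \<longrightarrow> ln x powr K < y \<longrightarrow> y \<le> x \<longrightarrow>
       q > 0 \<longrightarrow> real q < ln x powr K'' \<longrightarrow> (\<forall>p\<in>prime_factors q. real p < y') \<longrightarrow>
       coprime a (int q) \<longrightarrow>
       (\<exists>E :: real. \<bar>E\<bar> \<le> C * ln x powr (- 1 / 5) \<and>
          real (Psi_ap x y' y q a) = real (Psi x y' y) / real (totient q) * (1 + E)))"
proof -
  obtain K0 where K0: "K0 \<ge> 1" and small: "\<forall>K' K'' K. K'' > 0 \<longrightarrow> K \<ge> 2 * K' \<longrightarrow> K \<ge> K0 \<longrightarrow> K \<ge> K0 * K'' \<longrightarrow>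
     (\<exists>X0. equidistributed X0 K' K'' (\<lambda>X. K * ln X) (\<lambda>X. X powr (1/4)))"
    using small_y_regime by blast
  show ?thesis
  proof (rule exI[of _ K0], rule exI[of _ K0], intro allI impI, goal_cases)
    case K: (1 K' K'' K)
    have "K \<ge> 2 * K'" "K \<ge> K0 * K''" using K by (auto simp: field_simps)
    then obtain X1 where "equidistributed X1 K' K'' (\<lambda>X. K * ln X) (\<lambda>X. X powr (1/4))"
      using small K(2,4) by blast
    note X1 = this[unfolded equidistributed_def, rule_format]
    obtain X2 where "equidistributed X2 K' K'' (\<lambda>X. X powr (1/4)) (\<lambda>X. X)"
      using large_y_regime[OF K(1,2)] by blast
    note X2 = this[unfolded equidistributed_def, rule_format]
    define X0 where "X0 = max 1 (max X1 X2)"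
    \<comment> \<open>For \<open>X \<ge> X0\<close> the constant 1 suffices. Below \<open>X0\<close>
      the trivial bound gives \<open>abs E \<le> totient q + 1 \<le> X0 powr K'' + 1\<close>, and
      \<open>X0 powr (1/5)\<close> compensates for the factor \<open>X powr (- 1/5)\<close>.\<close>
    define C where "C = 1 + (X0 powr K'' + 1) * X0 powr (1/5)"
    show ?case
    proof (rule exI[of _ C], intro allI impI)
      fix x y' y :: real and q :: nat and a :: int
      assume x: "x \<ge> 2" and y': "1 \<le> y'" "y' \<le> ln x powr K'" and y: "ln x powr K < y" "y \<le> x"
        and q: "q > 0" "real q < ln x powr K''" "\<forall>p\<in>prime_factors q. real p < y'" and a: "coprime a (int q)"
      define X where "X = ln x"
      define T where "T = ln y"
      define b where "b = nat (a mod int q)"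
      have X: "X > 0" "exp X = x" using x by (auto simp: X_def)
      have y0: "y > 0" using y by (smt (verit) powr_ge_zero)
      have T: "exp T = y" "T \<le> X" using y y0 by (auto simp: T_def X_def)
      have b: "int b = a mod int q" using q by (simp add: b_def)
      have cong: "[int n = a] (mod int q) \<longleftrightarrow> [n = b] (mod q)" for n
        unfolding cong_int_iff[symmetric] b by (simp add: unique_euclidean_semiring_class.cong_def)
      have cop: "coprime b q"
      proof -
        have "coprime (a mod int q) (int q)" using a q by simp
        then show ?thesis unfolding b[symmetric] by simp
      qed
      let ?P = "real (Psi x y' y)" and ?Q = "real (Psi_ap x y' y q a)" and ?f = "real (totient q)"
      have fin: "finite {n \<in> S_range y' y. real n \<le> x}"
        by (rule finite_subset[OF _ finite_nat_le_real(1)[of x]]) auto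
      have "1 \<in> {n \<in> S_range y' y. real n \<le> x}" using x by (simp add: S_range_def)
      then have P1: "?P \<ge> 1" using fin unfolding Psi_def by (metis One_nat_def Suc_leI card_gt_0_iff empty_iff of_nat_1 of_nat_le_iff)
      have f: "?f > 0" "?f \<le> real q" using q totient_le[of q] by auto
      have QP: "?Q \<le> ?P" unfolding Psi_def Psi_ap_def using fin by (intro of_nat_mono card_mono) auto
      define E where "E = ?Q * ?f / ?P - 1"
      have "?Q = ?P / ?f * (1 + E)" unfolding E_def by (rule relative_error(1)) (use P1 f in auto)
      moreover have "\<bar>E\<bar> \<le> C * X powr (- 1 / 5)"
      proof (cases "X \<ge> X0")
        case True
        have ly: "ln y' \<le> K' * ln X"
        proof -
          have "ln y' \<le> ln (X powr K')" using y' X by (intro ln_mono) (auto simp: X_def)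
          then show ?thesis using X by (simp add: ln_powr)
        qed
        have lT: "K * ln X \<le> T"
        proof -
          have "ln (X powr K) \<le> ln y" using y X y0 by (intro ln_mono) (auto simp: X_def)
          then show ?thesis using X by (simp add: ln_powr T_def)
        qed
        have qX: "real q \<le> X powr K''" using q by (simp add: X_def)
        have "classes_close (pint y' (exp T)) (exp X) q b (X powr (- 1/5))"
        proof (cases "T \<le> X powr (1/4)")
          case le: True
          show ?thesis by (rule X1[OF _ y'(1) ly lT le q(1) qX _ cop]) (use True q(3) in \<open>auto simp: X0_def\<close>)
        next
          case False
          show ?thesis by (rule X2[OF _ y'(1) ly _ T(2) q(1) qX _ cop]) (use True False q(3) in \<open>auto simp: X0_def\<close>)
        qed
        then have "\<bar>?Q - ?P / ?f\<bar> \<le> X powr (- 1/5) * (?P / ?f)"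
          unfolding classes_close_def T X(2) Psi_def Psi_ap_def S_range_eq cong .
        then have "\<bar>E\<bar> \<le> X powr (- 1/5)" unfolding E_def by (intro relative_error(2)) (use P1 f in auto)
        moreover have "1 * X powr (- 1/5) \<le> C * X powr (- 1/5)" by (intro mult_right_mono) (auto simp: C_def)
        ultimately show ?thesis by simp
      next
        case False
        have X01: "X0 \<ge> 1" by (simp add: X0_def)
        have "0 \<le> ?Q * ?f / ?P" using f P1 by simp
        moreover have "?Q * ?f / ?P \<le> ?f"
        proof -
          have "?Q * ?f \<le> ?P * ?f" using QP by (intro mult_right_mono) auto
          then show ?thesis using P1 by (simp add: field_simps)
        qed
        ultimately have "\<bar>E\<bar> \<le> ?f + 1" unfolding E_def by linarith
        also have "\<dots> \<le> X0 powr K'' + 1"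
        proof -
          have "X powr K'' \<le> X0 powr K''" using False X K by (intro powr_mono2) auto
          then show ?thesis using f q unfolding X_def by linarith
        qed
        also have "\<dots> = (X0 powr K'' + 1) * X0 powr (1/5) * X0 powr (- 1/5)"
          using X01 by (simp add: powr_add[symmetric] mult.assoc)
        also have "\<dots> \<le> (X0 powr K'' + 1) * X0 powr (1/5) * X powr (- 1/5)"
          using False X X01 by (intro mult_left_mono powr_mono2') auto
        also have "\<dots> \<le> C * X powr (- 1/5)" by (intro mult_right_mono) (auto simp: C_def)
        finally show ?thesis by simp
      qed
      ultimately show "\<exists>E. \<bar>E\<bar> \<le> C * ln x powr (- 1 / 5) \<and> ?Q = ?P / ?f * (1 + E)" unfolding X_def by blast
    qed
  qed
qed

end
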